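(* Let $\epsilon>0$. Then there exists a positive constant $c$, independent of $d$, such that for all sufficiently large $d$, the expected number of nests of a Kostlan random real plane curve of degree $d$ which have depth at least $$\frac{1}{30}\log\left(\epsilon \log(d)/2\right)$$ is bounded below by $\displaystyle \frac{c\,d^{1-\epsilon}}{\log(\log d)}$.
   Context: Let $H_d$ be the complex vector space of homogeneous polynomials of degree $d$ in $X_0,X_1,X_2$, of dimension $N_d=\binom{d+2}{2}$. For $P\in H_d$ the pointwise Fubini-Study norm at $[X]\in\mathbb{C}P^2$ is $\|P\|_{FS}^2=|P(X)|^2/\|X\|^{2d}$; in the affine chart $z=(z_1,z_2)\leftrightarrow[1:z_1:z_2]$ it is $|P(1,z_1,z_2)|^2/(1+\|z\|^2)^d$. The Fubini-Study volume form is $dVol_{FS}=dVol/(1+\|z\|^2)^3$ in this chart ($dVol$ is Lebesgue measure on $\mathbb{C}^2$), so $Vol_{FS}(\mathbb{C}P^2)=\pi^2/2$. The $L^2$-norm is $\|P\|_2^2=\frac{1}{Vol_{FS}(\mathbb{C}P^2)}\int_{\mathbb{C}P^2}\|P(z)\|_{FS}^2\,dVol_{FS}$. A Kostlan random real polynomial of degree $d$ is a random element of the real vector space of real polynomials in $H_d$ with the Gaussian probability measure $\pi^{-N_d/2}e^{-\|P\|_2^2}\,dP$, where $dP$ is Lebesgue measure for the inner product inducing $\|\cdot\|_2$. A Kostlan random real plane curve of degree $d$ is the zero locus in $\mathbb{R}P^2$ of a Kostlan random real polynomial of degree $d$; it is almost surely smooth. An oval of a smooth curve in $\mathbb{R}P^2$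 is a connected component whose complement in $\mathbb{R}P^2$ has two components, one diffeomorphic to a disk (the interior of the oval) and one diffeomorphic to a Möbius band (the exterior). A finite collection of ovals of the curve forms a nest if the ovals can be ordered so that each oval in the sequence contains all the previous ones in its interior. The depth of a nest is the number of ovals in it. *)

theory Defs
  imports "HOL-Analysis.Analysis"
begin

section \<open>Ternary forms and the Kostlan measure\<close>

definition exponents :: "nat \<Rightarrow> (nat \<times> nat \<times> nat) set" where
  "exponents d = {(i, j, k). i + j + k = d}"

text \<open>A form of degree d is given by its coefficient family; only the coefficients indexed by
  \<^term>\<open>exponents d\<close> are ever used.\<close>

definition form_eval :: "nat \<Rightarrow> (nat \<times> nat \<times> nat \<Rightarrow> 'a) \<Rightarrow> 'a^3 \<Rightarrow> 'a::comm_semiring_1" where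
  "form_eval d P X = (\<Sum>(i, j, k)\<in>exponents d. P (i, j, k) * (X$1)^i * (X$2)^j * (X$3)^k)"

definition fs_norm :: "nat \<Rightarrow> (nat \<times> nat \<times> nat \<Rightarrow> complex) \<Rightarrow> complex^3 \<Rightarrow> real" where
  "fs_norm d P X = cmod (form_eval d P X) / norm X ^ d"

text \<open>The Fubini-Study volume, carried to \<open>\<complex>\<^sup>2\<close> by the affine chart
  \<open>z \<mapsto> [1 : z\<^sub>1 : z\<^sub>2]\<close>; the line at infinity is a null set.\<close>

definition fs_volume :: "(complex^2) measure" where
  "fs_volume = density lborel (\<lambda>z. ennreal (1 / (1 + (norm z)\<^sup>2) ^ 3))"

definition l2_norm :: "nat \<Rightarrow> (nat \<times> nat \<times> nat \<Rightarrow> complex) \<Rightarrow> real" where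
  "l2_norm d P = sqrt (1 / measure fs_volume UNIV *
     (\<integral>z. (fs_norm d P (vector [1, z$1, z$2]))\<^sup>2 \<partial>fs_volume))"

definition real_l2_norm :: "nat \<Rightarrow> (nat \<times> nat \<times> nat \<Rightarrow> real) \<Rightarrow> real" where
  "real_l2_norm d P = l2_norm d (\<lambda>\<alpha>. complex_of_real (P \<alpha>))"

text \<open>By polarization, the inner product that induces the norm.\<close>

definition real_l2_inner ::
    "nat \<Rightarrow> (nat \<times> nat \<times> nat \<Rightarrow> real) \<Rightarrow> (nat \<times> nat \<times> nat \<Rightarrow> real) \<Rightarrow> real" where
  "real_l2_inner d P Q =
     ((real_l2_norm d (\<lambda>\<alpha>. P \<alpha> + Q \<alpha>))\<^sup>2 - (real_l2_norm d P)\<^sup>2 - (real_l2_norm d Q)\<^sup>2) / 2"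

definition form_dim :: "nat \<Rightarrow> nat" where
  "form_dim d = (d + 2) choose 2"

text \<open>Since \<^term>\<open>form_dim d\<close> is the dimension of the space of real forms of degree d, an
  orthonormal family of this size is a basis.\<close>

definition l2_orthonormal_basis :: "nat \<Rightarrow> (nat \<Rightarrow> nat \<times> nat \<times> nat \<Rightarrow> real) \<Rightarrow> bool" where
  "l2_orthonormal_basis d b \<longleftrightarrow>
     (\<forall>m<form_dim d. \<forall>n<form_dim d. real_l2_inner d (b m) (b n) = (if m = n then 1 else 0))"

text \<open>Lebesgue measure of the Euclidean space of real forms of degree d with the above inner
  product: standard Lebesgue measure in the coordinates of an orthonormal basis. It does not
  depend on the basis.\<close>

definition form_lebesgue :: "nat \<Rightarrow> (nat \<times> nat \<times> nat \<Rightarrow> real) measure" where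
  "form_lebesgue d =
     (let b = (SOME b. l2_orthonormal_basis d b) in
      distr (\<Pi>\<^sub>M m\<in>{..<form_dim d}. lborel) (\<Pi>\<^sub>M \<alpha>\<in>exponents d. borel)
        (\<lambda>t. \<lambda>\<alpha>\<in>exponents d. \<Sum>m<form_dim d. t m * b m \<alpha>))"

definition kostlan :: "nat \<Rightarrow> (nat \<times> nat \<times> nat \<Rightarrow> real) measure" where
  "kostlan d = density (form_lebesgue d)
     (\<lambda>P. ennreal (pi powr (- real (form_dim d) / 2) * exp (- (real_l2_norm d P)\<^sup>2)))"


section \<open>The real projective plane\<close>

typedef rp2 = "{L :: (real^3) set. subspace L \<and> dim L = 1}"
proof
  show "span {axis 1 1} \<in> {L :: (real^3) set. subspace L \<and> dim L = 1}"
    by (simp add: dim_span axis_eq_0_iff)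
qed

text \<open>\<open>[x\<^sub>0 : x\<^sub>1 : x\<^sub>2]\<close>, to be used for nonzero vectors only.\<close>

definition rp2_point :: "real^3 \<Rightarrow> rp2" where
  "rp2_point x = Abs_rp2 (span {x})"

text \<open>The quotient topology of \<open>\<real>\<^sup>3 - {0}\<close>.\<close>

instantiation rp2 :: topological_space
begin

definition open_rp2 :: "rp2 set \<Rightarrow> bool" where
  "open_rp2 U \<longleftrightarrow> open {x. x \<noteq> 0 \<and> rp2_point x \<in> U}"

instance
proof
  have "{x :: real^3. x \<noteq> 0} = - {0}"
    by auto
  then show "open (UNIV :: rp2 set)"
    by (simp add: open_rp2_def open_Compl)
next
  fix S T :: "rp2 set"
  assume "open S" "open T"
  moreover have "{x. x \<noteq> 0 \<and> rp2_point x \<in> S \<inter> T} =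
      {x. x \<noteq> 0 \<and> rp2_point x \<in> S} \<inter> {x. x \<noteq> 0 \<and> rp2_point x \<in> T}"
    by auto
  ultimately show "open (S \<inter> T)"
    by (simp only: open_rp2_def open_Int)
next
  fix K :: "rp2 set set"
  assume "\<forall>S\<in>K. open S"
  moreover have "{x. x \<noteq> 0 \<and> rp2_point x \<in> \<Union>K} = (\<Union>S\<in>K. {x. x \<noteq> 0 \<and> rp2_point x \<in> S})"
    by auto
  ultimately show "open (\<Union>K)"
    by (simp only: open_rp2_def open_UN)
qed

end


section \<open>Diffeomorphisms of surfaces\<close>

text \<open>Continuous differentiability of order k on an open set of a Euclidean space.\<close>

primrec Ck_on :: "nat \<Rightarrow> 'a::euclidean_space set \<Rightarrow> ('a \<Rightarrow> 'b::euclidean_space) \<Rightarrow> bool" where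
  "Ck_on 0 S f \<longleftrightarrow> continuous_on S f"
| "Ck_on (Suc k) S f \<longleftrightarrow> (\<forall>x\<in>S. f differentiable (at x)) \<and>
     (\<forall>v. Ck_on k S (\<lambda>x. frechet_derivative f (at x) v))"

definition smooth_on :: "'a::euclidean_space set \<Rightarrow> ('a \<Rightarrow> 'b::euclidean_space) \<Rightarrow> bool" where
  "smooth_on S f \<longleftrightarrow> (\<forall>k. Ck_on k S f)"

text \<open>An atlas is a set of parametrizations (inverse charts), each an injective map with its open
  domain in the plane. An open subset of a surface carries the restricted smooth structure.\<close>

type_synonym 'a atlas = "((real \<times> real) set \<times> (real \<times> real \<Rightarrow> 'a)) set"

definition smooth_map :: "'a atlas \<Rightarrow> 'a set \<Rightarrow> 'b atlas \<Rightarrow> ('a \<Rightarrow> 'b) \<Rightarrow> bool" where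
  "smooth_map A U B f \<longleftrightarrow> (\<forall>(W, \<phi>)\<in>A. \<forall>(W', \<psi>)\<in>B.
     (let T = {w \<in> W. \<phi> w \<in> U \<and> f (\<phi> w) \<in> \<psi> ` W'}
      in open T \<and> smooth_on T (\<lambda>w. inv_into W' \<psi> (f (\<phi> w)))))"

definition diffeomorphic :: "'a atlas \<Rightarrow> 'a set \<Rightarrow> 'b atlas \<Rightarrow> 'b set \<Rightarrow> bool" where
  "diffeomorphic A U B V \<longleftrightarrow>
     (\<exists>f. bij_betw f U V \<and> smooth_map A U B f \<and> smooth_map B V A (inv_into U f))"

definition rp2_atlas :: "rp2 atlas" where
  "rp2_atlas =
     {(UNIV, \<lambda>(u, v). rp2_point (vector [1, u, v])),
      (UNIV, \<lambda>(u, v). rp2_point (vector [u, 1, v])),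
      (UNIV, \<lambda>(u, v). rp2_point (vector [u, v, 1]))}"

definition disk :: "(real \<times> real) set" where
  "disk = ball 0 1"

definition disk_atlas :: "(real \<times> real) atlas" where
  "disk_atlas = {(disk, \<lambda>w. w)}"

text \<open>The open Moebius band is the quotient of \<open>\<real> \<times> (-1, 1)\<close> by the translations
  generated by \<open>(x, y) \<mapsto> (x + 1, - y)\<close>; its points are the orbits.\<close>

definition moebius_point :: "real \<times> real \<Rightarrow> (real \<times> real) set" where
  "moebius_point = (\<lambda>(x, y). range (\<lambda>n::int. (x + of_int n, if even n then y else - y)))"

definition moebius_band :: "(real \<times> real) set set" where
  "moebius_band = moebius_point ` (UNIV \<times> {-1<..<1})"

definition moebius_atlas :: "(real \<times> real) set atlas" where
  "moebius_atlas = range (\<lambda>a. ({a<..<a + 1} \<times> {-1<..<1}, moebius_point))"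


section \<open>Real plane curves, ovals and nests\<close>

definition real_curve :: "nat \<Rightarrow> (nat \<times> nat \<times> nat \<Rightarrow> real) \<Rightarrow> rp2 set" where
  "real_curve d P = {rp2_point x |x. x \<noteq> 0 \<and> form_eval d P x = 0}"

definition smooth_real_curve :: "nat \<Rightarrow> (nat \<times> nat \<times> nat \<Rightarrow> real) \<Rightarrow> bool" where
  "smooth_real_curve d P \<longleftrightarrow>
     (\<forall>x. x \<noteq> 0 \<longrightarrow> form_eval d P x = 0 \<longrightarrow> \<not> (form_eval d P has_derivative (\<lambda>_. 0)) (at x))"

definition separates_disk_moebius :: "rp2 set \<Rightarrow> rp2 set \<Rightarrow> rp2 set \<Rightarrow> bool" where
  "separates_disk_moebius C I E \<longleftrightarrow>
     components (- C) = {I, E} \<and> I \<noteq> E \<and>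
     diffeomorphic rp2_atlas I disk_atlas disk \<and>
     diffeomorphic rp2_atlas E moebius_atlas moebius_band"

text \<open>Only smooth curves have ovals; the singular ones form a null set.\<close>

definition oval :: "nat \<Rightarrow> (nat \<times> nat \<times> nat \<Rightarrow> real) \<Rightarrow> rp2 set \<Rightarrow> bool" where
  "oval d P C \<longleftrightarrow> smooth_real_curve d P \<and> C \<in> components (real_curve d P) \<and>
     (\<exists>I E. separates_disk_moebius C I E)"

definition in_oval_interior :: "rp2 set \<Rightarrow> rp2 set \<Rightarrow> bool" where
  "in_oval_interior C D \<longleftrightarrow> (\<exists>I E. separates_disk_moebius D I E \<and> C \<subseteq> I)"

definition nest :: "nat \<Rightarrow> (nat \<times> nat \<times> nat \<Rightarrow> real) \<Rightarrow> rp2 set set \<Rightarrow> bool" where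
  "nest d P N \<longleftrightarrow> (\<forall>C\<in>N. oval d P C) \<and>
     (\<exists>Cs. distinct Cs \<and> set Cs = N \<and> sorted_wrt in_oval_interior Cs)"

text \<open>A smooth curve has only finitely many ovals, so the cardinality below is that of a finite
  set. The expectation of the nonnegative count is its Lebesgue integral with values in
  \<open>[0, \<infinity>]\<close>.\<close>

definition num_nests :: "nat \<Rightarrow> (nat \<times> nat \<times> nat \<Rightarrow> real) \<Rightarrow> real \<Rightarrow> nat" where
  "num_nests d P h = card {N. nest d P N \<and> real (card N) \<ge> h}"

definition expected_num_nests :: "nat \<Rightarrow> real \<Rightarrow> ennreal" where
  "expected_num_nests d h = (\<integral>\<^sup>+P. of_nat (num_nests d P h) \<partial>kostlan d)"

end

theory Submission
  imports Defs "HOL-Probability.Probability" "HOL-Complex_Analysis.Riemann_Mapping"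
    "HOL-Real_Asymp.Real_Asymp"
begin

text \<open>The proof plants nests. Fix a depth \<open>n\<close> and a point of the real projective plane, moved to
  \<open>[1 : 0 : 0]\<close> by an orthogonal map. With \<open>s\<^sup>2 = X\<^sub>1\<^sup>2 + X\<^sub>2\<^sup>2\<close> and \<open>\<tau>\<^sup>2 = 6 n / d\<close>, the form
  \<open>Re ((X\<^sub>0 + i \<tau> s) ^ d)\<close>, called the barrier here, equals
  \<open>(1 + \<tau>\<^sup>2 r\<^sup>2) powr (d / 2) * cos (d * arctan (\<tau> r))\<close> on the circle of radius \<open>r\<close> about the point. Hence it
  changes sign on \<open>n\<close> concentric circles within the radius \<open>r0\<close> given by \<open>r0\<^sup>2 = 2 n / d\<close>, while its
  squared norm is only of the order \<open>exp (12 n) / d\<^sup>2\<close> (\<open>barrier_exists\<close>).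

  A form \<open>P\<close> has these sign changes too if \<open>P\<close> minus a multiple \<open>\<sigma> B\<close> of the barrier is small
  on the disc of radius \<open>r0\<close>, together with its radial derivative. The difference is controlled
  by its affine coefficients. Distinct monomials are orthogonal and the norm is invariant under
  orthogonal maps, so each coefficient is bounded by the norm of the form
  (\<open>rot_coefficient_bound\<close>); for \<open>\<sigma>\<close> a suitable multiple of \<open>d exp (8 n)\<close>, a
  Gaussian form is therefore small compared with \<open>\<sigma>\<close>, in this sense, with probability at least \<open>1 / 2\<close>. That event is symmetric about the
  origin, and translating a symmetric event by \<open>\<sigma> B\<close> costs at most the factor \<open>exp (- \<parallel>\<sigma> B\<parallel>\<^sup>2)\<close>
  (\<open>gaussian_shift_symmetric\<close>). Therefore a nest of depth \<open>n\<close> sits at a given place with probability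
  at least \<open>exp (- C2 * exp (28 n)) / 2\<close> (\<open>place_event\<close>).

  In each of the \<open>n\<close> annuli the curve is met by every ray exactly once and transversally, so it
  is a smooth star-shaped curve. Such a curve is an oval: its interior is a star-shaped domain in an
  affine chart, hence a disk by the Riemann mapping theorem, and every line through the centre meets
  its exterior in a segment, which turns the exterior into a Moebius band (\<open>star_curve\<close>).

  About \<open>d / (5000 n)\<close> such discs of radius \<open>r0\<close> fit disjointly into the projective plane, and disjoint places carry
  different nests. Adding up the probabilities bounds the expectation from below
  (\<open>expected_num_nests_ge\<close>); this uses that almost every curve is smooth, and that smooth curves have finitely
  many components, so that the count is the cardinality of a finite set. For
  \<open>n\<close> equal to \<open>ln (\<epsilon> ln d / 2) / 30\<close> rounded up, \<open>exp (28 n)\<close> is of the order \<open>(ln d) powr (14 / 15)\<close>, so the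
  probability is at least \<open>d powr (- \<epsilon>)\<close> up to a constant, and \<open>n \<le> ln (ln d)\<close>.\<close>

section \<open>Smooth maps\<close>

lemma Ck_on_cong:
  assumes "open S" "\<And>x. x \<in> S \<Longrightarrow> f x = g x"
  shows "Ck_on k S f \<longleftrightarrow> Ck_on k S g"
  using assms(2)
proof (induction k arbitrary: f g)
  case 0
  then show ?case by (simp cong: continuous_on_cong)
next
  case (Suc k)
  have ev: "eventually (\<lambda>y. f y = g y) (nhds x)" if "x \<in> S" for x
    using Suc.prems that assms(1) eventually_nhds by blast
  have d: "(f has_derivative f') (at x) \<longleftrightarrow> (g has_derivative f') (at x)" if "x \<in> S" for x f'
    by (metis (mono_tags, lifting) Suc.prems assms(1) has_derivative_transform_within_open that)
  have fd: "frechet_derivative f (at x) = frechet_derivative g (at x)" if "x \<in> S" for x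
    using d[OF that] by (simp add: frechet_derivative_def)
  have "Ck_on k S (\<lambda>x. frechet_derivative f (at x) v) \<longleftrightarrow> Ck_on k S (\<lambda>x. frechet_derivative g (at x) v)" for v
    by (rule Suc.IH) (simp add: fd)
  then show ?case
    using d by (auto simp: differentiable_def)
qed

lemma Ck_on_subset: "Ck_on k S f \<Longrightarrow> T \<subseteq> S \<Longrightarrow> Ck_on k T f"
  by (induction k arbitrary: f) (auto intro: continuous_on_subset)

lemma Ck_on_Suc_imp: "Ck_on (Suc k) S f \<Longrightarrow> Ck_on k S f"
proof (induction k arbitrary: f)
  case 0
  then show ?case
    by (simp add: continuous_at_imp_continuous_on differentiable_imp_continuous_within)
next
  case (Suc k)
  then show ?case by (metis Ck_on.simps(2))
qed

lemma Ck_on_SucI: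
  assumes "open S" "\<And>x. x \<in> S \<Longrightarrow> (f has_derivative f' x) (at x)" "\<And>v. Ck_on k S (\<lambda>x. f' x v)"
  shows "Ck_on (Suc k) S f"
proof -
  have "frechet_derivative f (at x) = f' x" if "x \<in> S" for x
    using assms(2)[OF that] frechet_derivative_at by metis
  then have "Ck_on k S (\<lambda>x. frechet_derivative f (at x) v)" for v
    by (intro iffD2[OF Ck_on_cong[OF assms(1)] assms(3)]) simp
  then show ?thesis using assms(2) by (auto simp: differentiable_def)
qed

lemma Ck_on_SucD:
  assumes "Ck_on (Suc k) S f" "x \<in> S"
  shows "(f has_derivative frechet_derivative f (at x)) (at x)"
  using assms by (simp add: frechet_derivative_works)

lemma Ck_on_const: "Ck_on k S (\<lambda>x. c)"
proof (induction k arbitrary: c)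
  case (Suc k)
  have "frechet_derivative (\<lambda>x. c) (at x) = (\<lambda>v. 0)" for x :: 'a
    using frechet_derivative_at[of "\<lambda>x. c" "\<lambda>v. 0" x] by simp
  then show ?case using Suc by simp
qed simp

lemma Ck_on_bounded_linear_compose:
  assumes "open S" "bounded_linear L" "Ck_on k S f"
  shows "Ck_on k S (\<lambda>x. L (f x))"
  using assms(3)
proof (induction k arbitrary: f)
  case 0
  then show ?case by (simp add: assms(2) bounded_linear.continuous_on)
next
  case (Suc k)
  show ?case
  proof (rule Ck_on_SucI[OF assms(1)])
    show "((\<lambda>x. L (f x)) has_derivative (\<lambda>v. L (frechet_derivative f (at x) v))) (at x)" if "x \<in> S" for x
      using bounded_linear.has_derivative[OF assms(2) Ck_on_SucD[OF Suc.prems that]] .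
    show "Ck_on k S (\<lambda>x. L (frechet_derivative f (at x) v))" for v
      using Suc by simp
  qed
qed

lemma Ck_on_ident: "open S \<Longrightarrow> Ck_on k S (\<lambda>x. x)"
proof (induction k)
  case (Suc k)
  show ?case by (rule Ck_on_SucI[OF Suc.prems, of _ "\<lambda>_ v. v"]) (auto simp: Ck_on_const)
qed simp

lemma Ck_on_add:
  assumes "open S" "Ck_on k S f" "Ck_on k S g"
  shows "Ck_on k S (\<lambda>x. f x + g x)"
  using assms(2,3)
proof (induction k arbitrary: f g)
  case 0
  then show ?case by (simp add: continuous_on_add)
next
  case (Suc k)
  show ?case
  proof (rule Ck_on_SucI[OF assms(1)])
    show "((\<lambda>x. f x + g x) has_derivative (\<lambda>v. frechet_derivative f (at x) v + frechet_derivative g (at x) v)) (at x)"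
      if "x \<in> S" for x
      by (intro has_derivative_add Ck_on_SucD[OF Suc.prems(1) that] Ck_on_SucD[OF Suc.prems(2) that])
    show "Ck_on k S (\<lambda>x. frechet_derivative f (at x) v + frechet_derivative g (at x) v)" for v
      using Suc by simp
  qed
qed

text \<open>Induction on the order by the product rule; bilinearity covers products, scalar multiples and
  inner products at once.\<close>

lemma Ck_on_bilinear:
  assumes "open S" "bounded_bilinear B" "Ck_on k S f" "Ck_on k S g"
  shows "Ck_on k S (\<lambda>x. B (f x) (g x))"
  using assms(3,4)
proof (induction k arbitrary: f g)
  case 0
  then show ?case by (simp add: assms(2) bounded_bilinear.continuous_on)
next
  case (Suc k)
  show ?case
  proof (rule Ck_on_SucI[OF assms(1)])
    show "((\<lambda>x. B (f x) (g x)) has_derivative (\<lambda>v. B (f x) (frechet_derivative g (at x) v) + B (frechet_derivative f (at x) v) (g x))) (at x)"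
      if "x \<in> S" for x
      by (intro bounded_bilinear.FDERIV[OF assms(2)] Ck_on_SucD[OF Suc.prems(1) that] Ck_on_SucD[OF Suc.prems(2) that])
    show "Ck_on k S (\<lambda>x. B (f x) (frechet_derivative g (at x) v) + B (frechet_derivative f (at x) v) (g x))" for v
      using Suc Ck_on_Suc_imp[OF Suc.prems(1)] Ck_on_Suc_imp[OF Suc.prems(2)]
      by (intro Ck_on_add[OF assms(1)] Suc.IH) auto
  qed
qed

lemma Ck_on_sum:
  assumes "open S" "\<And>i. i \<in> I \<Longrightarrow> Ck_on k S (f i)"
  shows "Ck_on k S (\<lambda>x. \<Sum>i\<in>I. f i x)"
  using assms(2) by (induction I rule: infinite_finite_induct) (simp_all add: Ck_on_const Ck_on_add[OF assms(1)])

text \<open>The chain rule expresses a directional derivative of the composition through partial derivatives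
  of the outer map along a basis, so that the induction hypothesis applies to each summand.\<close>

lemma Ck_on_compose:
  assumes "open S" "open T" "Ck_on k S f" "Ck_on k T g" "f ` S \<subseteq> T"
  shows "Ck_on k S (\<lambda>x. g (f x))"
  using assms(3,4)
proof (induction k arbitrary: g)
  case 0
  then show ?case using assms(5) by (simp add: continuous_on_compose2)
next
  case (Suc k)
  have f: "Ck_on k S f" using Ck_on_Suc_imp[OF Suc.prems(1)] .
  show ?case
  proof (rule Ck_on_SucI[OF assms(1)])
    fix x assume x: "x \<in> S"
    let ?Df = "frechet_derivative f (at x)" and ?Dg = "frechet_derivative g (at (f x))"
    have "f x \<in> T" using x assms(5) by auto
    then have g: "(g has_derivative ?Dg) (at (f x))" using Ck_on_SucD[OF Suc.prems(2)] by simp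
    have lin: "linear ?Dg" using g has_derivative_linear by blast
    have "?Dg (?Df v) = (\<Sum>b\<in>Basis. (?Df v \<bullet> b) *\<^sub>R ?Dg b)" for v
      by (subst (1) euclidean_representation[of "?Df v", symmetric])
         (simp add: linear_sum[OF lin] linear_cmul[OF lin])
    moreover have "((\<lambda>x. g (f x)) has_derivative (\<lambda>v. ?Dg (?Df v))) (at x)"
      using has_derivative_compose[OF Ck_on_SucD[OF Suc.prems(1) x] g] .
    ultimately show "((\<lambda>x. g (f x)) has_derivative (\<lambda>v. \<Sum>b\<in>Basis. (?Df v \<bullet> b) *\<^sub>R ?Dg b)) (at x)"
      by presburger
  next
    fix v
    show "Ck_on k S (\<lambda>x. \<Sum>b\<in>Basis. (frechet_derivative f (at x) v \<bullet> b) *\<^sub>R frechet_derivative g (at (f x)) b)"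
    proof (rule Ck_on_sum[OF assms(1)])
      fix b :: 'b assume "b \<in> Basis"
      have "Ck_on k S (\<lambda>x. frechet_derivative f (at x) v \<bullet> b)"
        using Suc.prems(1) by (intro Ck_on_bounded_linear_compose[OF assms(1) bounded_linear_inner_left]) simp
      moreover have "Ck_on k S (\<lambda>x. frechet_derivative g (at (f x)) b)"
        by (rule Suc.IH) (use f Suc.prems(2) in auto)
      ultimately show "Ck_on k S (\<lambda>x. (frechet_derivative f (at x) v \<bullet> b) *\<^sub>R frechet_derivative g (at (f x)) b)"
        using Ck_on_bilinear[OF assms(1) bounded_bilinear_scaleR] by blast
    qed
  qed
qed

lemma smooth_on_cong:
  assumes "open S" "\<And>x. x \<in> S \<Longrightarrow> f x = g x"
  shows "smooth_on S f \<longleftrightarrow> smooth_on S g"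
proof -
  have "Ck_on k S f \<longleftrightarrow> Ck_on k S g" for k by (rule Ck_on_cong[OF assms])
  then show ?thesis by (simp add: smooth_on_def)
qed

lemma smooth_on_subset: "smooth_on S f \<Longrightarrow> T \<subseteq> S \<Longrightarrow> smooth_on T f"
  by (auto simp: smooth_on_def intro: Ck_on_subset)

lemma smooth_on_const: "smooth_on S (\<lambda>x. c)"
  by (simp add: smooth_on_def Ck_on_const)

lemma smooth_on_ident: "open S \<Longrightarrow> smooth_on S (\<lambda>x. x)"
  by (simp add: smooth_on_def Ck_on_ident)

lemma smooth_on_bounded_linear:
  "open S \<Longrightarrow> bounded_linear L \<Longrightarrow> smooth_on S f \<Longrightarrow> smooth_on S (\<lambda>x. L (f x))"
  by (simp add: smooth_on_def Ck_on_bounded_linear_compose)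

lemma smooth_on_add:
  "open S \<Longrightarrow> smooth_on S f \<Longrightarrow> smooth_on S g \<Longrightarrow> smooth_on S (\<lambda>x. f x + g x)"
  by (simp add: smooth_on_def Ck_on_add)

lemma smooth_on_sum:
  "open S \<Longrightarrow> (\<And>i. i \<in> I \<Longrightarrow> smooth_on S (f i)) \<Longrightarrow> smooth_on S (\<lambda>x. \<Sum>i\<in>I. f i x)"
  by (simp add: smooth_on_def Ck_on_sum)

lemma smooth_on_minus:
  "open S \<Longrightarrow> smooth_on S f \<Longrightarrow> smooth_on S (\<lambda>x. - f x)"
  by (rule smooth_on_bounded_linear[of _ uminus]) (auto intro: bounded_linear_minus bounded_linear_ident)

lemma smooth_on_diff:
  "open S \<Longrightarrow> smooth_on S f \<Longrightarrow> smooth_on S g \<Longrightarrow> smooth_on S (\<lambda>x. f x - g x)"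
  using smooth_on_add[OF _ _ smooth_on_minus, of S f g] by simp

lemma smooth_on_mult:
  fixes f g :: "'a::euclidean_space \<Rightarrow> 'b::{euclidean_space, real_normed_algebra}"
  shows "open S \<Longrightarrow> smooth_on S f \<Longrightarrow> smooth_on S g \<Longrightarrow> smooth_on S (\<lambda>x. f x * g x)"
  by (simp add: smooth_on_def Ck_on_bilinear[OF _ bounded_bilinear_mult])

lemma smooth_on_scaleR:
  "open S \<Longrightarrow> smooth_on S f \<Longrightarrow> smooth_on S g \<Longrightarrow> smooth_on S (\<lambda>x. f x *\<^sub>R g x)"
  by (simp add: smooth_on_def Ck_on_bilinear[OF _ bounded_bilinear_scaleR])

lemma smooth_on_power:
  fixes f :: "'a::euclidean_space \<Rightarrow> real"
  shows "open S \<Longrightarrow> smooth_on S f \<Longrightarrow> smooth_on S (\<lambda>x. f x ^ n)"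
  by (induction n) (auto simp: smooth_on_const intro: smooth_on_mult)

lemma smooth_on_compose:
  assumes "open S" "open T" "smooth_on S f" "smooth_on T g" "\<And>x. x \<in> S \<Longrightarrow> f x \<in> T"
  shows "smooth_on S (\<lambda>x. g (f x))"
proof -
  have "f ` S \<subseteq> T" using assms(5) by auto
  with assms(3,4) have "Ck_on k S (\<lambda>x. g (f x))" for k
    using Ck_on_compose[OF assms(1,2), of k f g] by (simp add: smooth_on_def)
  then show ?thesis by (simp add: smooth_on_def)
qed

lemma smooth_on_Pair:
  assumes "open S" "smooth_on S f" "smooth_on S g"
  shows "smooth_on S (\<lambda>x. (f x, g x))"
proof -
  have "smooth_on S (\<lambda>x. (f x, 0) + (0, g x))"
    by (intro smooth_on_add assms smooth_on_bounded_linear[of S "\<lambda>y. (y, 0)" f] smooth_on_bounded_linear[of S "\<lambda>y. (0, y)" g]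
        bounded_linear_Pair bounded_linear_ident bounded_linear_zero)
  then show ?thesis by simp
qed

lemma smooth_on_fst: "open S \<Longrightarrow> smooth_on S f \<Longrightarrow> smooth_on S (\<lambda>x. fst (f x))"
  by (rule smooth_on_bounded_linear[OF _ bounded_linear_fst])

lemma smooth_on_snd: "open S \<Longrightarrow> smooth_on S f \<Longrightarrow> smooth_on S (\<lambda>x. snd (f x))"
  by (rule smooth_on_bounded_linear[OF _ bounded_linear_snd])

lemma smooth_on_vec_nth:
  fixes f :: "'a::euclidean_space \<Rightarrow> real ^ 'n"
  shows "open S \<Longrightarrow> smooth_on S f \<Longrightarrow> smooth_on S (\<lambda>x. f x $ i)"
  by (rule smooth_on_bounded_linear[OF _ bounded_linear_vec_nth])

lemma smooth_on_matrix_vector: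
  fixes A :: "real ^ 'n ^ 'm"
  shows "open S \<Longrightarrow> smooth_on S f \<Longrightarrow> smooth_on S (\<lambda>x. A *v f x)"
  by (rule smooth_on_bounded_linear[OF _ matrix_vector_mul_bounded_linear])

lemma smooth_on_vector_3:
  fixes f g h :: "'a::euclidean_space \<Rightarrow> real"
  assumes "open S" "smooth_on S f" "smooth_on S g" "smooth_on S h"
  shows "smooth_on S (\<lambda>x. vector [f x, g x, h x] :: real^3)"
proof -
  have "smooth_on S (\<lambda>x. f x *\<^sub>R axis 1 1 + g x *\<^sub>R axis 2 1 + h x *\<^sub>R axis 3 1 :: real^3)"
    by (intro smooth_on_add smooth_on_scaleR smooth_on_const assms)
  also have "(\<lambda>x. f x *\<^sub>R axis 1 1 + g x *\<^sub>R axis 2 1 + h x *\<^sub>R axis 3 1 :: real^3) = (\<lambda>x. vector [f x, g x, h x])"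
    by (auto simp: vec_eq_iff forall_3 axis_def fun_eq_iff)
  finally show ?thesis .
qed

text \<open>In one real variable, smoothness is bootstrapped from an equation for the derivative.\<close>

lemma Ck_on_real_SucI:
  fixes f :: "real \<Rightarrow> real"
  assumes "open S" "\<And>x. x \<in> S \<Longrightarrow> (f has_real_derivative f' x) (at x)" "Ck_on k S f'"
  shows "Ck_on (Suc k) S f"
  by (rule Ck_on_SucI[OF assms(1), of _ "\<lambda>x v. f' x * v"])
     (use assms(2) Ck_on_bounded_linear_compose[OF assms(1) bounded_linear_mult_left assms(3)] in
       \<open>simp_all add: has_field_derivative_def\<close>)

lemma smooth_on_from_derivative:
  fixes f :: "real \<Rightarrow> real"
  assumes "open S" "\<And>x. x \<in> S \<Longrightarrow> (f has_real_derivative f' x) (at x)"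
    and "\<And>k. Ck_on k S f \<Longrightarrow> Ck_on k S f'"
  shows "smooth_on S f"
proof -
  have "Ck_on k S f" for k
  proof (induction k)
    case 0
    show ?case
      using DERIV_continuous_on[of S f f', OF has_field_derivative_at_within[OF assms(2)]] by simp
  next
    case (Suc k)
    show ?case by (rule Ck_on_real_SucI[OF assms(1,2) assms(3)[OF Suc]])
  qed
  then show ?thesis by (simp add: smooth_on_def)
qed

text \<open>The derivative of the inverse is minus its square, that of the arcus tangens is a rational
  function, and the derivatives of sine and cosine are each other up to sign: these equations feed
  the bootstrap.\<close>

lemma smooth_on_inverse_real: "smooth_on (- {0}) (inverse :: real \<Rightarrow> real)"
proof (rule smooth_on_from_derivative)
  show op: "open (- {0} :: real set)" by (rule open_Compl) simp
  show "(inverse has_real_derivative - (inverse x * inverse x)) (at x)" if "x \<in> - {0}" for x :: real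
    using that by (auto intro!: derivative_eq_intros simp: field_simps power2_eq_square)
  show "Ck_on k (- {0}) (\<lambda>x::real. - (inverse x * inverse x))" if "Ck_on k (- {0}) (inverse :: real \<Rightarrow> real)" for k
    using Ck_on_bounded_linear_compose[OF op bounded_linear_minus[OF bounded_linear_ident]
        Ck_on_bilinear[OF op bounded_bilinear_mult that that]] .
qed

lemma smooth_on_divide:
  fixes f g :: "'a::euclidean_space \<Rightarrow> real"
  assumes "open S" "smooth_on S f" "smooth_on S g" "\<And>x. x \<in> S \<Longrightarrow> g x \<noteq> 0"
  shows "smooth_on S (\<lambda>x. f x / g x)"
proof -
  have "smooth_on S (\<lambda>x. f x * inverse (g x))"
    using assms by (intro smooth_on_mult smooth_on_compose[OF assms(1) _ assms(3) smooth_on_inverse_real]) auto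
  then show ?thesis by (simp add: divide_inverse)
qed

lemma smooth_on_sqrt: "smooth_on {0<..} sqrt"
proof (rule smooth_on_from_derivative)
  show op: "open {0::real<..}" by simp
  show "(sqrt has_real_derivative (1/2) * inverse (sqrt x)) (at x)" if "x \<in> {0<..}" for x
    using that DERIV_real_sqrt[of x] by (simp add: field_simps)
  show "Ck_on k {0<..} (\<lambda>x. (1/2) * inverse (sqrt x))" if "Ck_on k {0<..} sqrt" for k
  proof -
    have "Ck_on k (- {0}) (inverse :: real \<Rightarrow> real)"
      using smooth_on_inverse_real by (simp add: smooth_on_def)
    moreover have "sqrt ` {0<..} \<subseteq> - {0}" "open (- {0} :: real set)" by (auto intro: open_Compl)
    ultimately have "Ck_on k {0<..} (\<lambda>x. inverse (sqrt x))"
      using Ck_on_compose[OF op _ that] by blast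
    then show ?thesis by (rule Ck_on_bilinear[OF op bounded_bilinear_mult Ck_on_const])
  qed
qed

lemma smooth_on_arctan: "smooth_on UNIV arctan"
proof (rule smooth_on_from_derivative)
  show "(arctan has_real_derivative 1 / (1 + x\<^sup>2)) (at x)" for x
    using DERIV_arctan[of x] by (simp add: field_simps)
  have "smooth_on UNIV (\<lambda>x::real. 1 / (1 + x\<^sup>2))"
    using smooth_on_divide[OF open_UNIV smooth_on_const[of UNIV "1::real"]
        smooth_on_add[OF open_UNIV smooth_on_const[of UNIV "1::real"] smooth_on_power[OF open_UNIV smooth_on_ident[OF open_UNIV], of 2]]]
    by (simp add: add_nonneg_eq_0_iff)
  then show "Ck_on k UNIV (\<lambda>x::real. 1 / (1 + x\<^sup>2))" for k by (simp add: smooth_on_def)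
qed simp

lemma smooth_on_sin_cos: "smooth_on UNIV (sin :: real \<Rightarrow> real)" "smooth_on UNIV (cos :: real \<Rightarrow> real)"
proof -
  have "Ck_on k UNIV (sin :: real \<Rightarrow> real) \<and> Ck_on k UNIV (cos :: real \<Rightarrow> real)" for k
  proof (induction k)
    case 0
    then show ?case by (auto intro: continuous_intros)
  next
    case (Suc k)
    have "Ck_on k UNIV (\<lambda>x::real. - sin x)"
      by (rule Ck_on_bounded_linear_compose[OF open_UNIV bounded_linear_minus[OF bounded_linear_ident] conjunct1[OF Suc]])
    then show ?case
      using Ck_on_real_SucI[of UNIV sin cos k] Ck_on_real_SucI[of UNIV cos "\<lambda>x. - sin x" k] Suc
      by simp
  qed
  then show "smooth_on UNIV (sin :: real \<Rightarrow> real)" "smooth_on UNIV (cos :: real \<Rightarrow> real)"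
    by (auto simp: smooth_on_def)
qed

lemma smooth_on_sin [simp]: "open S \<Longrightarrow> smooth_on S f \<Longrightarrow> smooth_on S (\<lambda>x. sin (f x :: real))"
  and smooth_on_cos [simp]: "open S \<Longrightarrow> smooth_on S f \<Longrightarrow> smooth_on S (\<lambda>x. cos (f x :: real))"
  using smooth_on_compose[OF _ open_UNIV _ smooth_on_sin_cos(1), of S f]
    smooth_on_compose[OF _ open_UNIV _ smooth_on_sin_cos(2), of S f] by simp_all

text \<open>Derivatives of holomorphic functions are holomorphic, and the real derivative is multiplication by
  the complex one. This turns a biholomorphic map into a diffeomorphism.\<close>

lemma smooth_on_holomorphic:
  assumes "open S" "f holomorphic_on S"
  shows "smooth_on S f"
proof -
  have "Ck_on k S f" for k
    using assms(2)
  proof (induction k arbitrary: f)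
    case 0
    then show ?case by (simp add: holomorphic_on_imp_continuous_on)
  next
    case (Suc k)
    show ?case
    proof (rule Ck_on_SucI[OF assms(1)])
      show "(f has_derivative (\<lambda>v. deriv f x * v)) (at x)" if "x \<in> S" for x
        using holomorphic_derivI[OF Suc.prems assms(1) that, of UNIV] by (simp add: has_field_derivative_def)
      show "Ck_on k S (\<lambda>x. deriv f x * v)" for v
        by (rule Suc.IH) (intro holomorphic_intros Suc.prems assms(1))
    qed
  qed
  then show ?thesis by (simp add: smooth_on_def)
qed

lemma smooth_on_Complex:
  assumes "open S" "smooth_on S f" "smooth_on S g"
  shows "smooth_on S (\<lambda>x. Complex (f x) (g x))"
proof -
  have "smooth_on S (\<lambda>x. f x *\<^sub>R 1 + g x *\<^sub>R \<i>)"
    by (intro smooth_on_add smooth_on_scaleR smooth_on_const assms)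
  then show ?thesis by (simp add: complex_eq_iff Complex_eq scaleR_conv_of_real mult.commute)
qed

lemma smooth_on_imp_continuous_on: "smooth_on S f \<Longrightarrow> continuous_on S f"
  by (metis Ck_on.simps(1) smooth_on_def)

lemma smooth_on_has_derivative:
  "smooth_on S f \<Longrightarrow> x \<in> S \<Longrightarrow> (f has_derivative frechet_derivative f (at x)) (at x)"
  unfolding smooth_on_def by (rule Ck_on_SucD[of 0]) blast+

lemma smooth_on_frechet_derivative: "smooth_on S f \<Longrightarrow> smooth_on S (\<lambda>x. frechet_derivative f (at x) v)"
  unfolding smooth_on_def by (metis Ck_on.simps(2))

text \<open>An implicit solution of a smooth equation is smooth, because its derivative is a smooth
  function of itself.\<close>

lemma smooth_on_autonomous:
  fixes \<rho> :: "real \<Rightarrow> real" and G :: "real \<times> real \<Rightarrow> real"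
  assumes "open \<Omega>" "smooth_on \<Omega> G" "\<And>\<theta>. (\<rho> \<theta>, \<theta>) \<in> \<Omega>"
    and "\<And>\<theta>. (\<rho> has_real_derivative G (\<rho> \<theta>, \<theta>)) (at \<theta>)"
  shows "smooth_on UNIV \<rho>"
proof (rule smooth_on_from_derivative[OF open_UNIV assms(4)])
  fix k assume r: "Ck_on k UNIV \<rho>"
  have "Ck_on k UNIV (\<lambda>x. (\<rho> x, 0) + (0, x))"
    by (rule Ck_on_add[OF open_UNIV Ck_on_bounded_linear_compose[OF open_UNIV bounded_linear_Pair[OF bounded_linear_ident bounded_linear_zero] r]
        Ck_on_bounded_linear_compose[OF open_UNIV bounded_linear_Pair[OF bounded_linear_zero bounded_linear_ident] Ck_on_ident[OF open_UNIV]]])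
  then have "Ck_on k UNIV (\<lambda>x. (\<rho> x, x))" by simp
  then show "Ck_on k UNIV (\<lambda>\<theta>. G (\<rho> \<theta>, \<theta>))"
    using Ck_on_compose[OF open_UNIV assms(1), of k "\<lambda>x. (\<rho> x, x)" G] assms(2,3)
    by (auto simp: smooth_on_def)
qed

section \<open>The real projective plane\<close>

lemma rp2_line: "x \<noteq> 0 \<Longrightarrow> span {x} \<in> {L :: (real^3) set. subspace L \<and> dim L = 1}"
  by (simp add: dim_span)

lemma rp2_point_eq_iff:
  assumes "x \<noteq> 0" "y \<noteq> 0"
  shows "rp2_point x = rp2_point y \<longleftrightarrow> (\<exists>c. c \<noteq> 0 \<and> x = c *\<^sub>R y)"
proof
  assume "rp2_point x = rp2_point y"
  then have "span {x} = span {y}"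
    using Abs_rp2_inject[OF rp2_line[OF assms(1)] rp2_line[OF assms(2)]] by (simp add: rp2_point_def)
  then have "x \<in> span {y}" by (metis insertI1 span_base)
  then obtain c where "x = c *\<^sub>R y" by (auto simp: span_singleton)
  then show "\<exists>c. c \<noteq> 0 \<and> x = c *\<^sub>R y" using assms by auto
next
  assume "\<exists>c. c \<noteq> 0 \<and> x = c *\<^sub>R y"
  then obtain c where c: "c \<noteq> 0" "x = c *\<^sub>R y" by auto
  have "range (\<lambda>k. k *\<^sub>R (c *\<^sub>R y)) = range (\<lambda>k. k *\<^sub>R y)"
  proof -
    have "range (\<lambda>k. k *\<^sub>R (c *\<^sub>R y)) = (\<lambda>k. k *\<^sub>R y) ` range (\<lambda>k. k * c)"
      by (simp add: image_image)
    also have "range (\<lambda>k. k * c) = UNIV"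
      using c(1) by (auto intro!: surjI[of _ "\<lambda>k. k / c"])
    finally show ?thesis .
  qed
  then show "rp2_point x = rp2_point y" unfolding rp2_point_def c(2) span_singleton by simp
qed

lemma rp2_point_exhaust: obtains x where "x \<noteq> 0" "L = rp2_point x"
proof -
  obtain S where S: "L = Abs_rp2 S" "subspace S" "dim S = 1" using Abs_rp2_cases[of L] by auto
  obtain B where B: "B \<subseteq> S" "independent B" "S \<subseteq> span B" "card B = dim S" using basis_exists[of S] by metis
  then obtain x where "B = {x}" using S(3) card_1_singletonE by metis
  then have "S = span {x}" "x \<noteq> 0" using B S(2) by (auto simp: span_minimal subset_antisym)
  then show thesis using that S(1) by (auto simp: rp2_point_def)
qed

lemma rp2_point_scaleR: "x \<noteq> 0 \<Longrightarrow> c \<noteq> 0 \<Longrightarrow> rp2_point (c *\<^sub>R x) = rp2_point x"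
  by (subst rp2_point_eq_iff) auto

lemma open_punctured: "open {x :: real^3. x \<noteq> 0}"
  by (metis (no_types) Collect_neg_eq closed_singleton open_Compl singleton_conv)

lemma continuous_on_rp2_point: "continuous_on {x. x \<noteq> 0} rp2_point"
  unfolding continuous_on_open_vimage[OF open_punctured] open_rp2_def
  by (auto simp: vimage_def Collect_conj_eq Int_commute)

lemma continuous_on_rp2_point_compose:
  "continuous_on S g \<Longrightarrow> (\<And>x. x \<in> S \<Longrightarrow> g x \<noteq> 0) \<Longrightarrow> continuous_on S (\<lambda>x. rp2_point (g x))"
  by (rule continuous_on_compose2[OF continuous_on_rp2_point]) auto

text \<open>The projection onto the quotient is open, because the saturation of an open set is a union of its
  scalings.\<close>

lemma open_image_rp2_point:
  assumes "open S" "0 \<notin> S"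
  shows "open (rp2_point ` S)"
proof -
  have "{x. x \<noteq> 0 \<and> rp2_point x \<in> rp2_point ` S} = (\<Union>c\<in>-{0}. (\<lambda>x. c *\<^sub>R x) ` S)"
  proof (intro set_eqI iffI)
    fix x assume "x \<in> {x. x \<noteq> 0 \<and> rp2_point x \<in> rp2_point ` S}"
    then obtain y where y: "x \<noteq> 0" "y \<in> S" "rp2_point x = rp2_point y" by auto
    then have "y \<noteq> 0" using assms by auto
    then show "x \<in> (\<Union>c\<in>-{0}. (\<lambda>x. c *\<^sub>R x) ` S)" using y rp2_point_eq_iff by auto
  next
    fix x assume "x \<in> (\<Union>c\<in>-{0}. (\<lambda>x. c *\<^sub>R x) ` S)"
    then obtain c y where "c \<noteq> 0" "y \<in> S" "x = c *\<^sub>R y" by auto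
    moreover then have "y \<noteq> 0" using assms by auto
    ultimately show "x \<in> {x. x \<noteq> 0 \<and> rp2_point x \<in> rp2_point ` S}" by (auto simp: rp2_point_scaleR)
  qed
  also have "open \<dots>" using assms by (auto intro!: open_UN open_scaling)
  finally show ?thesis by (simp add: open_rp2_def)
qed

lemma rp2_atlas_cases:
  assumes "(W, \<phi>) \<in> rp2_atlas"
  obtains c :: "real \<times> real \<Rightarrow> real^3" and i j k where "W = UNIV" "\<phi> = (\<lambda>w. rp2_point (c w))" "smooth_on UNIV c"
    "\<And>w. c w $ i = 1" "\<And>w. c w $ j = fst w" "\<And>w. c w $ k = snd w" "UNIV = {i, j, k}"
proof -
  have s: "smooth_on UNIV (\<lambda>w :: real \<times> real. 1 :: real)" "smooth_on UNIV (\<lambda>w :: real \<times> real. fst w)"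
    "smooth_on UNIV (\<lambda>w :: real \<times> real. snd w)"
    by (auto intro!: smooth_on_const smooth_on_fst smooth_on_snd smooth_on_ident)
  have U: "(UNIV :: 3 set) = {1, 2, 3}" using UNIV_3 .
  from assms consider "W = UNIV" "\<phi> = (\<lambda>w. rp2_point (vector [1, fst w, snd w]))"
    | "W = UNIV" "\<phi> = (\<lambda>w. rp2_point (vector [fst w, 1, snd w]))"
    | "W = UNIV" "\<phi> = (\<lambda>w. rp2_point (vector [fst w, snd w, 1]))"
    unfolding rp2_atlas_def case_prod_unfold by blast
  then show thesis
  proof cases
    case 1
    show thesis by (rule that[of "\<lambda>w. vector [1, fst w, snd w]" 1 2 3]) (use 1 s U in \<open>auto intro!: smooth_on_vector_3\<close>)
  next
    case 2
    show thesis by (rule that[of "\<lambda>w. vector [fst w, 1, snd w]" 2 1 3]) (use 2 s U in \<open>auto intro!: smooth_on_vector_3\<close>)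
  next
    case 3
    show thesis by (rule that[of "\<lambda>w. vector [fst w, snd w, 1]" 3 1 2]) (use 3 s U in \<open>auto intro!: smooth_on_vector_3\<close>)
  qed
qed

text \<open>The charts of the projective plane all factor through its cone of nonzero vectors. A map out of an
  open set is smooth as soon as its expression in each target chart extends to a smooth function of
  homogeneous coordinates; the dual criterion below lifts maps into the projective plane.\<close>

lemma smooth_map_from_rp2:
  assumes "\<And>W' \<psi>. (W', \<psi>) \<in> B \<Longrightarrow> inj_on \<psi> W' \<and> (\<exists>Om h. open Om \<and> smooth_on Om h \<and>
      (\<forall>x. x \<noteq> 0 \<longrightarrow> (x \<in> Om \<longleftrightarrow> rp2_point x \<in> U \<and> f (rp2_point x) \<in> \<psi> ` W')) \<and>
      (\<forall>x\<in>Om. h x \<in> W' \<and> \<psi> (h x) = f (rp2_point x)))"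
  shows "smooth_map rp2_atlas U B f"
  unfolding smooth_map_def Let_def
proof clarify
  fix W \<phi> W' \<psi> assume "(W, \<phi>) \<in> rp2_atlas" and B: "(W', \<psi>) \<in> B"
  then obtain c :: "real \<times> real \<Rightarrow> real^3" and i where c: "W = UNIV" "\<phi> = (\<lambda>w. rp2_point (c w))" "smooth_on UNIV c"
    "\<And>w. c w $ i = 1" by (metis rp2_atlas_cases)
  have nz: "c w \<noteq> 0" for w using c(4)[of w] by auto
  obtain Om h where Om: "inj_on \<psi> W'" "open Om" "smooth_on Om h"
      "\<And>x. x \<noteq> 0 \<Longrightarrow> x \<in> Om \<longleftrightarrow> rp2_point x \<in> U \<and> f (rp2_point x) \<in> \<psi> ` W'"
      "\<And>x. x \<in> Om \<Longrightarrow> h x \<in> W' \<and> \<psi> (h x) = f (rp2_point x)" using assms[OF B] by metis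
  let ?T = "{w \<in> W. \<phi> w \<in> U \<and> f (\<phi> w) \<in> \<psi> ` W'}"
  have T: "?T = c -` Om" using Om(4)[OF nz] c by auto
  have op: "open ?T" unfolding T
    using open_vimage[OF Om(2)] smooth_on_imp_continuous_on[OF c(3)] by blast
  have "smooth_on ?T (\<lambda>w. h (c w))"
    by (rule smooth_on_compose[OF op Om(2) smooth_on_subset[OF c(3)] Om(3)]) (auto simp: T)
  moreover have "inv_into W' \<psi> (f (\<phi> w)) = h (c w)" if "w \<in> ?T" for w
    using Om(5)[of "c w"] that Om(1) unfolding T by (metis c(2) inv_into_f_f vimage_eq)
  ultimately have "smooth_on ?T (\<lambda>w. inv_into W' \<psi> (f (\<phi> w)))"
    using smooth_on_cong[OF op] by (metis (no_types, lifting))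
  then show "open ?T \<and> smooth_on ?T (\<lambda>w. inv_into W' \<psi> (f (\<phi> w)))" using op by simp
qed

lemma smooth_map_to_rp2:
  assumes "\<And>W \<phi>. (W, \<phi>) \<in> A \<Longrightarrow> open W \<and> \<phi> ` W \<subseteq> V \<and>
     (\<exists>L :: _ \<Rightarrow> real^3. smooth_on W L \<and> (\<forall>w\<in>W. L w \<noteq> 0 \<and> f (\<phi> w) = rp2_point (L w)))"
  shows "smooth_map A V rp2_atlas f"
  unfolding smooth_map_def Let_def
proof clarify
  fix W \<phi> W' \<psi> assume A: "(W, \<phi>) \<in> A" and "(W', \<psi>) \<in> rp2_atlas"
  then obtain c :: "real \<times> real \<Rightarrow> real^3" and i j k where c: "W' = UNIV" "\<psi> = (\<lambda>w. rp2_point (c w))" "smooth_on UNIV c"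
    "\<And>w. c w $ i = 1" "\<And>w. c w $ j = fst w" "\<And>w. c w $ k = snd w" "UNIV = {i, j, k}" by (metis rp2_atlas_cases)
  have nz: "c w \<noteq> 0" for w using c(4)[of w] by auto
  obtain L :: "_ \<Rightarrow> real^3" where L: "open W" "\<phi> ` W \<subseteq> V" "smooth_on W L" "\<And>w. w \<in> W \<Longrightarrow> L w \<noteq> 0"
      "\<And>w. w \<in> W \<Longrightarrow> f (\<phi> w) = rp2_point (L w)" using assms[OF A] by metis
  have inj: "inj \<psi>"
  proof (rule injI)
    fix v w assume "\<psi> v = \<psi> w"
    then obtain r where r: "c v = r *\<^sub>R c w" using rp2_point_eq_iff nz c(2) by metis
    then have "r = 1" using c(4)[of v] c(4)[of w] by simp
    then show "v = w" using r c(5)[of v] c(5)[of w] c(6)[of v] c(6)[of w] by (simp add: prod_eq_iff)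
  qed
  have coord: "\<psi> (x $ j / x $ i, x $ k / x $ i) = rp2_point x" if "x $ i \<noteq> 0" for x
  proof -
    have "c (x $ j / x $ i, x $ k / x $ i) = inverse (x $ i) *\<^sub>R x"
      unfolding vec_eq_iff
    proof
      fix l have "l \<in> {i, j, k}" using c(7) by auto
      then show "c (x $ j / x $ i, x $ k / x $ i) $ l = (inverse (x $ i) *\<^sub>R x) $ l"
        using that by (auto simp: c(4-6) divide_inverse mult.commute)
    qed
    moreover have "x \<noteq> 0" using that by auto
    ultimately show ?thesis using that c(2) by (simp add: rp2_point_scaleR)
  qed
  let ?T = "{w \<in> W. \<phi> w \<in> V \<and> f (\<phi> w) \<in> \<psi> ` W'}"
  have iff: "rp2_point x \<in> range \<psi> \<longleftrightarrow> x $ i \<noteq> 0" if x0: "x \<noteq> 0" for x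
  proof
    assume "rp2_point x \<in> range \<psi>"
    then obtain w where "rp2_point x = rp2_point (c w)" using c(2) by auto
    then obtain r where "r \<noteq> 0" "x = r *\<^sub>R c w" using rp2_point_eq_iff[OF x0 nz] by auto
    then show "x $ i \<noteq> 0" using c(4) by simp
  qed (use coord in \<open>metis rangeI\<close>)
  have "w \<in> ?T \<longleftrightarrow> w \<in> W \<and> L w $ i \<noteq> 0" for w
  proof (cases "w \<in> W")
    case True
    then have "\<phi> w \<in> V" using L(2) by blast
    moreover have "f (\<phi> w) \<in> \<psi> ` W' \<longleftrightarrow> L w $ i \<noteq> 0" unfolding c(1) L(5)[OF True] by (rule iff[OF L(4)[OF True]])
    ultimately show ?thesis using True by blast
  qed simp
  then have T: "?T = {w \<in> W. L w $ i \<noteq> 0}" by blast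
  have "continuous_on W (\<lambda>w. L w $ i)"
    by (intro continuous_intros smooth_on_imp_continuous_on L)
  then have op: "open ?T" unfolding T
    using L(1) continuous_open_preimage[of W "\<lambda>w. L w $ i" "- {0}"] by (simp add: vimage_def Int_def open_Compl)
  have LT: "smooth_on ?T L" by (rule smooth_on_subset[OF L(3)]) auto
  have "smooth_on ?T (\<lambda>w. (L w $ j / L w $ i, L w $ k / L w $ i))"
    by (intro smooth_on_Pair smooth_on_divide smooth_on_vec_nth LT op) (simp_all add: T)
  moreover have "inv_into W' \<psi> (f (\<phi> w)) = (L w $ j / L w $ i, L w $ k / L w $ i)" if "w \<in> ?T" for w
    using that unfolding T using L(5)[of w] coord[of "L w"] inj c(1) inv_into_f_f[OF inj] by (metis (mono_tags, lifting) UNIV_I mem_Collect_eq)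
  ultimately have "smooth_on ?T (\<lambda>w. inv_into W' \<psi> (f (\<phi> w)))"
    using smooth_on_cong[OF op] by (metis (no_types, lifting))
  then show "open ?T \<and> smooth_on ?T (\<lambda>w. inv_into W' \<psi> (f (\<phi> w)))" using op by simp
qed

lemma components_of_open_pair:
  fixes I E :: "'a::topological_space set"
  assumes "open I" "open E" "connected I" "connected E" "I \<noteq> {}" "E \<noteq> {}" "I \<inter> E = {}"
  shows "components (I \<union> E) = {I, E}"
proof -
  have *: "P \<in> components (P \<union> Q)" if "open P" "open Q" "connected P" "P \<noteq> {}" "P \<inter> Q = {}" for P Q :: "'a set"
    unfolding in_components_maximal
  proof (intro conjI allI impI)
    fix d assume d: "d \<noteq> {} \<and> P \<subseteq> d \<and> d \<subseteq> P \<union> Q \<and> connected d"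
    then have "P \<inter> Q \<inter> d = {}" "P \<inter> d \<noteq> {}" using that by auto
    then have "Q \<inter> d = {}" using connectedD[of d P Q] d that by blast
    then show "d = P" using d by auto
  qed (use that in auto)
  have 1: "I \<in> components (I \<union> E)" using *[of I E] assms by auto
  have 2: "E \<in> components (I \<union> E)" using *[of E I] assms by (simp add: Un_commute Int_commute)
  have "D = I \<or> D = E" if D: "D \<in> components (I \<union> E)" for D
  proof -
    have "D \<noteq> {}" "D \<subseteq> I \<union> E" using in_components_nonempty[OF D] in_components_subset[OF D] by auto
    then have "D \<inter> I \<noteq> {} \<or> D \<inter> E \<noteq> {}" by auto
    then show ?thesis using components_eq[OF D 1] components_eq[OF D 2] by auto
  qed
  then show ?thesis using 1 2 by auto
qed

lemma moebius_point_eq_iff: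
  "moebius_point (x, y) = moebius_point (x', y') \<longleftrightarrow> (\<exists>n::int. x' = x + of_int n \<and> y' = (if even n then y else - y))"
proof
  assume "moebius_point (x, y) = moebius_point (x', y')"
  then have "(x' + of_int 0, if even (0::int) then y' else - y') \<in> moebius_point (x, y)"
    unfolding moebius_point_def by blast
  then show "\<exists>n::int. x' = x + of_int n \<and> y' = (if even n then y else - y)"
    unfolding moebius_point_def by auto
next
  assume "\<exists>n::int. x' = x + of_int n \<and> y' = (if even n then y else - y)"
  then obtain n :: int where n: "x' = x + of_int n" "y' = (if even n then y else - y)" by auto
  have "range (\<lambda>k::int. (x' + of_int k, if even k then y' else - y')) = range ((\<lambda>k::int. (x + of_int k, if even k then y else - y)) \<circ> (\<lambda>k. n + k))"
    by (rule arg_cong[where f = range]) (auto simp: n fun_eq_iff)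
  also have "\<dots> = range (\<lambda>k::int. (x + of_int k, if even k then y else - y))"
    unfolding image_comp[symmetric] by (simp add: surj_plus)
  finally show "moebius_point (x, y) = moebius_point (x', y')" by (simp add: moebius_point_def)
qed

lemma inj_on_moebius_point: "inj_on moebius_point ({a<..<a + 1} \<times> {-1<..<1})"
proof (rule inj_onI, clarify)
  fix x y x' y' assume *: "moebius_point (x, y) = moebius_point (x', y')" "x \<in> {a<..<a + 1}" "x' \<in> {a<..<a + 1}"
  then obtain n :: int where n: "x' = x + of_int n" "y' = (if even n then y else - y)" by (auto simp: moebius_point_eq_iff)
  then have "\<bar>of_int n :: real\<bar> < 1" using *(2,3) by auto
  then have "n = 0" by linarith
  then show "x = x' \<and> y = y'" using n by simp
qed

section \<open>Star-shaped curves are ovals\<close>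

text \<open>A curve \<open>r = \<rho> \<theta>\<close> in polar coordinates about the point \<open>A [1 : 0 : 0]\<close>. Away from this centre,
  a point of the projective plane is written as \<open>A [s : cos \<theta> : sin \<theta>]\<close> with \<open>s = 1 / r\<close>; the
  points at infinity are \<open>s = 0\<close>, and \<open>(s, \<theta>)\<close> and \<open>(- s, \<theta> + \<pi>)\<close> are the same point. On the line of
  direction \<open>\<theta>\<close> the curve has the two points \<open>s = \<alpha> \<theta>\<close> and \<open>s = - \<alpha> (\<theta> + \<pi>)\<close>, and the exterior lies between
  them.\<close>

locale star_curve =
  fixes A :: "real^3^3" and \<rho> :: "real \<Rightarrow> real"
  assumes orth: "orthogonal_matrix A" and pos: "\<And>\<theta>. \<rho> \<theta> > 0"
    and per: "\<And>\<theta>. \<rho> (\<theta> + 2 * pi) = \<rho> \<theta>" and sm: "smooth_on UNIV \<rho>"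
begin

definition \<alpha> :: "real \<Rightarrow> real" where "\<alpha> \<theta> = 1 / \<rho> \<theta>"

definition lift :: "real \<Rightarrow> real \<Rightarrow> real^3" where "lift s \<theta> = A *v vector [s, cos \<theta>, sin \<theta>]"

definition pt :: "real \<Rightarrow> real \<Rightarrow> rp2" where "pt s \<theta> = rp2_point (lift s \<theta>)"

definition crd :: "real^3 \<Rightarrow> real^3" where "crd x = transpose A *v x"

lemma crd_A [simp]: "crd (A *v y) = y" and A_crd [simp]: "A *v crd x = x"
  using orth unfolding orthogonal_matrix_def crd_def
  by (simp_all add: matrix_vector_mul_assoc del: transpose_matrix_vector)

lemma crd_scaleR: "crd (c *\<^sub>R x) = c *\<^sub>R crd x"
  by (simp add: crd_def matrix_vector_mult_scaleR del: transpose_matrix_vector)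

lemma crd_0 [simp]: "crd 0 = 0"
  by (simp add: crd_def)

lemma smooth_crd: "open S \<Longrightarrow> smooth_on S crd"
  unfolding crd_def by (intro smooth_on_matrix_vector smooth_on_ident)

lemma A_nz: "A *v y \<noteq> 0 \<longleftrightarrow> y \<noteq> 0"
  by (metis crd_A matrix_vector_mult_0_right)

lemma vector3_eq [simp]: "vector [a, b, c] = (vector [a', b', c'] :: real^3) \<longleftrightarrow> a = a' \<and> b = b' \<and> c = c'"
  by (auto simp: vec_eq_iff forall_3)

lemma scaleR_vector3: "r *\<^sub>R vector [a, b, c] = (vector [r * a, r * b, r * c] :: real^3)"
  by (auto simp: vec_eq_iff forall_3)

lemma vector3_polar_nz: "vector [s, cos \<theta>, sin \<theta>] \<noteq> (0 :: real^3)"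
proof
  assume "vector [s, cos \<theta>, sin \<theta>] = (0 :: real^3)"
  then have "cos \<theta> = 0" "sin \<theta> = 0" by (auto simp: vec_eq_iff forall_3)
  then show False using sin_cos_squared_add[of \<theta>] by simp
qed

lemma lift_nz: "lift s \<theta> \<noteq> 0"
  by (simp add: lift_def A_nz vector3_polar_nz)

lemma \<alpha>_pos: "\<alpha> \<theta> > 0" by (simp add: \<alpha>_def pos)

lemma \<rho>_cong: assumes "cos \<theta>' = cos \<theta>" "sin \<theta>' = sin \<theta>" shows "\<rho> \<theta>' = \<rho> \<theta>"
proof -
  have nat: "\<rho> (\<theta> + 2 * pi * real n) = \<rho> \<theta>" for n \<theta>
  proof (induction n)
    case (Suc n)
    then show ?case using per[of "\<theta> + 2 * pi * real n"] by (simp add: algebra_simps)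
  qed simp
  obtain n :: int where n: "\<theta>' = \<theta> + 2 * pi * of_int n" using sin_cos_eq_iff[of \<theta>' \<theta>] assms by auto
  show ?thesis
  proof (cases "n \<ge> 0")
    case True
    then show ?thesis using nat[of \<theta> "nat n"] n by simp
  next
    case False
    then show ?thesis using nat[of \<theta>' "nat (- n)"] n by simp
  qed
qed

lemma \<alpha>_cong: "cos \<theta>' = cos \<theta> \<Longrightarrow> sin \<theta>' = sin \<theta> \<Longrightarrow> \<alpha> \<theta>' = \<alpha> \<theta>"
  by (simp add: \<alpha>_def \<rho>_cong[of \<theta>' \<theta>])

lemma pt_cong: "s' = s \<Longrightarrow> cos \<theta>' = cos \<theta> \<Longrightarrow> sin \<theta>' = sin \<theta> \<Longrightarrow> pt s' \<theta>' = pt s \<theta>"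
  by (simp add: pt_def lift_def)

lemma pt_scaleR: "r \<noteq> 0 \<Longrightarrow> rp2_point (A *v (r *\<^sub>R vector [s, cos \<theta>, sin \<theta>])) = pt s \<theta>"
  using rp2_point_scaleR[OF lift_nz, of r s \<theta>] by (simp add: pt_def lift_def matrix_vector_mult_scaleR)

lemma pt_antipode: "pt (- s) (\<theta> + pi) = pt s \<theta>"
  using pt_scaleR[of "-1" s \<theta>] by (simp add: pt_def lift_def scaleR_vector3)

lemma pt_eqD:
  assumes "pt s \<theta> = pt s' \<theta>'"
  shows "(s' = s \<and> cos \<theta>' = cos \<theta> \<and> sin \<theta>' = sin \<theta>) \<or> (s' = - s \<and> cos \<theta>' = - cos \<theta> \<and> sin \<theta>' = - sin \<theta>)"
proof -
  obtain c where c: "lift s \<theta> = c *\<^sub>R lift s' \<theta>'"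
    using assms rp2_point_eq_iff[OF lift_nz lift_nz] by (auto simp: pt_def)
  then have "crd (lift s \<theta>) = c *\<^sub>R crd (lift s' \<theta>')"
    by (simp add: crd_scaleR)
  then have v: "s = c * s'" "cos \<theta> = c * cos \<theta>'" "sin \<theta> = c * sin \<theta>'"
    by (simp_all add: lift_def scaleR_vector3)
  have "1 = (sin \<theta>)\<^sup>2 + (cos \<theta>)\<^sup>2" by simp
  also have "\<dots> = c\<^sup>2 * ((sin \<theta>')\<^sup>2 + (cos \<theta>')\<^sup>2)" unfolding v by algebra
  finally have "c\<^sup>2 = 1" by simp
  then have "c = 1 \<or> c = -1" by (simp add: power2_eq_1_iff)
  then show ?thesis using v by auto
qed

text \<open>The parts of the line of direction \<open>\<theta>\<close> that lie in the exterior, in the interior and on the curve.\<close>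

definition Ein where "Ein s \<theta> \<longleftrightarrow> - \<alpha> (\<theta> + pi) < s \<and> s < \<alpha> \<theta>"
definition Iin where "Iin s \<theta> \<longleftrightarrow> s < - \<alpha> (\<theta> + pi) \<or> \<alpha> \<theta> < s"
definition Cin where "Cin s \<theta> \<longleftrightarrow> s = - \<alpha> (\<theta> + pi) \<or> s = \<alpha> \<theta>"

text \<open>The three conditions depend on the point alone, since the identification \<open>(s, \<theta>) \<sim> (- s, \<theta> + \<pi>)\<close>
  exchanges the two end points of the segment.\<close>

lemma in_cong:
  assumes "pt s \<theta> = pt s' \<theta>'"
  shows "Ein s' \<theta>' = Ein s \<theta>" "Iin s' \<theta>' = Iin s \<theta>" "Cin s' \<theta>' = Cin s \<theta>"
proof -
  from pt_eqD[OF assms]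
  have "(s' = s \<and> \<alpha> \<theta>' = \<alpha> \<theta> \<and> \<alpha> (\<theta>' + pi) = \<alpha> (\<theta> + pi)) \<or> (s' = - s \<and> \<alpha> \<theta>' = \<alpha> (\<theta> + pi) \<and> \<alpha> (\<theta>' + pi) = \<alpha> \<theta>)"
    using \<alpha>_cong[of \<theta>' \<theta>] \<alpha>_cong[of "\<theta>' + pi" "\<theta> + pi"] \<alpha>_cong[of \<theta>' "\<theta> + pi"] \<alpha>_cong[of "\<theta>' + pi" \<theta>] by auto
  then show "Ein s' \<theta>' = Ein s \<theta>" "Iin s' \<theta>' = Iin s \<theta>" "Cin s' \<theta>' = Cin s \<theta>"
    unfolding Ein_def Iin_def Cin_def by auto
qed

definition "centre = rp2_point (A *v vector [1, 0, 0])"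
definition "curve = range (\<lambda>\<theta>. pt (\<alpha> \<theta>) \<theta>)"
definition "exterior = {pt s \<theta> |s \<theta>. Ein s \<theta>}"
definition "interior_disc = insert centre {pt s \<theta> |s \<theta>. Iin s \<theta>}"

lemma centre_neq: "centre \<noteq> pt s \<theta>"
proof
  have nz: "vector [1, 0, 0] \<noteq> (0 :: real^3)" by (auto simp: vec_eq_iff forall_3)
  assume "centre = pt s \<theta>"
  then obtain c where "A *v vector [1, 0, 0] = c *\<^sub>R lift s \<theta>" "c \<noteq> 0"
    unfolding centre_def pt_def using rp2_point_eq_iff[of "A *v vector [1, 0, 0]" "lift s \<theta>"] lift_nz A_nz nz by auto
  then have "crd (A *v vector [1, 0, 0]) = c *\<^sub>R crd (lift s \<theta>)" by (simp add: crd_scaleR)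
  then have "cos \<theta> = 0" "sin \<theta> = 0" using \<open>c \<noteq> 0\<close> by (simp_all add: lift_def scaleR_vector3)
  then show False using sin_cos_squared_add[of \<theta>] by simp
qed

lemma pt_in_iff [simp]:
  "pt s \<theta> \<in> exterior \<longleftrightarrow> Ein s \<theta>" "pt s \<theta> \<in> interior_disc \<longleftrightarrow> Iin s \<theta>" "pt s \<theta> \<in> curve \<longleftrightarrow> Cin s \<theta>"
proof -
  show "pt s \<theta> \<in> exterior \<longleftrightarrow> Ein s \<theta>" unfolding exterior_def using in_cong(1) by blast
  show "pt s \<theta> \<in> interior_disc \<longleftrightarrow> Iin s \<theta>"
    unfolding interior_disc_def using in_cong(2) centre_neq[of s \<theta>, symmetric] by blast
  have "Cin (\<alpha> \<phi>) \<phi>" for \<phi> by (simp add: Cin_def)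
  moreover have "pt s \<theta> \<in> curve" if "Cin s \<theta>"
  proof (cases "s = \<alpha> \<theta>")
    case False
    then have "pt s \<theta> = pt (\<alpha> (\<theta> + pi)) (\<theta> + pi)" using that pt_antipode[of s \<theta>] by (simp add: Cin_def)
    then show ?thesis by (auto simp: curve_def)
  qed (auto simp: curve_def)
  ultimately show "pt s \<theta> \<in> curve \<longleftrightarrow> Cin s \<theta>" unfolding curve_def using in_cong(3) by blast
qed

lemma centre_in [simp]: "centre \<in> interior_disc" "centre \<notin> exterior" "centre \<notin> curve"
  using centre_neq by (auto simp: interior_disc_def exterior_def curve_def)

lemma plane_polar:
  fixes x y :: real
  obtains r \<theta> where "r \<ge> 0" "x = r * cos \<theta>" "y = r * sin \<theta>"
proof -
  have "Complex x y = rcis (cmod (Complex x y)) (Arg (Complex x y))" by (simp add: rcis_cmod_Arg)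
  then show thesis using that[of "cmod (Complex x y)" "Arg (Complex x y)"]
    by (metis Re_rcis Im_rcis complex.sel norm_ge_zero)
qed

lemma point_cases: obtains "L = centre" | s \<theta> where "L = pt s \<theta>"
proof -
  obtain x where x: "x \<noteq> 0" "L = rp2_point x" by (rule rp2_point_exhaust)
  obtain r \<theta> where r: "r \<ge> 0" "crd x $ 2 = r * cos \<theta>" "crd x $ 3 = r * sin \<theta>" by (rule plane_polar)
  show thesis
  proof (cases "r = 0")
    case True
    then have c: "crd x = crd x $ 1 *\<^sub>R vector [1, 0, 0]" using r by (auto simp: vec_eq_iff forall_3)
    then have "crd x $ 1 \<noteq> 0" using x by (metis A_crd matrix_vector_mult_0_right scaleR_zero_left)
    moreover have "x = crd x $ 1 *\<^sub>R (A *v vector [1, 0, 0])"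
      using c by (metis A_crd matrix_vector_mult_scaleR)
    moreover have "A *v vector [1, 0, 0] \<noteq> 0" using A_nz by (auto simp: vec_eq_iff forall_3)
    ultimately have "L = centre" unfolding x(2) centre_def by (metis rp2_point_scaleR)
    then show thesis using that by blast
  next
    case False
    then have "crd x = r *\<^sub>R vector [crd x $ 1 / r, cos \<theta>, sin \<theta>]" using r by (auto simp: vec_eq_iff forall_3)
    then have "L = pt (crd x $ 1 / r) \<theta>" using x(2) pt_scaleR[OF False] by (metis A_crd)
    then show thesis using that by blast
  qed
qed

lemma complement_curve: "- curve = interior_disc \<union> exterior" "interior_disc \<inter> exterior = {}"
proof -
  have "\<alpha> (\<theta> + pi) > 0" "\<alpha> \<theta> > 0" for \<theta> by (rule \<alpha>_pos)+
  then have *: "Cin s \<theta> \<longleftrightarrow> \<not> Iin s \<theta> \<and> \<not> Ein s \<theta>" "\<not> (Iin s \<theta> \<and> Ein s \<theta>)" for s \<theta>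
    unfolding Cin_def Iin_def Ein_def by (smt (verit))+
  show "- curve = interior_disc \<union> exterior"
  proof (rule set_eqI)
    fix L show "L \<in> - curve \<longleftrightarrow> L \<in> interior_disc \<union> exterior"
      by (cases L rule: point_cases) (auto simp: *(1))
  qed
  have "L \<notin> interior_disc \<inter> exterior" for L
    by (cases L rule: point_cases) (use *(2) in auto)
  then show "interior_disc \<inter> exterior = {}" by blast
qed

text \<open>Off the line of direction \<open>b\<close>, a smooth choice of the angle \<open>ang b\<close> and of a signed radius \<open>rad b\<close>. The
  antipodal map fixes the angle and changes the sign of the radius, so both are adapted to the
  projective plane.\<close>

definition pc :: "real \<Rightarrow> real^3 \<Rightarrow> real" where "pc b y = y $ 2 * cos b + y $ 3 * sin b"
definition qc :: "real \<Rightarrow> real^3 \<Rightarrow> real" where "qc b y = y $ 3 * cos b - y $ 2 * sin b"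
definition ang :: "real \<Rightarrow> real^3 \<Rightarrow> real" where "ang b y = b + pi / 2 - arctan (pc b y / qc b y)"
definition rad :: "real \<Rightarrow> real^3 \<Rightarrow> real" where "rad b y = qc b y * sqrt (1 + (pc b y / qc b y)\<^sup>2)"

lemma local_polar:
  assumes "qc b y \<noteq> 0"
  shows "y $ 2 = rad b y * cos (ang b y)" "y $ 3 = rad b y * sin (ang b y)" "rad b y \<noteq> 0"
    "b < ang b y" "ang b y < b + pi"
proof -
  let ?t = "pc b y / qc b y"
  have s: "sqrt (1 + ?t\<^sup>2) > 0" by (simp add: add_pos_nonneg)
  have c: "rad b y * cos (arctan ?t) = qc b y" "rad b y * sin (arctan ?t) = pc b y"
    using s assms by (simp_all add: rad_def cos_arctan sin_arctan)
  have a: "cos (ang b y) = sin (arctan ?t) * cos b - cos (arctan ?t) * sin b"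
    "sin (ang b y) = cos (arctan ?t) * cos b + sin (arctan ?t) * sin b"
    unfolding ang_def by (simp_all add: cos_diff sin_diff cos_add sin_add algebra_simps)
  have "rad b y * cos (ang b y) = (rad b y * sin (arctan ?t)) * cos b - (rad b y * cos (arctan ?t)) * sin b"
    unfolding a by (simp add: algebra_simps)
  also have "\<dots> = pc b y * cos b - qc b y * sin b" unfolding c ..
  also have "\<dots> = y $ 2 * ((sin b)\<^sup>2 + (cos b)\<^sup>2)" unfolding pc_def qc_def by algebra
  finally show "y $ 2 = rad b y * cos (ang b y)" by simp
  have "rad b y * sin (ang b y) = (rad b y * cos (arctan ?t)) * cos b + (rad b y * sin (arctan ?t)) * sin b"
    unfolding a by (simp add: algebra_simps)
  also have "\<dots> = qc b y * cos b + pc b y * sin b" unfolding c ..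
  also have "\<dots> = y $ 3 * ((sin b)\<^sup>2 + (cos b)\<^sup>2)" unfolding pc_def qc_def by algebra
  finally show "y $ 3 = rad b y * sin (ang b y)" by simp
  show "rad b y \<noteq> 0" using s assms by (simp add: rad_def)
  show "b < ang b y" "ang b y < b + pi" using arctan_bounded[of ?t] by (auto simp: ang_def)
qed

lemma local_pt:
  assumes "qc b (crd x) \<noteq> 0"
  shows "rp2_point x = pt (crd x $ 1 / rad b (crd x)) (ang b (crd x))"
proof -
  let ?y = "crd x"
  note l = local_polar[OF assms]
  have "?y = rad b ?y *\<^sub>R vector [?y $ 1 / rad b ?y, cos (ang b ?y), sin (ang b ?y)]"
    using l(3) l(1,2)[symmetric] by (auto simp: vec_eq_iff forall_3)
  then show ?thesis using pt_scaleR[OF l(3)] by (metis A_crd)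
qed

definition "Q b = {y. qc b y \<noteq> 0}"

lemma open_Q: "open (Q b)"
proof -
  have "continuous_on UNIV (qc b)" unfolding qc_def by (intro continuous_intros)
  then have "open (qc b -` (- {0}))" by (intro open_vimage open_Compl) auto
  then show ?thesis by (simp add: Q_def vimage_def Compl_eq)
qed

lemma smooth_local: "smooth_on (Q b) (ang b)" "smooth_on (Q b) (rad b)"
proof -
  have p: "smooth_on (Q b) (pc b)" "smooth_on (Q b) (qc b)" unfolding pc_def qc_def
    by (intro smooth_on_add smooth_on_diff smooth_on_mult smooth_on_const smooth_on_vec_nth smooth_on_ident open_Q)+
  have pq: "smooth_on (Q b) (\<lambda>y. pc b y / qc b y)"
    by (rule smooth_on_divide[OF open_Q p]) (simp add: Q_def)
  show "smooth_on (Q b) (ang b)" unfolding ang_def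
    using smooth_on_diff[OF open_Q smooth_on_const smooth_on_compose[OF open_Q open_UNIV pq smooth_on_arctan]] by simp
  have pq1: "smooth_on (Q b) (\<lambda>y. 1 + (pc b y / qc b y)\<^sup>2)"
    by (rule smooth_on_add[OF open_Q smooth_on_const smooth_on_power[OF open_Q pq]])
  have "smooth_on (Q b) (\<lambda>y. sqrt (1 + (pc b y / qc b y)\<^sup>2))"
    by (rule smooth_on_compose[OF open_Q _ pq1 smooth_on_sqrt]) (auto simp: add_pos_nonneg)
  then show "smooth_on (Q b) (rad b)" unfolding rad_def by (rule smooth_on_mult[OF open_Q p(2)])
qed

lemma smooth_\<rho>: "open S \<Longrightarrow> smooth_on S f \<Longrightarrow> smooth_on S (\<lambda>x. \<rho> (f x))"
  by (rule smooth_on_compose[OF _ open_UNIV _ sm]) auto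

lemma smooth_\<alpha>: "open S \<Longrightarrow> smooth_on S f \<Longrightarrow> smooth_on S (\<lambda>x. \<alpha> (f x))"
  unfolding \<alpha>_def using smooth_on_divide[OF _ smooth_on_const smooth_\<rho>] pos less_irrefl by metis

lemma Q_cover: "y \<in> Q 0 \<or> y \<in> Q (pi / 2) \<longleftrightarrow> \<not> (y $ 2 = 0 \<and> y $ 3 = 0)"
  by (auto simp: Q_def qc_def)

lemma open_in_Q:
  assumes "smooth_on (Q b) f" "smooth_on (Q b) g"
  shows "open {y \<in> Q b. (f y :: real) < 0 \<and> (g y :: real) < 0}"
proof -
  have "open (Q b \<inter> f -` {..<0})" "open (Q b \<inter> g -` {..<0})"
    by (rule continuous_open_preimage[OF smooth_on_imp_continuous_on[OF assms(1)] open_Q open_lessThan],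
        rule continuous_open_preimage[OF smooth_on_imp_continuous_on[OF assms(2)] open_Q open_lessThan])
  then have "open ((Q b \<inter> f -` {..<0}) \<inter> (Q b \<inter> g -` {..<0}))" by (rule open_Int)
  also have "(Q b \<inter> f -` {..<0}) \<inter> (Q b \<inter> g -` {..<0}) = {y \<in> Q b. f y < 0 \<and> g y < 0}" by auto
  finally show ?thesis .
qed

lemma open_crd: "open S \<Longrightarrow> open {x. crd x \<in> S}"
  using open_vimage[of S crd] smooth_on_imp_continuous_on[OF smooth_crd[OF open_UNIV]] by (simp add: vimage_def)

text \<open>The exterior in homogeneous coordinates, without the line of direction \<open>b\<close>.\<close>

definition "Eloc b = {y \<in> Q b. Ein (y $ 1 / rad b y) (ang b y)}"

lemma open_Eloc: "open (Eloc b)"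
proof -
  have r: "y \<in> Q b \<Longrightarrow> rad b y \<noteq> 0" for y using local_polar(3) by (auto simp: Q_def)
  have s: "smooth_on (Q b) (\<lambda>y. y $ 1 / rad b y)"
    by (intro smooth_on_divide smooth_on_vec_nth smooth_on_ident open_Q smooth_local r)
  have 1: "smooth_on (Q b) (\<lambda>y. - \<alpha> (ang b y + pi) - y $ 1 / rad b y)"
    by (intro smooth_on_diff smooth_on_minus smooth_\<alpha> smooth_on_add smooth_on_const smooth_local s open_Q)
  have 2: "smooth_on (Q b) (\<lambda>y. y $ 1 / rad b y - \<alpha> (ang b y))"
    by (intro smooth_on_diff smooth_\<alpha> smooth_local s open_Q)
  show ?thesis using open_in_Q[OF 1 2] by (simp add: Eloc_def Ein_def)
qed

lemma Eloc_iff: "crd x \<in> Q b \<Longrightarrow> rp2_point x \<in> exterior \<longleftrightarrow> crd x \<in> Eloc b"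
  using local_pt[of b x] by (simp add: Eloc_def Q_def)

lemma centre_iff: "x \<noteq> 0 \<Longrightarrow> crd x $ 2 = 0 \<Longrightarrow> crd x $ 3 = 0 \<Longrightarrow> rp2_point x = centre"
proof -
  assume x: "x \<noteq> 0" "crd x $ 2 = 0" "crd x $ 3 = 0"
  then have c: "crd x = crd x $ 1 *\<^sub>R vector [1, 0, 0]" by (auto simp: vec_eq_iff forall_3)
  then have "crd x $ 1 \<noteq> 0" using x by (metis A_crd matrix_vector_mult_0_right scaleR_zero_left)
  moreover have "x = crd x $ 1 *\<^sub>R (A *v vector [1, 0, 0])"
    using c by (metis A_crd matrix_vector_mult_scaleR)
  moreover have "A *v vector [1, 0, 0] \<noteq> 0" using A_nz by (auto simp: vec_eq_iff forall_3)
  ultimately show ?thesis unfolding centre_def by (metis rp2_point_scaleR)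
qed

lemma open_exterior: "open exterior"
proof -
  have nz: "crd x \<in> Q b \<Longrightarrow> x \<noteq> 0" for x b by (auto simp: Q_def qc_def)
  have "{x. x \<noteq> 0 \<and> rp2_point x \<in> exterior} = {x. crd x \<in> Eloc 0} \<union> {x. crd x \<in> Eloc (pi / 2)}"
  proof (intro set_eqI iffI)
    fix x assume x: "x \<in> {x. x \<noteq> 0 \<and> rp2_point x \<in> exterior}"
    then have "crd x \<in> Q 0 \<or> crd x \<in> Q (pi / 2)" unfolding Q_cover using centre_iff[of x] centre_in(2) by fastforce
    then show "x \<in> {x. crd x \<in> Eloc 0} \<union> {x. crd x \<in> Eloc (pi / 2)}" using x Eloc_iff by blast
  next
    fix x assume "x \<in> {x. crd x \<in> Eloc 0} \<union> {x. crd x \<in> Eloc (pi / 2)}"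
    then obtain b where b: "crd x \<in> Eloc b" by auto
    then have "crd x \<in> Q b" by (auto simp: Eloc_def)
    then show "x \<in> {x. x \<noteq> 0 \<and> rp2_point x \<in> exterior}" using b Eloc_iff nz by blast
  qed
  then show ?thesis unfolding open_rp2_def using open_Un[OF open_crd[OF open_Eloc[of 0]] open_crd[OF open_Eloc[of "pi / 2"]]] by simp
qed

text \<open>The affine function that maps \<open>[-1, 1]\<close> onto the segment cut out on the line of direction \<open>\<theta>\<close>.
  Changing \<open>\<theta>\<close> into \<open>\<theta> + \<pi>\<close> reverses the segment, which is the twist of the Moebius band.\<close>

definition sfun :: "real \<Rightarrow> real \<Rightarrow> real" where
  "sfun \<theta> y = ((\<alpha> \<theta> + \<alpha> (\<theta> + pi)) * y + \<alpha> \<theta> - \<alpha> (\<theta> + pi)) / 2"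

definition emap :: "real \<times> real \<Rightarrow> rp2" where
  "emap = (\<lambda>(x, y). pt (sfun (pi * x) y) (pi * x))"

lemma sfun_Ein: "Ein (sfun \<theta> y) \<theta> \<longleftrightarrow> -1 < y \<and> y < 1"
proof -
  let ?a = "\<alpha> \<theta>" and ?b = "\<alpha> (\<theta> + pi)"
  have ab: "?a + ?b > 0" using \<alpha>_pos by (simp add: add_pos_pos)
  have "?a - sfun \<theta> y = (?a + ?b) * (1 - y) / 2" "sfun \<theta> y - (- ?b) = (?a + ?b) * (1 + y) / 2"
    by (simp_all add: sfun_def algebra_simps add_divide_distrib diff_divide_distrib)
  then have "sfun \<theta> y < ?a \<longleftrightarrow> 0 < (?a + ?b) * (1 - y)" "- ?b < sfun \<theta> y \<longleftrightarrow> 0 < (?a + ?b) * (1 + y)"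
    by linarith+
  then show ?thesis unfolding Ein_def using ab by (auto simp: zero_less_mult_iff)
qed

lemma sfun_inverse: "sfun \<theta> ((2 * s + \<alpha> (\<theta> + pi) - \<alpha> \<theta>) / (\<alpha> \<theta> + \<alpha> (\<theta> + pi))) = s"
proof -
  have "\<alpha> \<theta> + \<alpha> (\<theta> + pi) \<noteq> 0" using \<alpha>_pos[of \<theta>] \<alpha>_pos[of "\<theta> + pi"] by linarith
  then show ?thesis unfolding sfun_def by (simp add: field_simps)
qed

lemma sfun_inj: "sfun \<theta> y = sfun \<theta> y' \<Longrightarrow> y = y'"
  using \<alpha>_pos[of \<theta>] \<alpha>_pos[of "\<theta> + pi"] by (simp add: sfun_def)

lemma sfun_cong: "cos \<theta>' = cos \<theta> \<Longrightarrow> sin \<theta>' = sin \<theta> \<Longrightarrow> sfun \<theta>' y = sfun \<theta> y"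
  using \<alpha>_cong[of \<theta>' \<theta>] \<alpha>_cong[of "\<theta>' + pi" "\<theta> + pi"] by (simp add: sfun_def)

lemma sfun_antipode: "cos \<theta>' = - cos \<theta> \<Longrightarrow> sin \<theta>' = - sin \<theta> \<Longrightarrow> sfun \<theta>' (- y) = - sfun \<theta> y"
  using \<alpha>_cong[of \<theta>' "\<theta> + pi"] \<alpha>_cong[of "\<theta>' + pi" \<theta>] by (simp add: sfun_def field_simps)

text \<open>Equality of points means equality of directions modulo \<open>\<pi>\<close> with the sign of \<open>s\<close> switched at every
  half turn; in the coordinate \<open>\<theta> / \<pi>\<close> this is the orbit relation of the Moebius band.\<close>

lemma emap_eq_iff: "emap w = emap w' \<longleftrightarrow> moebius_point w = moebius_point w'"
proof -
  obtain x y x' y' where w: "w = (x, y)" "w' = (x', y')" by (metis surj_pair)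
  show ?thesis
  proof
    assume "emap w = emap w'"
    then have e: "pt (sfun (pi * x) y) (pi * x) = pt (sfun (pi * x') y') (pi * x')" by (simp add: emap_def w)
    from pt_eqD[OF this] show "moebius_point w = moebius_point w'"
    proof
      assume a: "sfun (pi * x') y' = sfun (pi * x) y \<and> cos (pi * x') = cos (pi * x) \<and> sin (pi * x') = sin (pi * x)"
      then obtain n :: int where n: "pi * x' = pi * x + 2 * pi * of_int n" using sin_cos_eq_iff[of "pi * x'" "pi * x"] by auto
      then have "pi * x' = pi * (x + 2 * of_int n)" by (simp add: algebra_simps)
      then have "x' = x + of_int (2 * n)" by simp
      moreover have "y' = y" using a sfun_cong[of "pi * x'" "pi * x" y'] sfun_inj by metis
      ultimately show ?thesis unfolding w moebius_point_eq_iff by (intro exI[of _ "2 * n"]) auto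
    next
      assume a: "sfun (pi * x') y' = - sfun (pi * x) y \<and> cos (pi * x') = - cos (pi * x) \<and> sin (pi * x') = - sin (pi * x)"
      then have "cos (pi * x') = cos (pi * x + pi)" "sin (pi * x') = sin (pi * x + pi)" by auto
      then obtain n :: int where n: "pi * x' = pi * x + pi + 2 * pi * of_int n" using sin_cos_eq_iff[of "pi * x'" "pi * x + pi"] by auto
      then have "pi * x' = pi * (x + (1 + 2 * of_int n))" by (simp add: algebra_simps)
      then have "x' = x + of_int (1 + 2 * n)" by simp
      moreover have "y' = - y" using a sfun_antipode[of "pi * x'" "pi * x" y] sfun_inj by metis
      ultimately show ?thesis unfolding w moebius_point_eq_iff by (intro exI[of _ "1 + 2 * n"]) auto
    qed
  next
    assume "moebius_point w = moebius_point w'"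
    then obtain n :: int where n: "x' = x + of_int n" "y' = (if even n then y else - y)"
      by (auto simp: w moebius_point_eq_iff)
    show "emap w = emap w'"
    proof (cases "even n")
      case True
      then obtain k where "n = 2 * k" by blast
      then have "pi * x' = pi * x + 2 * pi * of_int k" using n by (simp add: algebra_simps)
      then have "sin (pi * x') = sin (pi * x) \<and> cos (pi * x') = cos (pi * x)" using sin_cos_eq_iff[of "pi * x'" "pi * x"] by blast
      then show ?thesis using n True by (auto simp: w emap_def intro!: pt_cong sfun_cong[symmetric])
    next
      case False
      then obtain k where "n = 2 * k + 1" by (metis oddE)
      then have "pi * x' = (pi * x + pi) + 2 * pi * of_int k" using n by (simp add: algebra_simps)
      then have "sin (pi * x') = sin (pi * x + pi) \<and> cos (pi * x') = cos (pi * x + pi)"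
        using sin_cos_eq_iff[of "pi * x'" "pi * x + pi"] by blast
      then have c: "sin (pi * x') = - sin (pi * x)" "cos (pi * x') = - cos (pi * x)" by auto
      have "emap w = pt (- sfun (pi * x) y) (pi * x + pi)" by (simp add: w emap_def pt_antipode)
      also have "\<dots> = emap w'" unfolding w emap_def prod.case
        by (rule pt_cong) (use n False c sfun_antipode[of "pi * x'" "pi * x" y] in auto)
      finally show ?thesis .
    qed
  qed
qed

abbreviation "strip \<equiv> (UNIV :: real set) \<times> {-1<..<1::real}"

lemma emap_image: "emap ` strip = exterior"
proof (intro set_eqI iffI)
  fix L assume "L \<in> emap ` strip"
  then show "L \<in> exterior" by (auto simp: emap_def sfun_Ein)
next
  fix L assume "L \<in> exterior"
  then obtain s \<theta> where L: "L = pt s \<theta>" "Ein s \<theta>" by (auto simp: exterior_def)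
  let ?y = "(2 * s + \<alpha> (\<theta> + pi) - \<alpha> \<theta>) / (\<alpha> \<theta> + \<alpha> (\<theta> + pi))"
  have "emap (\<theta> / pi, ?y) = L" by (simp add: emap_def sfun_inverse L)
  moreover have "-1 < ?y \<and> ?y < 1" using sfun_Ein[of \<theta> ?y] L(2) by (simp add: sfun_inverse)
  ultimately show "L \<in> emap ` strip" by (auto intro!: image_eqI[of _ _ "(\<theta> / pi, ?y)"])
qed

lemma smooth_sfun: "smooth_on UNIV (\<lambda>w. sfun (pi * fst w) (snd w))"
proof -
  have 1: "smooth_on UNIV (\<lambda>w::real\<times>real. pi * fst w)" "smooth_on UNIV (\<lambda>w::real\<times>real. snd w)"
    by (intro smooth_on_mult smooth_on_const smooth_on_fst smooth_on_snd smooth_on_ident open_UNIV)+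
  have 2: "smooth_on UNIV (\<lambda>w::real\<times>real. \<alpha> (pi * fst w + pi))"
    by (intro smooth_\<alpha> smooth_on_add smooth_on_const 1 open_UNIV)
  show ?thesis unfolding sfun_def
    by (rule smooth_on_divide) (auto intro!: smooth_on_diff smooth_on_add smooth_on_mult smooth_\<alpha>[OF open_UNIV 1(1)] 1 2 smooth_on_const)
qed

lemma smooth_emap_lift: "smooth_on UNIV (\<lambda>w. lift (sfun (pi * fst w) (snd w)) (pi * fst w))"
proof -
  have 1: "smooth_on UNIV (\<lambda>w::real\<times>real. pi * fst w)"
    by (intro smooth_on_mult smooth_on_const smooth_on_fst smooth_on_ident open_UNIV)
  show ?thesis unfolding lift_def
    by (rule smooth_on_matrix_vector[OF open_UNIV smooth_on_vector_3[OF open_UNIV smooth_sfun smooth_on_cos[OF open_UNIV 1] smooth_on_sin[OF open_UNIV 1]]])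
qed

lemma emap_lift: "emap w = rp2_point (lift (sfun (pi * fst w) (snd w)) (pi * fst w))"
  by (simp add: emap_def pt_def case_prod_beta)

lemma connected_exterior: "connected exterior"
proof -
  have "continuous_on strip emap" unfolding emap_lift
    by (rule continuous_on_rp2_point_compose) (auto intro: continuous_on_subset[OF smooth_on_imp_continuous_on[OF smooth_emap_lift]] simp: lift_nz)
  moreover have "connected strip" by (intro convex_connected convex_Times) auto
  ultimately show ?thesis using connected_continuous_image emap_image by metis
qed

text \<open>The diffeomorphism is the inverse of \<open>emap\<close>. In a chart of the band the inverse is explicit: the
  smooth angle on a half plane of directions, divided by \<open>\<pi>\<close>, and the affine coordinate on the segment.\<close>

lemma diffeomorphic_exterior: "diffeomorphic rp2_atlas exterior moebius_atlas moebius_band"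
proof -
  define f where "f L = moebius_point (SOME w. w \<in> strip \<and> emap w = L)" for L
  have f: "f (emap w) = moebius_point w" if "w \<in> strip" for w
  proof -
    have "\<exists>v. v \<in> strip \<and> emap v = emap w" using that by blast
    then have "emap (SOME v. v \<in> strip \<and> emap v = emap w) = emap w" by (rule someI2_ex) auto
    then show ?thesis unfolding f_def using emap_eq_iff by blast
  qed
  have inj: "inj_on f exterior"
    unfolding emap_image[symmetric]
  proof (rule inj_onI)
    fix K L assume KL: "K \<in> emap ` strip" "L \<in> emap ` strip" "f K = f L"
    then obtain v w where "v \<in> strip" "w \<in> strip" "K = emap v" "L = emap w" by blast
    then show "K = L" using KL(3) f emap_eq_iff by simp
  qed
  have "f ` exterior = moebius_band"
    unfolding emap_image[symmetric] moebius_band_def image_image using f by (intro image_cong) auto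
  then have bij: "bij_betw f exterior moebius_band" using inj by (simp add: bij_betw_def)
  have finv: "inv_into exterior f (moebius_point w) = emap w" if "w \<in> strip" for w
    using inv_into_f_f[OF inj, of "emap w"] that f emap_image by (metis image_eqI)
  have 1: "smooth_map rp2_atlas exterior moebius_atlas f"
  proof (rule smooth_map_from_rp2)
    fix W' \<psi> assume "(W', \<psi>) \<in> moebius_atlas"
    then obtain a where W: "W' = {a<..<a + 1} \<times> {-1<..<1}" "\<psi> = moebius_point" by (auto simp: moebius_atlas_def)
    let ?b = "pi * a"
    let ?\<theta> = "\<lambda>x. ang ?b (crd x)" and ?s = "\<lambda>x. crd x $ 1 / rad ?b (crd x)"
    define h where "h x = (?\<theta> x / pi, (2 * ?s x + \<alpha> (?\<theta> x + pi) - \<alpha> (?\<theta> x)) / (\<alpha> (?\<theta> x) + \<alpha> (?\<theta> x + pi)))" for x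
    define Om where "Om = {x. crd x \<in> Eloc ?b}"
    have op: "open Om" unfolding Om_def by (rule open_crd[OF open_Eloc])
    have OQ: "crd x \<in> Q ?b" if "x \<in> Om" for x using that by (simp add: Om_def Eloc_def)
    have hx: "h x \<in> W' \<and> emap (h x) = rp2_point x" if "x \<in> Om" for x
    proof -
      have q: "qc ?b (crd x) \<noteq> 0" using OQ[OF that] by (simp add: Q_def)
      note l = local_polar[OF q]
      have si: "sfun (?\<theta> x) (snd (h x)) = ?s x"
        using sfun_inverse[of "?\<theta> x" "?s x"] by (simp only: h_def snd_conv)
      have "emap (h x) = pt (sfun (?\<theta> x) (snd (h x))) (?\<theta> x)" by (simp add: h_def emap_def)
      then have e: "emap (h x) = pt (?s x) (?\<theta> x)" unfolding si .
      have "Ein (?s x) (?\<theta> x)" using that by (simp add: Om_def Eloc_def)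
      then have "-1 < snd (h x) \<and> snd (h x) < 1"
        using sfun_Ein[of "?\<theta> x" "snd (h x)"] unfolding si by simp
      moreover have "a < fst (h x)" "fst (h x) < a + 1"
        using l(4,5) by (simp_all add: h_def field_simps)
      ultimately have "h x \<in> W'" unfolding W by (simp add: mem_Times_iff)
      then show ?thesis using e local_pt[OF q] by simp
    qed
    have crd_nz: "x \<in> Om \<Longrightarrow> x \<noteq> 0" for x using OQ[of x] by (auto simp: Q_def qc_def)
    have "smooth_on Om h"
    proof -
      have c: "smooth_on Om crd" by (rule smooth_crd[OF op])
      have t: "smooth_on Om ?\<theta>" by (rule smooth_on_compose[OF op open_Q c smooth_local(1) OQ])
      have r: "smooth_on Om (\<lambda>x. rad ?b (crd x))" by (rule smooth_on_compose[OF op open_Q c smooth_local(2) OQ])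
      have s: "smooth_on Om ?s"
        by (rule smooth_on_divide[OF op smooth_on_vec_nth[OF op c] r]) (use OQ local_polar(3) in \<open>auto simp: Q_def\<close>)
      have a: "smooth_on Om (\<lambda>x. \<alpha> (?\<theta> x))" by (rule smooth_\<alpha>[OF op t])
      have a': "smooth_on Om (\<lambda>x. \<alpha> (?\<theta> x + pi))" by (rule smooth_\<alpha>[OF op smooth_on_add[OF op t smooth_on_const]])
      have nz: "\<alpha> t + \<alpha> (t + pi) \<noteq> 0" for t using \<alpha>_pos[of t] \<alpha>_pos[of "t + pi"] by linarith
      have "smooth_on Om (\<lambda>x. ?\<theta> x / pi)" by (rule smooth_on_divide[OF op t smooth_on_const]) simp
      moreover have "smooth_on Om (\<lambda>x. (2 * ?s x + \<alpha> (?\<theta> x + pi) - \<alpha> (?\<theta> x)) / (\<alpha> (?\<theta> x) + \<alpha> (?\<theta> x + pi)))"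
        by (rule smooth_on_divide[OF op smooth_on_diff[OF op smooth_on_add[OF op smooth_on_mult[OF op smooth_on_const s] a'] a] smooth_on_add[OF op a a']]) (rule nz)
      ultimately show ?thesis unfolding h_def by (rule smooth_on_Pair[OF op])
    qed
    moreover have "x \<in> Om \<longleftrightarrow> rp2_point x \<in> exterior \<and> f (rp2_point x) \<in> \<psi> ` W'" if x: "x \<noteq> 0" for x
    proof
      assume "x \<in> Om"
      then have hw: "h x \<in> W'" "emap (h x) = rp2_point x" using hx by auto
      then have "h x \<in> strip" by (auto simp: W)
      then show "rp2_point x \<in> exterior \<and> f (rp2_point x) \<in> \<psi> ` W'"
        using hw f emap_image W(2) by (metis image_eqI)
    next
      assume "rp2_point x \<in> exterior \<and> f (rp2_point x) \<in> \<psi> ` W'"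
      then obtain w where w: "rp2_point x \<in> exterior" "w \<in> W'" "f (rp2_point x) = moebius_point w" by (auto simp: W)
      have ws: "w \<in> strip" using w(2) by (auto simp: W)
      obtain v where v: "v \<in> strip" "rp2_point x = emap v" using w(1) emap_image by blast
      then have "moebius_point v = moebius_point w" using f w(3) by simp
      then have "rp2_point x = emap w" using v(2) emap_eq_iff by simp
      then obtain c where c: "c \<noteq> 0" "x = c *\<^sub>R lift (sfun (pi * fst w) (snd w)) (pi * fst w)"
        unfolding emap_lift using rp2_point_eq_iff[OF x lift_nz] by blast
      then have cx: "crd x = c *\<^sub>R vector [sfun (pi * fst w) (snd w), cos (pi * fst w), sin (pi * fst w)]"
        by (simp add: lift_def crd_scaleR)
      have "qc ?b (crd x) = c * sin (pi * fst w - ?b)" unfolding cx qc_def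
        by (simp add: sin_diff algebra_simps)
      moreover have "0 < pi * fst w - ?b" "pi * fst w - ?b < pi"
      proof -
        have "a < fst w" "fst w < a + 1" using w(2) by (auto simp: W)
        then have "pi * a < pi * fst w" "pi * fst w < pi * (a + 1)" by simp_all
        then show "0 < pi * fst w - ?b" "pi * fst w - ?b < pi" by (simp_all add: algebra_simps)
      qed
      then have "sin (pi * fst w - ?b) > 0" by (rule sin_gt_zero)
      ultimately have "crd x \<in> Q ?b" using c(1) by (simp add: Q_def)
      then show "x \<in> Om" using Eloc_iff w(1) by (simp add: Om_def)
    qed
    moreover have "h x \<in> W' \<and> \<psi> (h x) = f (rp2_point x)" if "x \<in> Om" for x
    proof -
      have "h x \<in> strip" using hx[OF that] by (auto simp: W)
      then show ?thesis using hx[OF that] f W(2) by metis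
    qed
    ultimately show "inj_on \<psi> W' \<and> (\<exists>Om h. open Om \<and> smooth_on Om h \<and>
      (\<forall>x. x \<noteq> 0 \<longrightarrow> (x \<in> Om \<longleftrightarrow> rp2_point x \<in> exterior \<and> f (rp2_point x) \<in> \<psi> ` W')) \<and>
      (\<forall>x\<in>Om. h x \<in> W' \<and> \<psi> (h x) = f (rp2_point x)))"
      using op inj_on_moebius_point W by blast
  qed
  have 2: "smooth_map moebius_atlas moebius_band rp2_atlas (inv_into exterior f)"
  proof (rule smooth_map_to_rp2)
    fix W \<phi> assume "(W, \<phi>) \<in> moebius_atlas"
    then obtain a where W: "W = {a<..<a + 1} \<times> {-1<..<1}" "\<phi> = moebius_point" by (auto simp: moebius_atlas_def)
    have "open W" unfolding W by (intro open_Times) auto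
    moreover have Ws: "W \<subseteq> strip" by (auto simp: W)
    then have "\<phi> ` W \<subseteq> moebius_band" unfolding W(2) moebius_band_def by blast
    moreover have "smooth_on W (\<lambda>w. lift (sfun (pi * fst w) (snd w)) (pi * fst w))"
      using smooth_on_subset[OF smooth_emap_lift] by simp
    moreover have "inv_into exterior f (\<phi> w) = rp2_point (lift (sfun (pi * fst w) (snd w)) (pi * fst w))" if "w \<in> W" for w
      using finv Ws that W(2) emap_lift by (metis subsetD)
    ultimately show "open W \<and> \<phi> ` W \<subseteq> moebius_band \<and> (\<exists>L. smooth_on W L \<and>
        (\<forall>w\<in>W. L w \<noteq> 0 \<and> inv_into exterior f (\<phi> w) = rp2_point (L w)))"
      using lift_nz by blast
  qed
  show ?thesis unfolding diffeomorphic_def using bij 1 2 by blast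
qed

end

context star_curve
begin

definition lp :: "complex \<Rightarrow> rp2" where "lp z = rp2_point (A *v vector [1, Re z, Im z])"

text \<open>The interior of the curve in the affine chart, as a star-shaped plane domain.\<close>

definition "J = {of_real r * cis \<theta> |r \<theta>. 0 \<le> r \<and> r < \<rho> \<theta>}"

text \<open>A point of the line of direction \<open>\<theta>\<close> at signed distance \<open>m\<close> lies on the ray of direction \<open>\<theta>\<close> or on the
  opposite one.\<close>

lemma J_iff: "of_real m * cis \<theta> \<in> J \<longleftrightarrow> - \<rho> (\<theta> + pi) < m \<and> m < \<rho> \<theta>"
proof
  assume "of_real m * cis \<theta> \<in> J"
  then obtain r \<phi> where r: "of_real m * cis \<theta> = of_real r * cis \<phi>" "0 \<le> r" "r < \<rho> \<phi>" by (auto simp: J_def)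
  have "cmod (of_real m * cis \<theta>) = cmod (of_real r * cis \<phi>)" using r(1) by simp
  then have m: "\<bar>m\<bar> = r" using r(2) by (simp add: norm_mult)
  have c: "m * cos \<theta> = r * cos \<phi>" "m * sin \<theta> = r * sin \<phi>" using r(1) by (auto simp: complex_eq_iff)
  consider "m = 0" | "m > 0" "m = r" | "m < 0" "m = - r" using m by linarith
  then show "- \<rho> (\<theta> + pi) < m \<and> m < \<rho> \<theta>"
  proof cases
    case 1
    then show ?thesis using pos[of \<theta>] pos[of "\<theta> + pi"] by simp
  next
    case 2
    then have "\<rho> \<phi> = \<rho> \<theta>" using c by (intro \<rho>_cong) auto
    then show ?thesis using 2 r pos[of "\<theta> + pi"] by simp
  next
    case 3
    have "r * (- cos \<theta>) = r * cos \<phi>" "r * (- sin \<theta>) = r * sin \<phi>" "r \<noteq> 0" using 3 c by auto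
    then have "\<rho> \<phi> = \<rho> (\<theta> + pi)" by (intro \<rho>_cong) (simp_all only: mult_cancel_left cos_periodic_pi sin_periodic_pi, auto)
    then show ?thesis using 3 r pos[of \<theta>] by simp
  qed
next
  assume a: "- \<rho> (\<theta> + pi) < m \<and> m < \<rho> \<theta>"
  show "of_real m * cis \<theta> \<in> J"
  proof (cases "m \<ge> 0")
    case True
    then show ?thesis using a by (auto simp: J_def)
  next
    case False
    have "of_real m * cis \<theta> = of_real (- m) * cis (\<theta> + pi)" by (simp add: complex_eq_iff)
    then show ?thesis using a False unfolding J_def
      by (intro CollectI exI[of _ "- m"] exI[of _ "\<theta> + pi"]) auto
  qed
qed

definition yz :: "complex \<Rightarrow> real^3" where "yz z = vector [1, Re z, Im z]"

lemma yz_sel [simp]: "yz z $ 1 = 1" "yz z $ 2 = Re z" "yz z $ 3 = Im z"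
  by (simp_all add: yz_def)

lemma continuous_yz: "continuous_on UNIV yz"
proof -
  have e: "yz = (\<lambda>z. axis 1 1 + Re z *\<^sub>R axis 2 1 + Im z *\<^sub>R axis 3 1)"
    by (auto simp: fun_eq_iff vec_eq_iff forall_3 axis_def)
  show ?thesis unfolding e by (intro continuous_intros)
qed

definition "Jloc b = {y \<in> Q b. - \<rho> (ang b y + pi) - rad b y < 0 \<and> rad b y - \<rho> (ang b y) < 0}"

lemma open_Jloc: "open (Jloc b)"
proof -
  have 1: "smooth_on (Q b) (\<lambda>y. - \<rho> (ang b y + pi) - rad b y)"
    by (rule smooth_on_diff[OF open_Q smooth_on_minus[OF open_Q smooth_\<rho>[OF open_Q smooth_on_add[OF open_Q smooth_local(1) smooth_on_const]]] smooth_local(2)])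
  have 2: "smooth_on (Q b) (\<lambda>y. rad b y - \<rho> (ang b y))"
    by (rule smooth_on_diff[OF open_Q smooth_local(2) smooth_\<rho>[OF open_Q smooth_local(1)]])
  show ?thesis unfolding Jloc_def by (rule open_in_Q[OF 1 2])
qed

lemma Jloc_iff: assumes "yz z \<in> Q b" shows "z \<in> J \<longleftrightarrow> yz z \<in> Jloc b"
proof -
  have q: "qc b (yz z) \<noteq> 0" using assms by (simp add: Q_def)
  have "z = of_real (rad b (yz z)) * cis (ang b (yz z))"
    using local_polar(1,2)[OF q] by (simp add: complex_eq_iff)
  then have "z \<in> J \<longleftrightarrow> - \<rho> (ang b (yz z) + pi) < rad b (yz z) \<and> rad b (yz z) < \<rho> (ang b (yz z))"
    using J_iff by metis
  then show ?thesis using assms by (auto simp: Jloc_def)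
qed

lemma complex_polar: obtains r \<theta> where "r \<ge> 0" "z = of_real r * cis \<theta>"
  by (metis rcis_cmod_Arg rcis_def norm_ge_zero)

text \<open>Near the origin the minimum of \<open>\<rho>\<close> gives a disc; elsewhere the radius and the angle are
  continuous off a line through the origin, and two lines suffice to cover the punctured plane.\<close>

lemma open_J: "open J"
proof -
  have "\<exists>x\<in>{0..2*pi}. \<forall>y\<in>{0..2*pi}. \<rho> x \<le> \<rho> y"
    by (rule continuous_attains_inf) (auto intro: continuous_on_subset[OF smooth_on_imp_continuous_on[OF sm]])
  then obtain t where t: "\<And>y. y \<in> {0..2*pi} \<Longrightarrow> \<rho> t \<le> \<rho> y" by blast
  have ball: "ball 0 (\<rho> t) \<subseteq> J"
  proof
    fix z :: complex assume z: "z \<in> ball 0 (\<rho> t)"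
    have "z = of_real (cmod z) * cis (Arg2pi z)" by (metis Arg2pi_eq cis_conv_exp)
    moreover have "cmod z < \<rho> (Arg2pi z)"
      using t[of "Arg2pi z"] z Arg2pi_ge_0[of z] Arg2pi_lt_2pi[of z] by (simp add: dist_norm)
    ultimately show "z \<in> J" unfolding J_def using norm_ge_zero by blast
  qed
  have "J = ball 0 (\<rho> t) \<union> yz -` Jloc 0 \<union> yz -` Jloc (pi / 2)"
  proof (intro set_eqI iffI)
    fix z assume z: "z \<in> J"
    show "z \<in> ball 0 (\<rho> t) \<union> yz -` Jloc 0 \<union> yz -` Jloc (pi / 2)"
    proof (cases "z = 0")
      case True
      then show ?thesis using pos by simp
    next
      case False
      then have "yz z \<in> Q 0 \<or> yz z \<in> Q (pi / 2)" unfolding Q_cover by (auto simp: complex_eq_iff)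
      then show ?thesis using z Jloc_iff by blast
    qed
  next
    fix z assume "z \<in> ball 0 (\<rho> t) \<union> yz -` Jloc 0 \<union> yz -` Jloc (pi / 2)"
    moreover have "yz z \<in> Jloc b \<Longrightarrow> z \<in> J" for b using Jloc_iff[of z b] by (simp add: Jloc_def)
    ultimately show "z \<in> J" using ball by blast
  qed
  also have "open \<dots>" using open_vimage[OF open_Jloc continuous_yz] by (simp add: open_Un)
  finally show ?thesis .
qed

lemma zero_in_J: "0 \<in> J"
  using J_iff[of 0 0] pos[of 0] pos[of "0 + pi"] by simp

lemma starlike_J: "starlike J"
  unfolding starlike_def
proof (intro bexI ballI subsetI)
  fix x y assume x: "x \<in> J" "y \<in> closed_segment 0 x"
  then obtain u where u: "y = u *\<^sub>R x" "0 \<le> u" "u \<le> 1" by (auto simp: in_segment)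
  obtain r \<theta> where r: "x = of_real r * cis \<theta>" "0 \<le> r" "r < \<rho> \<theta>" using x(1) by (auto simp: J_def)
  have "y = of_real (u * r) * cis \<theta>" using u r by (simp add: scaleR_conv_of_real)
  moreover have "u * r \<le> r" "0 \<le> u * r" using u r by (simp_all add: mult_left_le_one_le)
  ultimately show "y \<in> J" unfolding J_def using r(3) by (intro CollectI exI[of _ "u * r"] exI[of _ \<theta>]) auto
qed (rule zero_in_J)

lemma lp_alt: "lp z = rp2_point (A *v yz z)" by (simp add: lp_def yz_def)

lemma A_yz_nz: "A *v yz z \<noteq> 0"
  unfolding A_nz by (metis yz_sel(1) zero_index zero_neq_one)

lemma lp_eq_iff:
  assumes "x \<noteq> 0"
  shows "rp2_point x = lp z \<longleftrightarrow> crd x $ 1 \<noteq> 0 \<and> z = Complex (crd x $ 2 / crd x $ 1) (crd x $ 3 / crd x $ 1)"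
proof
  assume "rp2_point x = lp z"
  then obtain c where c: "c \<noteq> 0" "x = c *\<^sub>R (A *v yz z)" using rp2_point_eq_iff[OF assms A_yz_nz] by (auto simp: lp_alt)
  then have "crd x = c *\<^sub>R yz z" by (simp add: crd_scaleR)
  then show "crd x $ 1 \<noteq> 0 \<and> z = Complex (crd x $ 2 / crd x $ 1) (crd x $ 3 / crd x $ 1)"
    using c by (auto simp: complex_eq_iff)
next
  assume z: "crd x $ 1 \<noteq> 0 \<and> z = Complex (crd x $ 2 / crd x $ 1) (crd x $ 3 / crd x $ 1)"
  then have "crd x = crd x $ 1 *\<^sub>R yz z" by (auto simp: vec_eq_iff forall_3)
  then have "x = crd x $ 1 *\<^sub>R (A *v yz z)" by (metis A_crd matrix_vector_mult_scaleR)
  then show "rp2_point x = lp z" unfolding lp_alt using z by (metis rp2_point_scaleR A_yz_nz)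
qed

lemma inj_lp: "inj lp"
proof (rule injI)
  fix z w assume "lp z = lp w"
  then show "z = w" using lp_eq_iff[OF A_yz_nz, of z w] by (simp add: lp_alt[symmetric])
qed

lemma lp_polar: assumes "r \<noteq> 0" shows "lp (of_real r * cis \<theta>) = pt (1 / r) \<theta>"
proof -
  have "vector [1, Re (of_real r * cis \<theta>), Im (of_real r * cis \<theta>)] = r *\<^sub>R (vector [1 / r, cos \<theta>, sin \<theta>] :: real^3)"
    using assms by (simp add: scaleR_vector3)
  then show ?thesis unfolding lp_def using pt_scaleR[OF assms] by simp
qed

lemma lp_in_interior: "lp z \<in> interior_disc \<longleftrightarrow> z \<in> J"
proof -
  obtain r \<theta> where r: "r \<ge> 0" "z = of_real r * cis \<theta>" by (rule complex_polar)
  show ?thesis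
  proof (cases "r = 0")
    case True
    then show ?thesis using r zero_in_J centre_in(1) by (simp add: lp_def centre_def)
  next
    case False
    have "1 / r > - \<alpha> (\<theta> + pi)" "- \<rho> (\<theta> + pi) < r" using \<alpha>_pos[of "\<theta> + pi"] pos[of "\<theta> + pi"] r False
      by (smt (verit) divide_nonneg_nonneg)+
    moreover have "\<alpha> \<theta> < 1 / r \<longleftrightarrow> r < \<rho> \<theta>" using pos[of \<theta>] r False by (simp add: \<alpha>_def field_simps)
    ultimately show ?thesis using r False lp_polar[OF False, of \<theta>] J_iff[of r \<theta>] by (auto simp: Iin_def)
  qed
qed

lemma interior_eq: "interior_disc = lp ` J"
proof (intro set_eqI iffI)
  fix L assume L: "L \<in> interior_disc"
  show "L \<in> lp ` J"
  proof (cases L rule: point_cases)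
    case 1
    then show ?thesis using zero_in_J by (auto simp: lp_def centre_def intro!: image_eqI[of _ _ 0])
  next
    case (2 s \<theta>)
    then have "Iin s \<theta>" using L by simp
    then have "s \<noteq> 0" using \<alpha>_pos[of \<theta>] \<alpha>_pos[of "\<theta> + pi"] by (auto simp: Iin_def)
    then have "L = lp (of_real (1 / s) * cis \<theta>)" using lp_polar[of "1 / s" \<theta>] 2 by simp
    then show ?thesis using L lp_in_interior by blast
  qed
qed (use lp_in_interior in blast)

definition "ycd y = Complex (y $ 2 / y $ 1) (y $ 3 / y $ 1)" for y :: "real^3"
definition "Iloc = {y :: real^3. y $ 1 \<noteq> 0 \<and> ycd y \<in> J}"

lemma open_nz1: "open {y :: real^3. y $ 1 \<noteq> 0}"
proof -
  have "open ((\<lambda>y :: real^3. y $ 1) -` (- {0}))" by (intro open_vimage open_Compl continuous_intros closed_singleton)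
  then show ?thesis by (simp add: vimage_def Compl_eq)
qed

lemma smooth_ycd: "smooth_on {y :: real^3. y $ 1 \<noteq> 0} ycd"
  unfolding ycd_def by (intro smooth_on_Complex smooth_on_divide smooth_on_vec_nth smooth_on_ident open_nz1) auto

lemma open_Iloc: "open Iloc"
proof -
  have "open ({y :: real^3. y $ 1 \<noteq> 0} \<inter> ycd -` J)"
    by (rule continuous_open_preimage[OF smooth_on_imp_continuous_on[OF smooth_ycd] open_nz1 open_J])
  then show ?thesis by (simp add: Iloc_def vimage_def Int_def)
qed

lemma interior_iff: assumes "x \<noteq> 0" shows "rp2_point x \<in> interior_disc \<longleftrightarrow> crd x \<in> Iloc"
proof
  assume "rp2_point x \<in> interior_disc"
  then obtain z where "z \<in> J" "rp2_point x = lp z" by (auto simp: interior_eq)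
  then show "crd x \<in> Iloc" using lp_eq_iff[OF assms] by (auto simp: Iloc_def ycd_def)
next
  assume "crd x \<in> Iloc"
  then have "rp2_point x = lp (ycd (crd x))" "ycd (crd x) \<in> J" using lp_eq_iff[OF assms] by (auto simp: Iloc_def ycd_def)
  then show "rp2_point x \<in> interior_disc" using lp_in_interior by simp
qed

lemma open_interior: "open interior_disc"
proof -
  have "{x. x \<noteq> 0 \<and> rp2_point x \<in> interior_disc} = {x. crd x \<in> Iloc}"
  proof -
    have "crd x \<in> Iloc \<Longrightarrow> x \<noteq> 0" for x by (auto simp: Iloc_def)
    then show ?thesis using interior_iff by blast
  qed
  then show ?thesis unfolding open_rp2_def using open_crd[OF open_Iloc] by simp
qed

lemma connected_interior: "connected interior_disc"
proof -
  have c: "continuous_on UNIV (\<lambda>z. A *v yz z)"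
    using continuous_on_compose2[OF linear_continuous_on[OF matrix_vector_mul_bounded_linear[of A]] continuous_yz subset_UNIV] .
  have "continuous_on J lp" unfolding lp_alt
    by (rule continuous_on_rp2_point_compose[OF continuous_on_subset[OF c] A_yz_nz]) simp
  then show ?thesis unfolding interior_eq using starlike_J starlike_imp_connected connected_continuous_image by blast
qed

lemma connected_curve: "connected curve"
proof -
  have s: "smooth_on UNIV (\<lambda>\<theta>. vector [\<alpha> \<theta>, cos \<theta>, sin \<theta>] :: real^3)"
    by (rule smooth_on_vector_3[OF open_UNIV smooth_\<alpha>[OF open_UNIV smooth_on_ident[OF open_UNIV]] smooth_on_sin_cos(2,1)])
  have "continuous_on UNIV (\<lambda>\<theta>. lift (\<alpha> \<theta>) \<theta>)" unfolding lift_def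
    by (rule smooth_on_imp_continuous_on[OF smooth_on_matrix_vector[OF open_UNIV s]])
  then have "continuous_on UNIV (\<lambda>\<theta>. pt (\<alpha> \<theta>) \<theta>)" unfolding pt_def
    by (rule continuous_on_rp2_point_compose) (rule lift_nz)
  then show ?thesis unfolding curve_def by (intro connected_continuous_image) auto
qed

text \<open>The star-shaped domain is simply connected and not the plane, so the Riemann mapping
  theorem gives a biholomorphic map onto the unit disk; it is composed with the affine chart.\<close>

lemma diffeomorphic_interior: "diffeomorphic rp2_atlas interior_disc disk_atlas disk"
proof -
  have "\<rho> 0 \<notin> {m. complex_of_real m * cis 0 \<in> J}" unfolding mem_Collect_eq J_iff by simp
  then have "J \<noteq> UNIV" by auto
  then obtain f g where fg: "f holomorphic_on J" "g holomorphic_on ball 0 1"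
     "\<And>z. z \<in> J \<Longrightarrow> f z \<in> ball 0 1 \<and> g (f z) = z" "\<And>z. z \<in> ball 0 1 \<Longrightarrow> g z \<in> J \<and> f (g z) = z"
    using Riemann_mapping_theorem[of J] open_J zero_in_J starlike_imp_simply_connected[OF starlike_J] by blast
  define pr :: "complex \<Rightarrow> real \<times> real" where "pr z = (Re z, Im z)" for z
  define cp :: "real \<times> real \<Rightarrow> complex" where "cp w = Complex (fst w) (snd w)" for w
  have pc [simp]: "pr (cp w) = w" "cp (pr z) = z" for w z by (auto simp: pr_def cp_def complex_eq_iff)
  have disk: "w \<in> disk \<longleftrightarrow> cp w \<in> ball 0 1" for w
    by (cases w) (simp add: disk_def cp_def norm_Pair cmod_def)
  have disk': "pr z \<in> disk \<longleftrightarrow> z \<in> ball 0 1" for z by (simp add: disk)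
  define F where "F L = pr (f (inv_into J lp L))" for L
  have F: "F (lp z) = pr (f z)" if "z \<in> J" for z
    using inv_into_f_f[OF inj_on_subset[OF inj_lp subset_UNIV] that] by (simp add: F_def)
  have inj: "inj_on F interior_disc" unfolding interior_eq
  proof (rule inj_onI, clarify)
    fix z w assume "z \<in> J" "w \<in> J" "F (lp z) = F (lp w)"
    then have "cp (pr (f z)) = cp (pr (f w))" using F by simp
    then have "g (f z) = g (f w)" by simp
    then show "lp z = lp w" using fg(3) \<open>z \<in> J\<close> \<open>w \<in> J\<close> by simp
  qed
  have Fg: "F (lp (g (cp w))) = w" "lp (g (cp w)) \<in> interior_disc" if "w \<in> disk" for w
  proof -
    have "g (cp w) \<in> J" "f (g (cp w)) = cp w" using that fg(4) disk by auto
    then show "F (lp (g (cp w))) = w" "lp (g (cp w)) \<in> interior_disc" using F lp_in_interior by auto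
  qed
  have "F ` interior_disc = disk"
  proof (intro set_eqI iffI)
    fix w assume "w \<in> F ` interior_disc"
    then obtain z where "z \<in> J" "w = F (lp z)" by (auto simp: interior_eq)
    then show "w \<in> disk" using F fg(3) disk' by simp
  next
    fix w assume "w \<in> disk"
    then show "w \<in> F ` interior_disc" using Fg by (metis image_eqI)
  qed
  then have bij: "bij_betw F interior_disc disk" using inj by (simp add: bij_betw_def)
  have finv: "inv_into interior_disc F w = lp (g (cp w))" if "w \<in> disk" for w
    using inv_into_f_f[OF inj Fg(2)[OF that]] Fg(1)[OF that] by simp
  have blre: "bounded_linear pr" unfolding pr_def
    by (rule bounded_linear_Pair[OF bounded_linear_Re bounded_linear_Im])
  have 1: "smooth_map rp2_atlas interior_disc disk_atlas F"
  proof (rule smooth_map_from_rp2)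
    fix W' \<psi> assume "(W', \<psi>) \<in> disk_atlas"
    then have W: "W' = disk" "\<psi> = (\<lambda>w. w)" by (auto simp: disk_atlas_def)
    define Om where "Om = {x. crd x \<in> Iloc}"
    define h where "h x = pr (f (ycd (crd x)))" for x
    have op: "open Om" unfolding Om_def by (rule open_crd[OF open_Iloc])
    have s1: "smooth_on Om (\<lambda>x. ycd (crd x))"
      by (rule smooth_on_compose[OF op open_nz1 smooth_crd[OF op] smooth_ycd]) (simp add: Om_def Iloc_def)
    have s2: "smooth_on Om (\<lambda>x. f (ycd (crd x)))"
      by (rule smooth_on_compose[OF op open_J s1 smooth_on_holomorphic[OF open_J fg(1)]]) (simp add: Om_def Iloc_def)
    have s3: "smooth_on Om h" unfolding h_def by (rule smooth_on_bounded_linear[OF op blre s2])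
    have nz: "x \<in> Om \<Longrightarrow> x \<noteq> 0" for x by (auto simp: Om_def Iloc_def)
    have hx: "h x = F (rp2_point x) \<and> h x \<in> disk" if "x \<in> Om" for x
    proof -
      have "ycd (crd x) \<in> J" "rp2_point x = lp (ycd (crd x))"
        using that lp_eq_iff[OF nz[OF that]] by (auto simp: Om_def Iloc_def ycd_def)
      then show ?thesis using F fg(3) disk' by (simp add: h_def)
    qed
    have i: "inj_on \<psi> W'" "\<forall>x\<in>Om. h x \<in> W' \<and> \<psi> (h x) = F (rp2_point x)"
      unfolding W using hx by (simp, blast)
    have "x \<in> Om \<longleftrightarrow> rp2_point x \<in> interior_disc \<and> F (rp2_point x) \<in> \<psi> ` W'" if "x \<noteq> 0" for x
      using interior_iff[OF that] hx[of x] by (auto simp: W Om_def)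
    then show "inj_on \<psi> W' \<and> (\<exists>Om h. open Om \<and> smooth_on Om h \<and>
      (\<forall>x. x \<noteq> 0 \<longrightarrow> (x \<in> Om \<longleftrightarrow> rp2_point x \<in> interior_disc \<and> F (rp2_point x) \<in> \<psi> ` W')) \<and>
      (\<forall>x\<in>Om. h x \<in> W' \<and> \<psi> (h x) = F (rp2_point x)))"
      using op s3 i by blast
  qed
  have 2: "smooth_map disk_atlas disk rp2_atlas (inv_into interior_disc F)"
  proof (rule smooth_map_to_rp2)
    fix W \<phi> assume "(W, \<phi>) \<in> disk_atlas"
    then have W: "W = disk" "\<phi> = (\<lambda>w. w)" by (auto simp: disk_atlas_def)
    have op: "open disk" by (simp add: disk_def)
    have "smooth_on disk cp" unfolding cp_def
      by (intro smooth_on_Complex smooth_on_fst smooth_on_snd smooth_on_ident op)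
    then have s: "smooth_on disk (\<lambda>w. g (cp w))"
      by (rule smooth_on_compose[OF op open_ball _ smooth_on_holomorphic[OF open_ball fg(2)]]) (simp only: disk[symmetric])
    have "smooth_on disk (\<lambda>w. A *v yz (g (cp w)))" unfolding yz_def
      by (intro smooth_on_matrix_vector smooth_on_vector_3 smooth_on_const smooth_on_bounded_linear[OF op bounded_linear_Re s]
         smooth_on_bounded_linear[OF op bounded_linear_Im s] op)
    then show "open W \<and> \<phi> ` W \<subseteq> disk \<and> (\<exists>L. smooth_on W L \<and>
        (\<forall>w\<in>W. L w \<noteq> 0 \<and> inv_into interior_disc F (\<phi> w) = rp2_point (L w)))"
      using op finv A_yz_nz unfolding W lp_alt by (intro conjI exI[of _ "\<lambda>w. A *v yz (g (cp w))"]) auto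
  qed
  show ?thesis unfolding diffeomorphic_def using bij 1 2 by blast
qed

lemma separates: "separates_disk_moebius curve interior_disc exterior"
proof -
  have e: "exterior \<noteq> {}"
  proof -
    have "Ein 0 0" using \<alpha>_pos[of 0] \<alpha>_pos[of "0 + pi"] by (simp add: Ein_def)
    then show ?thesis by (auto simp: exterior_def)
  qed
  have i: "interior_disc \<noteq> {}" using centre_in by blast
  have "components (- curve) = {interior_disc, exterior}"
    unfolding complement_curve(1)
    by (rule components_of_open_pair) (use open_interior open_exterior connected_interior connected_exterior e i complement_curve in auto)
  then show ?thesis unfolding separates_disk_moebius_def
    using diffeomorphic_interior diffeomorphic_exterior complement_curve(2) i by auto
qed

text \<open>The curve is connected, and relatively open in the zero locus by the hypothesis on \<open>U\<close>. A larger
  connected subset of the zero locus would be disconnected by \<open>U\<close> and the complement of the curve.\<close>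

lemma oval_curve:
  assumes "smooth_real_curve d P" "curve \<subseteq> real_curve d P" "open U" "curve \<subseteq> U" "real_curve d P \<inter> U \<subseteq> curve"
  shows "oval d P curve"
proof -
  have ne: "curve \<noteq> {}" by (simp add: curve_def)
  have "curve \<in> components (real_curve d P)"
    unfolding in_components_maximal
  proof (intro conjI allI impI)
    fix S assume S: "S \<noteq> {} \<and> curve \<subseteq> S \<and> S \<subseteq> real_curve d P \<and> connected S"
    have op: "open (- curve)" unfolding complement_curve(1) using open_interior open_exterior by auto
    have "U \<inter> (- curve) \<inter> S = {}" using S assms(5) by auto
    moreover have "S \<subseteq> U \<union> - curve" using assms(4) by auto
    moreover have "U \<inter> S \<noteq> {}" using S assms(4) ne by auto
    ultimately have "(- curve) \<inter> S = {}" using connectedD[of S U "- curve"] S assms(3) op by blast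
    then show "S = curve" using S by auto
  qed (use assms connected_curve ne in auto)
  then show ?thesis unfolding oval_def using assms(1) separates by blast
qed

end

lemma star_curve_nested:
  assumes "star_curve A \<rho>" "star_curve A \<rho>'" "\<And>\<theta>. \<rho> \<theta> < \<rho>' \<theta>"
  shows "in_oval_interior (star_curve.curve A \<rho>) (star_curve.curve A \<rho>')"
    and "star_curve.curve A \<rho> \<noteq> star_curve.curve A \<rho>'"
proof -
  interpret a: star_curve A \<rho> by fact
  interpret b: star_curve A \<rho>' by fact
  have "a.curve \<subseteq> b.interior_disc"
  proof
    fix L assume "L \<in> a.curve"
    then obtain \<theta> where L: "L = b.pt (1 / \<rho> \<theta>) \<theta>"
      by (auto simp: a.curve_def a.\<alpha>_def a.pt_def b.pt_def a.lift_def b.lift_def)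
    have "1 / \<rho>' \<theta> < 1 / \<rho> \<theta>" using assms(3)[of \<theta>] a.pos[of \<theta>] by (simp add: frac_less2)
    then show "L \<in> b.interior_disc" unfolding L by (simp add: b.Iin_def b.\<alpha>_def)
  qed
  moreover have "b.curve \<inter> b.interior_disc = {}" using b.complement_curve by auto
  moreover have "a.curve \<noteq> {}" by (simp add: a.curve_def)
  ultimately show "in_oval_interior a.curve b.curve" "a.curve \<noteq> b.curve"
    unfolding in_oval_interior_def using b.separates by auto
qed

section \<open>Implicit functions\<close>

text \<open>Differentiability of the inverse is all that is recorded: higher regularity of an implicit solution
  comes from its differential equation.\<close>

lemma smooth_local_inverse:
  fixes f :: "'a::euclidean_space \<Rightarrow> 'a"
  assumes f: "smooth_on UNIV f" and inj: "inj (frechet_derivative f (at x0))"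
  obtains U V g where "open U" "x0 \<in> U" "open V" "f x0 \<in> V" "homeomorphism U V f g"
    "\<And>y. y \<in> V \<Longrightarrow> g differentiable (at y)"
proof -
  let ?D = "\<lambda>x. frechet_derivative f (at x)"
  have der: "(f has_derivative ?D x) (at x)" for x using smooth_on_has_derivative[OF f] by simp
  have bl: "bounded_linear (?D x)" for x using der has_derivative_bounded_linear by blast
  define f' where "f' x = Blinfun (?D x)" for x
  have f': "blinfun_apply (f' x) = ?D x" for x unfolding f'_def by (rule bounded_linear_Blinfun_apply[OF bl])
  obtain h where h: "linear h" "h \<circ> ?D x0 = id"
    using linear_injective_left_inverse[OF bounded_linear.linear[OF bl] inj] by blast
  have blh: "bounded_linear h" using h(1) by (simp add: linear_conv_bounded_linear)
  have 1: "Blinfun h o\<^sub>L f' x0 = id_blinfun"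
    by (rule blinfun_eqI) (use h(2) in \<open>simp add: f' bounded_linear_Blinfun_apply[OF blh] fun_eq_iff\<close>)
  have 2: "continuous_on UNIV f'"
    by (rule continuous_on_blinfun_componentwise) (simp add: f' smooth_on_imp_continuous_on[OF smooth_on_frechet_derivative[OF f]])
  have 3: "(f has_derivative blinfun_apply (f' x)) (at x)" for x by (simp add: f' der)
  show thesis
  proof (rule inverse_function_theorem[OF open_UNIV 3 2 UNIV_I 1])
    fix U V g g'
    assume g: "open U" "x0 \<in> U" "open V" "f x0 \<in> V" "homeomorphism U V f g"
      and d: "\<And>y. y \<in> V \<Longrightarrow> (g has_derivative (g' y)) (at y)"
    have "g differentiable (at y)" if "y \<in> V" for y
      using d[OF that] unfolding differentiable_def by blast
    then show thesis by (rule that[OF g])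
  qed
qed

text \<open>The map \<open>(r, \<theta>) \<mapsto> (q (r, \<theta>), \<theta>)\<close> is locally invertible, and its inverse gives a differentiable
  local solution of \<open>q = 0\<close>, which is \<open>\<rho>\<close> by uniqueness. Differentiating \<open>q (\<rho> \<theta>, \<theta>) = 0\<close> then
  yields an equation \<open>\<rho>' \<theta> = G (\<rho> \<theta>, \<theta>)\<close> with \<open>G\<close> smooth, which makes \<open>\<rho>\<close> smooth.\<close>

lemma smooth_implicit_radius:
  fixes q :: "real \<times> real \<Rightarrow> real" and \<rho> :: "real \<Rightarrow> real"
  assumes q: "smooth_on UNIV q"
    and \<rho>: "\<And>\<theta>. r1 < \<rho> \<theta> \<and> \<rho> \<theta> < r2 \<and> q (\<rho> \<theta>, \<theta>) = 0"
    and uniq: "\<And>\<theta> r. r1 < r \<Longrightarrow> r < r2 \<Longrightarrow> q (r, \<theta>) = 0 \<Longrightarrow> r = \<rho> \<theta>"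
    and nd: "\<And>\<theta>. frechet_derivative q (at (\<rho> \<theta>, \<theta>)) (1, 0) \<noteq> 0"
  shows "smooth_on UNIV \<rho>"
proof -
  let ?D = "\<lambda>x. frechet_derivative q (at x)"
  have der: "(q has_derivative ?D x) (at x)" for x using smooth_on_has_derivative[OF q] by simp
  have lin: "linear (?D x)" for x using der has_derivative_linear by blast
  define \<Omega> where "\<Omega> = (\<lambda>x. ?D x (1, 0)) -` (- {0})"
  have op: "open \<Omega>" unfolding \<Omega>_def
    by (intro open_vimage open_Compl smooth_on_imp_continuous_on[OF smooth_on_frechet_derivative[OF q]]) simp
  have sG: "smooth_on \<Omega> (\<lambda>x. - ?D x (0, 1) / ?D x (1, 0))"
    by (intro smooth_on_divide smooth_on_minus op smooth_on_subset[OF smooth_on_frechet_derivative[OF q] subset_UNIV])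
       (simp add: \<Omega>_def)
  have diff: "\<rho> differentiable (at t)" for t
  proof -
    define G where "G x = (q x, snd x)" for x
    have sG: "smooth_on UNIV G" unfolding G_def by (intro smooth_on_Pair q smooth_on_snd smooth_on_ident open_UNIV)
    let ?x0 = "(\<rho> t, t)"
    have dG: "(G has_derivative (\<lambda>v. (?D ?x0 v, snd v))) (at ?x0)" unfolding G_def
      by (intro has_derivative_Pair der has_derivative_snd has_derivative_ident)
    then have "frechet_derivative G (at ?x0) = (\<lambda>v. (?D ?x0 v, snd v))" using frechet_derivative_at by metis
    moreover have "inj (\<lambda>v. (?D ?x0 v, snd v))"
    proof (rule injI)
      fix v w assume vw: "(?D ?x0 v, snd v) = (?D ?x0 w, snd w)"
      have e: "v - w = (fst v - fst w) *\<^sub>R (1, 0)" using vw by (simp add: prod_eq_iff)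
      have "?D ?x0 (v - w) = (fst v - fst w) * ?D ?x0 (1, 0)" by (subst e, subst linear_cmul[OF lin]) simp
      moreover have "?D ?x0 (v - w) = 0" using vw by (simp add: linear_diff[OF lin])
      ultimately have "fst v = fst w" using nd[of t] by simp
      then show "v = w" using vw by (simp add: prod_eq_iff)
    qed
    ultimately have "inj (frechet_derivative G (at ?x0))" by simp
    from smooth_local_inverse[OF sG this] obtain U V g where
      g: "open U" "?x0 \<in> U" "open V" "G ?x0 \<in> V" "homeomorphism U V G g" "\<And>y. y \<in> V \<Longrightarrow> g differentiable (at y)" by blast
    have V0: "(0, t) \<in> V" using g(4) \<rho>[of t] by (simp add: G_def)
    have g0: "g (0, t) = ?x0" using homeomorphism_apply1[OF g(5) g(2)] \<rho>[of t] by (simp add: G_def)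
    have gd: "(\<lambda>s. fst (g (0, s))) differentiable (at t)"
    proof -
      have "(\<lambda>s::real. (0::real, s)) differentiable (at t)"
        by (auto simp: differentiable_def intro!: exI has_derivative_Pair has_derivative_const has_derivative_ident)
      then have "(\<lambda>s. g (0, s)) differentiable (at t)"
        using differentiable_chain_at[of "\<lambda>s. (0, s)" t g] g(6)[OF V0] by (simp add: o_def)
      then show ?thesis by (auto simp: differentiable_def intro: has_derivative_fst)
    qed
    then have cont: "isCont (\<lambda>s. fst (g (0, s))) t" by (rule differentiable_imp_continuous_within)
    have "fst (g (0, t)) \<in> {r1<..<r2}" using g0 \<rho>[of t] by simp
    then have e1: "eventually (\<lambda>s. fst (g (0, s)) \<in> {r1<..<r2}) (at t)"
      by (rule topological_tendstoD[OF cont[unfolded isCont_def] open_greaterThanLessThan])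
    have "isCont (\<lambda>s::real. (0::real, s)) t" by (intro continuous_intros)
    then have e2: "eventually (\<lambda>s. (0, s) \<in> V) (at t)"
      unfolding isCont_def by (rule topological_tendstoD[OF _ g(3) V0])
    have ev: "eventually (\<lambda>s. fst (g (0, s)) = \<rho> s) (at t)"
      using e1 e2
    proof eventually_elim
      case (elim s)
      have "G (g (0, s)) = (0, s)" using homeomorphism_apply2[OF g(5) elim(2)] .
      then have "q (g (0, s)) = 0" "snd (g (0, s)) = s" by (auto simp: G_def)
      then have "q (fst (g (0, s)), s) = 0" by (metis prod.collapse)
      then show ?case using uniq elim(1) by simp
    qed
    obtain D where "((\<lambda>s. fst (g (0, s))) has_derivative D) (at t)" using gd by (auto simp: differentiable_def)
    then have "(\<rho> has_derivative D) (at t)"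
      by (rule has_derivative_transform_eventually[OF _ ev]) (use g0 in auto)
    then show ?thesis by (auto simp: differentiable_def)
  qed
  show ?thesis
  proof (rule smooth_on_autonomous[OF op sG])
    show "(\<rho> \<theta>, \<theta>) \<in> \<Omega>" for \<theta> using nd by (simp add: \<Omega>_def)
    show "(\<rho> has_real_derivative - ?D (\<rho> \<theta>, \<theta>) (0, 1) / ?D (\<rho> \<theta>, \<theta>) (1, 0)) (at \<theta>)" for \<theta>
    proof -
      obtain D where D: "(\<rho> has_real_derivative D) (at \<theta>)"
        using diff[of \<theta>] real_differentiable_def by blast
      have p: "((\<lambda>t. (\<rho> t, t)) has_derivative (\<lambda>h. (D * h, h))) (at \<theta>)"
        using D by (intro has_derivative_Pair has_derivative_ident) (simp add: has_field_derivative_def)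
      have "((\<lambda>t. q (\<rho> t, t)) has_derivative (\<lambda>h. ?D (\<rho> \<theta>, \<theta>) (D * h, h))) (at \<theta>)"
        using has_derivative_compose[OF p der] .
      moreover have "(\<lambda>t. q (\<rho> t, t)) = (\<lambda>t. 0)" using \<rho> by simp
      ultimately have "((\<lambda>t. 0) has_derivative (\<lambda>h. ?D (\<rho> \<theta>, \<theta>) (D * h, h))) (at \<theta>)" by simp
      then have "(\<lambda>h. ?D (\<rho> \<theta>, \<theta>) (D * h, h)) = (\<lambda>h. 0)"
        using has_derivative_unique has_derivative_const by blast
      then have z: "?D (\<rho> \<theta>, \<theta>) (D, 1) = 0" by (metis mult.right_neutral)
      have "(D, 1) = D *\<^sub>R (1, 0) + (0, 1::real)" by simp
      then have "?D (\<rho> \<theta>, \<theta>) (D, 1) = D * ?D (\<rho> \<theta>, \<theta>) (1, 0) + ?D (\<rho> \<theta>, \<theta>) (0, 1)"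
        by (metis linear_add[OF lin] linear_cmul[OF lin] real_scaleR_def)
      then have "D = - ?D (\<rho> \<theta>, \<theta>) (0, 1) / ?D (\<rho> \<theta>, \<theta>) (1, 0)" using z nd[of \<theta>] by (simp add: field_simps)
      then show ?thesis using D by simp
    qed
  qed
qed

section \<open>From alternating annuli to nests\<close>

lemma smooth_form_eval: "smooth_on UNIV (form_eval d P :: real^3 \<Rightarrow> real)"
proof -
  have "smooth_on UNIV (\<lambda>X :: real^3. case \<alpha> of (i, j, k) \<Rightarrow> P (i, j, k) * X $ 1 ^ i * X $ 2 ^ j * X $ 3 ^ k)" for \<alpha>
    by (cases \<alpha>) (auto intro!: smooth_on_mult smooth_on_power smooth_on_const smooth_on_vec_nth smooth_on_ident)
  then show ?thesis unfolding form_eval_def by (intro smooth_on_sum open_UNIV)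
qed

definition polar_form :: "nat \<Rightarrow> (nat \<times> nat \<times> nat \<Rightarrow> real) \<Rightarrow> real^3^3 \<Rightarrow> real \<times> real \<Rightarrow> real" where
  "polar_form d P A = (\<lambda>(r, \<theta>). form_eval d P (A *v vector [1, r * cos \<theta>, r * sin \<theta>]))"

lemma smooth_polar_form: "smooth_on UNIV (polar_form d P A)"
proof -
  have f: "smooth_on UNIV (fst :: real \<times> real \<Rightarrow> real)" "smooth_on UNIV (snd :: real \<times> real \<Rightarrow> real)"
    using smooth_on_fst[OF open_UNIV smooth_on_ident[OF open_UNIV]] smooth_on_snd[OF open_UNIV smooth_on_ident[OF open_UNIV]]
    by simp_all
  have "smooth_on UNIV (\<lambda>x :: real \<times> real. A *v vector [1, fst x * cos (snd x), fst x * sin (snd x)])"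
    by (intro smooth_on_matrix_vector smooth_on_vector_3 smooth_on_mult smooth_on_const smooth_on_sin smooth_on_cos f open_UNIV)
  from smooth_on_compose[OF open_UNIV open_UNIV this smooth_form_eval[of d P] UNIV_I]
  show ?thesis by (simp add: polar_form_def case_prod_unfold)
qed

lemma form_eval_scaleR:
  "form_eval d P (c *\<^sub>R x :: real^3) = c ^ d * form_eval d P x"
proof -
  have "(case \<alpha> of (i, j, k) \<Rightarrow> P (i, j, k) * (c *\<^sub>R x) $ 1 ^ i * (c *\<^sub>R x) $ 2 ^ j * (c *\<^sub>R x) $ 3 ^ k) =
    c ^ d * (case \<alpha> of (i, j, k) \<Rightarrow> P (i, j, k) * x $ 1 ^ i * x $ 2 ^ j * x $ 3 ^ k)" if "\<alpha> \<in> exponents d" for \<alpha>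
    using that by (auto simp: exponents_def power_mult_distrib power_add)
  then show ?thesis unfolding form_eval_def sum_distrib_left by (intro sum.cong) auto
qed

lemma rp2_point_in_real_curve:
  assumes "x \<noteq> 0" shows "rp2_point x \<in> real_curve d P \<longleftrightarrow> form_eval d P x = 0"
proof
  assume "rp2_point x \<in> real_curve d P"
  then obtain y where y: "rp2_point x = rp2_point y" "y \<noteq> 0" "form_eval d P y = 0" by (auto simp: real_curve_def)
  then obtain c where "x = c *\<^sub>R y" using rp2_point_eq_iff[OF assms] by blast
  then show "form_eval d P x = 0" using y by (simp add: form_eval_scaleR)
qed (use assms in \<open>auto simp: real_curve_def\<close>)

definition place_disc :: "real^3^3 \<Rightarrow> real \<Rightarrow> rp2 set" where
  "place_disc A R = {rp2_point (A *v vector [1, r * cos \<theta>, r * sin \<theta>]) |r \<theta>. 0 \<le> r \<and> r < R}"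

text \<open>The unique radial zeros form a star-shaped curve. The open annulus isolates it from the rest of the
  zero locus, so that it is a whole component.\<close>

lemma oval_of_annulus:
  assumes smc: "smooth_real_curve d P" and orth: "orthogonal_matrix A" and r1: "0 \<le> r1"
    and ex: "\<And>\<theta>. \<exists>!r. r1 < r \<and> r < r2 \<and> polar_form d P A (r, \<theta>) = 0"
    and nd: "\<And>r \<theta>. r1 < r \<Longrightarrow> r < r2 \<Longrightarrow> polar_form d P A (r, \<theta>) = 0 \<Longrightarrow>
        \<exists>D. D \<noteq> 0 \<and> ((\<lambda>r. polar_form d P A (r, \<theta>)) has_real_derivative D) (at r)"
  obtains \<rho> where "star_curve A \<rho>" "oval d P (star_curve.curve A \<rho>)" "\<And>\<theta>. r1 < \<rho> \<theta> \<and> \<rho> \<theta> < r2"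
    "star_curve.curve A \<rho> \<subseteq> place_disc A r2"
proof -
  let ?q = "polar_form d P A"
  define \<rho> where "\<rho> \<theta> = (THE r. r1 < r \<and> r < r2 \<and> ?q (r, \<theta>) = 0)" for \<theta>
  have \<rho>: "r1 < \<rho> \<theta> \<and> \<rho> \<theta> < r2 \<and> ?q (\<rho> \<theta>, \<theta>) = 0" for \<theta>
    unfolding \<rho>_def by (rule theI') (rule ex)
  have uniq: "r = \<rho> \<theta>" if "r1 < r" "r < r2" "?q (r, \<theta>) = 0" for r \<theta>
    using ex[of \<theta>] \<rho>[of \<theta>] that by blast
  have nd': "frechet_derivative ?q (at (\<rho> \<theta>, \<theta>)) (1, 0) \<noteq> 0" for \<theta>
  proof -
    obtain D where D: "D \<noteq> 0" "((\<lambda>r. ?q (r, \<theta>)) has_real_derivative D) (at (\<rho> \<theta>))" using nd \<rho> by blast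
    have p: "((\<lambda>r. (r, \<theta>)) has_derivative (\<lambda>h. (h, 0))) (at (\<rho> \<theta>))"
      by (intro has_derivative_Pair has_derivative_ident has_derivative_const)
    have "((\<lambda>r. ?q (r, \<theta>)) has_derivative (\<lambda>h. frechet_derivative ?q (at (\<rho> \<theta>, \<theta>)) (h, 0))) (at (\<rho> \<theta>))"
      using has_derivative_compose[OF p smooth_on_has_derivative[OF smooth_polar_form UNIV_I]] .
    with D(2) have "(\<lambda>h. frechet_derivative ?q (at (\<rho> \<theta>, \<theta>)) (h, 0)) = (*) D"
      unfolding has_field_derivative_def using has_derivative_unique by blast
    then have "frechet_derivative ?q (at (\<rho> \<theta>, \<theta>)) (1, 0) = D * 1" by metis
    then show ?thesis using D(1) by simp
  qed
  have "smooth_on UNIV \<rho>" by (rule smooth_implicit_radius[OF smooth_polar_form \<rho> uniq nd'])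
  moreover have "\<rho> (\<theta> + 2 * pi) = \<rho> \<theta>" for \<theta> by (simp add: \<rho>_def polar_form_def)
  moreover have "\<rho> \<theta> > 0" for \<theta> using \<rho>[of \<theta>] r1 by simp
  ultimately have star: "star_curve A \<rho>" using orth by (simp add: star_curve_def)
  interpret star_curve A \<rho> by (rule star)
  have lpc: "lp (of_real r * cis \<theta>) = rp2_point (A *v vector [1, r * cos \<theta>, r * sin \<theta>])" for r \<theta>
    by (simp add: lp_def)
  have nz: "A *v vector [1, a, b] \<noteq> 0" for a b using A_nz by (auto simp: vec_eq_iff forall_3)
  have cu: "pt (\<alpha> \<theta>) \<theta> = rp2_point (A *v vector [1, \<rho> \<theta> * cos \<theta>, \<rho> \<theta> * sin \<theta>])" for \<theta>
    using lp_polar[of "\<rho> \<theta>" \<theta>] pos[of \<theta>] by (simp add: \<alpha>_def lpc)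
  define S where "S = {x. r1 * \<bar>crd x $ 1\<bar> < sqrt ((crd x $ 2)\<^sup>2 + (crd x $ 3)\<^sup>2) \<and> sqrt ((crd x $ 2)\<^sup>2 + (crd x $ 3)\<^sup>2) < r2 * \<bar>crd x $ 1\<bar>}"
  have cc: "continuous_on UNIV (\<lambda>x. crd x $ i)" for i
    using smooth_on_imp_continuous_on[OF smooth_on_vec_nth[OF open_UNIV smooth_crd[OF open_UNIV]]] .
  have "open S" unfolding S_def by (intro open_Collect_conj open_Collect_less continuous_intros cc)
  moreover have S0: "0 \<notin> S" by (simp add: S_def)
  ultimately have opU: "open (rp2_point ` S)" by (rule open_image_rp2_point)
  have inS: "A *v vector [1, r * cos \<theta>, r * sin \<theta>] \<in> S \<longleftrightarrow> r1 < r \<and> r < r2" if "0 \<le> r" for r \<theta>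
  proof -
    have "(r * cos \<theta>)\<^sup>2 + (r * sin \<theta>)\<^sup>2 = r\<^sup>2 * ((sin \<theta>)\<^sup>2 + (cos \<theta>)\<^sup>2)" by algebra
    then have "sqrt ((r * cos \<theta>)\<^sup>2 + (r * sin \<theta>)\<^sup>2) = r" using that by simp
    then show ?thesis by (simp add: S_def)
  qed
  have cS: "c *\<^sub>R x \<in> S \<longleftrightarrow> x \<in> S" if "c \<noteq> 0" for c x
  proof -
    have "sqrt ((c * a)\<^sup>2 + (c * b)\<^sup>2) = \<bar>c\<bar> * sqrt (a\<^sup>2 + b\<^sup>2)" for a b
    proof -
      have "(c * a)\<^sup>2 + (c * b)\<^sup>2 = c\<^sup>2 * (a\<^sup>2 + b\<^sup>2)" by algebra
      then show ?thesis by (simp add: real_sqrt_mult)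
    qed
    moreover have "r * \<bar>c * a\<bar> = \<bar>c\<bar> * (r * \<bar>a\<bar>)" for r a by (simp add: abs_mult)
    moreover have "\<bar>c\<bar> > 0" using that by simp
    ultimately show ?thesis unfolding S_def mem_Collect_eq crd_scaleR vector_scaleR_component real_scaleR_def
      by (simp only: mult_less_cancel_left_pos)
  qed
  have ov: "oval d P curve"
  proof (rule oval_curve[OF smc _ opU])
    show "curve \<subseteq> real_curve d P"
      using \<rho> nz by (auto simp: curve_def cu rp2_point_in_real_curve polar_form_def)
    show "curve \<subseteq> rp2_point ` S"
      unfolding curve_def cu using inS pos less_imp_le \<rho> by blast
    show "real_curve d P \<inter> rp2_point ` S \<subseteq> curve"
    proof
      fix L assume L: "L \<in> real_curve d P \<inter> rp2_point ` S"
      then obtain x where x: "x \<in> S" "L = rp2_point x" by auto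
      then have x0: "x \<noteq> 0" using S0 by auto
      have "crd x $ 1 \<noteq> 0"
      proof
        assume "crd x $ 1 = 0"
        then show False using x(1) by (auto simp: S_def)
      qed
      then obtain z where z: "L = lp z" using lp_eq_iff[OF x0] x(2) by blast
      obtain r \<theta> where r: "r \<ge> 0" "z = of_real r * cis \<theta>" by (rule complex_polar)
      have L2: "L = rp2_point (A *v vector [1, r * cos \<theta>, r * sin \<theta>])" unfolding z r(2) lpc ..
      then obtain c where "c \<noteq> 0" "x = c *\<^sub>R (A *v vector [1, r * cos \<theta>, r * sin \<theta>])"
        using rp2_point_eq_iff[OF x0 nz] x(2) by auto
      then have "r1 < r \<and> r < r2" using cS x(1) inS[OF r(1)] by metis
      moreover have "?q (r, \<theta>) = 0" using L L2 nz by (auto simp: rp2_point_in_real_curve polar_form_def)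
      ultimately have "r = \<rho> \<theta>" using uniq by blast
      then show "L \<in> curve" using L2 cu by (auto simp: curve_def)
    qed
  qed
  have "curve \<subseteq> place_disc A r2"
    unfolding curve_def cu place_disc_def using \<rho> pos less_imp_le by blast
  then show thesis using that star ov \<rho> by blast
qed

text \<open>One oval for each annulus; since the annuli are concentric, the radius functions increase
  with the index and the ovals are nested.\<close>

lemma nest_of_annuli:
  assumes sm: "smooth_real_curve d P" and orth: "orthogonal_matrix A" and r: "0 \<le> r 0" "\<And>k. k < n \<Longrightarrow> r k < r (Suc k)"
    and ex: "\<And>k \<theta>. k < n \<Longrightarrow> \<exists>!s. r k < s \<and> s < r (Suc k) \<and> polar_form d P A (s, \<theta>) = 0"
    and nd: "\<And>k s \<theta>. k < n \<Longrightarrow> r k < s \<Longrightarrow> s < r (Suc k) \<Longrightarrow> polar_form d P A (s, \<theta>) = 0 \<Longrightarrow>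
        \<exists>D. D \<noteq> 0 \<and> ((\<lambda>s. polar_form d P A (s, \<theta>)) has_real_derivative D) (at s)"
  shows "\<exists>N. nest d P N \<and> card N = n \<and> \<Union>N \<subseteq> place_disc A (r n) \<and> {} \<notin> N"
proof -
  have "r i \<le> r (i + m)" if "i + m \<le> n" for i m
    using that
  proof (induction m)
    case (Suc m)
    then have "r i \<le> r (i + m)" "r (i + m) < r (Suc (i + m))" using r(2)[of "i + m"] by auto
    then show ?case by simp
  qed simp
  then have mono: "r i \<le> r j" if "i \<le> j" "j \<le> n" for i j
    using that le_Suc_ex by blast
  have "\<exists>\<rho>. star_curve A \<rho> \<and> oval d P (star_curve.curve A \<rho>) \<and> (\<forall>\<theta>. r k < \<rho> \<theta> \<and> \<rho> \<theta> < r (Suc k)) \<and>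
      star_curve.curve A \<rho> \<subseteq> place_disc A (r (Suc k))" if k: "k < n" for k
  proof -
    have "0 \<le> r k" using mono[of 0 k] r(1) k by simp
    show ?thesis
      by (rule oval_of_annulus[OF sm orth \<open>0 \<le> r k\<close> ex[OF k]], rule nd[OF k]) blast+
  qed
  then obtain \<rho> where \<rho>: "\<And>k. k < n \<Longrightarrow> star_curve A (\<rho> k)" "\<And>k. k < n \<Longrightarrow> oval d P (star_curve.curve A (\<rho> k))"
    "\<And>k \<theta>. k < n \<Longrightarrow> r k < \<rho> k \<theta> \<and> \<rho> k \<theta> < r (Suc k)"
    "\<And>k. k < n \<Longrightarrow> star_curve.curve A (\<rho> k) \<subseteq> place_disc A (r (Suc k))" by metis
  define C where "C k = star_curve.curve A (\<rho> k)" for k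
  have lt: "\<rho> i \<theta> < \<rho> j \<theta>" if "i < j" "j < n" for i j \<theta>
    using \<rho>(3)[of i \<theta>] \<rho>(3)[of j \<theta>] mono[of "Suc i" j] that by fastforce
  have nest: "in_oval_interior (C i) (C j)" "C i \<noteq> C j" if "i < j" "j < n" for i j
    unfolding C_def using star_curve_nested[OF \<rho>(1) \<rho>(1) lt[OF that]] that by auto
  define Cs where "Cs = map C [0..<n]"
  have inj: "inj_on C {0..<n}" using nest(2) by (auto intro!: inj_onI) (metis linorder_neqE_nat)
  have dist: "distinct Cs" unfolding Cs_def distinct_map using inj by simp
  have sorted: "sorted_wrt in_oval_interior Cs"
    unfolding sorted_wrt_iff_nth_less by (auto simp: Cs_def nest)
  have mem: "(\<forall>X \<in> set Cs. oval d P X)" using \<rho>(2) by (auto simp: Cs_def C_def)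
  have sub: "C k \<subseteq> place_disc A (r n)" if "k < n" for k
  proof -
    have "place_disc A (r (Suc k)) \<subseteq> place_disc A (r n)"
      unfolding place_disc_def using mono[of "Suc k" n] that by fastforce
    then show ?thesis using \<rho>(4)[OF that] by (auto simp: C_def)
  qed
  have ne: "C k \<noteq> {}" if "k < n" for k
    unfolding C_def by (simp add: star_curve.curve_def[OF \<rho>(1)[OF that]])
  have s: "set Cs = C ` {..<n}" by (auto simp: Cs_def)
  have "nest d P (set Cs)" unfolding nest_def using dist sorted mem by blast
  moreover have "card (set Cs) = n" using distinct_card[OF dist] by (simp add: Cs_def)
  moreover have "\<Union>(set Cs) \<subseteq> place_disc A (r n)" unfolding s using sub by blast
  moreover have "{} \<notin> set Cs" unfolding s using ne by (metis imageE lessThan_iff)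
  ultimately show ?thesis by blast
qed

section \<open>Lebesgue measure under isometries\<close>

text \<open>Orthogonal invariance of Lebesgue measure is carried from a coordinate space to an arbitrary
  Euclidean space by a linear map that matches the standard bases; such a map pulls boxes back to boxes.\<close>

lemma lborel_distr_Basis:
  fixes f :: "'a::euclidean_space \<Rightarrow> 'b::euclidean_space"
  assumes lin: "linear f" and bij: "bij_betw f Basis Basis"
  shows "distr lborel borel f = lborel"
proof (rule lborel_eqI[symmetric])
  have inner: "f x \<bullet> f b = x \<bullet> b" if b: "b \<in> Basis" for x b
  proof -
    have fB: "f b' \<in> Basis" if "b' \<in> Basis" for b' using bij that by (auto simp: bij_betw_def)
    have "f x = (\<Sum>b'\<in>Basis. (x \<bullet> b') *\<^sub>R f b')"
      by (subst (1) euclidean_representation[of x, symmetric]) (simp add: linear_sum[OF lin] linear_cmul[OF lin])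
    then have "f x \<bullet> f b = (\<Sum>b'\<in>Basis. (x \<bullet> b') * (f b' \<bullet> f b))" by (simp add: inner_sum_left)
    also have "\<dots> = (\<Sum>b'\<in>Basis. (x \<bullet> b') * (if b' = b then 1 else 0))"
    proof (rule sum.cong[OF refl])
      fix b' :: 'a assume b': "b' \<in> Basis"
      have "f b' = f b \<longleftrightarrow> b' = b" using bij b b' by (metis bij_betw_def inj_on_eq_iff)
      then show "(x \<bullet> b') * (f b' \<bullet> f b) = (x \<bullet> b') * (if b' = b then 1 else 0)"
        using fB[OF b] fB[OF b'] by (simp add: inner_Basis)
    qed
    also have "\<dots> = x \<bullet> b" using b by (simp add: if_distrib sum.delta cong: if_cong)
    finally show ?thesis .
  qed
  have cont: "continuous_on UNIV f" using lin by (simp add: linear_continuous_on linear_conv_bounded_linear)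
  then have meas: "f \<in> borel_measurable lborel" by (simp add: borel_measurable_continuous_onI)
  fix l u :: 'b assume lu: "\<And>b. b \<in> Basis \<Longrightarrow> l \<bullet> b \<le> u \<bullet> b"
  define g where "g y = (\<Sum>b\<in>Basis. (y \<bullet> f b) *\<^sub>R b)" for y :: 'b
  have g: "g y \<bullet> b = y \<bullet> f b" if "b \<in> Basis" for y b
    using that by (simp add: g_def inner_sum_left inner_Basis if_distrib sum.delta cong: if_cong)
  have img: "Basis = f ` Basis" using bij by (simp add: bij_betw_def)
  have "f -` box l u = box (g l) (g u)"
    unfolding box_def using g inner by (subst img) (auto simp: vimage_def)
  then have "emeasure (distr lborel borel f) (box l u) = emeasure lborel (box (g l) (g u))"
    using meas by (simp add: emeasure_distr)
  also have "\<dots> = (\<Prod>b\<in>Basis. (g u - g l) \<bullet> b)"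
    using lu bij by (intro emeasure_lborel_box) (auto simp: g bij_betw_def)
  also have "(\<Prod>b\<in>Basis. (g u - g l) \<bullet> b) = (\<Prod>b\<in>Basis. (u - l) \<bullet> f b)"
    by (intro prod.cong) (simp_all add: inner_diff_left g)
  also have "\<dots> = (\<Prod>b\<in>Basis. (u - l) \<bullet> b)"
    by (rule prod.reindex_bij_betw[OF bij])
  finally show "emeasure (distr lborel borel f) (box l u) = ennreal (\<Prod>b\<in>Basis. (u - l) \<bullet> b)" .
qed simp

lemma exists_linear_Basis_bij:
  assumes "DIM('a::euclidean_space) = DIM('b::euclidean_space)"
  obtains f :: "'a::euclidean_space \<Rightarrow> 'b::euclidean_space" where "linear f" "bij_betw f Basis Basis" "\<And>x. norm (f x) = norm x"
proof -
  obtain \<beta> :: "'a \<Rightarrow> 'b" where \<beta>: "bij_betw \<beta> Basis Basis"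
    using assms finite_same_card_bij[OF finite_Basis finite_Basis] by blast
  define f where "f x = (\<Sum>b\<in>Basis. (x \<bullet> b) *\<^sub>R \<beta> b)" for x
  have lin: "linear f" unfolding f_def
    by (intro linearI) (simp_all add: inner_add_left scaleR_add_left sum.distrib scaleR_sum_right)
  have fb: "f b = \<beta> b" if "b \<in> Basis" for b
    using that by (simp add: f_def inner_Basis if_distrib[of "\<lambda>c. c *\<^sub>R _"] sum.delta' cong: if_cong)
  then have bij: "bij_betw f Basis Basis" using \<beta> bij_betw_cong[of Basis f \<beta>] by simp
  have "norm (f x) = norm x" for x
  proof -
    have "(norm (f x))\<^sup>2 = (\<Sum>c\<in>Basis. (f x \<bullet> c)\<^sup>2)"
      unfolding power2_norm_eq_inner by (subst euclidean_inner) (simp add: power2_eq_square)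
    also have "\<dots> = (\<Sum>b\<in>Basis. (f x \<bullet> \<beta> b)\<^sup>2)"
      by (rule sum.reindex_bij_betw[OF \<beta>, symmetric])
    also have "\<dots> = (\<Sum>b\<in>Basis. (x \<bullet> b)\<^sup>2)"
    proof (intro sum.cong refl arg_cong[where f = "\<lambda>t. t\<^sup>2"])
      fix b :: 'a assume b: "b \<in> Basis"
      have "f x \<bullet> \<beta> b = (\<Sum>b'\<in>Basis. (x \<bullet> b') * (\<beta> b' \<bullet> \<beta> b))" by (simp add: f_def inner_sum_left)
      also have "\<dots> = (\<Sum>b'\<in>Basis. (x \<bullet> b') * (if b' = b then 1 else 0))"
      proof (rule sum.cong[OF refl])
        fix b' :: 'a assume b': "b' \<in> Basis"
        have "\<beta> b' = \<beta> b \<longleftrightarrow> b' = b" using \<beta> b b' by (metis bij_betw_def inj_on_eq_iff)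
        moreover have "\<beta> b \<in> Basis" "\<beta> b' \<in> Basis" using \<beta> b b' by (auto simp: bij_betw_def)
        ultimately show "(x \<bullet> b') * (\<beta> b' \<bullet> \<beta> b) = (x \<bullet> b') * (if b' = b then 1 else 0)"
          by (simp add: inner_Basis)
      qed
      also have "\<dots> = x \<bullet> b" using b by (simp add: if_distrib sum.delta cong: if_cong)
      finally show "f x \<bullet> \<beta> b = x \<bullet> b" .
    qed
    also have "\<dots> = (norm x)\<^sup>2"
      unfolding power2_norm_eq_inner by (simp only: euclidean_inner[of x x] power2_eq_square)
    finally show ?thesis by simp
  qed
  then show thesis using that lin bij by blast
qed

lemma lborel_distr_orthogonal:
  fixes f :: "real^'n::{finite,wellorder} \<Rightarrow> real^'n::_"
  assumes f: "orthogonal_transformation f"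
  shows "distr lborel borel f = lborel"
proof (rule lborel_eqI[symmetric])
  have lin: "linear f" using f by (rule orthogonal_transformation_linear)
  have cont: "continuous_on UNIV f" using lin by (simp add: linear_continuous_on linear_conv_bounded_linear)
  then have meas: "f \<in> borel_measurable lborel" by (simp add: borel_measurable_continuous_onI)
  obtain g where g: "orthogonal_transformation g" "\<And>x. f (g x) = x" "\<And>x. g (f x) = x"
    by (metis f bij_inv_eq_iff orthogonal_transformation_bij orthogonal_transformation_inv)
  fix l u :: "real^'n::_" assume lu: "\<And>b. b \<in> Basis \<Longrightarrow> l \<bullet> b \<le> u \<bullet> b"
  have pre: "f -` box l u = g ` box l u"
  proof (intro set_eqI iffI)
    fix x assume "x \<in> f -` box l u"
    then have "g (f x) \<in> g ` box l u" by blast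
    then show "x \<in> g ` box l u" by (simp only: g(3))
  next
    fix x assume "x \<in> g ` box l u"
    then show "x \<in> f -` box l u" using g(2) by auto
  qed
  have bl: "box l u \<in> lmeasurable" by simp
  have gl: "g ` box l u \<in> lmeasurable" by (rule measurable_orthogonal_image[OF g(1) bl])
  have gb: "g ` box l u \<in> sets borel"
    using pre measurable_sets[OF meas, of "box l u"] by simp
  have "emeasure (distr lborel borel f) (box l u) = emeasure lborel (g ` box l u)"
    using meas by (simp add: emeasure_distr pre)
  also have "\<dots> = emeasure lebesgue (g ` box l u)" using gb by simp
  also have "\<dots> = ennreal (measure lebesgue (g ` box l u))"
    by (rule emeasure_eq_measure2[OF gl])
  also have "\<dots> = ennreal (measure lebesgue (box l u))" by (simp add: measure_orthogonal_image[OF g(1) bl])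
  also have "\<dots> = emeasure lebesgue (box l u)" by (rule emeasure_eq_measure2[OF bl, symmetric])
  also have "\<dots> = emeasure lborel (box l u)" by simp
  also have "\<dots> = ennreal (\<Prod>b\<in>Basis. (u - l) \<bullet> b)" using lu by (rule emeasure_lborel_box)
  finally show "emeasure (distr lborel borel f) (box l u) = ennreal (\<Prod>b\<in>Basis. (u - l) \<bullet> b)" .
qed simp

lemma linear_borel_measurable:
  fixes f :: "'a::euclidean_space \<Rightarrow> 'b::euclidean_space"
  shows "linear f \<Longrightarrow> f \<in> borel_measurable borel"
  by (simp add: borel_measurable_continuous_onI linear_continuous_on linear_conv_bounded_linear)

lemma lborel_distr_isometry:
  fixes f :: "'a::euclidean_space \<Rightarrow> 'b::euclidean_space" and T :: "'n::{finite,wellorder} itself"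
  assumes lin: "linear f" and iso: "\<And>x. norm (f x) = norm x"
    and dim: "DIM('a) = CARD('n)" "DIM('b) = CARD('n)"
  shows "distr lborel borel f = lborel"
proof -
  have "DIM(real^'n::_) = DIM('a)" "DIM('b) = DIM(real^'n::_)" using dim by simp_all
  note dims = this
  obtain h :: "real^'n::_ \<Rightarrow> 'a" where h: "linear h" "bij_betw h Basis Basis" "\<And>x. norm (h x) = norm x"
    by (rule exists_linear_Basis_bij[OF dims(1)]) blast
  obtain k :: "'b \<Rightarrow> real^'n::_" where k: "linear k" "bij_betw k Basis Basis" "\<And>x. norm (k x) = norm x"
    by (rule exists_linear_Basis_bij[OF dims(2)]) blast
  obtain k' :: "real^'n::_ \<Rightarrow> 'b" where k': "linear k'" "k' \<circ> k = id"
    using linear_injective_left_inverse[OF k(1)] k(3) linear_injective_0[OF k(1)] by (metis norm_eq_zero)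
  have ms: "f \<in> borel_measurable borel" "h \<in> borel_measurable borel" "k \<in> borel_measurable borel" "k' \<in> borel_measurable borel"
    using lin h(1) k(1) k'(1) linear_borel_measurable by blast+
  have "orthogonal_transformation (k \<circ> f \<circ> h)"
    unfolding orthogonal_transformation using lin h k iso by (simp add: linear_compose)
  then have "distr lborel borel (k \<circ> f \<circ> h) = lborel" by (rule lborel_distr_orthogonal)
  then have "distr (distr (distr lborel borel h) borel f) borel k = lborel"
    using ms by (simp add: distr_distr comp_assoc o_def)
  then have 1: "distr (distr lborel borel f) borel k = lborel"
    by (simp add: lborel_distr_Basis[OF h(1,2)])
  have "distr lborel borel f = distr (distr (distr lborel borel f) borel k) borel k'"
    using ms k'(2) by (simp add: distr_distr comp_assoc[symmetric] o_assoc)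
  also have "\<dots> = distr (distr lborel borel k) borel k'" by (simp add: 1 lborel_distr_Basis[OF k(1,2)])
  also have "\<dots> = distr lborel borel id" using ms k'(2) by (simp add: distr_distr)
  also have "\<dots> = lborel" using distr_id2[of borel lborel] by (simp add: id_def)
  finally show ?thesis .
qed

lemma nn_integral_lborel_isometry:
  fixes f :: "'a::euclidean_space \<Rightarrow> 'b::euclidean_space" and T :: "'n::{finite,wellorder} itself"
  assumes lin: "linear f" and iso: "\<And>x. norm (f x) = norm x"
    and dim: "DIM('a) = CARD('n)" "DIM('b) = CARD('n)" and g: "g \<in> borel_measurable borel"
  shows "(\<integral>\<^sup>+x. g (f x) \<partial>lborel) = (\<integral>\<^sup>+x. g x \<partial>lborel)"
proof -
  have "(\<integral>\<^sup>+x. g x \<partial>lborel) = (\<integral>\<^sup>+x. g x \<partial>distr lborel borel f)"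
    by (simp add: lborel_distr_isometry[OF lin iso dim])
  also have "\<dots> = (\<integral>\<^sup>+x. g (f x) \<partial>lborel)"
    by (rule nn_integral_distr) (use linear_borel_measurable[OF lin] g in auto)
  finally show ?thesis by simp
qed

lemma nn_integral_lborel_scaleR:
  fixes g :: "'a::euclidean_space \<Rightarrow> ennreal"
  assumes "c > 0" "g \<in> borel_measurable borel"
  shows "(\<integral>\<^sup>+x. g x \<partial>lborel) = ennreal (c ^ DIM('a)) * (\<integral>\<^sup>+x. g (c *\<^sub>R x) \<partial>lborel)"
proof -
  have "(\<integral>\<^sup>+x. g x \<partial>lborel) = (\<integral>\<^sup>+x. g x \<partial>density (distr lborel borel (\<lambda>x. 0 + c *\<^sub>R x)) (\<lambda>_. ennreal (\<bar>c\<bar>^DIM('a))))"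
    using lborel_affine[of c "0::'a"] assms(1) by simp
  also have "\<dots> = (\<integral>\<^sup>+x. ennreal (\<bar>c\<bar>^DIM('a)) * g (c *\<^sub>R x) \<partial>lborel)"
    using assms(2) by (simp add: nn_integral_density nn_integral_distr)
  also have "\<dots> = ennreal (c ^ DIM('a)) * (\<integral>\<^sup>+x. g (c *\<^sub>R x) \<partial>lborel)"
    using assms by (subst nn_integral_cmult) auto
  finally show ?thesis .
qed

section \<open>The Fubini-Study measure as a quotient of the ball\<close>

lemma norm_vec2: "(norm (z :: complex^2))\<^sup>2 = (cmod (z$1))\<^sup>2 + (cmod (z$2))\<^sup>2"
  unfolding norm_vec_def L2_set_def sum_2 by (rule real_sqrt_pow2) simp

lemma norm_vec3: "(norm (z :: complex^3))\<^sup>2 = (cmod (z$1))\<^sup>2 + (cmod (z$2))\<^sup>2 + (cmod (z$3))\<^sup>2"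
  unfolding norm_vec_def L2_set_def sum_3 by (rule real_sqrt_pow2) simp

definition hom3 :: "complex \<times> (complex^2) \<Rightarrow> complex^3" where
  "hom3 = (\<lambda>(w, z). vector [w, z$1, z$2])"

definition cscale :: "complex \<Rightarrow> complex^'n \<Rightarrow> complex^'n" where
  "cscale w X = (\<chi> i. w * X$i)"

lemma cscale_nth [simp]: "cscale w X $ i = w * X $ i" by (simp add: cscale_def)

lemma linear_cscale: "linear (cscale w)"
  by (rule linearI) (auto simp: vec_eq_iff algebra_simps scaleR_conv_of_real)

lemma norm_cscale: "norm (cscale w X) = cmod w * norm X"
  by (simp add: norm_vec_def cscale_def norm_mult L2_set_right_distrib)

lemma linear_hom3: "linear hom3"
  by (rule linearI) (auto simp: hom3_def vec_eq_iff forall_3 split: prod.splits)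

lemma norm_hom3: "norm (hom3 x) = norm x"
proof -
  have "(norm (hom3 x))\<^sup>2 = (norm (fst x))\<^sup>2 + (norm (snd x))\<^sup>2"
    by (simp add: hom3_def norm_vec3 norm_vec2 split: prod.splits)
  then show ?thesis by (simp add: norm_prod_def real_sqrt_unique)
qed

lemma DIM_complex_vec: "DIM(complex^2) = CARD(4)" "DIM(complex^3) = CARD(6)" "DIM(complex \<times> (complex^2)) = CARD(6)"
  "DIM(complex \<times> complex) = CARD(4)"
  by (simp_all only: DIM_cart DIM_prod DIM_complex card_bit0 card_num1 card_bit1) simp_all

lemma measurable_hom3 [measurable]: "hom3 \<in> borel_measurable borel"
  by (rule linear_borel_measurable[OF linear_hom3])

text \<open>Multiplication by \<open>w\<close> is a rotation followed by the dilation by \<open>\<bar>w\<bar>\<close> of a space of real dimension 4.\<close>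

lemma nn_integral_cscale:
  fixes g :: "complex^2 \<Rightarrow> ennreal"
  assumes "w \<noteq> 0" and g: "g \<in> borel_measurable borel"
  shows "(\<integral>\<^sup>+z. g z \<partial>lborel) = ennreal (cmod w ^ 4) * (\<integral>\<^sup>+z. g (cscale w z) \<partial>lborel)"
proof -
  let ?u = "w / of_real (cmod w)"
  have u: "norm (cscale ?u z) = norm z" for z :: "complex^2" using assms(1) by (simp add: norm_cscale norm_divide)
  have m: "(\<lambda>z. g (cscale ?u z)) \<in> borel_measurable borel"
    using g linear_borel_measurable[OF linear_cscale] by measurable
  have "(\<integral>\<^sup>+z. g z \<partial>lborel) = (\<integral>\<^sup>+z. g (cscale ?u z) \<partial>lborel)"
    by (rule nn_integral_lborel_isometry[OF linear_cscale u DIM_complex_vec(1) DIM_complex_vec(1) g, symmetric])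
  also have "\<dots> = ennreal (cmod w ^ DIM(complex^2)) * (\<integral>\<^sup>+z. g (cscale ?u (cmod w *\<^sub>R z)) \<partial>lborel)"
    by (rule nn_integral_lborel_scaleR[OF _ m]) (use assms(1) in simp)
  also have "\<dots> = ennreal (cmod w ^ 4) * (\<integral>\<^sup>+z. g (cscale w z) \<partial>lborel)"
  proof -
    have "cscale ?u (cmod w *\<^sub>R z) = cscale w z" for z :: "complex^2"
      using assms(1) unfolding vec_eq_iff cscale_nth vector_scaleR_component by (simp add: scaleR_conv_of_real)
    then show ?thesis by simp
  qed
  finally show ?thesis .
qed

text \<open>The constant of proportionality between the two integrals below. Norms are averages, so all that
  matters is that it is positive and finite.\<close>

definition \<kappa> :: ennreal where "\<kappa> = (\<integral>\<^sup>+w. ennreal (cmod w ^ 4) * indicator (ball 0 1) w \<partial>lborel)"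

lemma \<kappa>_bounds: "0 < \<kappa>" "\<kappa> < \<infinity>"
proof -
  have "\<kappa> \<le> (\<integral>\<^sup>+w. indicator (ball 0 1) w \<partial>(lborel :: complex measure))"
    unfolding \<kappa>_def by (intro nn_integral_mono) (auto simp: indicator_def power_le_one)
  also have "\<dots> = emeasure lborel (ball (0::complex) 1)" by simp
  also have "\<dots> < \<infinity>" by (rule emeasure_lborel_ball_finite)
  finally show "\<kappa> < \<infinity>" .
  let ?B = "ball (of_real (3/4)) (1/4) :: complex set"
  have *: "1/2 \<le> cmod w \<and> cmod w < 1" if "w \<in> ?B" for w
  proof -
    have "cmod (of_real (3/4) - w) < 1/4" using that by (simp add: dist_norm)
    moreover have "cmod (of_real (3/4) :: complex) = 3/4" by (simp only: norm_of_real)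
    ultimately show ?thesis using norm_triangle_ineq2[of "of_real (3/4)" w] norm_triangle_ineq3[of "of_real (3/4)" w] by linarith
  qed
  have "0 < ennreal (1/16) * emeasure lborel ?B"
    by (simp add: emeasure_ball ennreal_zero_less_mult_iff unit_ball_vol_pos)
  also have "\<dots> = (\<integral>\<^sup>+w. ennreal (1/16) * indicator ?B w \<partial>lborel)"
    by (rule nn_integral_cmult_indicator[symmetric]) simp
  also have "\<dots> \<le> \<kappa>" unfolding \<kappa>_def
  proof (intro nn_integral_mono)
    fix w :: complex
    show "ennreal (1/16) * indicator ?B w \<le> ennreal (cmod w ^ 4) * indicator (ball 0 1) w"
    proof (cases "w \<in> ?B")
      case True
      have "(1/2) ^ 4 \<le> cmod w ^ 4" by (rule power_mono) (use *[OF True] in auto)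
      then have "1/16 \<le> cmod w ^ 4" by (simp add: power4_eq_xxxx)
      then show ?thesis using *[OF True] True by (simp add: indicator_def ennreal_leI)
    qed simp
  qed
  finally show "0 < \<kappa>" .
qed

lemma \<kappa>_scale:
  assumes "c > 0"
  shows "(\<integral>\<^sup>+w. ennreal (cmod w ^ 4) * indicator {w. cmod w * c < 1} w \<partial>lborel) = ennreal (1 / c ^ 6) * \<kappa>"
proof -
  have "{w :: complex. cmod w * c < 1} \<in> sets borel" by measurable
  then have "(\<lambda>w::complex. ennreal (cmod w ^ 4) * indicator {w. cmod w * c < 1} w) \<in> borel_measurable borel"
    by measurable
  from nn_integral_lborel_scaleR[OF _ this, of "1 / c"] assms
  have "(\<integral>\<^sup>+w. ennreal (cmod w ^ 4) * indicator {w. cmod w * c < 1} w \<partial>lborel) =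
    ennreal ((1 / c) ^ 2) * (\<integral>\<^sup>+w. ennreal (cmod ((1 / c) *\<^sub>R w) ^ 4) * indicator {w. cmod w * c < 1} ((1 / c) *\<^sub>R w) \<partial>lborel)"
    by simp
  also have "(\<lambda>w :: complex. ennreal (cmod ((1 / c) *\<^sub>R w) ^ 4) * indicator {w. cmod w * c < 1} ((1 / c) *\<^sub>R w))
      = (\<lambda>w. ennreal ((1 / c) ^ 4) * (ennreal (cmod w ^ 4) * indicator (ball 0 1) w))"
  proof
    fix w :: complex
    have "cmod ((1 / c) *\<^sub>R w) = (1 / c) * cmod w" using assms by simp
    then have 1: "cmod ((1 / c) *\<^sub>R w) ^ 4 = (1 / c) ^ 4 * cmod w ^ 4" by (simp only: power_mult_distrib)
    have 2: "(1 / c) *\<^sub>R w \<in> {w. cmod w * c < 1} \<longleftrightarrow> w \<in> ball 0 1"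
      using assms by simp
    show "ennreal (cmod ((1 / c) *\<^sub>R w) ^ 4) * indicator {w. cmod w * c < 1} ((1 / c) *\<^sub>R w)
      = ennreal ((1 / c) ^ 4) * (ennreal (cmod w ^ 4) * indicator (ball 0 1) w)"
      unfolding 1 using 2 assms by (simp only: indicator_def) (simp add: ennreal_mult)
  qed
  also have "(\<integral>\<^sup>+w. ennreal ((1 / c) ^ 4) * (ennreal (cmod w ^ 4) * indicator (ball 0 1) w) \<partial>lborel) = ennreal ((1 / c) ^ 4) * \<kappa>"
  proof -
    have m: "(\<lambda>w::complex. ennreal (cmod w ^ 4) * indicator (ball 0 1) w) \<in> borel_measurable lborel"
      by (rule borel_measurable_times_ennreal[OF _ borel_measurable_indicator]) auto
    show ?thesis unfolding \<kappa>_def by (rule nn_integral_cmult[OF m])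
  qed
  finally show ?thesis using assms
    by (simp add: mult.assoc[symmetric] ennreal_mult[symmetric] power_divide flip: power_add)
qed

text \<open>A function on the projective plane, integrated over the unit ball of \<open>\<complex>\<^sup>3\<close> through its homogeneous
  extension, gives a multiple of its Fubini-Study integral: substitute \<open>X = (w, w z)\<close>, with
  Jacobian \<open>\<bar>w\<bar> ^ 4\<close>, and integrate over \<open>\<bar>w\<bar>\<^sup>2 < 1 / (1 + \<parallel>z\<parallel>\<^sup>2)\<close>, which produces the
  density \<open>(1 + \<parallel>z\<parallel>\<^sup>2) ^ (-3)\<close>. The ball is invariant under all unitary maps, whereas the affine chart hides
  this symmetry.\<close>

lemma ball_integral_eq_fs:
  fixes F :: "complex^3 \<Rightarrow> ennreal"
  assumes F[measurable]: "F \<in> borel_measurable borel"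
    and hom: "\<And>w X. w \<noteq> 0 \<Longrightarrow> F (cscale w X) = F X"
  shows "(\<integral>\<^sup>+X. F X * indicator (ball 0 1) X \<partial>lborel) = \<kappa> * (\<integral>\<^sup>+z. F (vector [1, z$1, z$2]) \<partial>fs_volume)"
proof -
  let ?G = "\<lambda>X. F X * indicator (ball 0 1) X"
  have [measurable]: "ball (0::complex^3) 1 \<in> sets borel" by simp
  have G[measurable]: "?G \<in> borel_measurable borel" by measurable
  let ?F1 = "\<lambda>z. F (hom3 (1, z))"
  have [measurable]: "hom3 \<in> borel_measurable (borel \<Otimes>\<^sub>M borel)" using measurable_hom3 by (simp add: borel_prod)
  have F1[measurable]: "?F1 \<in> borel_measurable borel"
  proof -
    have "(\<lambda>z::complex^2. (1::complex, z)) \<in> borel_measurable borel"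
      by (intro borel_measurable_continuous_onI continuous_intros)
    then show ?thesis by measurable
  qed
  let ?s = "\<lambda>z :: complex^2. sqrt (1 + (norm z)\<^sup>2)"
  have s1: "?s z > 0" for z by (simp add: add_pos_nonneg)
  have "(\<integral>\<^sup>+X. ?G X \<partial>lborel) = (\<integral>\<^sup>+x. ?G (hom3 x) \<partial>lborel)"
    by (rule nn_integral_lborel_isometry[OF linear_hom3 norm_hom3 DIM_complex_vec(3,2) G, symmetric])
  also have "\<dots> = (\<integral>\<^sup>+x. ?G (hom3 x) \<partial>(lborel \<Otimes>\<^sub>M lborel))" by (simp add: lborel_prod)
  also have "\<dots> = (\<integral>\<^sup>+w. \<integral>\<^sup>+z. ?G (hom3 (w, z)) \<partial>lborel \<partial>lborel)"
    by (rule lborel.nn_integral_fst[symmetric]) measurable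
  also have "\<dots> = (\<integral>\<^sup>+w. \<integral>\<^sup>+z. ennreal (cmod w ^ 4) * (?F1 z * indicator {w. cmod w * ?s z < 1} w) \<partial>lborel \<partial>lborel)"
  proof (rule nn_integral_cong_AE)
    show "AE w in lborel. (\<integral>\<^sup>+z. ?G (hom3 (w, z)) \<partial>lborel) =
      (\<integral>\<^sup>+z. ennreal (cmod w ^ 4) * (?F1 z * indicator {w. cmod w * ?s z < 1} w) \<partial>lborel)"
      using AE_lborel_singleton[of "0::complex"]
    proof eventually_elim
      case (elim w)
      have "(\<lambda>z::complex^2. (w, z)) \<in> borel_measurable borel"
        by (intro borel_measurable_continuous_onI continuous_intros)
      then have m: "(\<lambda>z. ?G (hom3 (w, z))) \<in> borel_measurable borel" by measurable
      have e: "?G (hom3 (w, cscale w z)) = ?F1 z * indicator {w. cmod w * ?s z < 1} w" for z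
      proof -
        have h: "hom3 (w, cscale w z) = cscale w (hom3 (1, z))" by (simp add: hom3_def vec_eq_iff forall_3)
        have "norm (hom3 (1 :: complex, z)) = ?s z" unfolding norm_hom3 by (simp add: norm_Pair)
        then show ?thesis unfolding h hom[OF elim] by (simp add: norm_cscale indicator_def)
      qed
      have "(\<integral>\<^sup>+z. ?G (hom3 (w, z)) \<partial>lborel) = ennreal (cmod w ^ 4) * (\<integral>\<^sup>+z. ?G (hom3 (w, cscale w z)) \<partial>lborel)"
        by (rule nn_integral_cscale[OF elim m])
      also have "\<dots> = (\<integral>\<^sup>+z. ennreal (cmod w ^ 4) * ?G (hom3 (w, cscale w z)) \<partial>lborel)"
      proof (rule nn_integral_cmult[symmetric])
        show "(\<lambda>z. ?G (hom3 (w, cscale w z))) \<in> borel_measurable lborel"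
          using measurable_compose[OF linear_borel_measurable[OF linear_cscale] m] by simp
      qed
      finally show ?case unfolding e .
    qed
  qed
  also have "\<dots> = (\<integral>\<^sup>+z. \<integral>\<^sup>+w. ennreal (cmod w ^ 4) * (?F1 z * indicator {w. cmod w * ?s z < 1} w) \<partial>lborel \<partial>lborel)"
  proof (rule lborel_pair.Fubini'[symmetric])
    have "{x :: complex \<times> (complex^2). cmod (fst x) * ?s (snd x) < 1} \<in> sets (borel \<Otimes>\<^sub>M borel)"
      unfolding borel_prod by (intro borel_open open_Collect_less continuous_intros)
    then have "(\<lambda>x :: complex \<times> (complex^2). ennreal (cmod (fst x) ^ 4) * (?F1 (snd x) * indicator {x. cmod (fst x) * ?s (snd x) < 1} x)) \<in> borel_measurable (borel \<Otimes>\<^sub>M borel)"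
      by measurable
    then show "(\<lambda>(w, z). ennreal (cmod w ^ 4) * (?F1 z * indicator {w. cmod w * ?s z < 1} w)) \<in> borel_measurable (lborel \<Otimes>\<^sub>M lborel)"
      by (simp add: case_prod_unfold indicator_def)
  qed
  also have "\<dots> = (\<integral>\<^sup>+z. \<kappa> * (ennreal (1 / (1 + (norm z)\<^sup>2) ^ 3) * ?F1 z) \<partial>lborel)"
  proof (intro nn_integral_cong)
    fix z :: "complex^2"
    have [measurable]: "{w :: complex. cmod w * ?s z < 1} \<in> sets borel" by measurable
    have "(\<integral>\<^sup>+w. ennreal (cmod w ^ 4) * (?F1 z * indicator {w. cmod w * ?s z < 1} w) \<partial>lborel)
      = (\<integral>\<^sup>+w. ?F1 z * (ennreal (cmod w ^ 4) * indicator {w. cmod w * ?s z < 1} w) \<partial>lborel)"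
      by (simp add: mult_ac)
    also have "\<dots> = ?F1 z * (ennreal (1 / ?s z ^ 6) * \<kappa>)"
      by (subst nn_integral_cmult, measurable) (simp add: \<kappa>_scale[OF s1])
    also have "?s z ^ 6 = (1 + (norm z)\<^sup>2) ^ 3"
    proof -
      have "?s z ^ 6 = ((?s z)\<^sup>2) ^ 3" using power_mult[of "?s z" 2 3] by simp
      also have "(?s z)\<^sup>2 = 1 + (norm z)\<^sup>2" by (rule real_sqrt_pow2) simp
      finally show ?thesis .
    qed
    finally show "(\<integral>\<^sup>+w. ennreal (cmod w ^ 4) * (?F1 z * indicator {w. cmod w * ?s z < 1} w) \<partial>lborel)
      = \<kappa> * (ennreal (1 / (1 + (norm z)\<^sup>2) ^ 3) * ?F1 z)" by (simp add: mult_ac)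
  qed
  also have "\<dots> = \<kappa> * (\<integral>\<^sup>+z. ennreal (1 / (1 + (norm z)\<^sup>2) ^ 3) * ?F1 z \<partial>lborel)"
    by (rule nn_integral_cmult) measurable
  also have "(\<integral>\<^sup>+z. ennreal (1 / (1 + (norm z)\<^sup>2) ^ 3) * ?F1 z \<partial>lborel) = (\<integral>\<^sup>+z. ?F1 z \<partial>fs_volume)"
    unfolding fs_volume_def by (subst nn_integral_density) auto
  finally show ?thesis by (simp add: hom3_def)
qed

section \<open>The L2 norm of a form\<close>

definition chart :: "complex^2 \<Rightarrow> complex^3" where "chart z = vector [1, z$1, z$2]"

lemma chart_nth [simp]: "chart z $ 1 = 1" "chart z $ 2 = z$1" "chart z $ 3 = z$2"
  by (simp_all add: chart_def)

lemma norm_chart: "(norm (chart z))\<^sup>2 = 1 + (norm z)\<^sup>2"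
  by (simp add: norm_vec3 norm_vec2)

lemma sets_fs [simp, measurable_cong]: "sets fs_volume = sets borel" and space_fs [simp]: "space fs_volume = UNIV"
  by (simp_all add: fs_volume_def)

lemma emeasure_fs: "emeasure fs_volume UNIV \<noteq> \<infinity>" "emeasure fs_volume UNIV \<noteq> 0"
proof -
  have e: "emeasure lborel (ball 0 1 :: (complex^3) set) = \<kappa> * emeasure fs_volume UNIV"
    using ball_integral_eq_fs[of "\<lambda>_. 1"] by simp
  have "emeasure lborel (ball 0 1 :: (complex^3) set) \<noteq> \<infinity>" using emeasure_lborel_ball_finite less_irrefl by metis
  then show "emeasure fs_volume UNIV \<noteq> \<infinity>" using e \<kappa>_bounds by (auto simp: ennreal_mult_eq_top_iff)
  have "emeasure lborel (ball 0 1 :: (complex^3) set) \<noteq> 0" by (simp add: emeasure_ball unit_ball_vol_pos less_imp_neq[symmetric])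
  then show "emeasure fs_volume UNIV \<noteq> 0" using e by auto
qed

interpretation fs: finite_measure fs_volume
  by (rule finite_measureI) (use emeasure_fs in simp)

definition Vfs :: real where "Vfs = measure fs_volume UNIV"

lemma Vfs: "Vfs > 0" "ennreal Vfs = emeasure fs_volume UNIV"
  using emeasure_fs by (auto simp: Vfs_def fs.emeasure_eq_measure zero_less_measure_iff)

lemma form_eval_split:
  "form_eval d P X = (\<Sum>\<alpha>\<in>exponents d. P \<alpha> * (X$1) ^ fst \<alpha> * (X$2) ^ fst (snd \<alpha>) * (X$3) ^ snd (snd \<alpha>))"
  unfolding form_eval_def by (intro sum.cong) auto

lemma finite_exponents [simp]: "finite (exponents d)"
  by (rule finite_subset[of _ "{..d} \<times> {..d} \<times> {..d}"]) (auto simp: exponents_def)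

lemma cmod_nth_le: "cmod (X $ i) \<le> norm X" for X :: "complex^'n"
  by (rule Finite_Cartesian_Product.norm_nth_le)

lemma cmod_form_eval_le:
  fixes P :: "nat \<times> nat \<times> nat \<Rightarrow> complex"
  shows "cmod (form_eval d P X) \<le> (\<Sum>\<alpha>\<in>exponents d. cmod (P \<alpha>)) * norm X ^ d"
  unfolding form_eval_split sum_distrib_right
proof (intro order_trans[OF norm_sum] sum_mono)
  fix \<alpha> assume "\<alpha> \<in> exponents d"
  then obtain i j k where a: "\<alpha> = (i, j, k)" "i + j + k = d" by (auto simp: exponents_def)
  have "cmod (X$1) ^ i * cmod (X$2) ^ j * cmod (X$3) ^ k \<le> norm X ^ i * norm X ^ j * norm X ^ k"
    by (intro mult_mono power_mono cmod_nth_le) auto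
  also have "\<dots> = norm X ^ d" unfolding a(2)[symmetric] by (simp add: power_add)
  finally have "cmod (P \<alpha>) * (cmod (X$1) ^ i * cmod (X$2) ^ j * cmod (X$3) ^ k) \<le> cmod (P \<alpha>) * norm X ^ d"
    by (rule mult_left_mono) simp
  then show "cmod (P \<alpha> * X $ 1 ^ fst \<alpha> * X $ 2 ^ fst (snd \<alpha>) * X $ 3 ^ snd (snd \<alpha>)) \<le> cmod (P \<alpha>) * norm X ^ d"
    by (simp add: a norm_mult norm_power mult.assoc)
qed

lemma measurable_form_eval [measurable]: "form_eval d (P :: _ \<Rightarrow> complex) \<in> borel_measurable borel"
proof -
  have "continuous_on UNIV (form_eval d P)" unfolding form_eval_split[abs_def] by (intro continuous_intros)
  then show ?thesis by (rule borel_measurable_continuous_onI)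
qed

lemma measurable_chart [measurable]: "chart \<in> borel_measurable borel"
proof -
  have "continuous_on UNIV hom3" using linear_hom3 by (simp add: linear_continuous_on linear_conv_bounded_linear)
  then have "continuous_on UNIV (\<lambda>z. hom3 (1, z))"
    by (rule continuous_on_compose2) (auto intro: continuous_intros)
  then show ?thesis by (simp add: chart_def[abs_def] hom3_def borel_measurable_continuous_onI)
qed

lemma measurable_fs_norm [measurable]: "fs_norm d P \<in> borel_measurable borel"
  unfolding fs_norm_def[abs_def] by measurable

lemma fs_norm_sq_integrable: "integrable fs_volume (\<lambda>z. (fs_norm d P (chart z))\<^sup>2)"
proof (rule fs.integrable_const_bound)
  let ?B = "\<Sum>\<alpha>\<in>exponents d. cmod (P \<alpha>)"
  show "AE z in fs_volume. norm ((fs_norm d P (chart z))\<^sup>2) \<le> ?B\<^sup>2"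
  proof (rule AE_I2)
    fix z
    have n: "norm (chart z) > 0" using norm_chart[of z] by (smt (verit) norm_ge_zero zero_less_norm_iff power_zero_numeral sum_power2_ge_zero norm_zero zero_le_power2)
    have "0 \<le> fs_norm d P (chart z)" by (simp add: fs_norm_def)
    moreover have "fs_norm d P (chart z) \<le> ?B"
      using cmod_form_eval_le[of d P "chart z"] n by (simp add: fs_norm_def pos_divide_le_eq)
    ultimately show "norm ((fs_norm d P (chart z))\<^sup>2) \<le> ?B\<^sup>2" by (simp add: power_mono)
  qed
qed simp

lemma l2_norm_sq: "(l2_norm d P)\<^sup>2 = (1 / Vfs) * (\<integral>z. (fs_norm d P (chart z))\<^sup>2 \<partial>fs_volume)"
  unfolding l2_norm_def Vfs_def[symmetric] chart_def[symmetric]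
  using Vfs(1) by (subst real_sqrt_pow2) auto

lemma l2_norm_nn: "ennreal (Vfs * (l2_norm d P)\<^sup>2) = (\<integral>\<^sup>+z. ennreal ((fs_norm d P (chart z))\<^sup>2) \<partial>fs_volume)"
  using nn_integral_eq_integral[OF fs_norm_sq_integrable] Vfs(1) by (simp add: l2_norm_sq)

lemma l2_norm_nonneg: "l2_norm d P \<ge> 0"
  by (simp add: l2_norm_def)

subsection \<open>Invariance under the orthogonal group\<close>

definition cmat :: "real^3^3 \<Rightarrow> complex^3 \<Rightarrow> complex^3" where
  "cmat A X = (\<chi> i. \<Sum>j\<in>UNIV. of_real (A$i$j) * X$j)"

lemma linear_cmat: "linear (cmat A)"
  by (rule linearI) (simp_all add: cmat_def vec_eq_iff distrib_left sum.distrib scaleR_sum_right)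

lemma norm_cmat: assumes "orthogonal_matrix A" shows "norm (cmat A X) = norm X"
proof -
  define R where "R Y = (\<chi> i. Re (Y$i))" for Y :: "complex^3"
  define I where "I Y = (\<chi> i. Im (Y$i))" for Y :: "complex^3"
  have n: "(norm Y)\<^sup>2 = (norm (R Y))\<^sup>2 + (norm (I Y))\<^sup>2" for Y
    unfolding norm_vec3 power2_norm_eq_inner inner_vec_def sum_3 R_def I_def
    by (simp add: inner_complex_def power2_eq_square)
  have "R (cmat A X) = A *v R X" "I (cmat A X) = A *v I X"
    by (simp_all add: R_def I_def cmat_def vec_eq_iff matrix_vector_mult_def)
  moreover have "orthogonal_transformation ((*v) A)"
    using assms by (simp add: orthogonal_transformation_matrix)
  then have "norm (A *v x) = norm x" for x by (rule orthogonal_transformation_norm)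
  ultimately have "(norm (cmat A X))\<^sup>2 = (norm X)\<^sup>2" using n by simp
  then show ?thesis by simp
qed

lemma fs_norm_cscale: "w \<noteq> 0 \<Longrightarrow> fs_norm d P (cscale w X) = fs_norm d P X"
proof -
  assume w: "w \<noteq> 0"
  have "form_eval d P (cscale w X) = w ^ d * form_eval d P X"
    unfolding form_eval_split sum_distrib_left
    by (intro sum.cong) (auto simp: exponents_def power_mult_distrib power_add)
  then show ?thesis using w by (simp add: fs_norm_def norm_cscale norm_mult norm_power power_mult_distrib)
qed

text \<open>Both norms are averages over the unit ball, which the orthogonal map preserves together
  with Lebesgue measure.\<close>

lemma l2_norm_rotate:
  assumes A: "orthogonal_matrix A" and P': "\<And>X. form_eval d P' X = form_eval d P (cmat A X)"
  shows "l2_norm d P' = l2_norm d P"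
proof -
  let ?F = "\<lambda>P X. ennreal ((fs_norm d P X)\<^sup>2)"
  have b: "(\<integral>\<^sup>+X. ?F P X * indicator (ball 0 1) X \<partial>lborel) = \<kappa> * ennreal (Vfs * (l2_norm d P)\<^sup>2)" for P
    unfolding l2_norm_nn chart_def by (rule ball_integral_eq_fs) (simp_all add: fs_norm_cscale)
  have [measurable]: "ball (0::complex^3) 1 \<in> sets borel" by simp
  have "fs_norm d P' X = fs_norm d P (cmat A X)" for X by (simp add: fs_norm_def P' norm_cmat[OF A])
  moreover have "indicator (ball 0 1) X = (indicator (ball 0 1) (cmat A X) :: ennreal)" for X
    by (simp add: indicator_def norm_cmat[OF A])
  ultimately have "(\<integral>\<^sup>+X. ?F P' X * indicator (ball 0 1) X \<partial>lborel) = (\<integral>\<^sup>+X. ?F P (cmat A X) * indicator (ball 0 1) (cmat A X) \<partial>lborel)"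
    by simp
  also have "\<dots> = (\<integral>\<^sup>+X. ?F P X * indicator (ball 0 1) X \<partial>lborel)"
    by (rule nn_integral_lborel_isometry[OF linear_cmat norm_cmat[OF A] DIM_complex_vec(2) DIM_complex_vec(2)]) measurable
  finally have "\<kappa> * ennreal (Vfs * (l2_norm d P')\<^sup>2) = \<kappa> * ennreal (Vfs * (l2_norm d P)\<^sup>2)" unfolding b .
  then have "ennreal (Vfs * (l2_norm d P')\<^sup>2) = ennreal (Vfs * (l2_norm d P)\<^sup>2)"
    using \<kappa>_bounds by (auto simp: ennreal_mult_cancel_left)
  then have "(l2_norm d P')\<^sup>2 = (l2_norm d P)\<^sup>2" using Vfs(1) by simp
  then show ?thesis by (simp add: l2_norm_nonneg)
qed

subsection \<open>Monomials are orthogonal\<close>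

definition affmon :: "nat \<times> nat \<times> nat \<Rightarrow> complex^2 \<Rightarrow> complex" where
  "affmon \<alpha> z = (z$1) ^ fst (snd \<alpha>) * (z$2) ^ snd (snd \<alpha>)"

text \<open>The Fubini-Study density together with the denominator of the squared pointwise norm of a form of
  degree \<open>d\<close>.\<close>

definition wgt :: "nat \<Rightarrow> complex^2 \<Rightarrow> real" where
  "wgt d z = 1 / (1 + (norm z)\<^sup>2) ^ (d + 3)"

lemma one_plus_norm_pos: "1 + (norm z)\<^sup>2 > 0" by (simp add: add_pos_nonneg)

lemma wgt_pos: "wgt d z > 0" unfolding wgt_def using one_plus_norm_pos[of z] by simp

lemma measurable_affmon [measurable]: "affmon \<alpha> \<in> borel_measurable borel"
  unfolding affmon_def[abs_def] by (intro borel_measurable_continuous_onI continuous_intros)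

lemma measurable_wgt [measurable]: "wgt d \<in> borel_measurable borel"
  unfolding wgt_def[abs_def] by measurable

lemma integrable_fs_iff:
  fixes f :: "complex^2 \<Rightarrow> 'b::{banach, second_countable_topology}"
  assumes f: "f \<in> borel_measurable borel"
  shows "(\<integral>z. f z \<partial>fs_volume) = (\<integral>z. (1 / (1 + (norm z)\<^sup>2) ^ 3) *\<^sub>R f z \<partial>lborel)"
    "integrable fs_volume f \<longleftrightarrow> integrable lborel (\<lambda>z. (1 / (1 + (norm z)\<^sup>2) ^ 3) *\<^sub>R f z)"
proof -
  have g: "(\<lambda>z :: complex^2. 1 / (1 + (norm z)\<^sup>2) ^ 3) \<in> borel_measurable lborel" by measurable
  have p: "AE z :: complex^2 in lborel. 0 \<le> 1 / (1 + (norm z)\<^sup>2) ^ 3"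
    by (intro AE_I2 divide_nonneg_nonneg zero_le_power) auto
  have f': "f \<in> borel_measurable lborel" using f by simp
  show "(\<integral>z. f z \<partial>fs_volume) = (\<integral>z. (1 / (1 + (norm z)\<^sup>2) ^ 3) *\<^sub>R f z \<partial>lborel)"
    unfolding fs_volume_def by (rule integral_density[OF f' g p])
  show "integrable fs_volume f \<longleftrightarrow> integrable lborel (\<lambda>z. (1 / (1 + (norm z)\<^sup>2) ^ 3) *\<^sub>R f z)"
    unfolding fs_volume_def by (rule integrable_density[OF f' g p])
qed

lemma measurable_cnj [measurable]: "cnj \<in> borel_measurable borel"
  by (intro borel_measurable_continuous_onI continuous_intros)

lemma Re_of_real_times: "Re (of_real w * m) = w * Re m"
  by simp

lemma Re_weighted_square: "Re (of_real w * (m * cnj m)) = w * (cmod m)\<^sup>2"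
proof -
  have "m * cnj m = of_real ((cmod m)\<^sup>2)" using complex_norm_square[of m] by simp
  then show ?thesis by (simp only: Re_of_real_times Re_complex_of_real)
qed

lemma integrable_fs_weight: "integrable lborel (\<lambda>z :: complex^2. 1 / (1 + (norm z)\<^sup>2) ^ 3)"
  "(\<integral>z. 1 / (1 + (norm z)\<^sup>2) ^ 3 \<partial>(lborel :: (complex^2) measure)) = Vfs"
  using integrable_fs_iff[of "\<lambda>_. 1 :: real"] fs.integrable_const[of "1::real"] by (auto simp: Vfs_def)

lemma cmod_affmon_sq_le:
  assumes "\<alpha> \<in> exponents d" shows "(cmod (affmon \<alpha> z))\<^sup>2 \<le> (1 + (norm z)\<^sup>2) ^ d"
proof -
  obtain i j k where a: "\<alpha> = (i, j, k)" "i + j + k = d" using assms by (auto simp: exponents_def)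
  have "(cmod (affmon \<alpha> z))\<^sup>2 = ((cmod (z$1))\<^sup>2) ^ j * ((cmod (z$2))\<^sup>2) ^ k"
    by (simp add: affmon_def a norm_mult norm_power power_mult_distrib power_mult[symmetric] mult.commute)
  also have "\<dots> \<le> (1 + (norm z)\<^sup>2) ^ j * (1 + (norm z)\<^sup>2) ^ k"
    by (intro mult_mono power_mono) (auto simp: norm_vec2)
  also have "\<dots> \<le> (1 + (norm z)\<^sup>2) ^ d" unfolding power_add[symmetric]
    by (rule power_increasing) (use a in auto)
  finally show ?thesis .
qed

lemma affmon_product_integrable:
  assumes "\<alpha> \<in> exponents d" "\<beta> \<in> exponents d"
  shows "integrable lborel (\<lambda>z. of_real (wgt d z) * (affmon \<alpha> z * cnj (affmon \<beta> z)))"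
proof (rule Bochner_Integration.integrable_bound[OF integrable_fs_weight(1)])
  show "AE z in lborel. norm (of_real (wgt d z) * (affmon \<alpha> z * cnj (affmon \<beta> z))) \<le> norm (1 / (1 + (norm z)\<^sup>2) ^ 3)"
  proof (rule AE_I2)
    fix z :: "complex^2"
    let ?a = "cmod (affmon \<alpha> z)" and ?b = "cmod (affmon \<beta> z)" and ?s = "1 + (norm z)\<^sup>2"
    have "2 * (?a * ?b) \<le> ?a\<^sup>2 + ?b\<^sup>2" using sum_squares_bound[of ?a ?b] by simp
    then have "?a * ?b \<le> ?s ^ d" using cmod_affmon_sq_le[OF assms(1), of z] cmod_affmon_sq_le[OF assms(2), of z] by linarith
    then have "wgt d z * (?a * ?b) \<le> wgt d z * ?s ^ d" using wgt_pos[of d z] by simp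
    also have "\<dots> = 1 / ?s ^ 3" using one_plus_norm_pos[of z] by (simp add: wgt_def power_add)
    finally show "norm (of_real (wgt d z) * (affmon \<alpha> z * cnj (affmon \<beta> z))) \<le> norm (1 / ?s ^ 3)"
      using wgt_pos[of d z] one_plus_norm_pos[of z] by (simp add: norm_mult)
  qed
qed measurable

text \<open>Rotating one coordinate by a suitable unit complex number multiplies the integral by a number
  different from 1, and leaves it unchanged since the weight and Lebesgue measure are invariant.\<close>

lemma affmon_orthogonal:
  assumes "\<alpha> \<in> exponents d" "\<beta> \<in> exponents d" "\<alpha> \<noteq> \<beta>"
  shows "(\<integral>z. of_real (wgt d z) * (affmon \<alpha> z * cnj (affmon \<beta> z)) \<partial>lborel) = 0"
proof -
  obtain i j k where a: "\<alpha> = (i, j, k)" "i + j + k = d" using assms by (auto simp: exponents_def)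
  obtain i' j' k' where b: "\<beta> = (i', j', k')" "i' + j' + k' = d" using assms by (auto simp: exponents_def)
  have ne: "j \<noteq> j' \<or> k \<noteq> k'" using assms(3) a b by auto
  let ?f = "\<lambda>z. of_real (wgt d z) * (affmon \<alpha> z * cnj (affmon \<beta> z))"
  (* an angle so small that its multiples by at most d are not full turns *)
  define t where "t = 1 / real (d + 1)"
  have rot: "(\<integral>z. ?f z \<partial>lborel) = 0" if uv: "cmod u = 1" "cmod v = 1"
     and n1: "u ^ j * cnj u ^ j' * (v ^ k * cnj v ^ k') \<noteq> 1" for u v
  proof -
    let ?U = "\<lambda>z :: complex^2. vector [u * z$1, v * z$2] :: complex^2"
    have lin: "linear ?U" by (rule linearI) (simp_all add: vec_eq_iff forall_2 distrib_left)
    have "(norm (?U z))\<^sup>2 = (norm z)\<^sup>2" for z unfolding norm_vec2 using uv by (simp add: norm_mult)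
    then have iso: "norm (?U z) = norm z" for z by simp
    have "(\<integral>z. ?f z \<partial>lborel) = (\<integral>z. ?f z \<partial>distr lborel borel ?U)"
      by (simp add: lborel_distr_isometry[OF lin iso DIM_complex_vec(1) DIM_complex_vec(1)])
    also have "\<dots> = (\<integral>z. ?f (?U z) \<partial>lborel)"
      by (rule integral_distr) (use linear_borel_measurable[OF lin] in simp, measurable)
    also have "\<dots> = (\<integral>z. (u ^ j * cnj u ^ j' * (v ^ k * cnj v ^ k')) * ?f z \<partial>lborel)"
      by (intro Bochner_Integration.integral_cong refl) (simp add: a b affmon_def wgt_def iso power_mult_distrib)
    also have "\<dots> = (u ^ j * cnj u ^ j' * (v ^ k * cnj v ^ k')) * (\<integral>z. ?f z \<partial>lborel)" by simp
    finally have e: "(\<integral>z. ?f z \<partial>lborel) = (u ^ j * cnj u ^ j' * (v ^ k * cnj v ^ k')) * (\<integral>z. ?f z \<partial>lborel)" .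
    have "x = a * x \<Longrightarrow> a \<noteq> 1 \<Longrightarrow> x = 0" for x a :: complex by auto
    then show ?thesis using n1 e by blast
  qed
  have cis1: "cis t ^ m * cnj (cis t) ^ m' \<noteq> 1" if "m \<noteq> m'" "m \<le> d" "m' \<le> d" for m m'
  proof
    assume "cis t ^ m * cnj (cis t) ^ m' = 1"
    then have "cis ((real m - real m') * t) = 1"
      by (simp add: cis_cnj Complex.DeMoivre cis_mult left_diff_distrib)
    then have c: "cos ((real m - real m') * t) = 1" by (metis cis.sel(1) one_complex.sel(1))
    have t: "\<bar>(real m - real m') * t\<bar> < 1" "(real m - real m') * t \<noteq> 0"
      using that by (auto simp: t_def abs_mult field_simps)
    obtain n :: int where n: "(real m - real m') * t = of_int n * 2 * pi" using c cos_one_2pi_int by blast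
    have "n \<noteq> 0" using n t by auto
    then have "1 \<le> \<bar>of_int n :: real\<bar>" by linarith
    then have "1 * (2 * pi) \<le> \<bar>of_int n * 2 * pi\<bar>" using pi_gt3 by (simp add: abs_mult)
    then show False using n t(1) pi_gt3 by linarith
  qed
  show ?thesis
  proof (cases "j = j'")
    case False
    show ?thesis by (rule rot[of "cis t" 1]) (use cis1[OF False] a b in auto)
  next
    case True
    then have "k \<noteq> k'" using ne by simp
    from cis1[OF this] show ?thesis by (intro rot[of 1 "cis t"]) (use a b in auto)
  qed
qed

text \<open>The squared norm of a monomial.\<close>

definition wt :: "nat \<Rightarrow> nat \<times> nat \<times> nat \<Rightarrow> real" where
  "wt d \<alpha> = (1 / Vfs) * (\<integral>z. wgt d z * (cmod (affmon \<alpha> z))\<^sup>2 \<partial>lborel)"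

lemma affmon_sq_integrable:
  assumes "\<alpha> \<in> exponents d" shows "integrable lborel (\<lambda>z. wgt d z * (cmod (affmon \<alpha> z))\<^sup>2)"
proof -
  have "integrable lborel (\<lambda>z. Re (of_real (wgt d z) * (affmon \<alpha> z * cnj (affmon \<alpha> z))))"
    by (rule integrable_Re[OF affmon_product_integrable[OF assms assms]])
  then show ?thesis unfolding Re_weighted_square .
qed

lemma real_l2_norm_sq: "(real_l2_norm d P)\<^sup>2 = (\<Sum>\<alpha>\<in>exponents d. wt d \<alpha> * (P \<alpha>)\<^sup>2)"
proof -
  let ?E = "exponents d"
  let ?p = "\<lambda>z. \<Sum>\<alpha>\<in>?E. of_real (P \<alpha>) * affmon \<alpha> z"
  let ?h = "\<lambda>\<alpha> \<beta> z. of_real (wgt d z) * (affmon \<alpha> z * cnj (affmon \<beta> z)) :: complex"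
  have fs: "(fs_norm d (\<lambda>\<alpha>. complex_of_real (P \<alpha>)) (chart z))\<^sup>2 = (cmod (?p z))\<^sup>2 / (1 + (norm z)\<^sup>2) ^ d" for z
  proof -
    have "form_eval d (\<lambda>\<alpha>. complex_of_real (P \<alpha>)) (chart z) = ?p z"
      unfolding form_eval_split by (intro sum.cong refl) (simp add: affmon_def mult.assoc)
    moreover have "(norm (chart z) ^ d)\<^sup>2 = (1 + (norm z)\<^sup>2) ^ d"
      unfolding norm_chart[symmetric] by (simp flip: power_mult add: mult.commute)
    ultimately show ?thesis by (simp add: fs_norm_def power_divide)
  qed
  have "(real_l2_norm d P)\<^sup>2 = (1 / Vfs) * (\<integral>z. (cmod (?p z))\<^sup>2 / (1 + (norm z)\<^sup>2) ^ d \<partial>fs_volume)"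
    unfolding real_l2_norm_def l2_norm_sq fs ..
  also have "(\<integral>z. (cmod (?p z))\<^sup>2 / (1 + (norm z)\<^sup>2) ^ d \<partial>fs_volume)
      = (\<integral>z. (1 / (1 + (norm z)\<^sup>2) ^ 3) *\<^sub>R ((cmod (?p z))\<^sup>2 / (1 + (norm z)\<^sup>2) ^ d) \<partial>lborel)"
    by (rule integrable_fs_iff(1)) measurable
  also have "\<dots> = (\<integral>z. (\<Sum>\<alpha>\<in>?E. \<Sum>\<beta>\<in>?E. P \<alpha> * P \<beta> * Re (?h \<alpha> \<beta> z)) \<partial>lborel)"
  proof (rule Bochner_Integration.integral_cong[OF refl])
    fix z :: "complex^2"
    have "(cmod (?p z))\<^sup>2 = Re (?p z * cnj (?p z))"
      by (simp only: complex_norm_square[symmetric] Re_complex_of_real)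
    also have "?p z * cnj (?p z) = (\<Sum>\<alpha>\<in>?E. \<Sum>\<beta>\<in>?E. of_real (P \<alpha> * P \<beta>) * (affmon \<alpha> z * cnj (affmon \<beta> z)))"
      by (simp add: sum_product mult_ac)
    finally have 1: "(cmod (?p z))\<^sup>2 = (\<Sum>\<alpha>\<in>?E. \<Sum>\<beta>\<in>?E. P \<alpha> * P \<beta> * Re (affmon \<alpha> z * cnj (affmon \<beta> z)))"
      by (simp only: Re_sum Re_complex_of_real Re_of_real_times)
    have 2: "(1 / (1 + (norm z)\<^sup>2) ^ 3) *\<^sub>R (x / (1 + (norm z)\<^sup>2) ^ d) = wgt d z * x" for x :: real
      by (simp add: wgt_def power_add)
    show "(1 / (1 + (norm z)\<^sup>2) ^ 3) *\<^sub>R ((cmod (?p z))\<^sup>2 / (1 + (norm z)\<^sup>2) ^ d) = (\<Sum>\<alpha>\<in>?E. \<Sum>\<beta>\<in>?E. P \<alpha> * P \<beta> * Re (?h \<alpha> \<beta> z))"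
      unfolding 2 1 sum_distrib_left Re_of_real_times by (intro sum.cong refl) (simp only: mult_ac)
  qed
  also have "\<dots> = (\<Sum>\<alpha>\<in>?E. \<Sum>\<beta>\<in>?E. P \<alpha> * P \<beta> * (\<integral>z. Re (?h \<alpha> \<beta> z) \<partial>lborel))"
  proof -
    have int: "integrable lborel (\<lambda>z. P \<alpha> * P \<beta> * Re (?h \<alpha> \<beta> z))" if "\<alpha> \<in> ?E" "\<beta> \<in> ?E" for \<alpha> \<beta>
      by (intro integrable_mult_right integrable_Re affmon_product_integrable that)
    have "(\<integral>z. (\<Sum>\<alpha>\<in>?E. \<Sum>\<beta>\<in>?E. P \<alpha> * P \<beta> * Re (?h \<alpha> \<beta> z)) \<partial>lborel) = (\<Sum>\<alpha>\<in>?E. \<integral>z. (\<Sum>\<beta>\<in>?E. P \<alpha> * P \<beta> * Re (?h \<alpha> \<beta> z)) \<partial>lborel)"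
      by (rule Bochner_Integration.integral_sum) (intro Bochner_Integration.integrable_sum int)
    also have "\<dots> = (\<Sum>\<alpha>\<in>?E. \<Sum>\<beta>\<in>?E. \<integral>z. P \<alpha> * P \<beta> * Re (?h \<alpha> \<beta> z) \<partial>lborel)"
      by (intro sum.cong refl Bochner_Integration.integral_sum int)
    finally show ?thesis by simp
  qed
  also have "\<dots> = (\<Sum>\<alpha>\<in>?E. Vfs * (wt d \<alpha> * (P \<alpha>)\<^sup>2))"
  proof (rule sum.cong[OF refl])
    fix \<alpha> assume \<alpha>: "\<alpha> \<in> ?E"
    have "P \<alpha> * P \<beta> * (\<integral>z. Re (?h \<alpha> \<beta> z) \<partial>lborel) = (if \<beta> = \<alpha> then Vfs * (wt d \<alpha> * (P \<alpha>)\<^sup>2) else 0)" if \<beta>: "\<beta> \<in> ?E" for \<beta>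
    proof (cases "\<beta> = \<alpha>")
      case True
      have VI: "(\<integral>z. wgt d z * (cmod (affmon \<alpha> z))\<^sup>2 \<partial>lborel) = Vfs * wt d \<alpha>"
        using Vfs(1) by (simp add: wt_def)
      show ?thesis unfolding True Re_weighted_square VI by (simp add: power2_eq_square)
    next
      case False
      have "(\<integral>z. Re (?h \<alpha> \<beta> z) \<partial>lborel) = Re (\<integral>z. ?h \<alpha> \<beta> z \<partial>lborel)"
        by (rule integral_Re[OF affmon_product_integrable[OF \<alpha> \<beta>]])
      then show ?thesis using affmon_orthogonal[OF \<alpha> \<beta>] False by simp
    qed
    then show "(\<Sum>\<beta>\<in>?E. P \<alpha> * P \<beta> * (\<integral>z. Re (?h \<alpha> \<beta> z) \<partial>lborel)) = Vfs * (wt d \<alpha> * (P \<alpha>)\<^sup>2)"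
      using \<alpha> by (simp add: sum.delta)
  qed
  finally show ?thesis using Vfs(1) by (simp add: sum_distrib_left[symmetric])
qed

subsection \<open>Norms of monomials from below\<close>

lemma linear_pair2: "linear (\<lambda>(a, b). vector [a, b] :: complex^2)"
  by (rule linearI) (auto simp: vec_eq_iff forall_2)

lemma norm_pair2: "norm ((\<lambda>(a, b). vector [a, b] :: complex^2) x) = norm x"
proof -
  have "(norm ((\<lambda>(a, b). vector [a, b] :: complex^2) x))\<^sup>2 = (norm (fst x))\<^sup>2 + (norm (snd x))\<^sup>2"
    by (cases x) (simp add: norm_vec2)
  then show ?thesis by (simp add: norm_prod_def real_sqrt_unique)
qed

lemma emeasure_annulus:
  assumes "0 \<le> r1" "r1 \<le> r2"
  shows "emeasure lborel {w :: complex. r1 \<le> cmod w \<and> cmod w < r2} = ennreal (pi * (r2\<^sup>2 - r1\<^sup>2))"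
proof -
  have e: "{w :: complex. r1 \<le> cmod w \<and> cmod w < r2} = ball 0 r2 - ball 0 r1" by auto
  have b: "emeasure lborel (ball (0::complex) r) = ennreal (pi * r\<^sup>2)" if "0 \<le> r" for r
    using that by (simp add: emeasure_ball unit_ball_vol_2)
  have sub: "ball (0::complex) r1 \<subseteq> ball 0 r2" using assms(2) by auto
  have "emeasure lborel (ball (0::complex) r2 - ball 0 r1) = emeasure lborel (ball (0::complex) r2) - emeasure lborel (ball (0::complex) r1)"
    by (rule emeasure_Diff) (use sub b[OF assms(1)] in auto)
  also have "\<dots> = ennreal (pi * r2\<^sup>2) - ennreal (pi * r1\<^sup>2)" using b assms by simp
  also have "\<dots> = ennreal (pi * r2\<^sup>2 - pi * r1\<^sup>2)" by (rule ennreal_minus) simp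
  finally show ?thesis unfolding e by (simp add: right_diff_distrib)
qed

text \<open>Only the part of the integral with both \<open>\<bar>z\<^sub>1\<bar>\<^sup>2\<close> and \<open>\<bar>z\<^sub>2\<bar>\<^sup>2\<close> between \<open>R / d\<close> and \<open>(R + 1) / d\<close> is
  kept. Each annulus has area \<open>\<pi> / d\<close>; the monomial is at least \<open>(R / d) ^ (j + k)\<close> there in square, and
  the weight costs \<open>exp (2 R + 8)\<close>. The size of \<open>R\<close> is free and is adapted to the depth of the nest later.\<close>

lemma wt_lower_bound:
  assumes \<alpha>: "(i, j, k) \<in> exponents d" and R: "0 < R" "R + 1 \<le> real d"
  shows "wt d (i, j, k) \<ge> (pi\<^sup>2 / Vfs) * exp (- (2 * R + 8)) / (real d)\<^sup>2 * (R / real d) ^ (j + k)"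
proof -
  have d: "real d > 0" using R by simp
  let ?A = "{w :: complex. sqrt (R / d) \<le> cmod w \<and> cmod w < sqrt ((R + 1) / d)}"
  have A: "?A \<in> sets borel" by measurable
  have eA: "emeasure lborel ?A = ennreal (pi / d)"
    using R d by (subst emeasure_annulus) (auto simp: diff_divide_distrib[symmetric] real_sqrt_le_iff divide_right_mono)
  define c where "c = exp (- (2 * R + 8)) * (R / real d) ^ (j + k)"
  have c: "c \<ge> 0" using R by (simp add: c_def)
  have pt: "c \<le> wgt d z * (cmod (affmon (i, j, k) z))\<^sup>2" if z: "z$1 \<in> ?A" "z$2 \<in> ?A" for z
  proof -
    have sq: "R / d \<le> (cmod w)\<^sup>2 \<and> (cmod w)\<^sup>2 \<le> (R + 1) / d" if w: "w \<in> ?A" for w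
    proof -
      have "(sqrt (R / d))\<^sup>2 \<le> (cmod w)\<^sup>2" "(cmod w)\<^sup>2 \<le> (sqrt ((R + 1) / d))\<^sup>2"
        using w R d power_mono[of "sqrt (R / d)" "cmod w" 2] power_mono[of "cmod w" "sqrt ((R + 1) / d)" 2] by simp_all
      then show ?thesis using R d by simp
    qed
    have "(R / d) ^ (j + k) \<le> ((cmod (z$1))\<^sup>2) ^ j * ((cmod (z$2))\<^sup>2) ^ k"
      unfolding power_add using sq[OF z(1)] sq[OF z(2)] R d by (intro mult_mono power_mono) auto
    also have "\<dots> = (cmod (affmon (i, j, k) z))\<^sup>2"
      by (simp add: affmon_def norm_mult norm_power power_mult_distrib power_mult[symmetric] mult.commute)
    finally have m: "(R / d) ^ (j + k) \<le> (cmod (affmon (i, j, k) z))\<^sup>2" .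
    let ?x = "2 * (R + 1) / d"
    have "1 + (norm z)\<^sup>2 \<le> 1 + ?x" unfolding norm_vec2 using sq[OF z(1)] sq[OF z(2)] by (simp add: add_divide_distrib)
    also have "\<dots> \<le> exp ?x" by (rule exp_ge_add_one_self)
    finally have "(1 + (norm z)\<^sup>2) ^ (d + 3) \<le> exp ?x ^ (d + 3)" by (intro power_mono) auto
    also have "\<dots> = exp (real (d + 3) * ?x)" by (rule exp_of_nat_mult[symmetric])
    also have "\<dots> \<le> exp (2 * R + 8)"
    proof -
      have "real (d + 3) * ?x = 2 * (R + 1) + 6 * ((R + 1) / d)" using d by (simp add: field_simps)
      also have "(R + 1) / d \<le> 1" using R d by simp
      finally show ?thesis by simp
    qed
    finally have "inverse (exp (2 * R + 8)) \<le> inverse ((1 + (norm z)\<^sup>2) ^ (d + 3))"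
      using one_plus_norm_pos[of z] by (intro le_imp_inverse_le) auto
    then have "exp (- (2 * R + 8)) \<le> wgt d z" by (simp only: wgt_def exp_minus inverse_eq_divide)
    then show ?thesis unfolding c_def using m R d by (intro mult_mono) (auto simp: wgt_pos less_imp_le)
  qed
  let ?pr = "\<lambda>(a, b). vector [a, b] :: complex^2"
  let ?S = "{z :: complex^2. z$1 \<in> ?A \<and> z$2 \<in> ?A}"
  have mnth: "(\<lambda>z :: complex^2. z $ i) \<in> borel_measurable borel" for i
    by (intro borel_measurable_continuous_onI continuous_intros)
  have S: "?S \<in> sets borel"
  proof -
    have e: "?S = ((\<lambda>z :: complex^2. z $ 1) -` ?A \<inter> space borel) \<inter> ((\<lambda>z :: complex^2. z $ 2) -` ?A \<inter> space borel)" by auto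
    show ?thesis unfolding e by (intro sets.Int measurable_sets[OF mnth A])
  qed
  have "ennreal (pi / d) * ennreal (pi / d) = emeasure (lborel \<Otimes>\<^sub>M lborel) (?A \<times> ?A)"
    using A eA by (simp add: lborel.emeasure_pair_measure_Times)
  also have "\<dots> = (\<integral>\<^sup>+x. indicator (?A \<times> ?A) x \<partial>(lborel :: (complex \<times> complex) measure))"
    using A by (simp add: lborel_prod borel_prod[symmetric])
  also have "\<dots> = (\<integral>\<^sup>+x. indicator ?S (?pr x) \<partial>(lborel :: (complex \<times> complex) measure))"
    by (intro nn_integral_cong) (auto simp: indicator_def)
  also have "\<dots> = (\<integral>\<^sup>+z. indicator ?S z \<partial>lborel)"
    by (rule nn_integral_lborel_isometry[OF linear_pair2 norm_pair2 DIM_complex_vec(4,1)]) (use S in simp)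
  finally have "ennreal (pi / d) * ennreal (pi / d) = (\<integral>\<^sup>+z. indicator ?S z \<partial>lborel)" .
  moreover have "ennreal ((pi / d) * (pi / d)) = ennreal (pi / d) * ennreal (pi / d)"
    by (rule ennreal_mult) simp_all
  ultimately have I: "(\<integral>\<^sup>+z. indicator ?S z \<partial>lborel) = ennreal ((pi / d) * (pi / d))"
    by (simp only:)
  have "ennreal (c * ((pi / d) * (pi / d))) = ennreal c * (\<integral>\<^sup>+z. indicator ?S z \<partial>lborel)"
    unfolding I using c d by (intro ennreal_mult) simp_all
  also have "\<dots> = (\<integral>\<^sup>+z. ennreal c * indicator ?S z \<partial>lborel)"
    by (rule nn_integral_cmult[symmetric]) (use S in simp)
  also have "\<dots> \<le> (\<integral>\<^sup>+z. ennreal (wgt d z * (cmod (affmon (i, j, k) z))\<^sup>2) \<partial>lborel)"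
    by (intro nn_integral_mono) (auto simp: indicator_def intro!: ennreal_leI pt)
  also have "\<dots> = ennreal (\<integral>z. wgt d z * (cmod (affmon (i, j, k) z))\<^sup>2 \<partial>lborel)"
    by (intro nn_integral_eq_integral affmon_sq_integrable \<alpha>) (auto simp: wgt_pos less_imp_le)
  also have "(\<integral>z. wgt d z * (cmod (affmon (i, j, k) z))\<^sup>2 \<partial>lborel) = Vfs * wt d (i, j, k)"
    using Vfs(1) by (simp add: wt_def)
  finally have "c * ((pi / d) * (pi / d)) \<le> Vfs * wt d (i, j, k)"
  proof (rule ennreal_le_iff[THEN iffD1, rotated])
    show "0 \<le> Vfs * wt d (i, j, k)" unfolding wt_def using Vfs(1)
      by (auto intro!: mult_nonneg_nonneg Bochner_Integration.integral_nonneg simp: wgt_pos less_imp_le)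
  qed
  then show ?thesis using Vfs(1) d unfolding c_def by (simp add: field_simps power2_eq_square)
qed

lemma wt_pos:
  assumes "\<alpha> \<in> exponents d" shows "wt d \<alpha> > 0"
proof -
  have nn: "wt d \<alpha> \<ge> 0" unfolding wt_def using Vfs(1)
    by (auto intro!: mult_nonneg_nonneg Bochner_Integration.integral_nonneg simp: wgt_pos less_imp_le)
  have "wt d \<alpha> \<noteq> 0"
  proof
    assume "wt d \<alpha> = 0"
    then have "(\<integral>z. wgt d z * (cmod (affmon \<alpha> z))\<^sup>2 \<partial>lborel) = 0" using Vfs(1) by (simp add: wt_def)
    then have "AE z in lborel. wgt d z * (cmod (affmon \<alpha> z))\<^sup>2 = 0"
      by (subst (asm) integral_nonneg_eq_0_iff_AE[OF affmon_sq_integrable[OF assms]]) (auto simp: wgt_pos less_imp_le)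
    then have "AE z in lborel. z \<notin> ball (vector [1, 1] :: complex^2) (1/2)"
    proof eventually_elim
      case (elim z)
      then have "affmon \<alpha> z = 0" using wgt_pos[of d z] by simp
      then have "z$1 = 0 \<or> z$2 = 0" by (auto simp: affmon_def split: if_splits)
      then have "(vector [1, 1] - z) $ 1 = 1 \<or> (vector [1, 1] - z) $ 2 = (1::complex)" by auto
      then have "1 \<le> norm (vector [1, 1] - z)" using cmod_nth_le[of "vector [1, 1] - z" 1] cmod_nth_le[of "vector [1, 1] - z" 2] by auto
      then show ?case by (simp add: dist_norm)
    qed
    then have "ball (vector [1, 1] :: complex^2) (1/2) \<in> null_sets lborel"
      using AE_iff_null_sets[of "ball (vector [1, 1] :: complex^2) (1/2)" lborel] by simp
    then have "emeasure lborel (ball (vector [1, 1] :: complex^2) (1/2)) = 0" by auto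
    then show False by (simp add: emeasure_ball unit_ball_vol_pos less_imp_neq[symmetric])
  qed
  then show ?thesis using nn by simp
qed

subsection \<open>Norms of concentrated forms from above\<close>

text \<open>The exponential decay of \<open>(1 - y) ^ d\<close> is traded for the cubic decay of the Fubini-Study density.\<close>

lemma one_minus_power_le:
  assumes "0 \<le> y" "y \<le> (1::real)"
  shows "(1 - y) ^ d * (1 + real d * y) ^ 3 \<le> 27"
proof -
  let ?t = "real d * y"
  have t: "?t \<ge> 0" using assms by simp
  have "(1 - y) ^ d \<le> exp (- y) ^ d"
    using assms exp_ge_add_one_self[of "- y"] by (intro power_mono) auto
  also have "\<dots> = exp (- ?t)" by (simp flip: exp_of_nat_mult)
  finally have 1: "(1 - y) ^ d \<le> exp (- ?t)" .
  have "(1 + ?t) ^ 3 \<le> (3 * exp (?t / 3)) ^ 3"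
  proof (rule power_mono)
    show "1 + ?t \<le> 3 * exp (?t / 3)" using exp_ge_add_one_self[of "?t / 3"] t by linarith
  qed (use t in simp)
  also have "\<dots> = 27 * exp ?t" by (simp add: power_mult_distrib flip: exp_of_nat_mult)
  finally have 2: "(1 + ?t) ^ 3 \<le> 27 * exp ?t" .
  have "(1 - y) ^ d * (1 + ?t) ^ 3 \<le> exp (- ?t) * (27 * exp ?t)"
    using 1 2 t assms by (intro mult_mono) auto
  also have "\<dots> = 27" by (simp add: exp_minus)
  finally show ?thesis .
qed

text \<open>By the arithmetic-geometric inequality \<open>(1 + \<tau> \<bar>z\<bar>)\<^sup>2 \<le> (1 + 2 \<tau>\<^sup>2) (1 + \<bar>z\<bar>\<^sup>2 / 2)\<close>, so the pointwise norm decays like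
  \<open>((1 + \<bar>z\<bar>\<^sup>2 / 2) / (1 + \<bar>z\<bar>\<^sup>2)) ^ d\<close>, on the scale \<open>\<bar>z\<bar>\<^sup>2 \<sim> 1 / d\<close>. The integrand is compared with a
  rescaled Fubini-Study density, whose integral contributes the factor \<open>d ^ (-2)\<close>.\<close>

lemma concentrated_l2_norm_le:
  fixes P :: "nat \<times> nat \<times> nat \<Rightarrow> complex"
  assumes d: "d > 0" and \<tau>: "\<tau> \<ge> 0"
    and P: "\<And>X. cmod (form_eval d P X) \<le> (cmod (X$1) + \<tau> * sqrt ((cmod (X$2))\<^sup>2 + (cmod (X$3))\<^sup>2)) ^ d"
  shows "(l2_norm d P)\<^sup>2 \<le> 108 * (1 + 2 * \<tau>\<^sup>2) ^ d / (real d)\<^sup>2"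
proof -
  let ?s = "\<lambda>z :: complex^2. (norm z)\<^sup>2"
  let ?c = "sqrt (real d / 2)"
  have c: "?c > 0" using d by simp
  let ?K = "27 * (1 + 2 * \<tau>\<^sup>2) ^ d"
  have pt: "1 / (1 + ?s z) ^ 3 * (fs_norm d P (chart z))\<^sup>2 \<le> ?K * (1 / (1 + (norm (?c *\<^sub>R z))\<^sup>2) ^ 3)" for z
  proof -
    let ?s = "?s z"
    have s: "?s \<ge> 0" by simp
    have "cmod (form_eval d P (chart z)) \<le> (1 + \<tau> * norm z) ^ d"
      using P[of "chart z"] by (simp add: norm_vec2[symmetric])
    then have "(cmod (form_eval d P (chart z)))\<^sup>2 \<le> ((1 + \<tau> * norm z) ^ d)\<^sup>2" by (rule power_mono) simp
    also have "\<dots> = ((1 + \<tau> * norm z)\<^sup>2) ^ d" by (simp add: mult.commute flip: power_mult)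
    also have "\<dots> \<le> ((1 + 2 * \<tau>\<^sup>2) * (1 + ?s / 2)) ^ d"
    proof (rule power_mono)
      have "(1 + 2 * \<tau>\<^sup>2) * (1 + ?s / 2) - (1 + \<tau> * norm z)\<^sup>2 = (2 * \<tau> - norm z)\<^sup>2 / 2"
        by (simp add: power2_eq_square field_simps)
      moreover have "0 \<le> (2 * \<tau> - norm z)\<^sup>2" by simp
      ultimately show "(1 + \<tau> * norm z)\<^sup>2 \<le> (1 + 2 * \<tau>\<^sup>2) * (1 + ?s / 2)" by linarith
    qed simp
    finally have f: "(cmod (form_eval d P (chart z)))\<^sup>2 \<le> (1 + 2 * \<tau>\<^sup>2) ^ d * (1 + ?s / 2) ^ d" by (simp only: power_mult_distrib)
    have n: "(norm (chart z) ^ d)\<^sup>2 = (1 + ?s) ^ d"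
      unfolding norm_chart[symmetric] by (simp add: mult.commute flip: power_mult)
    have "(fs_norm d P (chart z))\<^sup>2 \<le> (1 + 2 * \<tau>\<^sup>2) ^ d * (1 + ?s / 2) ^ d / (1 + ?s) ^ d"
      unfolding fs_norm_def power_divide n using f s by (intro divide_right_mono) auto
    also have "\<dots> = (1 + 2 * \<tau>\<^sup>2) ^ d * ((1 + ?s / 2) / (1 + ?s)) ^ d" by (simp add: power_divide)
    also have "(1 + ?s / 2) / (1 + ?s) = 1 - ?s / (2 * (1 + ?s))"
    proof -
      have nz: "1 + ?s \<noteq> 0" using s by linarith
      have "(1 + ?s / 2) / (1 + ?s) = ((1 + ?s) - ?s / 2) / (1 + ?s)" by simp
      also have "\<dots> = (1 + ?s) / (1 + ?s) - ?s / 2 / (1 + ?s)" by (rule diff_divide_distrib)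
      also have "\<dots> = 1 - ?s / (2 * (1 + ?s))" using nz by simp
      finally show ?thesis .
    qed
    finally have f2: "(fs_norm d P (chart z))\<^sup>2 \<le> (1 + 2 * \<tau>\<^sup>2) ^ d * (1 - ?s / (2 * (1 + ?s))) ^ d" .
    let ?y = "?s / (2 * (1 + ?s))"
    have s2: "0 < 2 * (1 + ?s)" by (simp add: add_pos_nonneg)
    have "?s \<le> 2 * (1 + ?s)" by simp
    then have y: "0 \<le> ?y" "?y \<le> 1"
      using s2 by (simp_all only: divide_le_eq_1_pos) (rule divide_nonneg_pos[OF s s2])
    have pos: "1 + real d * ?y > 0" using y(1) by (simp add: add_pos_nonneg)
    have "(1 - ?y) ^ d \<le> 27 / (1 + real d * ?y) ^ 3"
      using one_minus_power_le[OF y, of d] pos by (simp add: pos_le_divide_eq)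
    then have "1 / (1 + ?s) ^ 3 * (1 - ?y) ^ d \<le> 1 / (1 + ?s) ^ 3 * (27 / (1 + real d * ?y) ^ 3)"
      using s by (intro mult_left_mono) auto
    also have "\<dots> = 27 / ((1 + ?s) * (1 + real d * ?y)) ^ 3" by (simp add: power_mult_distrib)
    also have "(1 + ?s) * (1 + real d * ?y) = 1 + ?s + real d * ?s / 2"
    proof -
      have nz: "1 + ?s \<noteq> 0" using s by linarith
      have "(1 + ?s) * ?y = ?s / 2"
        using mult_divide_mult_cancel_left[OF nz, of ?s 2] by (simp only: times_divide_eq_right mult.commute)
      then have "(1 + ?s) + real d * ((1 + ?s) * ?y) = 1 + ?s + real d * ?s / 2"
        by (simp only: times_divide_eq_right)
      moreover have "(1 + x) * (1 + a * y) = (1 + x) + a * ((1 + x) * y)" for x a y :: real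
        by (simp add: algebra_simps)
      ultimately show ?thesis by (simp only:)
    qed
    also have "27 / (1 + ?s + real d * ?s / 2) ^ 3 \<le> 27 / (1 + real d * ?s / 2) ^ 3"
      using s by (intro divide_left_mono power_mono mult_pos_pos zero_less_power) (auto simp: add_pos_nonneg)
    finally have g: "1 / (1 + ?s) ^ 3 * (1 - ?y) ^ d \<le> 27 / (1 + real d * ?s / 2) ^ 3" .
    have "1 / (1 + ?s) ^ 3 * (fs_norm d P (chart z))\<^sup>2 \<le> 1 / (1 + ?s) ^ 3 * ((1 + 2 * \<tau>\<^sup>2) ^ d * (1 - ?y) ^ d)"
      using s by (intro mult_left_mono f2) auto
    also have "\<dots> = (1 + 2 * \<tau>\<^sup>2) ^ d * (1 / (1 + ?s) ^ 3 * (1 - ?y) ^ d)" by simp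
    also have "\<dots> \<le> (1 + 2 * \<tau>\<^sup>2) ^ d * (27 / (1 + real d * ?s / 2) ^ 3)" by (intro mult_left_mono g) simp
    also have "real d * ?s / 2 = (norm (?c *\<^sub>R z))\<^sup>2" by (simp add: power_mult_distrib)
    finally show ?thesis by (simp add: mult.commute)
  qed
  have m: "(\<lambda>z :: complex^2. ennreal (1 / (1 + (norm z)\<^sup>2) ^ 3)) \<in> borel_measurable borel" by measurable
  have I: "(\<integral>\<^sup>+z. ennreal (1 / (1 + (norm z)\<^sup>2) ^ 3) \<partial>(lborel :: (complex^2) measure)) = ennreal Vfs"
    using nn_integral_eq_integral[OF integrable_fs_weight(1)] integrable_fs_weight(2) by (simp add: add_nonneg_nonneg)
  have "ennreal Vfs = ennreal (?c ^ DIM(complex^2)) * (\<integral>\<^sup>+z. ennreal (1 / (1 + (norm (?c *\<^sub>R z))\<^sup>2) ^ 3) \<partial>(lborel :: (complex^2) measure))"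
    unfolding I[symmetric] by (rule nn_integral_lborel_scaleR[OF c m])
  also have "?c ^ DIM(complex^2) = (real d)\<^sup>2 / 4"
  proof -
    have "?c ^ DIM(complex^2) = (?c\<^sup>2)\<^sup>2" using power_mult[of ?c 2 2] by simp
    also have "?c\<^sup>2 = real d / 2" by (rule real_sqrt_pow2) simp
    finally show ?thesis by (simp add: power_divide)
  qed
  finally have sc: "ennreal Vfs = ennreal ((real d)\<^sup>2 / 4) * (\<integral>\<^sup>+z. ennreal (1 / (1 + (norm (?c *\<^sub>R z))\<^sup>2) ^ 3) \<partial>(lborel :: (complex^2) measure))"
    (is "_ = _ * ?J") .
  have "ennreal (Vfs * (l2_norm d P)\<^sup>2) = (\<integral>\<^sup>+z. ennreal (1 / (1 + ?s z) ^ 3) * ennreal ((fs_norm d P (chart z))\<^sup>2) \<partial>lborel)"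
    unfolding l2_norm_nn fs_volume_def by (subst nn_integral_density) auto
  also have "\<dots> \<le> (\<integral>\<^sup>+z. ennreal ?K * ennreal (1 / (1 + (norm (?c *\<^sub>R z))\<^sup>2) ^ 3) \<partial>(lborel :: (complex^2) measure))"
  proof (intro nn_integral_mono)
    fix z :: "complex^2"
    have a: "0 \<le> 1 / (1 + ?s z) ^ 3" "0 \<le> 1 / (1 + (norm (?c *\<^sub>R z))\<^sup>2) ^ 3" by (simp_all add: add_nonneg_nonneg)
    have k: "0 \<le> ?K" by simp
    show "ennreal (1 / (1 + ?s z) ^ 3) * ennreal ((fs_norm d P (chart z))\<^sup>2) \<le> ennreal ?K * ennreal (1 / (1 + (norm (?c *\<^sub>R z))\<^sup>2) ^ 3)"
      unfolding ennreal_mult[OF a(1) zero_le_power2, symmetric] ennreal_mult[OF k a(2), symmetric]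
      by (rule ennreal_leI[OF pt])
  qed
  also have "\<dots> = ennreal ?K * ?J" by (rule nn_integral_cmult) measurable
  finally have le: "ennreal (Vfs * (l2_norm d P)\<^sup>2) \<le> ennreal ?K * ?J" .
  have "ennreal ((real d)\<^sup>2 / 4) * ennreal (Vfs * (l2_norm d P)\<^sup>2) \<le> ennreal ?K * ennreal Vfs"
    unfolding sc using mult_left_mono[OF le, of "ennreal ((real d)\<^sup>2 / 4)"] by (simp add: mult_ac)
  then have "(real d)\<^sup>2 / 4 * (Vfs * (l2_norm d P)\<^sup>2) \<le> ?K * Vfs"
    using Vfs(1) by (simp add: ennreal_mult[symmetric])
  then have "Vfs * ((real d)\<^sup>2 * (l2_norm d P)\<^sup>2) \<le> Vfs * (4 * ?K)" by (simp add: mult_ac)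
  then have "(real d)\<^sup>2 * (l2_norm d P)\<^sup>2 \<le> 4 * ?K" using Vfs(1) by (simp only: mult_le_cancel_left_pos)
  then show ?thesis using d by (simp add: pos_le_divide_eq mult.commute)
qed

section \<open>Coordinates of real forms\<close>

text \<open>The inner product in the coefficients. Monomials being orthogonal, it is diagonal.\<close>

definition ip :: "nat \<Rightarrow> (nat \<times> nat \<times> nat \<Rightarrow> real) \<Rightarrow> (nat \<times> nat \<times> nat \<Rightarrow> real) \<Rightarrow> real" where
  "ip d P Q = (\<Sum>\<alpha>\<in>exponents d. wt d \<alpha> * P \<alpha> * Q \<alpha>)"

lemma real_l2_inner_eq: "real_l2_inner d P Q = ip d P Q"
proof -
  have "(\<Sum>\<alpha>\<in>exponents d. wt d \<alpha> * (P \<alpha> + Q \<alpha>)\<^sup>2) =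
      (\<Sum>\<alpha>\<in>exponents d. wt d \<alpha> * (P \<alpha>)\<^sup>2) + (\<Sum>\<alpha>\<in>exponents d. wt d \<alpha> * (Q \<alpha>)\<^sup>2) + 2 * ip d P Q"
    unfolding ip_def sum_distrib_left sum.distrib[symmetric]
    by (intro sum.cong refl) (simp add: power2_eq_square algebra_simps)
  then show ?thesis unfolding real_l2_inner_def real_l2_norm_sq by simp
qed

lemma real_l2_norm_ip: "(real_l2_norm d P)\<^sup>2 = ip d P P"
  unfolding real_l2_norm_sq ip_def by (intro sum.cong refl) (simp add: power2_eq_square)

lemma real_l2_norm_nonneg: "real_l2_norm d P \<ge> 0"
  by (simp add: real_l2_norm_def l2_norm_nonneg)

lemma card_exponents: "card (exponents d) = form_dim d"
proof -
  have e: "exponents d = (\<lambda>(i, j). (i, j, d - i - j)) ` (SIGMA i:{..d}. {..d - i})"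
    by (auto simp: exponents_def image_iff)
  have "inj_on (\<lambda>(i, j). (i, j, d - i - j)) (SIGMA i:{..d}. {..d - i})" by (auto simp: inj_on_def)
  then have "card (exponents d) = (\<Sum>i\<le>d. Suc (d - i))"
    unfolding e by (simp add: card_image)
  also have "\<dots> = (\<Sum>i\<le>d. Suc i)" by (rule sum.nat_diff_reindex[of Suc "Suc d", unfolded lessThan_Suc_atMost diff_Suc_Suc, simplified])
  also have "\<dots> = form_dim d" unfolding form_dim_def
    by (induction d) (simp_all add: numeral_2_eq_2)
  finally show ?thesis .
qed

definition onb :: "nat \<Rightarrow> nat \<Rightarrow> nat \<times> nat \<times> nat \<Rightarrow> real" where
  "onb d = (SOME b. l2_orthonormal_basis d b)"

text \<open>The normalized monomials are an orthonormal basis, so the choice made by the Kostlan measure is a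
  legitimate one.\<close>

lemma onb: "l2_orthonormal_basis d (onb d)"
proof -
  obtain e where e: "bij_betw e {..<form_dim d} (exponents d)"
    using ex_bij_betw_nat_finite[OF finite_exponents, of d] by (auto simp: card_exponents atLeast0LessThan)
  define b where "b m \<alpha> = (if \<alpha> = e m then 1 / sqrt (wt d \<alpha>) else 0)" for m \<alpha>
  have "l2_orthonormal_basis d b"
    unfolding l2_orthonormal_basis_def real_l2_inner_eq
  proof (intro allI impI)
    fix m n assume mn: "m < form_dim d" "n < form_dim d"
    have em: "e m \<in> exponents d" using e mn by (auto simp: bij_betw_def)
    have inj: "e m = e n \<longleftrightarrow> m = n" using e mn by (auto simp: bij_betw_def inj_on_def)
    have "ip d (b m) (b n) = (\<Sum>\<alpha>\<in>exponents d. if \<alpha> = e m then (if m = n then 1 else 0) else 0)"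
      unfolding ip_def
    proof (intro sum.cong refl)
      fix \<alpha> assume "\<alpha> \<in> exponents d"
      then have "wt d \<alpha> > 0" by (rule wt_pos)
      then show "wt d \<alpha> * b m \<alpha> * b n \<alpha> = (if \<alpha> = e m then (if m = n then 1 else 0) else 0)"
        using inj by (auto simp: b_def)
    qed
    then show "ip d (b m) (b n) = (if m = n then 1 else 0)" using em by simp
  qed
  then show ?thesis unfolding onb_def by (rule someI[of "l2_orthonormal_basis d" b])
qed

lemma ip_onb: "m < form_dim d \<Longrightarrow> n < form_dim d \<Longrightarrow> ip d (onb d m) (onb d n) = (if m = n then 1 else 0)"
  using onb[of d] by (simp add: l2_orthonormal_basis_def real_l2_inner_eq)

definition comb :: "nat \<Rightarrow> (nat \<Rightarrow> real) \<Rightarrow> nat \<times> nat \<times> nat \<Rightarrow> real" where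
  "comb d t \<alpha> = (\<Sum>m<form_dim d. t m * onb d m \<alpha>)"

lemma ip_comb_left: "ip d (comb d t) Q = (\<Sum>m<form_dim d. t m * ip d (onb d m) Q)"
proof -
  have "ip d (comb d t) Q = (\<Sum>\<alpha>\<in>exponents d. \<Sum>m<form_dim d. t m * (wt d \<alpha> * onb d m \<alpha> * Q \<alpha>))"
    unfolding ip_def comb_def by (intro sum.cong refl) (simp add: sum_distrib_left sum_distrib_right mult_ac)
  also have "\<dots> = (\<Sum>m<form_dim d. t m * ip d (onb d m) Q)"
    by (subst sum.swap) (simp add: ip_def sum_distrib_left)
  finally show ?thesis .
qed

lemma ip_commute: "ip d P Q = ip d Q P"
  unfolding ip_def by (simp add: mult_ac)

lemma ip_onb_comb: "n < form_dim d \<Longrightarrow> ip d (onb d n) (comb d t) = t n"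
  by (subst ip_commute) (simp add: ip_comb_left ip_onb if_distrib cong: if_cong)

lemma norm_comb: "(real_l2_norm d (comb d t))\<^sup>2 = (\<Sum>m<form_dim d. (t m)\<^sup>2)"
  unfolding real_l2_norm_ip ip_comb_left by (intro sum.cong refl) (simp add: ip_onb_comb power2_eq_square)

lemma ip_diff_diff: "ip d (\<lambda>\<alpha>. P \<alpha> - Q \<alpha>) (\<lambda>\<alpha>. P \<alpha> - Q \<alpha>) = ip d P P - 2 * ip d P Q + ip d Q Q"
  unfolding ip_def sum_distrib_left sum_subtractf[symmetric] sum.distrib[symmetric]
  by (intro sum.cong refl) (simp add: algebra_simps)

lemma ip_nonneg: "ip d P P \<ge> 0"
  unfolding real_l2_norm_ip[symmetric] by simp

lemma ip_zero_imp: assumes "ip d P P = 0" "\<alpha> \<in> exponents d" shows "P \<alpha> = 0"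
proof -
  have "\<forall>\<alpha>\<in>exponents d. wt d \<alpha> * P \<alpha> * P \<alpha> = 0"
    using assms(1) unfolding ip_def
    by (subst (asm) sum_nonneg_eq_0_iff) (auto simp: mult.assoc intro!: mult_nonneg_nonneg[OF less_imp_le[OF wt_pos]])
  then show ?thesis using assms(2) wt_pos[OF assms(2)] by auto
qed

text \<open>An orthonormal family whose size is the dimension spans: Bessel's inequality for each
  coordinate vector is an equality, because both sides have the same sum over the coordinates.\<close>

lemma comb_surj:
  obtains v where "\<And>\<alpha>. \<alpha> \<in> exponents d \<Longrightarrow> comb d v \<alpha> = P \<alpha>" "(\<Sum>m<form_dim d. (v m)\<^sup>2) = (real_l2_norm d P)\<^sup>2"
proof -
  let ?N = "form_dim d" and ?E = "exponents d"
  define D where "D \<alpha> \<beta> = (if \<beta> = \<alpha> then 1 else 0 :: real)" for \<alpha> \<beta> :: "nat \<times> nat \<times> nat"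
  define c where "c \<alpha> m = ip d (onb d m) (D \<alpha>)" for \<alpha> m
  have c: "c \<alpha> m = wt d \<alpha> * onb d m \<alpha>" if "\<alpha> \<in> ?E" for \<alpha> m
    using that unfolding c_def ip_def D_def by (simp add: if_distrib cong: if_cong)
  have DD: "ip d (D \<alpha>) (D \<alpha>) = wt d \<alpha>" if "\<alpha> \<in> ?E" for \<alpha>
    using that unfolding ip_def D_def by (simp add: if_distrib cong: if_cong)
  have res: "ip d (\<lambda>\<beta>. D \<alpha> \<beta> - comb d (c \<alpha>) \<beta>) (\<lambda>\<beta>. D \<alpha> \<beta> - comb d (c \<alpha>) \<beta>) = wt d \<alpha> - (\<Sum>m<?N. (c \<alpha> m)\<^sup>2)"
    if "\<alpha> \<in> ?E" for \<alpha>
  proof -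
    have "ip d (D \<alpha>) (comb d (c \<alpha>)) = (\<Sum>m<?N. (c \<alpha> m)\<^sup>2)"
      by (subst ip_commute) (simp add: ip_comb_left c_def[symmetric] power2_eq_square)
    moreover have "ip d (comb d (c \<alpha>)) (comb d (c \<alpha>)) = (\<Sum>m<?N. (c \<alpha> m)\<^sup>2)"
      using norm_comb by (simp add: real_l2_norm_ip)
    ultimately show ?thesis unfolding ip_diff_diff DD[OF that] by simp
  qed
  have bessel: "1 - (\<Sum>m<?N. wt d \<alpha> * (onb d m \<alpha>)\<^sup>2) \<ge> 0" and
    bessel_eq: "wt d \<alpha> - (\<Sum>m<?N. (c \<alpha> m)\<^sup>2) = wt d \<alpha> * (1 - (\<Sum>m<?N. wt d \<alpha> * (onb d m \<alpha>)\<^sup>2))" if a: "\<alpha> \<in> ?E" for \<alpha>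
  proof -
    show e: "wt d \<alpha> - (\<Sum>m<?N. (c \<alpha> m)\<^sup>2) = wt d \<alpha> * (1 - (\<Sum>m<?N. wt d \<alpha> * (onb d m \<alpha>)\<^sup>2))"
      by (simp add: c[OF a] right_diff_distrib sum_distrib_left power2_eq_square mult_ac)
    show "1 - (\<Sum>m<?N. wt d \<alpha> * (onb d m \<alpha>)\<^sup>2) \<ge> 0"
      using res[OF a] ip_nonneg[of d "\<lambda>\<beta>. D \<alpha> \<beta> - comb d (c \<alpha>) \<beta>"] wt_pos[OF a] unfolding e
      by (simp add: zero_le_mult_iff)
  qed
  have "(\<Sum>\<alpha>\<in>?E. 1 - (\<Sum>m<?N. wt d \<alpha> * (onb d m \<alpha>)\<^sup>2)) = real ?N - (\<Sum>m<?N. ip d (onb d m) (onb d m))"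
    unfolding sum_subtractf by (subst sum.swap) (simp add: card_exponents ip_def power2_eq_square mult.assoc)
  also have "\<dots> = 0" by (simp add: ip_onb)
  finally have "\<forall>\<alpha>\<in>?E. 1 - (\<Sum>m<?N. wt d \<alpha> * (onb d m \<alpha>)\<^sup>2) = 0"
    by (subst (asm) sum_nonneg_eq_0_iff) (use bessel in auto)
  then have zero: "ip d (\<lambda>\<beta>. D \<alpha> \<beta> - comb d (c \<alpha>) \<beta>) (\<lambda>\<beta>. D \<alpha> \<beta> - comb d (c \<alpha>) \<beta>) = 0" if "\<alpha> \<in> ?E" for \<alpha>
    using res[OF that] bessel_eq[OF that] that by simp
  have span: "comb d (c \<alpha>) \<beta> = D \<alpha> \<beta>" if "\<alpha> \<in> ?E" "\<beta> \<in> ?E" for \<alpha> \<beta>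
    using ip_zero_imp[OF zero[OF that(1)] that(2)] by simp
  define v where "v m = (\<Sum>\<alpha>\<in>?E. P \<alpha> * c \<alpha> m)" for m
  have v: "comb d v \<beta> = P \<beta>" if "\<beta> \<in> ?E" for \<beta>
  proof -
    have "comb d v \<beta> = (\<Sum>\<alpha>\<in>?E. P \<alpha> * comb d (c \<alpha>) \<beta>)"
      unfolding comb_def v_def sum_distrib_right sum_distrib_left by (subst sum.swap) (simp add: mult_ac)
    also have "\<dots> = (\<Sum>\<alpha>\<in>?E. if \<beta> = \<alpha> then P \<alpha> else 0)"
      by (intro sum.cong refl) (simp add: span that D_def)
    finally show ?thesis using that by simp
  qed
  moreover have "(\<Sum>m<?N. (v m)\<^sup>2) = (real_l2_norm d P)\<^sup>2"
    unfolding norm_comb[symmetric] real_l2_norm_sq by (intro sum.cong refl) (simp add: v)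
  ultimately show thesis using that by blast
qed

section \<open>The Kostlan measure as a Gaussian measure\<close>

text \<open>The one-dimensional factor of the Kostlan density: a centred Gaussian of variance \<open>1 / 2\<close>, in contrast
  with the usual normalization.\<close>

definition gd :: "real \<Rightarrow> real" where "gd x = exp (- x\<^sup>2) / sqrt pi"

lemma gd_nn: "(\<integral>\<^sup>+x. ennreal (gd x) \<partial>lborel) = 1"
proof -
  have g: "normal_density 0 (1 / sqrt 2) x = gd x" for x
    by (simp add: normal_density_def gd_def power_divide)
  have "(\<integral>\<^sup>+x. ennreal (normal_density 0 (1 / sqrt 2) x) \<partial>lborel) = ennreal (\<integral>x. normal_density 0 (1 / sqrt 2) x \<partial>lborel)"
    by (rule nn_integral_eq_integral) auto
  then show ?thesis unfolding g by (simp flip: g)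
qed

lemma gd_pos: "gd x > 0" by (simp add: gd_def)

lemma measurable_gd [measurable]: "gd \<in> borel_measurable borel"
  unfolding gd_def[abs_def] by measurable

interpretation lb: product_sigma_finite "\<lambda>_ :: nat. lborel :: real measure"
  by unfold_locales

abbreviation "lam n \<equiv> (\<Pi>\<^sub>M m\<in>{..<n}. (lborel :: real measure))"

definition gw :: "nat \<Rightarrow> (nat \<Rightarrow> real) \<Rightarrow> real" where "gw n t = (\<Prod>m<n. gd (t m))"

lemma gw_pos: "gw n t > 0" unfolding gw_def by (intro prod_pos) (simp add: gd_pos)

lemma gw_eq: "gw n t = pi powr (- real n / 2) * exp (- (\<Sum>m<n. (t m)\<^sup>2))"
proof -
  have "gw n t = (\<Prod>m<n. exp (- (t m)\<^sup>2)) / sqrt pi ^ n"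
    unfolding gw_def gd_def by (simp add: prod_dividef)
  also have "(\<Prod>m<n. exp (- (t m)\<^sup>2)) = exp (- (\<Sum>m<n. (t m)\<^sup>2))"
    by (simp add: exp_sum sum_negf[symmetric])
  also have "sqrt pi ^ n = pi powr (real n / 2)"
    by (simp add: powr_half_sqrt[symmetric] powr_realpow[symmetric] powr_powr)
  also have "exp (- (\<Sum>m<n. (t m)\<^sup>2)) / pi powr (real n / 2) = pi powr (- real n / 2) * exp (- (\<Sum>m<n. (t m)\<^sup>2))"
  proof -
    have "pi powr (- real n / 2) = 1 / pi powr (real n / 2)" using powr_minus_divide[of pi "real n / 2"] by simp
    then show ?thesis by simp
  qed
  finally show ?thesis .
qed

lemma measurable_coord: "m < n \<Longrightarrow> (\<lambda>t. t m) \<in> borel_measurable (lam n)"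
  using measurable_component_singleton[of m "{..<n}" "\<lambda>_. lborel :: real measure"] by simp

lemma measurable_gw [measurable]: "gw n \<in> borel_measurable (lam n)"
  unfolding gw_def[abs_def] by (intro borel_measurable_prod measurable_compose[OF measurable_coord measurable_gd]) simp

lemma gw_total: "(\<integral>\<^sup>+t. ennreal (gw n t) \<partial>lam n) = 1"
proof -
  have "(\<integral>\<^sup>+t. ennreal (gw n t) \<partial>lam n) = (\<integral>\<^sup>+t. (\<Prod>m<n. ennreal (gd (t m))) \<partial>lam n)"
    unfolding gw_def by (simp add: prod_ennreal gd_pos less_imp_le)
  also have "\<dots> = (\<Prod>m<n. \<integral>\<^sup>+x. ennreal (gd x) \<partial>lborel)"
    by (rule lb.product_nn_integral_prod) auto
  finally show ?thesis by (simp add: gd_nn)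
qed

text \<open>The reflection through the origin is \<open>c = -1\<close>, translations are \<open>c = 1\<close>; both preserve Lebesgue
  measure and are treated together.\<close>

definition aff :: "nat \<Rightarrow> real \<Rightarrow> (nat \<Rightarrow> real) \<Rightarrow> (nat \<Rightarrow> real) \<Rightarrow> nat \<Rightarrow> real" where
  "aff n c v t = (\<lambda>m\<in>{..<n}. c * t m + v m)"

lemma aff_nth [simp]: "m < n \<Longrightarrow> aff n c v t m = c * t m + v m" by (simp add: aff_def)

lemma measurable_aff [measurable]: "aff n c v \<in> measurable (lam n) (lam n)"
  unfolding aff_def
proof (rule measurable_restrict)
  fix m assume "m \<in> {..<n}"
  then have "(\<lambda>t. c * t m + v m) \<in> borel_measurable (lam n)"
    by (intro borel_measurable_add borel_measurable_times borel_measurable_const measurable_coord) simp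
  then show "(\<lambda>t. c * t m + v m) \<in> measurable (lam n) lborel" by simp
qed

lemma nn_integral_aff:
  assumes c: "c = 1 \<or> c = -1" and f: "f \<in> borel_measurable (lam n)"
  shows "(\<integral>\<^sup>+t. f (aff n c v t) \<partial>lam n) = (\<integral>\<^sup>+t. f t \<partial>lam n)"
proof -
  have "distr (lam n) (lam n) (aff n c v) = lam n"
  proof (rule lb.PiM_eqI)
    fix A :: "nat \<Rightarrow> real set" assume A: "\<And>i. i \<in> {..<n} \<Longrightarrow> A i \<in> sets lborel"
    have pre: "aff n c v -` Pi\<^sub>E {..<n} A \<inter> space (lam n) = Pi\<^sub>E {..<n} (\<lambda>i. (\<lambda>x. v i + c * x) -` A i)"
      by (auto simp: space_PiM PiE_iff aff_def extensional_def add.commute)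
    have pm: "(\<lambda>x. v i + c * x) -` A i \<in> sets lborel" if "i < n" for i
    proof -
      have "(\<lambda>x. v i + c * x) \<in> borel_measurable borel" by measurable
      then show ?thesis using measurable_sets[of _ borel borel "A i"] A that by fastforce
    qed
    have one: "emeasure lborel ((\<lambda>x. v i + c * x) -` A i) = emeasure lborel (A i)" if i: "i < n" for i
    proof -
      have "(lborel :: real measure) = density (distr lborel borel (\<lambda>x. v i + c * x)) (\<lambda>_. ennreal \<bar>c\<bar>)"
        using lborel_real_affine[of c "v i"] c by auto
      also have "\<dots> = distr lborel borel (\<lambda>x. v i + c * x)" using c by (auto simp: density_1)
      finally have "emeasure lborel (A i) = emeasure (distr lborel borel (\<lambda>x. v i + c * x)) (A i)" by simp
      then show ?thesis using A i by (simp add: emeasure_distr)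
    qed
    have "emeasure (distr (lam n) (lam n) (aff n c v)) (Pi\<^sub>E {..<n} A) = emeasure (lam n) (Pi\<^sub>E {..<n} (\<lambda>i. (\<lambda>x. v i + c * x) -` A i))"
      using A by (subst emeasure_distr) (auto simp: pre intro!: sets_PiM_I_finite)
    also have "\<dots> = (\<Prod>i<n. emeasure lborel ((\<lambda>x. v i + c * x) -` A i))"
      by (rule lb.emeasure_PiM) (use pm in auto)
    also have "\<dots> = (\<Prod>i<n. emeasure lborel (A i))" using one by simp
    finally show "emeasure (distr (lam n) (lam n) (aff n c v)) (Pi\<^sub>E {..<n} A) = (\<Prod>i<n. emeasure lborel (A i))" .
  qed simp_all
  then have "(\<integral>\<^sup>+t. f t \<partial>lam n) = (\<integral>\<^sup>+t. f t \<partial>distr (lam n) (lam n) (aff n c v))" by simp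
  also have "\<dots> = (\<integral>\<^sup>+t. f (aff n c v t) \<partial>lam n)" by (rule nn_integral_distr) (use f in auto)
  finally show ?thesis by simp
qed

text \<open>The parametrization of the space of forms by coordinates with respect to the orthonormal basis,
  as a point of the product space.\<close>

definition rcomb :: "nat \<Rightarrow> (nat \<Rightarrow> real) \<Rightarrow> nat \<times> nat \<times> nat \<Rightarrow> real" where
  "rcomb d t = restrict (comb d t) (exponents d)"

abbreviation "forms d \<equiv> (\<Pi>\<^sub>M \<alpha>\<in>exponents d. (borel :: real measure))"

lemma measurable_rcomb [measurable]: "rcomb d \<in> measurable (lam (form_dim d)) (forms d)"
  unfolding rcomb_def comb_def[abs_def] restrict_def
  by (rule measurable_restrict[unfolded restrict_def]) (intro borel_measurable_sum borel_measurable_times borel_measurable_const measurable_coord, simp)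

lemma measurable_form_coord: "\<alpha> \<in> exponents d \<Longrightarrow> (\<lambda>P. P \<alpha>) \<in> borel_measurable (forms d)"
  by (rule measurable_component_singleton)

lemma real_l2_norm_cong:
  assumes "\<And>\<alpha>. \<alpha> \<in> exponents d \<Longrightarrow> P \<alpha> = Q \<alpha>" shows "real_l2_norm d P = real_l2_norm d Q"
proof -
  have "(real_l2_norm d P)\<^sup>2 = (real_l2_norm d Q)\<^sup>2" unfolding real_l2_norm_sq using assms by simp
  then show ?thesis by (simp add: real_l2_norm_nonneg)
qed

lemma sets_kostlan: "sets (kostlan d) = sets (forms d)" and space_kostlan: "space (kostlan d) = space (forms d)"
  by (simp_all add: kostlan_def form_lebesgue_def Let_def)

lemma nn_integral_kostlan:
  assumes G: "G \<in> borel_measurable (forms d)"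
  shows "(\<integral>\<^sup>+P. G P \<partial>kostlan d) = (\<integral>\<^sup>+t. ennreal (gw (form_dim d) t) * G (rcomb d t) \<partial>lam (form_dim d))"
proof -
  let ?N = "form_dim d"
  let ?D = "\<lambda>P. ennreal (pi powr (- real ?N / 2) * exp (- (real_l2_norm d P)\<^sup>2))"
  have fl: "form_lebesgue d = distr (lam ?N) (forms d) (rcomb d)"
    unfolding form_lebesgue_def onb_def[symmetric] Let_def rcomb_def comb_def restrict_def ..
  have D: "?D \<in> borel_measurable (forms d)" unfolding real_l2_norm_sq
    by (intro measurable_compose[OF _ measurable_ennreal] borel_measurable_times borel_measurable_const borel_measurable_exp[THEN measurable_compose_rev]
        borel_measurable_uminus borel_measurable_sum borel_measurable_power measurable_form_coord)
  have "(\<integral>\<^sup>+P. G P \<partial>kostlan d) = (\<integral>\<^sup>+P. ?D P * G P \<partial>form_lebesgue d)"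
    unfolding kostlan_def fl
    by (rule nn_integral_density) (unfold measurable_distr_eq1, rule D, rule G)
  also have "\<dots> = (\<integral>\<^sup>+t. ?D (rcomb d t) * G (rcomb d t) \<partial>lam ?N)"
    unfolding fl by (rule nn_integral_distr[OF measurable_rcomb]) (unfold measurable_distr_eq1, rule borel_measurable_times_ennreal[OF D G])
  also have "\<dots> = (\<integral>\<^sup>+t. ennreal (gw ?N t) * G (rcomb d t) \<partial>lam ?N)"
  proof -
    have "real_l2_norm d (rcomb d t) = real_l2_norm d (comb d t)" for t
      by (rule real_l2_norm_cong) (simp add: rcomb_def)
    then have "?D (rcomb d t) = ennreal (gw ?N t)" for t by (simp add: norm_comb gw_eq)
    then show ?thesis by presburger
  qed
  finally show ?thesis .
qed

lemma emeasure_kostlan: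
  assumes "E \<in> sets (forms d)"
  shows "emeasure (kostlan d) E = (\<integral>\<^sup>+t. ennreal (gw (form_dim d) t) * indicator E (rcomb d t) \<partial>lam (form_dim d))"
  using nn_integral_kostlan[of "indicator E" d] assms by (simp add: sets_kostlan)

lemma gw_aff:
  assumes "c = 1 \<or> c = -1"
  shows "gw n (aff n c v t) = gw n t * exp (- (\<Sum>m<n. (v m)\<^sup>2)) * exp (- 2 * c * (\<Sum>m<n. t m * v m))"
proof -
  have "(\<Sum>m<n. (aff n c v t m)\<^sup>2) = (\<Sum>m<n. (t m)\<^sup>2 + (v m)\<^sup>2 + 2 * c * (t m * v m))"
    using assms by (intro sum.cong refl) (auto simp: power2_eq_square algebra_simps)
  also have "\<dots> = (\<Sum>m<n. (t m)\<^sup>2) + (\<Sum>m<n. (v m)\<^sup>2) + 2 * c * (\<Sum>m<n. t m * v m)"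
    by (simp add: sum.distrib sum_distrib_left)
  finally show ?thesis unfolding gw_eq by (simp add: exp_add[symmetric] mult.assoc)
qed

text \<open>Moment generating function, by completing the square.\<close>

lemma gaussian_mgf:
  "(\<integral>\<^sup>+t. ennreal (gw n t * exp (\<Sum>m<n. t m * \<beta> m)) \<partial>lam n) = ennreal (exp ((\<Sum>m<n. (\<beta> m)\<^sup>2) / 4))"
proof -
  let ?v = "\<lambda>m. - \<beta> m / 2"
  have "gw n t * exp (\<Sum>m<n. t m * \<beta> m) = exp ((\<Sum>m<n. (\<beta> m)\<^sup>2) / 4) * gw n (aff n 1 ?v t)" for t
    unfolding gw_aff[OF disjI1[OF refl]]
    by (simp add: power_divide sum_divide_distrib[symmetric] sum_negf mult_ac exp_minus flip: sum_divide_distrib)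
  then have "(\<integral>\<^sup>+t. ennreal (gw n t * exp (\<Sum>m<n. t m * \<beta> m)) \<partial>lam n)
      = (\<integral>\<^sup>+t. ennreal (exp ((\<Sum>m<n. (\<beta> m)\<^sup>2) / 4)) * ennreal (gw n (aff n 1 ?v t)) \<partial>lam n)"
    by (simp add: ennreal_mult gw_pos less_imp_le)
  also have "\<dots> = ennreal (exp ((\<Sum>m<n. (\<beta> m)\<^sup>2) / 4)) * (\<integral>\<^sup>+t. ennreal (gw n (aff n 1 ?v t)) \<partial>lam n)"
    by (rule nn_integral_cmult) measurable
  also have "(\<integral>\<^sup>+t. ennreal (gw n (aff n 1 ?v t)) \<partial>lam n) = (\<integral>\<^sup>+t. ennreal (gw n t) \<partial>lam n)"
    by (rule nn_integral_aff) simp_all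
  finally show ?thesis by (simp add: gw_total)
qed

text \<open>From \<open>\<bar>x\<bar> \<le> exp x + exp (- x)\<close> and the moment generating function, applied to the functional divided
  by \<open>c\<close>.\<close>

lemma gaussian_abs_le:
  assumes "c > 0" "(\<Sum>m<n. (\<beta> m)\<^sup>2) \<le> c\<^sup>2"
  shows "(\<integral>\<^sup>+t. ennreal (gw n t * \<bar>\<Sum>m<n. t m * \<beta> m\<bar>) \<partial>lam n) \<le> ennreal (3 * c)"
proof -
  have mc: "(\<lambda>t. \<Sum>m<n. t m * \<gamma> m) \<in> borel_measurable (lam n)" for \<gamma>
    by (intro borel_measurable_sum borel_measurable_times borel_measurable_const measurable_coord) simp
  have q: "(\<Sum>m<n. (\<beta> m / c)\<^sup>2) \<le> 1"
    using assms by (simp add: power_divide flip: sum_divide_distrib)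
  have e: "exp ((\<Sum>m<n. (\<beta> m / c)\<^sup>2) / 4) \<le> 3 / 2"
  proof -
    have "exp (1/4 :: real) \<le> 1 + 1/4 + (1/4)\<^sup>2" by (rule exp_bound) auto
    then have "exp (1/4 :: real) \<le> 3 / 2" by (simp add: power2_eq_square)
    moreover have "exp ((\<Sum>m<n. (\<beta> m / c)\<^sup>2) / 4) \<le> exp (1/4)" using q by simp
    ultimately show ?thesis by linarith
  qed
  let ?x = "\<lambda>t. \<Sum>m<n. t m * (\<beta> m / c)" and ?y = "\<lambda>t. \<Sum>m<n. t m * (- \<beta> m / c)"
  have pt: "gw n t * \<bar>\<Sum>m<n. t m * \<beta> m\<bar> \<le> c * (gw n t * exp (?x t)) + c * (gw n t * exp (?y t))" for t
  proof -
    have s: "(\<Sum>m<n. t m * \<beta> m) = c * ?x t" "?y t = - ?x t" using assms(1)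
      by (simp_all add: sum_distrib_left sum_negf)
    have ab: "\<bar>x\<bar> \<le> exp x + exp (- x)" for x :: real
      using exp_ge_add_one_self[of x] exp_ge_add_one_self[of "- x"] exp_gt_zero[of x] exp_gt_zero[of "- x"] by linarith
    have "\<bar>\<Sum>m<n. t m * \<beta> m\<bar> = c * \<bar>?x t\<bar>" unfolding s(1) using assms(1) by (simp add: abs_mult)
    also have "\<dots> \<le> c * (exp (?x t) + exp (?y t))" unfolding s(2) using ab assms(1) by (intro mult_left_mono) auto
    finally have "gw n t * \<bar>\<Sum>m<n. t m * \<beta> m\<bar> \<le> gw n t * (c * (exp (?x t) + exp (?y t)))"
      by (intro mult_left_mono) (simp_all add: gw_pos less_imp_le)
    then show ?thesis by (simp add: algebra_simps)
  qed
  have "(\<integral>\<^sup>+t. ennreal (gw n t * \<bar>\<Sum>m<n. t m * \<beta> m\<bar>) \<partial>lam n)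
    \<le> (\<integral>\<^sup>+t. ennreal c * ennreal (gw n t * exp (?x t)) + ennreal c * ennreal (gw n t * exp (?y t)) \<partial>lam n)"
  proof (rule nn_integral_mono)
    fix t
    have "0 \<le> gw n t * exp (?x t)" "0 \<le> gw n t * exp (?y t)" using gw_pos[of n t] by simp_all
    then show "ennreal (gw n t * \<bar>\<Sum>m<n. t m * \<beta> m\<bar>) \<le> ennreal c * ennreal (gw n t * exp (?x t)) + ennreal c * ennreal (gw n t * exp (?y t))"
      using pt[of t] assms(1) by (simp add: ennreal_mult[symmetric] ennreal_plus[symmetric] ennreal_leI del: ennreal_plus)
  qed
  also have "\<dots> = ennreal c * (\<integral>\<^sup>+t. ennreal (gw n t * exp (?x t)) \<partial>lam n) + ennreal c * (\<integral>\<^sup>+t. ennreal (gw n t * exp (?y t)) \<partial>lam n)"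
    using mc by (simp add: nn_integral_add nn_integral_cmult)
  also have "\<dots> \<le> ennreal c * ennreal (3 / 2) + ennreal c * ennreal (3 / 2)"
    unfolding gaussian_mgf using e by (intro add_mono mult_left_mono ennreal_leI) auto
  also have "\<dots> = ennreal (3 * c)" using assms(1) by (simp add: ennreal_mult[symmetric] ennreal_plus[symmetric] del: ennreal_plus)
  finally show ?thesis .
qed

text \<open>This is the Cameron-Martin inequality for symmetric events. The density at \<open>t + v\<close> is
  \<open>exp (- \<parallel>v\<parallel>\<^sup>2) * exp (- 2 \<langle>t, v\<rangle>)\<close> times the density at \<open>t\<close>. Averaging over \<open>t\<close> and \<open>- t\<close>, which are both in
  the event, replaces the second factor by a hyperbolic cosine, which is at least 1.\<close>

lemma gaussian_shift_symmetric:
  assumes S: "S \<in> sets (lam n)" and sym: "\<And>t. t \<in> space (lam n) \<Longrightarrow> t \<in> S \<Longrightarrow> aff n (-1) (\<lambda>_. 0) t \<in> S"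
  shows "(\<integral>\<^sup>+t. ennreal (gw n t) * indicator S (aff n 1 (\<lambda>m. - v m) t) \<partial>lam n)
     \<ge> ennreal (exp (- (\<Sum>m<n. (v m)\<^sup>2))) * (\<integral>\<^sup>+t. ennreal (gw n t) * indicator S t \<partial>lam n)"
proof -
  let ?I = "\<integral>\<^sup>+t. ennreal (gw n t) * indicator S (aff n 1 (\<lambda>m. - v m) t) \<partial>lam n"
  have ms: "(\<lambda>t. indicator S (aff n c w t) :: ennreal) \<in> borel_measurable (lam n)" for c w
    by (rule measurable_compose[OF measurable_aff borel_measurable_indicator[OF S]])
  have mI: "(\<lambda>t. ennreal (gw n t) * indicator S (aff n 1 (\<lambda>m. - v m) t)) \<in> borel_measurable (lam n)"
    using ms by measurable
  have ext: "aff n 1 (\<lambda>m. - v m) (aff n c v t) = aff n c (\<lambda>_. 0) t" for c t by (auto simp: aff_def)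
  have one: "aff n 1 (\<lambda>_. 0) t = t" if "t \<in> space (lam n)" for t
    using that by (auto simp: aff_def space_PiM PiE_iff extensional_def)
  have 1: "?I = (\<integral>\<^sup>+t. ennreal (gw n (aff n 1 v t)) * indicator S t \<partial>lam n)"
    using nn_integral_aff[OF _ mI, of 1 v] by (simp add: ext one cong: nn_integral_cong)
  have sym': "indicator S (aff n (-1) (\<lambda>_. 0) t) = (indicator S t :: ennreal)" if t: "t \<in> space (lam n)" for t
  proof -
    have "aff n (-1) (\<lambda>_. 0) (aff n (-1) (\<lambda>_. 0) t) = aff n 1 (\<lambda>_. 0) t" by (auto simp: aff_def)
    moreover have "aff n (-1) (\<lambda>_. 0) t \<in> space (lam n)" by (simp add: aff_def space_PiM)
    ultimately have "aff n (-1) (\<lambda>_. 0) t \<in> S \<longleftrightarrow> t \<in> S" using sym t one by metis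
    then show ?thesis by (simp add: indicator_def)
  qed
  have 2: "?I = (\<integral>\<^sup>+t. ennreal (gw n (aff n (-1) v t)) * indicator S t \<partial>lam n)"
    using nn_integral_aff[OF _ mI, of "-1" v] by (simp add: ext sym' cong: nn_integral_cong)
  have m2: "(\<lambda>t. ennreal (gw n (aff n c v t)) * indicator S t) \<in> borel_measurable (lam n)" for c
    using S by measurable
  let ?e = "exp (- (\<Sum>m<n. (v m)\<^sup>2))"
  have "2 * (ennreal ?e * (\<integral>\<^sup>+t. ennreal (gw n t) * indicator S t \<partial>lam n)) = (\<integral>\<^sup>+t. 2 * ennreal ?e * (ennreal (gw n t) * indicator S t) \<partial>lam n)"
    using S by (subst nn_integral_cmult) (auto simp: mult.assoc)
  also have "\<dots> \<le> (\<integral>\<^sup>+t. ennreal (gw n (aff n 1 v t)) * indicator S t + ennreal (gw n (aff n (-1) v t)) * indicator S t \<partial>lam n)"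
  proof (rule nn_integral_mono)
    fix t
    let ?y = "2 * (\<Sum>m<n. t m * v m)"
    have "2 \<le> exp (- ?y) + exp ?y" using exp_ge_add_one_self[of ?y] exp_ge_add_one_self[of "- ?y"] by linarith
    then have "(gw n t * ?e) * 2 \<le> (gw n t * ?e) * (exp (- ?y) + exp ?y)"
      by (intro mult_left_mono) (simp_all add: gw_pos less_imp_le)
    also have "\<dots> = gw n (aff n 1 v t) + gw n (aff n (-1) v t)"
      by (simp add: gw_aff algebra_simps)
    finally have "ennreal (2 * ?e * gw n t) \<le> ennreal (gw n (aff n 1 v t) + gw n (aff n (-1) v t))"
      by (intro ennreal_leI) (simp add: mult_ac)
    then have "2 * ennreal ?e * ennreal (gw n t) \<le> ennreal (gw n (aff n 1 v t)) + ennreal (gw n (aff n (-1) v t))"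
      by (simp add: ennreal_mult gw_pos less_imp_le)
    then show "2 * ennreal ?e * (ennreal (gw n t) * indicator S t) \<le> ennreal (gw n (aff n 1 v t)) * indicator S t + ennreal (gw n (aff n (-1) v t)) * indicator S t"
      by (cases "t \<in> S") (simp_all add: mult.assoc)
  qed
  also have "\<dots> = ?I + ?I" using nn_integral_add[OF m2 m2, of 1 "-1"] 1 2 by simp
  finally have "2 * (ennreal ?e * (\<integral>\<^sup>+t. ennreal (gw n t) * indicator S t \<partial>lam n)) \<le> 2 * ?I" by (simp add: mult_2)
  then show ?thesis by (simp add: ennreal_mult_le_mult_iff)
qed

definition form_add :: "nat \<Rightarrow> (nat \<times> nat \<times> nat \<Rightarrow> real) \<Rightarrow> (nat \<times> nat \<times> nat \<Rightarrow> real) \<Rightarrow> nat \<times> nat \<times> nat \<Rightarrow> real" where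
  "form_add d P Q = (\<lambda>\<alpha>\<in>exponents d. P \<alpha> + Q \<alpha>)"

lemma rcomb_aff:
  assumes "\<And>\<alpha>. \<alpha> \<in> exponents d \<Longrightarrow> comb d v \<alpha> = Q \<alpha>"
  shows "rcomb d (aff (form_dim d) 1 v t) = form_add d (rcomb d t) Q"
proof -
  have "comb d (aff (form_dim d) 1 v t) \<alpha> = comb d t \<alpha> + comb d v \<alpha>" for \<alpha>
    unfolding comb_def sum.distrib[symmetric] by (intro sum.cong refl) (simp add: algebra_simps)
  then show ?thesis using assms by (auto simp: rcomb_def form_add_def restrict_def)
qed

text \<open>For \<open>B = 0\<close> the weighted sum of the functionals has expectation at most \<open>M / 2\<close>, so the event has
  probability at least \<open>1 / 2\<close> by Markov's inequality, and it is symmetric. The general case is its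
  translate by \<open>B\<close>.\<close>

lemma barrier_probability:
  fixes lin_fun :: "'i \<Rightarrow> (nat \<times> nat \<times> nat \<Rightarrow> real) \<Rightarrow> real" and L :: "'i \<Rightarrow> nat \<times> nat \<times> nat \<Rightarrow> real"
    and B :: "nat \<times> nat \<times> nat \<Rightarrow> real"
  assumes fin: "finite I" and lin: "\<And>i P. i \<in> I \<Longrightarrow> lin_fun i P = (\<Sum>\<alpha>\<in>exponents d. L i \<alpha> * P \<alpha>)"
    and bd: "\<And>i P. i \<in> I \<Longrightarrow> \<bar>lin_fun i P\<bar> \<le> c i * real_l2_norm d P"
    and c: "\<And>i. i \<in> I \<Longrightarrow> c i > 0" and a: "\<And>i. i \<in> I \<Longrightarrow> a i \<ge> 0"
    and M: "6 * (\<Sum>i\<in>I. a i * c i) \<le> M" "M > 0"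
  defines "E \<equiv> {P \<in> space (forms d). (\<Sum>i\<in>I. a i * \<bar>lin_fun i (\<lambda>\<alpha>. P \<alpha> - B \<alpha>)\<bar>) \<le> M}"
  shows "E \<in> sets (forms d)" "emeasure (kostlan d) E \<ge> ennreal (exp (- (real_l2_norm d B)\<^sup>2) / 2)"
proof -
  let ?N = "form_dim d"
  have ml: "(\<lambda>P. lin_fun i (\<lambda>\<alpha>. P \<alpha> - Q \<alpha>)) \<in> borel_measurable (forms d)" if "i \<in> I" for i Q
    unfolding lin[OF that] by (intro borel_measurable_sum borel_measurable_times borel_measurable_diff borel_measurable_const measurable_form_coord)
  have mE: "(\<lambda>P. \<Sum>i\<in>I. a i * \<bar>lin_fun i (\<lambda>\<alpha>. P \<alpha> - Q \<alpha>)\<bar>) \<in> borel_measurable (forms d)" for Q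
    by (intro borel_measurable_sum borel_measurable_times borel_measurable_abs ml) auto
  show E: "E \<in> sets (forms d)" unfolding E_def
    using mE[of B] by measurable
  obtain v where v: "\<And>\<alpha>. \<alpha> \<in> exponents d \<Longrightarrow> comb d v \<alpha> = B \<alpha>" "(\<Sum>m<?N. (v m)\<^sup>2) = (real_l2_norm d B)\<^sup>2"
    by (rule comb_surj[of d B]) blast
  define f where "f t = (\<Sum>i\<in>I. a i * \<bar>lin_fun i (comb d t)\<bar>)" for t
  define S where "S = {t \<in> space (lam ?N). f t \<le> M}"
  define \<beta> where "\<beta> i m = lin_fun i (onb d m)" for i m
  have lc: "lin_fun i (comb d t) = (\<Sum>m<?N. t m * \<beta> i m)" if "i \<in> I" for i t
    unfolding lin[OF that] \<beta>_def comb_def sum_distrib_left by (subst sum.swap) (simp add: mult_ac)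
  have \<beta>: "(\<Sum>m<?N. (\<beta> i m)\<^sup>2) \<le> (c i)\<^sup>2" if i: "i \<in> I" for i
  proof -
    let ?s = "\<Sum>m<?N. (\<beta> i m)\<^sup>2"
    have s0: "?s \<ge> 0" by (intro sum_nonneg) simp
    have n: "real_l2_norm d (comb d (\<beta> i)) = sqrt ?s"
      using norm_comb[of d "\<beta> i"] real_l2_norm_nonneg[of d "comb d (\<beta> i)"] by (simp add: real_sqrt_unique)
    have "?s = lin_fun i (comb d (\<beta> i))" unfolding lc[OF i] by (simp add: power2_eq_square)
    also have "\<dots> \<le> c i * sqrt ?s" using bd[OF i, of "comb d (\<beta> i)"] unfolding n by linarith
    finally have "sqrt ?s * sqrt ?s \<le> c i * sqrt ?s" using s0 by simp
    then have "sqrt ?s \<le> c i"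
    proof (cases "?s = 0")
      case False
      then have "0 < sqrt ?s" using s0 by simp
      with \<open>sqrt ?s * sqrt ?s \<le> c i * sqrt ?s\<close> show ?thesis by (rule mult_right_le_imp_le)
    qed (use c[OF i] in simp)
    then have "(sqrt ?s)\<^sup>2 \<le> (c i)\<^sup>2" using s0 by (intro power_mono) auto
    then show ?thesis using s0 by simp
  qed
  have mlc: "(\<lambda>t. \<Sum>m<?N. t m * \<beta> i m) \<in> borel_measurable (lam ?N)" for i
    by (intro borel_measurable_sum borel_measurable_times borel_measurable_const measurable_coord) simp
  have mf: "f \<in> borel_measurable (lam ?N)"
    unfolding f_def[abs_def] using mlc lc by (auto intro!: borel_measurable_sum borel_measurable_times borel_measurable_abs cong: measurable_cong)
  have S: "S \<in> sets (lam ?N)" unfolding S_def using mf by measurable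
  have "(\<integral>\<^sup>+t. ennreal (gw ?N t * f t) \<partial>lam ?N) = (\<integral>\<^sup>+t. (\<Sum>i\<in>I. ennreal (a i) * ennreal (gw ?N t * \<bar>\<Sum>m<?N. t m * \<beta> i m\<bar>)) \<partial>lam ?N)"
  proof (rule nn_integral_cong)
    fix t
    have "gw ?N t * f t = (\<Sum>i\<in>I. a i * (gw ?N t * \<bar>\<Sum>m<?N. t m * \<beta> i m\<bar>))"
      unfolding f_def sum_distrib_left by (intro sum.cong refl) (simp add: lc mult_ac)
    also have "ennreal \<dots> = (\<Sum>i\<in>I. ennreal (a i * (gw ?N t * \<bar>\<Sum>m<?N. t m * \<beta> i m\<bar>)))"
      by (rule sum_ennreal[symmetric]) (use a gw_pos[of ?N t] in \<open>auto intro!: mult_nonneg_nonneg\<close>)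
    also have "\<dots> = (\<Sum>i\<in>I. ennreal (a i) * ennreal (gw ?N t * \<bar>\<Sum>m<?N. t m * \<beta> i m\<bar>))"
      by (intro sum.cong refl ennreal_mult) (use a gw_pos[of ?N t] in \<open>auto intro!: mult_nonneg_nonneg\<close>)
    finally show "ennreal (gw ?N t * f t) = (\<Sum>i\<in>I. ennreal (a i) * ennreal (gw ?N t * \<bar>\<Sum>m<?N. t m * \<beta> i m\<bar>))" .
  qed
  also have "\<dots> = (\<Sum>i\<in>I. \<integral>\<^sup>+t. ennreal (a i) * ennreal (gw ?N t * \<bar>\<Sum>m<?N. t m * \<beta> i m\<bar>) \<partial>lam ?N)"
    by (rule nn_integral_sum) (use mlc in measurable)
  also have "\<dots> \<le> (\<Sum>i\<in>I. ennreal (a i * (3 * c i)))"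
  proof (rule sum_mono)
    fix i assume i: "i \<in> I"
    have "(\<integral>\<^sup>+t. ennreal (a i) * ennreal (gw ?N t * \<bar>\<Sum>m<?N. t m * \<beta> i m\<bar>) \<partial>lam ?N)
       = ennreal (a i) * (\<integral>\<^sup>+t. ennreal (gw ?N t * \<bar>\<Sum>m<?N. t m * \<beta> i m\<bar>) \<partial>lam ?N)"
      by (rule nn_integral_cmult) (use mlc in measurable)
    also have "\<dots> \<le> ennreal (a i) * ennreal (3 * c i)"
      by (intro mult_left_mono gaussian_abs_le c[OF i] \<beta>[OF i]) simp
    also have "\<dots> = ennreal (a i * (3 * c i))" using a[OF i] c[OF i] by (simp add: ennreal_mult)
    finally show "(\<integral>\<^sup>+t. ennreal (a i) * ennreal (gw ?N t * \<bar>\<Sum>m<?N. t m * \<beta> i m\<bar>) \<partial>lam ?N) \<le> ennreal (a i * (3 * c i))" .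
  qed
  also have "\<dots> = ennreal (\<Sum>i\<in>I. a i * (3 * c i))"
    by (rule sum_ennreal) (use a c in \<open>auto intro!: mult_nonneg_nonneg simp: less_imp_le\<close>)
  also have "\<dots> \<le> ennreal (M / 2)"
    using M(1) by (intro ennreal_leI) (simp add: sum_distrib_left[symmetric] mult.left_commute[of _ 3])
  finally have Ef: "(\<integral>\<^sup>+t. ennreal (gw ?N t * f t) \<partial>lam ?N) \<le> ennreal (M / 2)" .
  have f0: "f t \<ge> 0" for t unfolding f_def using a by (intro sum_nonneg mult_nonneg_nonneg) auto
  have mS: "(\<lambda>t. ennreal (gw ?N t) * indicator S t) \<in> borel_measurable (lam ?N)" using S by measurable
  have "1 = (\<integral>\<^sup>+t. ennreal (gw ?N t) \<partial>lam ?N)" by (simp add: gw_total)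
  also have "\<dots> \<le> (\<integral>\<^sup>+t. ennreal (gw ?N t) * indicator S t + ennreal (1 / M) * ennreal (gw ?N t * f t) \<partial>lam ?N)"
  proof (rule nn_integral_mono)
    fix t assume t: "t \<in> space (lam ?N)"
    show "ennreal (gw ?N t) \<le> ennreal (gw ?N t) * indicator S t + ennreal (1 / M) * ennreal (gw ?N t * f t)"
    proof (cases "t \<in> S")
      case False
      then have "M \<le> f t" using t by (simp add: S_def)
      then have "gw ?N t * 1 \<le> gw ?N t * (1 / M * f t)"
        using M(2) by (intro mult_left_mono) (simp_all add: field_simps gw_pos less_imp_le)
      then have "ennreal (gw ?N t) \<le> ennreal (1 / M * (gw ?N t * f t))" by (intro ennreal_leI) (simp add: mult_ac)
      also have "\<dots> = ennreal (1 / M) * ennreal (gw ?N t * f t)"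
        using M(2) f0[of t] gw_pos[of ?N t] by (intro ennreal_mult) simp_all
      finally show ?thesis using False by simp
    qed simp
  qed
  also have "\<dots> = (\<integral>\<^sup>+t. ennreal (gw ?N t) * indicator S t \<partial>lam ?N) + ennreal (1 / M) * (\<integral>\<^sup>+t. ennreal (gw ?N t * f t) \<partial>lam ?N)"
    using mS mf by (simp add: nn_integral_add nn_integral_cmult)
  also have "\<dots> \<le> (\<integral>\<^sup>+t. ennreal (gw ?N t) * indicator S t \<partial>lam ?N) + ennreal (1 / M) * ennreal (M / 2)"
    by (intro add_left_mono mult_left_mono Ef) simp
  also have "ennreal (1 / M) * ennreal (M / 2) = ennreal (1 / 2)"
    using M(2) by (simp add: ennreal_mult[symmetric])
  finally have half: "1 \<le> (\<integral>\<^sup>+t. ennreal (gw ?N t) * indicator S t \<partial>lam ?N) + ennreal (1 / 2)" .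
  have half': "ennreal (1 / 2) \<le> (\<integral>\<^sup>+t. ennreal (gw ?N t) * indicator S t \<partial>lam ?N)"
  proof -
    have "ennreal (1 / 2) + ennreal (1 / 2) = ennreal 1" by (subst ennreal_plus[symmetric]) auto
    then have "ennreal (1 / 2) + ennreal (1 / 2) \<le> (\<integral>\<^sup>+t. ennreal (gw ?N t) * indicator S t \<partial>lam ?N) + ennreal (1 / 2)"
      using half by simp
    then show ?thesis by (simp add: ennreal_add_left_cancel_le add.commute)
  qed
  have sym: "aff ?N (-1) (\<lambda>_. 0) t \<in> S" if "t \<in> S" for t
  proof -
    have "f (aff ?N (-1) (\<lambda>_. 0) t) = f t" unfolding f_def
    proof (intro sum.cong refl)
      fix i assume i: "i \<in> I"
      have "(\<Sum>m<?N. aff ?N (-1) (\<lambda>_. 0) t m * \<beta> i m) = - (\<Sum>m<?N. t m * \<beta> i m)"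
        unfolding sum_negf[symmetric] by (intro sum.cong refl) simp
      then show "a i * \<bar>lin_fun i (comb d (aff ?N (-1) (\<lambda>_. 0) t))\<bar> = a i * \<bar>lin_fun i (comb d t)\<bar>" unfolding lc[OF i] by simp
    qed
    then show ?thesis using that by (simp add: S_def aff_def space_PiM)
  qed
  have SE: "aff ?N 1 (\<lambda>m. - v m) t \<in> S \<Longrightarrow> rcomb d t \<in> E" if t: "t \<in> space (lam ?N)" for t
  proof -
    assume s: "aff ?N 1 (\<lambda>m. - v m) t \<in> S"
    have "lin_fun i (comb d (aff ?N 1 (\<lambda>m. - v m) t)) = lin_fun i (\<lambda>\<alpha>. rcomb d t \<alpha> - B \<alpha>)" if "i \<in> I" for i
    proof -
      have "comb d (aff ?N 1 (\<lambda>m. - v m) t) \<alpha> = rcomb d t \<alpha> - B \<alpha>" if a: "\<alpha> \<in> exponents d" for \<alpha>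
      proof -
        have "comb d (aff ?N 1 (\<lambda>m. - v m) t) \<alpha> = comb d t \<alpha> - comb d v \<alpha>"
          unfolding comb_def sum_subtractf[symmetric] by (intro sum.cong refl) (simp add: algebra_simps)
        then show ?thesis using a v(1) by (simp add: rcomb_def)
      qed
      then show ?thesis unfolding lin[OF that] by simp
    qed
    moreover have "rcomb d t \<in> space (forms d)" using measurable_space[OF measurable_rcomb t] .
    ultimately show "rcomb d t \<in> E" using s by (simp add: E_def S_def f_def)
  qed
  have "ennreal (exp (- (real_l2_norm d B)\<^sup>2) / 2) = ennreal (exp (- (\<Sum>m<?N. (v m)\<^sup>2))) * ennreal (1 / 2)"
    by (subst ennreal_mult[symmetric]) (simp_all add: v(2))
  also have "\<dots> \<le> ennreal (exp (- (\<Sum>m<?N. (v m)\<^sup>2))) * (\<integral>\<^sup>+t. ennreal (gw ?N t) * indicator S t \<partial>lam ?N)"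
    by (intro mult_left_mono half') simp
  also have "\<dots> \<le> (\<integral>\<^sup>+t. ennreal (gw ?N t) * indicator S (aff ?N 1 (\<lambda>m. - v m) t) \<partial>lam ?N)"
    by (rule gaussian_shift_symmetric[OF S sym])
  also have "\<dots> \<le> (\<integral>\<^sup>+t. ennreal (gw ?N t) * indicator E (rcomb d t) \<partial>lam ?N)"
    by (intro nn_integral_mono mult_left_mono) (use SE in \<open>auto simp: indicator_def\<close>)
  also have "\<dots> = emeasure (kostlan d) E" by (rule emeasure_kostlan[OF E, symmetric])
  finally show "emeasure (kostlan d) E \<ge> ennreal (exp (- (real_l2_norm d B)\<^sup>2) / 2)" .
qed

text \<open>Let \<open>\<mu>\<close> be the Lebesgue measure of the set. By Fubini, integrating the measures of its translates by
  the span of three forms over the three parameters gives 0, because each fibre is null. But each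
  translate has measure \<open>\<mu>\<close>, so the integral is \<open>\<mu> * \<infinity>\<close>, and \<open>\<mu> = 0\<close>.\<close>

lemma kostlan_null_of_translates:
  fixes Q1 Q2 Q3 :: "nat \<times> nat \<times> nat \<Rightarrow> real"
  assumes E: "E \<in> sets (forms d)"
    and null: "\<And>P. AE x in (lborel :: (real \<times> real \<times> real) measure).
       form_add d P (\<lambda>\<alpha>. fst x * Q1 \<alpha> + fst (snd x) * Q2 \<alpha> + snd (snd x) * Q3 \<alpha>) \<notin> E"
  shows "E \<in> null_sets (kostlan d)"
proof -
  let ?N = "form_dim d"
  obtain v1 where v1: "\<And>\<alpha>. \<alpha> \<in> exponents d \<Longrightarrow> comb d v1 \<alpha> = Q1 \<alpha>" by (rule comb_surj[of d Q1]) blast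
  obtain v2 where v2: "\<And>\<alpha>. \<alpha> \<in> exponents d \<Longrightarrow> comb d v2 \<alpha> = Q2 \<alpha>" by (rule comb_surj[of d Q2]) blast
  obtain v3 where v3: "\<And>\<alpha>. \<alpha> \<in> exponents d \<Longrightarrow> comb d v3 \<alpha> = Q3 \<alpha>" by (rule comb_surj[of d Q3]) blast
  define V :: "real \<times> real \<times> real \<Rightarrow> nat \<Rightarrow> real" where "V x m = fst x * v1 m + fst (snd x) * v2 m + snd (snd x) * v3 m" for x m
  define Q where "Q x \<alpha> = fst x * Q1 \<alpha> + fst (snd x) * Q2 \<alpha> + snd (snd x) * Q3 \<alpha>" for x :: "real \<times> real \<times> real" and \<alpha>
  have VQ: "comb d (V x) \<alpha> = Q x \<alpha>" if "\<alpha> \<in> exponents d" for x \<alpha>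
  proof -
    have "comb d (V x) \<alpha> = fst x * comb d v1 \<alpha> + fst (snd x) * comb d v2 \<alpha> + snd (snd x) * comb d v3 \<alpha>"
      unfolding comb_def V_def sum_distrib_left sum.distrib[symmetric] by (intro sum.cong refl) (simp add: algebra_simps)
    then show ?thesis by (simp add: Q_def v1 v2 v3 that)
  qed
  let ?h = "\<lambda>t x. indicator E (rcomb d (aff ?N 1 (V x) t)) :: ennreal"
  have mj: "(\<lambda>p. aff ?N 1 (V (snd p)) (fst p)) \<in> measurable (lam ?N \<Otimes>\<^sub>M lborel) (lam ?N)"
    unfolding aff_def
  proof (rule measurable_restrict)
    fix m assume "m \<in> {..<?N}"
    then have "(\<lambda>p. fst p m) \<in> borel_measurable (lam ?N \<Otimes>\<^sub>M (lborel :: (real \<times> real \<times> real) measure))"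
      by (intro measurable_compose[OF measurable_fst measurable_coord]) simp
    moreover have "(\<lambda>x. V x m) \<in> borel_measurable (lborel :: (real \<times> real \<times> real) measure)"
      unfolding V_def by (simp, intro borel_measurable_continuous_onI continuous_intros)
    then have "(\<lambda>p. V (snd p) m) \<in> borel_measurable (lam ?N \<Otimes>\<^sub>M (lborel :: (real \<times> real \<times> real) measure))"
      by (rule measurable_compose[OF measurable_snd])
    ultimately have "(\<lambda>p. 1 * fst p m + V (snd p) m) \<in> borel_measurable (lam ?N \<Otimes>\<^sub>M (lborel :: (real \<times> real \<times> real) measure))"
      by (intro borel_measurable_add borel_measurable_times borel_measurable_const)
    then show "(\<lambda>p. 1 * fst p m + V (snd p) m) \<in> measurable (lam ?N \<Otimes>\<^sub>M (lborel :: (real \<times> real \<times> real) measure)) lborel" by simp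
  qed
  have mh: "(\<lambda>(t, x). ?h t x) \<in> borel_measurable (lam ?N \<Otimes>\<^sub>M lborel)"
    using measurable_compose[OF measurable_compose[OF mj measurable_rcomb] borel_measurable_indicator[OF E]]
    by (simp add: case_prod_unfold)
  interpret P: pair_sigma_finite "lam ?N" "lborel :: (real \<times> real \<times> real) measure"
    using lb.sigma_finite[of "{..<?N}"] lborel.sigma_finite_measure_axioms by (simp add: pair_sigma_finite_def)
  define \<mu> where "\<mu> = (\<integral>\<^sup>+t. indicator E (rcomb d t) \<partial>lam ?N)"
  have mE: "(\<lambda>t. indicator E (rcomb d t) :: ennreal) \<in> borel_measurable (lam ?N)"
    by (rule measurable_compose[OF measurable_rcomb borel_measurable_indicator[OF E]])
  have "(\<integral>\<^sup>+x. \<integral>\<^sup>+t. ?h t x \<partial>lam ?N \<partial>lborel) = (\<integral>\<^sup>+t. \<integral>\<^sup>+x. ?h t x \<partial>lborel \<partial>lam ?N)"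
    by (rule P.Fubini'[OF mh])
  also have "\<dots> = (\<integral>\<^sup>+t. 0 \<partial>lam ?N)"
  proof (rule nn_integral_cong)
    fix t
    have e: "rcomb d (aff ?N 1 (V x) t) = form_add d (rcomb d t) (Q x)" for x by (rule rcomb_aff) (rule VQ)
    have "(\<integral>\<^sup>+x. ?h t x \<partial>lborel) = (\<integral>\<^sup>+x. 0 \<partial>(lborel :: (real \<times> real \<times> real) measure))"
      by (rule nn_integral_cong_AE) (use null[of "rcomb d t"] in \<open>simp add: e Q_def[abs_def] indicator_def\<close>)
    then show "(\<integral>\<^sup>+x. ?h t x \<partial>lborel) = 0" by simp
  qed
  finally have 0: "(\<integral>\<^sup>+x. \<integral>\<^sup>+t. ?h t x \<partial>lam ?N \<partial>(lborel :: (real \<times> real \<times> real) measure)) = 0" by simp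
  have "(\<integral>\<^sup>+t. ?h t x \<partial>lam ?N) = \<mu>" for x unfolding \<mu>_def by (rule nn_integral_aff[OF _ mE]) simp
  then have "\<mu> * \<infinity> = 0" using 0 by (simp add: emeasure_lborel_UNIV)
  then have "\<mu> = 0" by (simp add: ennreal_mult_eq_top_iff)
  then have "AE t in lam ?N. indicator E (rcomb d t) = (0 :: ennreal)"
    unfolding \<mu>_def by (subst (asm) nn_integral_0_iff_AE[OF mE])
  then have "(\<integral>\<^sup>+t. ennreal (gw ?N t) * indicator E (rcomb d t) \<partial>lam ?N) = (\<integral>\<^sup>+t. 0 \<partial>lam ?N)"
    by (intro nn_integral_cong_AE) auto
  then show ?thesis using emeasure_kostlan[OF E] E by (intro null_setsI) (simp_all add: sets_kostlan)
qed

section \<open>Almost every form is smooth\<close>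

lemma form_eval_real_split:
  fixes P :: "nat \<times> nat \<times> nat \<Rightarrow> real"
  shows "form_eval d P X = (\<Sum>\<alpha>\<in>exponents d. P \<alpha> * ((X$1) ^ fst \<alpha> * (X$2) ^ fst (snd \<alpha>) * (X$3) ^ snd (snd \<alpha>)))"
  unfolding form_eval_def by (intro sum.cong) (auto simp: mult.assoc)

definition xmon :: "nat \<times> nat \<times> nat \<Rightarrow> real^3 \<Rightarrow> real" where
  "xmon \<alpha> X = (X$1) ^ fst \<alpha> * (X$2) ^ fst (snd \<alpha>) * (X$3) ^ snd (snd \<alpha>)"

lemma form_eval_xmon: "form_eval d P X = (\<Sum>\<alpha>\<in>exponents d. P \<alpha> * xmon \<alpha> X)"
  by (simp add: form_eval_real_split xmon_def)

lemma smooth_xmon: "smooth_on UNIV (xmon \<alpha>)"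
  unfolding xmon_def[abs_def] by (intro smooth_on_mult smooth_on_power smooth_on_vec_nth smooth_on_ident open_UNIV)

text \<open>The derivative in the direction \<open>v\<close> of a form in an affine chart \<open>c\<close>, written as a linear function of
  the coefficients, so that it is measurable in the form and smooth in the point.\<close>

definition dform :: "nat \<Rightarrow> (real \<times> real \<Rightarrow> real^3) \<Rightarrow> (nat \<times> nat \<times> nat \<Rightarrow> real) \<Rightarrow> real \<times> real \<Rightarrow> real \<times> real \<Rightarrow> real" where
  "dform d c P v w = (\<Sum>\<alpha>\<in>exponents d. P \<alpha> * frechet_derivative (\<lambda>w. xmon \<alpha> (c w)) (at w) v)"

lemma dform:
  assumes c: "smooth_on UNIV c"
  shows "((\<lambda>w. form_eval d P (c w)) has_derivative (\<lambda>v. dform d c P v w)) (at w)"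
    and "smooth_on UNIV (\<lambda>w. dform d c P v w)" and "smooth_on UNIV (\<lambda>w. form_eval d P (c w))"
proof -
  have s: "smooth_on UNIV (\<lambda>w. xmon \<alpha> (c w))" for \<alpha>
    by (rule smooth_on_compose[OF open_UNIV open_UNIV c smooth_xmon]) simp
  show "((\<lambda>w. form_eval d P (c w)) has_derivative (\<lambda>v. dform d c P v w)) (at w)"
    unfolding form_eval_xmon dform_def
    by (intro has_derivative_sum has_derivative_mult_right smooth_on_has_derivative[OF s]) simp
  show "smooth_on UNIV (\<lambda>w. dform d c P v w)" unfolding dform_def
    by (intro smooth_on_sum smooth_on_mult smooth_on_const smooth_on_frechet_derivative[OF s] open_UNIV)
  show "smooth_on UNIV (\<lambda>w. form_eval d P (c w))" unfolding form_eval_xmon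
    by (intro smooth_on_sum smooth_on_mult smooth_on_const s open_UNIV)
qed

definition sing_chart :: "nat \<Rightarrow> (real \<times> real \<Rightarrow> real^3) \<Rightarrow> (nat \<times> nat \<times> nat \<Rightarrow> real) set" where
  "sing_chart d c = {P \<in> space (forms d). \<exists>w. form_eval d P (c w) = 0 \<and> dform d c P (1, 0) w = 0 \<and> dform d c P (0, 1) w = 0}"

text \<open>The existential quantifier runs over an uncountable set. By compactness a zero of the continuous
  function \<open>g P\<close> in a closed ball exists if and only if \<open>g P\<close> takes arbitrarily small values at points of
  a countable dense set in that ball.\<close>

lemma sing_chart_measurable:
  assumes c: "smooth_on UNIV c" shows "sing_chart d c \<in> sets (forms d)"
proof -
  define g where "g P w = \<bar>form_eval d P (c w)\<bar> + \<bar>dform d c P (1, 0) w\<bar> + \<bar>dform d c P (0, 1) w\<bar>" for P w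
  have cg: "continuous_on UNIV (g P)" for P unfolding g_def
    by (intro continuous_intros smooth_on_imp_continuous_on dform c)
  have mg: "(\<lambda>P. g P w) \<in> borel_measurable (forms d)" for w
    unfolding g_def form_eval_xmon dform_def
    by (intro borel_measurable_add borel_measurable_abs borel_measurable_sum borel_measurable_times borel_measurable_const measurable_form_coord)
  have g0: "g P w = 0 \<longleftrightarrow> form_eval d P (c w) = 0 \<and> dform d c P (1, 0) w = 0 \<and> dform d c P (0, 1) w = 0" for P w
    by (auto simp: g_def add_nonneg_eq_0_iff)
  have gn: "g P w \<ge> 0" for P w by (simp add: g_def)
  obtain D :: "(real \<times> real) set" where D: "countable D" "\<And>X. open X \<Longrightarrow> X \<noteq> {} \<Longrightarrow> \<exists>d\<in>D. d \<in> X"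
    using countable_dense_exists by blast
  have "sing_chart d c = (\<Union>R::nat. \<Inter>k::nat. \<Union>w\<in>D \<inter> ball 0 (real R). {P \<in> space (forms d). g P w < 1 / real (Suc k)})"
  proof (intro set_eqI iffI)
    fix P assume "P \<in> sing_chart d c"
    then obtain w where P: "P \<in> space (forms d)" and w: "g P w = 0" by (auto simp: sing_chart_def g0)
    obtain R :: nat where R: "norm w < real R" using reals_Archimedean2 by blast
    have "\<exists>w'\<in>D \<inter> ball 0 (real R). g P w' < 1 / real (Suc k)" for k
    proof -
      have "open (ball 0 (real R) \<inter> g P -` {..<1 / real (Suc k)})"
        by (intro open_Int open_ball open_vimage cg open_lessThan)
      moreover have "w \<in> ball 0 (real R) \<inter> g P -` {..<1 / real (Suc k)}" using R w by simp
      ultimately show ?thesis using D(2) by blast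
    qed
    then show "P \<in> (\<Union>R::nat. \<Inter>k::nat. \<Union>w\<in>D \<inter> ball 0 (real R). {P \<in> space (forms d). g P w < 1 / real (Suc k)})"
      using P by blast
  next
    fix P assume "P \<in> (\<Union>R::nat. \<Inter>k::nat. \<Union>w\<in>D \<inter> ball 0 (real R). {P \<in> space (forms d). g P w < 1 / real (Suc k)})"
    then obtain R :: nat where R: "\<And>k. \<exists>w\<in>D \<inter> ball 0 (real R). P \<in> space (forms d) \<and> g P w < 1 / real (Suc k)" by auto
    have "\<exists>w0\<in>cball 0 (real R). \<forall>w\<in>cball 0 (real R). g P w0 \<le> g P w"
      by (rule continuous_attains_inf) (use continuous_on_subset[OF cg] in auto)
    then obtain w0 where w0: "\<And>w. w \<in> cball 0 (real R) \<Longrightarrow> g P w0 \<le> g P w" by blast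
    have "g P w0 < 1 / real (Suc k)" for k
    proof -
      obtain w where w: "w \<in> ball 0 (real R)" "g P w < 1 / real (Suc k)" using R[of k] by auto
      then have "g P w0 \<le> g P w" by (intro w0) auto
      then show ?thesis using w by linarith
    qed
    then have "\<not> 0 < g P w0" using nat_approx_posE[of "g P w0"] by (metis less_asym)
    then have "g P w0 = 0" using gn[of P w0] by simp
    moreover have "P \<in> space (forms d)" using R[of 0] by blast
    ultimately show "P \<in> sing_chart d c" unfolding sing_chart_def g0 by blast
  qed
  also have "\<dots> \<in> sets (forms d)"
    by (intro sets.countable_UN sets.countable_INT sets.countable_UN' image_subsetI countable_Int1 D(1) borel_measurable_less mg borel_measurable_const) auto
  finally show ?thesis .
qed

text \<open>Add a combination \<open>x\<^sub>1 q\<^sub>1 + x\<^sub>2 q\<^sub>2 + x\<^sub>3 q\<^sub>3\<close> of the monomials that are \<open>1\<close>, \<open>w\<^sub>1\<close> and \<open>w\<^sub>2\<close> in the chart.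
  If the sum is singular at \<open>w\<close>, the three equations determine \<open>x\<close> as a smooth function of \<open>w\<close>. So
  the bad parameters form the image of a plane in \<open>\<real>\<^sup>3\<close> under a smooth map, which is negligible.\<close>

lemma sing_chart_null:
  assumes c: "smooth_on UNIV c"
    and Q: "q1 \<in> exponents d" "q2 \<in> exponents d" "q3 \<in> exponents d" "q1 \<noteq> q2" "q1 \<noteq> q3" "q2 \<noteq> q3"
    and m: "\<And>w. xmon q1 (c w) = 1" "\<And>w. xmon q2 (c w) = fst w" "\<And>w. xmon q3 (c w) = snd w"
  shows "sing_chart d c \<in> null_sets (kostlan d)"
proof -
  define D where "D q \<alpha> = (if \<alpha> = q then 1 else 0 :: real)" for q \<alpha> :: "nat \<times> nat \<times> nat"
  show ?thesis
  proof (rule kostlan_null_of_translates[OF sing_chart_measurable[OF c], where ?Q1.0 = "D q1" and ?Q2.0 = "D q2" and ?Q3.0 = "D q3"])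
    fix P
    define F where "F w = (- form_eval d P (c w) + fst w * dform d c P (1, 0) w + snd w * dform d c P (0, 1) w,
       - dform d c P (1, 0) w, - dform d c P (0, 1) w)" for w
    have sF: "smooth_on UNIV F" unfolding F_def
      by (intro smooth_on_Pair smooth_on_add smooth_on_mult smooth_on_minus dform c smooth_on_fst smooth_on_snd smooth_on_ident open_UNIV)
    have "F differentiable_on UNIV"
      using smooth_on_has_derivative[OF sF] by (auto simp: differentiable_on_def differentiable_def)
    then have "negligible (F ` UNIV)"
      by (intro negligible_differentiable_image_lowdim) auto
    then have "F ` UNIV \<in> null_sets lebesgue" by (simp add: negligible_iff_null_sets)
    then obtain N where N: "F ` UNIV \<subseteq> N" "N \<in> null_sets lborel"
      by (metis null_sets_completion_iff2)
    have "form_add d P (\<lambda>\<alpha>. fst x * D q1 \<alpha> + fst (snd x) * D q2 \<alpha> + snd (snd x) * D q3 \<alpha>) \<notin> sing_chart d c" if x: "x \<notin> N" for x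
    proof
      let ?P = "form_add d P (\<lambda>\<alpha>. fst x * D q1 \<alpha> + fst (snd x) * D q2 \<alpha> + snd (snd x) * D q3 \<alpha>)"
      assume "?P \<in> sing_chart d c"
      then obtain w where w: "form_eval d ?P (c w) = 0" "dform d c ?P (1, 0) w = 0" "dform d c ?P (0, 1) w = 0"
        by (auto simp: sing_chart_def)
      have sumD: "(\<Sum>\<alpha>\<in>exponents d. D q \<alpha> * h \<alpha>) = h q" if "q \<in> exponents d" for q and h :: "nat \<times> nat \<times> nat \<Rightarrow> real"
        using that unfolding D_def by (simp add: if_distrib[of "\<lambda>z. z * _"] cong: if_cong)
      have lin: "(\<Sum>\<alpha>\<in>exponents d. ?P \<alpha> * h \<alpha>) = (\<Sum>\<alpha>\<in>exponents d. P \<alpha> * h \<alpha>) + fst x * h q1 + fst (snd x) * h q2 + snd (snd x) * h q3" for h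
      proof -
        have "(\<Sum>\<alpha>\<in>exponents d. ?P \<alpha> * h \<alpha>) = (\<Sum>\<alpha>\<in>exponents d. P \<alpha> * h \<alpha> + fst x * (D q1 \<alpha> * h \<alpha>) + fst (snd x) * (D q2 \<alpha> * h \<alpha>) + snd (snd x) * (D q3 \<alpha> * h \<alpha>))"
          by (intro sum.cong refl) (simp add: form_add_def algebra_simps)
        then show ?thesis by (simp add: sum.distrib sum_distrib_left[symmetric] sumD Q)
      qed
      have d1: "frechet_derivative (\<lambda>w. xmon q1 (c w)) (at w) v = 0" for v
        unfolding m by (metis frechet_derivative_const)
      have d2: "frechet_derivative (\<lambda>w. xmon q2 (c w)) (at w) v = fst v" for v
      proof -
        have "(fst has_derivative fst) (at w)" by (rule bounded_linear_imp_has_derivative[OF bounded_linear_fst])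
        then show ?thesis unfolding m using frechet_derivative_at by metis
      qed
      have d3: "frechet_derivative (\<lambda>w. xmon q3 (c w)) (at w) v = snd v" for v
      proof -
        have "(snd has_derivative snd) (at w)" by (rule bounded_linear_imp_has_derivative[OF bounded_linear_snd])
        then show ?thesis unfolding m using frechet_derivative_at by metis
      qed
      have e: "form_eval d P (c w) + fst x + fst (snd x) * fst w + snd (snd x) * snd w = 0"
        "dform d c P (1, 0) w + fst (snd x) = 0" "dform d c P (0, 1) w + snd (snd x) = 0"
        using w unfolding form_eval_xmon dform_def lin unfolding d1 d2 d3 unfolding m by simp_all
      then have x23: "fst (snd x) = - dform d c P (1, 0) w" "snd (snd x) = - dform d c P (0, 1) w" by linarith+
      have "fst x = - form_eval d P (c w) + fst w * dform d c P (1, 0) w + snd w * dform d c P (0, 1) w"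
        using e(1) unfolding x23 by (simp add: mult.commute)
      then have "x = F w" using x23 by (simp add: F_def prod_eq_iff)
      then show False using x N(1) by auto
    qed
    then show "AE x in lborel. form_add d P (\<lambda>\<alpha>. fst x * D q1 \<alpha> + fst (snd x) * D q2 \<alpha> + snd (snd x) * D q3 \<alpha>) \<notin> sing_chart d c"
      by (intro AE_I'[OF N(2)]) auto
  qed
qed

text \<open>Three affine charts cover the projective plane, and a singular zero of a form scales to one in a
  chart.\<close>

lemma AE_smooth:
  assumes d: "d \<ge> 1" shows "AE P in kostlan d. smooth_real_curve d P"
proof -
  define c1 :: "real \<times> real \<Rightarrow> real^3" where "c1 w = vector [1, fst w, snd w]" for w
  define c2 :: "real \<times> real \<Rightarrow> real^3" where "c2 w = vector [fst w, 1, snd w]" for w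
  define c3 :: "real \<times> real \<Rightarrow> real^3" where "c3 w = vector [fst w, snd w, 1]" for w
  have s: "smooth_on UNIV (\<lambda>w :: real \<times> real. 1 :: real)" "smooth_on UNIV (\<lambda>w :: real \<times> real. fst w)"
    "smooth_on UNIV (\<lambda>w :: real \<times> real. snd w)"
    by (auto intro!: smooth_on_const smooth_on_fst smooth_on_snd smooth_on_ident)
  have c: "smooth_on UNIV c1" "smooth_on UNIV c2" "smooth_on UNIV c3"
    unfolding c1_def c2_def c3_def by (intro smooth_on_vector_3 s open_UNIV)+
  have 1: "sing_chart d c1 \<in> null_sets (kostlan d)"
    by (rule sing_chart_null[of c1 "(d, 0, 0)" d "(d - 1, 1, 0)" "(d - 1, 0, 1)"])
      (use d in \<open>auto simp: c exponents_def xmon_def c1_def\<close>)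
  have 2: "sing_chart d c2 \<in> null_sets (kostlan d)"
    by (rule sing_chart_null[of c2 "(0, d, 0)" d "(1, d - 1, 0)" "(0, d - 1, 1)"])
      (use d in \<open>auto simp: c exponents_def xmon_def c2_def\<close>)
  have 3: "sing_chart d c3 \<in> null_sets (kostlan d)"
    by (rule sing_chart_null[of c3 "(0, 0, d)" d "(1, 0, d - 1)" "(0, 1, d - 1)"])
      (use d in \<open>auto simp: c exponents_def xmon_def c3_def\<close>)
  have key: "P \<in> sing_chart d ch" if P: "P \<in> space (forms d)" and x: "x = s *\<^sub>R ch w" "s \<noteq> 0" and ch: "smooth_on UNIV ch"
    and z: "form_eval d P x = 0" and D: "(form_eval d P has_derivative (\<lambda>_. 0)) (at x)" for P ch w s and x :: "real^3"
  proof -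
    have sc: "form_eval d P y = (1 / s ^ d) * form_eval d P (s *\<^sub>R y)" for y :: "real^3"
      using x(2) by (simp add: form_eval_scaleR)
    have "((\<lambda>y. s *\<^sub>R y) has_derivative (\<lambda>y. s *\<^sub>R y)) (at (ch w))" by (intro derivative_eq_intros) auto
    from has_derivative_compose[OF this, of "form_eval d P" "\<lambda>_. 0"] D x(1)
    have "((\<lambda>y. form_eval d P (s *\<^sub>R y)) has_derivative (\<lambda>_. 0)) (at (ch w))" by simp
    then have "((\<lambda>y. (1 / s ^ d) * form_eval d P (s *\<^sub>R y)) has_derivative (\<lambda>h. (1 / s ^ d) * 0)) (at (ch w))"
      by (rule has_derivative_mult_right)
    then have "(form_eval d P has_derivative (\<lambda>_. 0)) (at (ch w))" unfolding sc[symmetric] by simp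
    then have "((\<lambda>w. form_eval d P (ch w)) has_derivative (\<lambda>_. 0)) (at w)"
      using has_derivative_compose[OF smooth_on_has_derivative[OF ch UNIV_I]] by blast
    then have "(\<lambda>v. dform d ch P v w) = (\<lambda>_. 0)"
      using dform(1)[OF ch] has_derivative_unique by blast
    then have "dform d ch P v w = 0" for v by metis
    moreover have "form_eval d P (ch w) = 0" using sc[of "ch w"] z x(1) by simp
    ultimately show ?thesis using P unfolding sing_chart_def by blast
  qed
  have "smooth_real_curve d P" if P: "P \<in> space (forms d)" "P \<notin> sing_chart d c1" "P \<notin> sing_chart d c2" "P \<notin> sing_chart d c3" for P
    unfolding smooth_real_curve_def
  proof (intro allI impI notI)
    fix x :: "real^3" assume x: "x \<noteq> 0" "form_eval d P x = 0" "(form_eval d P has_derivative (\<lambda>_. 0)) (at x)"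
    then consider "x$1 \<noteq> 0" | "x$2 \<noteq> 0" | "x$3 \<noteq> 0" by (auto simp: vec_eq_iff forall_3)
    then show False
    proof cases
      case 1
      then have "x = x$1 *\<^sub>R c1 (x$2 / x$1, x$3 / x$1)" by (auto simp: c1_def vec_eq_iff forall_3)
      then show False using key[OF P(1) _ 1 c(1) x(2,3)] P(2) by blast
    next
      case 2
      then have "x = x$2 *\<^sub>R c2 (x$1 / x$2, x$3 / x$2)" by (auto simp: c2_def vec_eq_iff forall_3)
      then show False using key[OF P(1) _ 2 c(2) x(2,3)] P(3) by blast
    next
      case 3
      then have "x = x$3 *\<^sub>R c3 (x$1 / x$3, x$2 / x$3)" by (auto simp: c3_def vec_eq_iff forall_3)
      then show False using key[OF P(1) _ 3 c(3) x(2,3)] P(4) by blast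
    qed
  qed
  then show ?thesis
    by (intro AE_I'[OF null_sets.Un[OF null_sets.Un[OF 1 2] 3]]) (auto simp: space_kostlan)
qed

section \<open>Smooth curves have finitely many components\<close>

text \<open>A local diffeomorphism straightens the level set to a hyperplane, whose intersection with a ball is
  convex, hence connected.\<close>

lemma smooth_level_locally_connected:
  fixes F :: "'a::euclidean_space \<Rightarrow> real"
  assumes F: "smooth_on UNIV F" and z: "F x = 0" and D: "\<not> (F has_derivative (\<lambda>_. 0)) (at x)"
    and W: "open W" "x \<in> W"
  obtains N where "open N" "x \<in> N" "N \<subseteq> W" "connected (N \<inter> {y. F y = 0})"
proof -
  let ?D = "frechet_derivative F (at x)"
  have hd: "(F has_derivative ?D) (at x)" using smooth_on_has_derivative[OF F UNIV_I] .
  have lin: "linear ?D" using hd has_derivative_linear by blast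
  obtain v where v: "?D v \<noteq> 0"
  proof (rule ccontr)
    assume "\<not> thesis"
    then have "?D = (\<lambda>_. 0)" using that by blast
    then show False using hd D by simp
  qed
  define e where "e = (1 / ?D v) *\<^sub>R v"
  have e: "?D e = 1" using v by (simp add: e_def linear_cmul[OF lin])
  (* G straightens the level set: F becomes the linear function ?D. *)
  define G where "G y = (y - x) + (F y - ?D (y - x)) *\<^sub>R e" for y
  have bl: "bounded_linear ?D" using hd has_derivative_bounded_linear by blast
  have sG: "smooth_on UNIV G" unfolding G_def
    by (intro smooth_on_add smooth_on_diff smooth_on_scaleR smooth_on_const smooth_on_ident F open_UNIV
        smooth_on_bounded_linear[OF open_UNIV bl])
  have "(G has_derivative (\<lambda>h. (h - 0) + ((?D h - ?D (h - 0)) *\<^sub>R e))) (at x)" unfolding G_def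
    by (intro has_derivative_add has_derivative_diff has_derivative_ident has_derivative_const has_derivative_scaleR_left hd
        bounded_linear.has_derivative[OF bl])
  then have "(G has_derivative (\<lambda>h. h)) (at x)" by simp
  then have "frechet_derivative G (at x) = (\<lambda>h. h)" using frechet_derivative_at by metis
  then have "inj (frechet_derivative G (at x))" by (simp add: inj_def)
  from smooth_local_inverse[OF sG this] obtain U V g where
    g: "open U" "x \<in> U" "open V" "G x \<in> V" "homeomorphism U V G g" "\<And>y. y \<in> V \<Longrightarrow> g differentiable (at y)" by blast
  have Gx: "G x = 0" using z lin by (simp add: G_def linear_0)
  have cg: "continuous_on V g" using g(5) by (simp add: homeomorphism_def)
  have "open (V \<inter> g -` W)" by (rule continuous_open_preimage[OF cg g(3) W(1)])
  moreover have "g 0 = x" using homeomorphism_apply1[OF g(5) g(2)] Gx by simp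
  then have "0 \<in> V \<inter> g -` W" using g(4) Gx W(2) by simp
  ultimately obtain r where r: "r > 0" "ball 0 r \<subseteq> V \<inter> g -` W" by (metis open_contains_ball)
  have DG: "?D (G y) = F y" for y
    by (simp add: G_def linear_add[OF lin] linear_cmul[OF lin] e)
  have img: "g ` ball 0 r = U \<inter> G -` ball 0 r"
  proof (intro set_eqI iffI)
    fix y assume "y \<in> g ` ball 0 r"
    then obtain u where u: "u \<in> ball 0 r" "y = g u" by auto
    then have "u \<in> V" using r by auto
    then show "y \<in> U \<inter> G -` ball 0 r" using u homeomorphism_apply2[OF g(5)] homeomorphism_image2[OF g(5)] by auto
  next
    fix y assume "y \<in> U \<inter> G -` ball 0 r"
    then show "y \<in> g ` ball 0 r" using homeomorphism_apply1[OF g(5), of y] by (intro image_eqI[of _ _ "G y"]) auto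
  qed
  define N where "N = U \<inter> G -` ball 0 r"
  have "open N" unfolding N_def
    by (intro open_Int g(1) open_vimage open_ball smooth_on_imp_continuous_on[OF sG])
  moreover have "x \<in> N" using g(2) r Gx by (simp add: N_def)
  moreover have "N \<subseteq> W" unfolding N_def img[symmetric] using r(2) by auto
  moreover have "connected (N \<inter> {y. F y = 0})"
  proof -
    have "N \<inter> {y. F y = 0} = g ` (ball 0 r \<inter> {u. ?D u = 0})"
    proof (intro set_eqI iffI)
      fix y assume y: "y \<in> N \<inter> {y. F y = 0}"
      then have "G y \<in> ball 0 r \<inter> {u. ?D u = 0}" by (simp add: N_def DG)
      moreover have "y = g (G y)" using y homeomorphism_apply1[OF g(5), of y] by (simp add: N_def)
      ultimately show "y \<in> g ` (ball 0 r \<inter> {u. ?D u = 0})" by blast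
    next
      fix y assume "y \<in> g ` (ball 0 r \<inter> {u. ?D u = 0})"
      then obtain u where u: "u \<in> ball 0 r" "?D u = 0" "y = g u" by auto
      have "u \<in> V" using u r by auto
      then have "G y = u" using homeomorphism_apply2[OF g(5)] u by simp
      then have "F y = 0" using DG[of y] u by simp
      moreover have "y \<in> N" unfolding N_def img[symmetric] using u by blast
      ultimately show "y \<in> N \<inter> {y. F y = 0}" by simp
    qed
    moreover have "convex (ball 0 r \<inter> {u. ?D u = 0})"
    proof (rule convex_Int[OF convex_ball])
      have "subspace {u. ?D u = 0}"
        unfolding subspace_def using linear_0[OF lin] linear_add[OF lin] linear_cmul[OF lin] by simp
      then show "convex {u. ?D u = 0}" by (rule subspace_imp_convex)
    qed
    moreover have "continuous_on (ball 0 r \<inter> {u. ?D u = 0}) g"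
      by (rule continuous_on_subset[OF cg]) (use r(2) in auto)
    ultimately show ?thesis using connected_continuous_image convex_connected by metis
  qed
  ultimately show thesis using that by blast
qed

text \<open>The zero locus on the unit sphere is compact and covered by open sets that meet the cone over the
  curve in connected sets. Finitely many of them suffice, and each meets one component only.\<close>

lemma finite_components_smooth:
  assumes sm: "smooth_real_curve d P"
  shows "finite (components (real_curve d P))"
proof -
  let ?F = "form_eval d P :: real^3 \<Rightarrow> real"
  define K where "K = sphere 0 1 \<inter> {y :: real^3. ?F y = 0}"
  have "closed {y :: real^3. ?F y = 0}"
    using continuous_closed_vimage[of "{0}" ?F] smooth_on_imp_continuous_on[OF smooth_form_eval]
    by (simp add: vimage_def continuous_on_eq_continuous_at)
  then have K: "compact K" unfolding K_def by (intro compact_Int_closed compact_sphere)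
  have "\<exists>N. open N \<and> x \<in> N \<and> 0 \<notin> N \<and> connected (N \<inter> {y. ?F y = 0})" if x: "x \<in> K" for x
  proof -
    have x0: "x \<noteq> 0" "?F x = 0" using x by (auto simp: K_def)
    have "\<not> (?F has_derivative (\<lambda>_. 0)) (at x)" using sm x0 by (simp add: smooth_real_curve_def)
    from smooth_level_locally_connected[OF smooth_form_eval x0(2) this, of "- {0}"]
    obtain M where "open M" "x \<in> M" "M \<subseteq> - {0}" "connected (M \<inter> {y. ?F y = 0})"
      using x0(1) open_Compl[OF closed_singleton] by blast
    then show ?thesis by blast
  qed
  then obtain N where N: "\<And>x. x \<in> K \<Longrightarrow> open (N x) \<and> x \<in> N x \<and> 0 \<notin> N x \<and> connected (N x \<inter> {y. ?F y = 0})" by metis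
  have "K \<subseteq> \<Union> (N ` K)" using N by blast
  then obtain T where T: "T \<subseteq> K" "finite T" "K \<subseteq> \<Union> (N ` T)"
    using compactE_image[OF K, of K N] N by (metis (no_types, lifting))
  define W where "W x = rp2_point ` (N x \<inter> {y. ?F y = 0})" for x
  have Wc: "connected (W x)" if "x \<in> T" for x
  proof -
    have "continuous_on (N x \<inter> {y. ?F y = 0}) rp2_point"
      by (rule continuous_on_subset[OF continuous_on_rp2_point]) (use N T that in auto)
    then show ?thesis unfolding W_def using N T that by (intro connected_continuous_image) auto
  qed
  have Wsub: "W x \<subseteq> real_curve d P" if "x \<in> T" for x
    using N T that unfolding W_def real_curve_def by blast
  have "\<exists>x\<in>T. W x \<inter> C \<noteq> {} \<and> W x \<subseteq> C" if C: "C \<in> components (real_curve d P)" for C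
  proof -
    obtain L where L: "L \<in> C" using in_components_nonempty[OF C] by blast
    then have "L \<in> real_curve d P" using in_components_subset[OF C] by blast
    then obtain y where y: "y \<noteq> 0" "?F y = 0" "L = rp2_point y" by (auto simp: real_curve_def)
    let ?y = "(1 / norm y) *\<^sub>R y"
    have "?y \<in> K" using y by (simp add: K_def form_eval_scaleR)
    then obtain x where x: "x \<in> T" "?y \<in> N x" using T by blast
    have "L = rp2_point ?y" using y rp2_point_scaleR[of y "1 / norm y"] by simp
    then have LW: "L \<in> W x" unfolding W_def using x(2) y by (auto simp: form_eval_scaleR intro!: image_eqI[of _ _ ?y])
    then have "W x \<subseteq> C"
      using components_maximal[OF C Wc[OF x(1)] Wsub[OF x(1)]] L by blast
    then show ?thesis using x LW L by blast
  qed
  then obtain \<xi> where \<xi>: "\<And>C. C \<in> components (real_curve d P) \<Longrightarrow> \<xi> C \<in> T \<and> W (\<xi> C) \<inter> C \<noteq> {} \<and> W (\<xi> C) \<subseteq> C" by metis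
  have "inj_on \<xi> (components (real_curve d P))"
  proof (rule inj_onI)
    fix C D assume CD: "C \<in> components (real_curve d P)" "D \<in> components (real_curve d P)" "\<xi> C = \<xi> D"
    then have "C \<inter> D \<noteq> {}" using \<xi>[OF CD(1)] \<xi>[OF CD(2)] by auto
    then show "C = D" using components_eq[OF CD(1,2)] by simp
  qed
  moreover have "\<xi> ` components (real_curve d P) \<subseteq> T" using \<xi> by blast
  ultimately show ?thesis using T(2) by (metis finite_imageD finite_subset)
qed

section \<open>Substitutions in forms\<close>

abbreviation cx :: "(nat \<times> nat \<times> nat \<Rightarrow> real) \<Rightarrow> nat \<times> nat \<times> nat \<Rightarrow> complex" where
  "cx P \<equiv> \<lambda>\<alpha>. of_real (P \<alpha>)"

definition cmon :: "nat \<times> nat \<times> nat \<Rightarrow> complex^3 \<Rightarrow> complex" where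
  "cmon \<alpha> X = (X$1) ^ fst \<alpha> * (X$2) ^ fst (snd \<alpha>) * (X$3) ^ snd (snd \<alpha>)"

lemma form_eval_cmon: "form_eval d P X = (\<Sum>\<alpha>\<in>exponents d. P \<alpha> * cmon \<alpha> X)"
  unfolding form_eval_split cmon_def by (intro sum.cong refl) (simp add: mult.assoc)

text \<open>Functions given by forms with real coefficients. Closure under sums and products shows that
  substitutions and the barrier are forms, without writing down their coefficients.\<close>

definition is_form :: "nat \<Rightarrow> (complex^3 \<Rightarrow> complex) \<Rightarrow> bool" where
  "is_form d F \<longleftrightarrow> (\<exists>P. \<forall>X. F X = form_eval d (cx P) X)"

lemma is_form_add: "is_form d F \<Longrightarrow> is_form d G \<Longrightarrow> is_form d (\<lambda>X. F X + G X)"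
  unfolding is_form_def form_eval_cmon
proof (elim exE)
  fix P Q assume "\<forall>X. F X = (\<Sum>\<alpha>\<in>exponents d. cx P \<alpha> * cmon \<alpha> X)" "\<forall>X. G X = (\<Sum>\<alpha>\<in>exponents d. cx Q \<alpha> * cmon \<alpha> X)"
  then show "\<exists>R. \<forall>X. F X + G X = (\<Sum>\<alpha>\<in>exponents d. cx R \<alpha> * cmon \<alpha> X)"
    by (intro exI[of _ "\<lambda>\<alpha>. P \<alpha> + Q \<alpha>"]) (simp add: distrib_right sum.distrib)
qed

lemma is_form_cmult: "is_form d F \<Longrightarrow> is_form d (\<lambda>X. of_real c * F X)"
  unfolding is_form_def form_eval_cmon
proof (elim exE)
  fix P assume "\<forall>X. F X = (\<Sum>\<alpha>\<in>exponents d. cx P \<alpha> * cmon \<alpha> X)"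
  then show "\<exists>R. \<forall>X. of_real c * F X = (\<Sum>\<alpha>\<in>exponents d. cx R \<alpha> * cmon \<alpha> X)"
    by (intro exI[of _ "\<lambda>\<alpha>. c * P \<alpha>"]) (simp add: sum_distrib_left mult.assoc)
qed

lemma is_form_one: "is_form 0 (\<lambda>X. 1)"
proof -
  have "exponents 0 = {(0, 0, 0)}" by (auto simp: exponents_def)
  then show ?thesis unfolding is_form_def form_eval_cmon by (intro exI[of _ "\<lambda>_. 1"]) (simp add: cmon_def)
qed

lemma is_form_linear: "is_form 1 (\<lambda>X. \<Sum>j\<in>UNIV. of_real (a j) * X$j)" for a :: "3 \<Rightarrow> real"
proof -
  have e: "exponents 1 = {(1, 0, 0), (0, 1, 0), (0, 0, 1)}"
    by (auto simp: exponents_def)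
  show ?thesis unfolding is_form_def form_eval_cmon e
    by (intro exI[of _ "\<lambda>(i, j, k). if i = 1 then a 1 else if j = 1 then a 2 else a 3"]) (simp add: cmon_def sum_3 add.assoc)
qed

lemma is_form_coord: "is_form 1 (\<lambda>X. X$i)"
proof -
  have "(\<lambda>X :: complex^3. X$i) = (\<lambda>X. \<Sum>j\<in>UNIV. of_real (if j = i then 1 else 0) * X$j)"
    by (auto simp: fun_eq_iff if_distrib[of "\<lambda>c. of_real c * _"] cong: if_cong)
  then show ?thesis using is_form_linear[of "\<lambda>j. if j = i then 1 else 0"] by simp
qed

lemma is_form_mult:
  assumes "is_form d1 F" "is_form d2 G" shows "is_form (d1 + d2) (\<lambda>X. F X * G X)"
proof -
  obtain P Q where P: "\<And>X. F X = (\<Sum>\<alpha>\<in>exponents d1. cx P \<alpha> * cmon \<alpha> X)" and Q: "\<And>X. G X = (\<Sum>\<beta>\<in>exponents d2. cx Q \<beta> * cmon \<beta> X)"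
    using assms unfolding is_form_def form_eval_cmon by auto
  define pl where "pl \<alpha> \<beta> = (fst \<alpha> + fst \<beta>, fst (snd \<alpha>) + fst (snd \<beta>), snd (snd \<alpha>) + snd (snd \<beta>))" for \<alpha> \<beta> :: "nat \<times> nat \<times> nat"
  have pl: "pl \<alpha> \<beta> \<in> exponents (d1 + d2)" if "\<alpha> \<in> exponents d1" "\<beta> \<in> exponents d2" for \<alpha> \<beta>
    using that by (auto simp: pl_def exponents_def)
  have cm: "cmon (pl \<alpha> \<beta>) X = cmon \<alpha> X * cmon \<beta> X" for \<alpha> \<beta> X
    by (simp add: cmon_def pl_def power_add mult_ac)
  define R where "R \<gamma> = (\<Sum>\<alpha>\<in>exponents d1. \<Sum>\<beta>\<in>exponents d2. if \<gamma> = pl \<alpha> \<beta> then P \<alpha> * Q \<beta> else 0)" for \<gamma>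
  have "F X * G X = (\<Sum>\<gamma>\<in>exponents (d1 + d2). cx R \<gamma> * cmon \<gamma> X)" for X
  proof -
    have "(\<Sum>\<gamma>\<in>exponents (d1 + d2). cx R \<gamma> * cmon \<gamma> X) = (\<Sum>\<gamma>\<in>exponents (d1 + d2). \<Sum>\<alpha>\<in>exponents d1. \<Sum>\<beta>\<in>exponents d2. if \<gamma> = pl \<alpha> \<beta> then of_real (P \<alpha> * Q \<beta>) * cmon \<gamma> X else 0)"
      unfolding R_def of_real_sum sum_distrib_right by (intro sum.cong refl) simp
    also have "\<dots> = (\<Sum>\<alpha>\<in>exponents d1. \<Sum>\<beta>\<in>exponents d2. \<Sum>\<gamma>\<in>exponents (d1 + d2). if \<gamma> = pl \<alpha> \<beta> then of_real (P \<alpha> * Q \<beta>) * cmon \<gamma> X else 0)"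
      (is "(\<Sum>\<gamma>\<in>_. \<Sum>\<alpha>\<in>_. \<Sum>\<beta>\<in>_. ?f \<gamma> \<alpha> \<beta>) = _")
    proof -
      have "(\<Sum>\<gamma>\<in>exponents (d1 + d2). \<Sum>\<alpha>\<in>exponents d1. \<Sum>\<beta>\<in>exponents d2. ?f \<gamma> \<alpha> \<beta>) =
         (\<Sum>\<alpha>\<in>exponents d1. \<Sum>\<gamma>\<in>exponents (d1 + d2). \<Sum>\<beta>\<in>exponents d2. ?f \<gamma> \<alpha> \<beta>)" by (rule sum.swap)
      also have "\<dots> = (\<Sum>\<alpha>\<in>exponents d1. \<Sum>\<beta>\<in>exponents d2. \<Sum>\<gamma>\<in>exponents (d1 + d2). ?f \<gamma> \<alpha> \<beta>)"
        by (rule sum.cong[OF refl], rule sum.swap)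
      finally show ?thesis .
    qed
    also have "\<dots> = (\<Sum>\<alpha>\<in>exponents d1. \<Sum>\<beta>\<in>exponents d2. of_real (P \<alpha> * Q \<beta>) * (cmon \<alpha> X * cmon \<beta> X))"
      by (intro sum.cong refl) (simp add: pl cm)
    also have "\<dots> = F X * G X" unfolding P Q sum_product by (intro sum.cong refl) (simp add: mult_ac)
    finally show ?thesis by simp
  qed
  then show ?thesis unfolding is_form_def form_eval_cmon by blast
qed

lemma is_form_power: "is_form 1 F \<Longrightarrow> is_form i (\<lambda>X. F X ^ i)"
proof (induction i)
  case 0
  then show ?case using is_form_one by simp
next
  case (Suc i)
  then show ?case using is_form_mult[OF Suc.prems Suc.IH] by simp
qed

text \<open>Coefficients of a form after the substitution of an orthogonal matrix; they depend linearly on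
  the coefficients of the form.\<close>

lemma substitution_coefficients:
  "\<exists>R. \<forall>P X. form_eval d (cx (\<lambda>\<gamma>. \<Sum>\<alpha>\<in>exponents d. R \<gamma> \<alpha> * P \<alpha>)) X = form_eval d (cx P) (cmat A X)"
proof -
  have "is_form d (\<lambda>X. cmon \<alpha> (cmat A X))" if "\<alpha> \<in> exponents d" for \<alpha>
  proof -
    obtain i j k where a: "\<alpha> = (i, j, k)" "i + j + k = d" using \<open>\<alpha> \<in> exponents d\<close> by (auto simp: exponents_def)
    have l: "is_form 1 (\<lambda>X. cmat A X $ m)" for m unfolding cmat_def using is_form_linear by simp
    show ?thesis unfolding cmon_def a using is_form_mult[OF is_form_mult[OF is_form_power[OF l[of 1], of i] is_form_power[OF l[of 2], of j]] is_form_power[OF l[of 3], of k]] a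
      by simp
  qed
  then obtain S where S: "\<And>\<alpha> X. \<alpha> \<in> exponents d \<Longrightarrow> cmon \<alpha> (cmat A X) = form_eval d (cx (S \<alpha>)) X"
    unfolding is_form_def by metis
  have "form_eval d (cx (\<lambda>\<gamma>. \<Sum>\<alpha>\<in>exponents d. S \<alpha> \<gamma> * P \<alpha>)) X = form_eval d (cx P) (cmat A X)" for P X
  proof -
    have "form_eval d (cx P) (cmat A X) = (\<Sum>\<alpha>\<in>exponents d. \<Sum>\<gamma>\<in>exponents d. cx P \<alpha> * (cx (S \<alpha>) \<gamma> * cmon \<gamma> X))"
      unfolding form_eval_cmon[of d "cx P"] by (intro sum.cong refl) (simp add: S form_eval_cmon sum_distrib_left)
    also have "\<dots> = form_eval d (cx (\<lambda>\<gamma>. \<Sum>\<alpha>\<in>exponents d. S \<alpha> \<gamma> * P \<alpha>)) X"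
      unfolding form_eval_cmon of_real_sum sum_distrib_right by (subst sum.swap) (simp add: mult_ac)
    finally show ?thesis by simp
  qed
  then show ?thesis by (intro exI[of _ "\<lambda>\<gamma> \<alpha>. S \<alpha> \<gamma>"]) blast
qed

definition rotmat :: "nat \<Rightarrow> real^3^3 \<Rightarrow> nat \<times> nat \<times> nat \<Rightarrow> nat \<times> nat \<times> nat \<Rightarrow> real" where
  "rotmat d A = (SOME R. \<forall>P X. form_eval d (cx (\<lambda>\<gamma>. \<Sum>\<alpha>\<in>exponents d. R \<gamma> \<alpha> * P \<alpha>)) X = form_eval d (cx P) (cmat A X))"

text \<open>The coefficients of the form after the substitution of the matrix. The Taylor coefficients
  at the point \<open>A [1 : 0 : 0]\<close> are those of \<open>rot d A P\<close>.\<close>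

definition rot :: "nat \<Rightarrow> real^3^3 \<Rightarrow> (nat \<times> nat \<times> nat \<Rightarrow> real) \<Rightarrow> nat \<times> nat \<times> nat \<Rightarrow> real" where
  "rot d A P \<gamma> = (\<Sum>\<alpha>\<in>exponents d. rotmat d A \<gamma> \<alpha> * P \<alpha>)"

lemma form_eval_rot: "form_eval d (cx (rot d A P)) X = form_eval d (cx P) (cmat A X)"
proof -
  have "\<forall>P X. form_eval d (cx (\<lambda>\<gamma>. \<Sum>\<alpha>\<in>exponents d. rotmat d A \<gamma> \<alpha> * P \<alpha>)) X = form_eval d (cx P) (cmat A X)"
    unfolding rotmat_def by (rule someI_ex[OF substitution_coefficients])
  then show ?thesis unfolding rot_def by blast
qed

definition cvec :: "real^3 \<Rightarrow> complex^3" where "cvec x = (\<chi> i. of_real (x$i))"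

lemma form_eval_cvec: "form_eval d (cx P) (cvec x) = of_real (form_eval d P x)"
  unfolding form_eval_cmon form_eval_xmon by (simp add: cvec_def cmon_def xmon_def)

lemma cmat_cvec: "cmat A (cvec x) = cvec (A *v x)"
  by (simp add: vec_eq_iff cmat_def cvec_def matrix_vector_mult_def)

lemma form_eval_rot_real: "form_eval d (rot d A P) x = form_eval d P (A *v x)"
proof -
  have "complex_of_real (form_eval d (rot d A P) x) = complex_of_real (form_eval d P (A *v x))"
    unfolding form_eval_cvec[symmetric] form_eval_rot cmat_cvec ..
  then show ?thesis by simp
qed

lemma real_l2_norm_rot:
  assumes "orthogonal_matrix A" shows "real_l2_norm d (rot d A P) = real_l2_norm d P"
  unfolding real_l2_norm_def by (rule l2_norm_rotate[OF assms form_eval_rot])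

definition C1 :: real where "C1 = sqrt Vfs * exp 4 / pi"

lemma C1_pos: "C1 > 0" using Vfs(1) by (simp add: C1_def)

text \<open>A single coefficient contributes at most the whole squared norm of the rotated form, by
  orthogonality of the monomials, and the norm is invariant under rotation. The constant comes from the
  lower bound for the norms of monomials.\<close>

lemma rot_coefficient_bound:
  assumes A: "orthogonal_matrix A" and \<gamma>: "(i, j, k) \<in> exponents d" and R: "0 < R" "R + 1 \<le> real d"
  shows "\<bar>rot d A P (i, j, k)\<bar> \<le> (C1 * real d * exp R * sqrt (real d / R) ^ (j + k)) * real_l2_norm d P"
proof -
  let ?p = "rot d A P (i, j, k)" and ?n = "real_l2_norm d P"
  let ?w = "(pi\<^sup>2 / Vfs) * exp (- (2 * R + 8)) / (real d)\<^sup>2 * (R / real d) ^ (j + k)"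
  let ?c = "C1 * real d * exp R * sqrt (real d / R) ^ (j + k)"
  have d: "real d > 0" using R by simp
  have "wt d (i, j, k) * ?p\<^sup>2 \<le> (\<Sum>\<alpha>\<in>exponents d. wt d \<alpha> * (rot d A P \<alpha>)\<^sup>2)"
    by (rule member_le_sum[OF \<gamma>]) (auto intro!: mult_nonneg_nonneg less_imp_le[OF wt_pos])
  also have "\<dots> = ?n\<^sup>2" using real_l2_norm_sq[of d "rot d A P"] real_l2_norm_rot[OF A, of d P] by simp
  finally have "wt d (i, j, k) * ?p\<^sup>2 \<le> ?n\<^sup>2" .
  moreover have "?w * ?p\<^sup>2 \<le> wt d (i, j, k) * ?p\<^sup>2" by (rule mult_right_mono[OF wt_lower_bound[OF \<gamma> R]]) simp
  ultimately have 1: "?w * ?p\<^sup>2 \<le> ?n\<^sup>2" by linarith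
  have "(sqrt (real d / R) ^ (j + k))\<^sup>2 * (R / real d) ^ (j + k) = 1"
  proof -
    have "(sqrt (real d / R) ^ (j + k))\<^sup>2 = ((sqrt (real d / R))\<^sup>2) ^ (j + k)"
      by (simp only: power_mult[symmetric] mult.commute)
    also have "(sqrt (real d / R))\<^sup>2 = real d / R" using R d by (intro real_sqrt_pow2) simp
    finally show ?thesis using R d by (simp flip: power_mult_distrib)
  qed
  moreover have "(C1 * real d * exp R)\<^sup>2 * ((pi\<^sup>2 / Vfs) * exp (- (2 * R + 8)) / (real d)\<^sup>2) = 1"
  proof -
    have "(exp R)\<^sup>2 = exp (2 * R)" "(exp 4)\<^sup>2 = exp (8::real)" by (simp_all flip: exp_double)
    then have "(C1 * real d * exp R)\<^sup>2 = Vfs * exp 8 / pi\<^sup>2 * (real d)\<^sup>2 * exp (2 * R)"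
      using Vfs(1) by (simp add: C1_def power_mult_distrib power_divide)
    moreover have "exp (2 * R) * exp (- (2 * R + 8)) * exp 8 = (1::real)" by (simp flip: exp_add)
    moreover have "(V * e / p * D * E1) * (p / V * E2 / D) = E1 * E2 * e" if "V \<noteq> 0" "p \<noteq> 0" "D \<noteq> 0" for V e p D E1 E2 :: real
      using that by simp
    ultimately show ?thesis using Vfs(1) d by (simp add: mult_ac)
  qed
  moreover have "(a * b)\<^sup>2 * (x * y) = (b\<^sup>2 * y) * (a\<^sup>2 * x)" for a b x y :: real by (simp add: power_mult_distrib mult_ac)
  ultimately have "?c\<^sup>2 * ?w = 1" by (simp only: mult_1_left)
  then have "?p\<^sup>2 = (?c\<^sup>2 * ?w) * ?p\<^sup>2" by (simp only: mult_1_left)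
  also have "\<dots> = ?c\<^sup>2 * (?w * ?p\<^sup>2)" by (rule mult.assoc)
  also have "\<dots> \<le> ?c\<^sup>2 * ?n\<^sup>2" by (rule mult_left_mono[OF 1]) simp
  finally have "?p\<^sup>2 \<le> (?c * ?n)\<^sup>2" by (simp only: power_mult_distrib)
  then have "\<bar>?p\<bar> \<le> \<bar>?c * ?n\<bar>" by (simp only: abs_le_square_iff)
  moreover have "0 \<le> ?c * ?n" using C1_pos d R real_l2_norm_nonneg[of d P] by (intro mult_nonneg_nonneg zero_le_power) auto
  ultimately show ?thesis by (simp only: abs_of_nonneg)
qed

section \<open>The barrier\<close>

text \<open>Real and imaginary part of the powers of \<open>X\<^sub>0 + i \<tau> s\<close>, as polynomials in \<open>X\<close>; here
  \<open>s\<close> is a square root of \<open>X\<^sub>1\<^sup>2 + X\<^sub>2\<^sup>2\<close> and the imaginary part is divided by \<open>\<tau> s\<close>.\<close>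

primrec bar_cs :: "real \<Rightarrow> complex^3 \<Rightarrow> nat \<Rightarrow> complex \<times> complex" where
  "bar_cs \<tau> X 0 = (1, 0)"
| "bar_cs \<tau> X (Suc m) = (X$1 * fst (bar_cs \<tau> X m) + of_real (- \<tau>\<^sup>2) * (((X$2)\<^sup>2 + (X$3)\<^sup>2) * snd (bar_cs \<tau> X m)),
     fst (bar_cs \<tau> X m) + X$1 * snd (bar_cs \<tau> X m))"

text \<open>The recursion is multiplication by \<open>X\<^sub>0 + i \<tau> s\<close>, in which \<open>s\<close> occurs only through its square. Both
  square roots are allowed, and adding the two identities isolates the first component.\<close>

lemma bar_cs_power:
  assumes "s\<^sup>2 = (X$2)\<^sup>2 + (X$3)\<^sup>2"
  shows "fst (bar_cs \<tau> X m) + \<i> * of_real \<tau> * s * snd (bar_cs \<tau> X m) = (X$1 + \<i> * of_real \<tau> * s) ^ m"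
proof (induction m)
  case (Suc m)
  let ?c = "fst (bar_cs \<tau> X m)" and ?t = "snd (bar_cs \<tau> X m)" and ?u = "\<i> * of_real \<tau> * s"
  have u: "?u * ?u = of_real (- \<tau>\<^sup>2) * ((X$2)\<^sup>2 + (X$3)\<^sup>2)"
  proof -
    have "?u * ?u = (\<i> * \<i>) * (of_real \<tau> * of_real \<tau>) * (s * s)" by (simp only: mult_ac)
    then show ?thesis unfolding assms[symmetric] by (simp add: power2_eq_square)
  qed
  have "(X$1 + ?u) ^ Suc m = (X$1 + ?u) * (?c + ?u * ?t)" using Suc by simp
  also have "\<dots> = X$1 * ?c + (?u * ?u) * ?t + ?u * (?c + X$1 * ?t)" by (simp add: algebra_simps)
  finally show ?case unfolding u by (simp add: mult.assoc)
qed simp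

lemma is_form_bar: "is_form m (\<lambda>X. fst (bar_cs \<tau> X m))"
proof -
  have q: "is_form 2 (\<lambda>X. (X$2)\<^sup>2 + (X$3)\<^sup>2)"
    by (intro is_form_add is_form_power[OF is_form_coord])
  have "is_form m (\<lambda>X. fst (bar_cs \<tau> X m)) \<and> is_form (Suc m) (\<lambda>X. fst (bar_cs \<tau> X (Suc m))) \<and> is_form m (\<lambda>X. snd (bar_cs \<tau> X (Suc m)))"
  proof (induction m)
    case 0
    show ?case using is_form_one is_form_coord[of 1] by simp
  next
    case (Suc m)
    have n: "1 + Suc m = Suc (Suc m)" "2 + m = Suc (Suc m)" "1 + m = Suc m" by simp_all
    have f1: "is_form (Suc (Suc m)) (\<lambda>X. X$1 * fst (bar_cs \<tau> X (Suc m)))"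
      using is_form_mult[OF is_form_coord] Suc unfolding n(1)[symmetric] by blast
    have f2: "is_form (Suc (Suc m)) (\<lambda>X. of_real (- \<tau>\<^sup>2) * (((X$2)\<^sup>2 + (X$3)\<^sup>2) * snd (bar_cs \<tau> X (Suc m))))"
      using is_form_cmult[OF is_form_mult[OF q]] Suc unfolding n(2)[symmetric] by blast
    have f3: "is_form (Suc m) (\<lambda>X. X$1 * snd (bar_cs \<tau> X (Suc m)))"
      using is_form_mult[OF is_form_coord] Suc unfolding n(3)[symmetric] by blast
    have "is_form (Suc (Suc m)) (\<lambda>X. fst (bar_cs \<tau> X (Suc (Suc m))))"
      unfolding bar_cs.simps(2)[of _ _ "Suc m"] fst_conv by (rule is_form_add[OF f1 f2])
    moreover have "is_form (Suc m) (\<lambda>X. snd (bar_cs \<tau> X (Suc (Suc m))))"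
      unfolding bar_cs.simps(2)[of _ _ "Suc m"] snd_conv by (rule is_form_add[OF _ f3]) (use Suc in blast)
    ultimately show ?case using Suc by blast
  qed
  then show ?thesis by blast
qed

text \<open>The barrier is half the sum of the powers of \<open>X\<^sub>0 + i \<tau> s\<close> and \<open>X\<^sub>0 - i \<tau> s\<close>, hence at complex points it is
  dominated by \<open>(\<bar>X\<^sub>0\<bar> + \<tau> \<parallel>(X\<^sub>1, X\<^sub>2)\<parallel>) ^ d\<close>. The domination bounds its norm, and restricting to real points
  makes the two powers conjugate.\<close>

lemma barrier_exists:
  assumes d: "d > 0" and \<tau>: "\<tau> \<ge> 0"
  obtains B :: "nat \<times> nat \<times> nat \<Rightarrow> real" where
    "\<And>r \<theta>. form_eval d B (vector [1, r * cos \<theta>, r * sin \<theta>]) = Re ((1 + \<i> * of_real (\<tau> * r)) ^ d)"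
    "(real_l2_norm d B)\<^sup>2 \<le> 108 * (1 + 2 * \<tau>\<^sup>2) ^ d / (real d)\<^sup>2"
proof -
  obtain B where B: "\<And>X. fst (bar_cs \<tau> X d) = form_eval d (cx B) X" using is_form_bar[of d \<tau>] unfolding is_form_def by blast
  have half: "2 * fst (bar_cs \<tau> X d) = (X$1 + \<i> * of_real \<tau> * s) ^ d + (X$1 - \<i> * of_real \<tau> * s) ^ d"
    if "s\<^sup>2 = (X$2)\<^sup>2 + (X$3)\<^sup>2" for X s
    using bar_cs_power[OF that, of \<tau> d] bar_cs_power[of "- s" X \<tau> d] that by (simp add: algebra_simps)
  have "form_eval d B (vector [1, r * cos \<theta>, r * sin \<theta>]) = Re ((1 + \<i> * of_real (\<tau> * r)) ^ d)" for r \<theta>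
  proof -
    let ?x = "vector [1, r * cos \<theta>, r * sin \<theta>] :: real^3"
    have "(r * cos \<theta>)\<^sup>2 + (r * sin \<theta>)\<^sup>2 = r\<^sup>2 * ((sin \<theta>)\<^sup>2 + (cos \<theta>)\<^sup>2)" by algebra
    then have "(of_real r)\<^sup>2 = (cvec ?x $ 2)\<^sup>2 + (cvec ?x $ 3)\<^sup>2"
      by (simp add: cvec_def flip: of_real_power of_real_add of_real_mult)
    from half[OF this] have "2 * of_real (form_eval d B ?x) = (1 + \<i> * of_real (\<tau> * r)) ^ d + (1 - \<i> * of_real (\<tau> * r)) ^ d"
      unfolding B form_eval_cvec by (simp add: cvec_def mult.assoc)
    also have "(1 - \<i> * of_real (\<tau> * r)) ^ d = cnj ((1 + \<i> * of_real (\<tau> * r)) ^ d)" by simp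
    finally have "2 * complex_of_real (form_eval d B ?x) = of_real (2 * Re ((1 + \<i> * of_real (\<tau> * r)) ^ d))"
      by (simp only: complex_add_cnj)
    then have "Re (2 * complex_of_real (form_eval d B ?x)) = Re (of_real (2 * Re ((1 + \<i> * of_real (\<tau> * r)) ^ d)))" by (rule arg_cong)
    then show ?thesis by simp
  qed
  moreover have "cmod (form_eval d (cx B) X) \<le> (cmod (X$1) + \<tau> * sqrt ((cmod (X$2))\<^sup>2 + (cmod (X$3))\<^sup>2)) ^ d" for X
  proof -
    define s where "s = csqrt ((X$2)\<^sup>2 + (X$3)\<^sup>2)"
    have s: "s\<^sup>2 = (X$2)\<^sup>2 + (X$3)\<^sup>2" by (simp add: s_def)
    have "(cmod s)\<^sup>2 \<le> (cmod (X$2))\<^sup>2 + (cmod (X$3))\<^sup>2"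
      unfolding norm_power[symmetric] s by (rule norm_triangle_ineq)
    then have cs: "cmod s \<le> sqrt ((cmod (X$2))\<^sup>2 + (cmod (X$3))\<^sup>2)" by (rule real_le_rsqrt)
    let ?b = "cmod (X$1) + \<tau> * sqrt ((cmod (X$2))\<^sup>2 + (cmod (X$3))\<^sup>2)"
    have ts: "\<tau> * cmod s \<le> \<tau> * sqrt ((cmod (X$2))\<^sup>2 + (cmod (X$3))\<^sup>2)" using cs \<tau> by (rule mult_left_mono)
    have u: "cmod (\<i> * of_real \<tau> * s) = \<tau> * cmod s" using \<tau> by (simp add: norm_mult)
    have p: "cmod (X$1 + \<i> * of_real \<tau> * s) \<le> ?b" "cmod (X$1 - \<i> * of_real \<tau> * s) \<le> ?b"
      using norm_triangle_ineq[of "X$1" "\<i> * of_real \<tau> * s"] norm_triangle_ineq4[of "X$1" "\<i> * of_real \<tau> * s"] u ts by linarith+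
    have "cmod (2 * form_eval d (cx B) X) \<le> cmod (X$1 + \<i> * of_real \<tau> * s) ^ d + cmod (X$1 - \<i> * of_real \<tau> * s) ^ d"
      unfolding B[symmetric] half[OF s] norm_power[symmetric] by (rule norm_triangle_ineq)
    also have "\<dots> \<le> ?b ^ d + ?b ^ d" using p by (intro add_mono power_mono) auto
    finally show ?thesis by (simp add: norm_mult)
  qed
  then have "(l2_norm d (cx B))\<^sup>2 \<le> 108 * (1 + 2 * \<tau>\<^sup>2) ^ d / (real d)\<^sup>2"
    by (rule concentrated_l2_norm_le[OF d \<tau>])
  ultimately show thesis using that unfolding real_l2_norm_def by blast
qed

section \<open>Zeros of a perturbed barrier along a ray\<close>

text \<open>The intermediate value theorem gives a zero between \<open>s1\<close> and \<open>s2\<close>, where the function is injective;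
  outside it keeps its sign.\<close>

lemma unique_simple_zero:
  fixes q q' :: "real \<Rightarrow> real"
  assumes ord: "a < s1" "s1 < s2" "s2 < b" and der: "\<And>r. (q has_real_derivative q' r) (at r)"
    and pos: "\<And>r. a < r \<Longrightarrow> r \<le> s1 \<Longrightarrow> q r > 0" and neg: "\<And>r. s2 \<le> r \<Longrightarrow> r < b \<Longrightarrow> q r < 0"
    and dec: "\<And>r. s1 \<le> r \<Longrightarrow> r \<le> s2 \<Longrightarrow> q' r < 0"
  shows "\<exists>!r. a < r \<and> r < b \<and> q r = 0" and "a < r \<Longrightarrow> r < b \<Longrightarrow> q r = 0 \<Longrightarrow> q' r \<noteq> 0"
proof -
  have mid: "s1 < r \<and> r < s2" if "a < r" "r < b" "q r = 0" for r
    using pos[of r] neg[of r] that by force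
  have cont: "continuous_on {s1..s2} q" using der by (intro DERIV_continuous_on[of _ q q']) (rule has_field_derivative_at_within)
  have "\<exists>r. s1 \<le> r \<and> r \<le> s2 \<and> q r = 0"
    using IVT2'[of q s2 0 s1] pos[of s1] neg[of s2] ord cont by (auto simp: less_imp_le)
  then obtain r where r: "s1 \<le> r" "r \<le> s2" "q r = 0" by blast
  have inj: "q y < q x" if "s1 \<le> x" "x < y" "y \<le> s2" for x y
    using DERIV_neg_imp_decreasing[OF that(2), of q] der dec that by (meson order_trans)
  show "\<exists>!r. a < r \<and> r < b \<and> q r = 0"
  proof (rule ex1I[of _ r])
    show "a < r \<and> r < b \<and> q r = 0" using r ord by linarith
    fix x assume x: "a < x \<and> x < b \<and> q x = 0"
    then have "s1 < x" "x < s2" using mid by blast+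
    then show "x = r" using inj[of x r] inj[of r x] r x by (metis less_imp_le less_irrefl linorder_cases)
  qed
  show "a < r \<Longrightarrow> r < b \<Longrightarrow> q r = 0 \<Longrightarrow> q' r \<noteq> 0" for r
    using mid[of r] dec[of r] by force
qed

lemma barrier_polar:
  assumes "- (pi / 2) < \<phi>" "\<phi> < pi / 2"
  shows "(1 + \<i> * of_real (tan \<phi>)) ^ m = of_real (1 / cos \<phi> ^ m) * cis (real m * \<phi>)"
proof -
  have c: "cos \<phi> \<noteq> 0" using cos_gt_zero_pi[OF assms] by simp
  have "1 + \<i> * of_real (tan \<phi>) = of_real (1 / cos \<phi>) * cis \<phi>"
    using c by (simp add: complex_eq_iff tan_def)
  then show ?thesis by (simp only: power_mult_distrib Complex.DeMoivre of_real_power[symmetric] power_one_over)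
qed

text \<open>The barrier on the circle of radius \<open>r\<close>, and its radial derivative.\<close>

definition bar :: "nat \<Rightarrow> real \<Rightarrow> real \<Rightarrow> real" where "bar d \<tau> r = Re ((1 + \<i> * of_real (\<tau> * r)) ^ d)"
definition bar' :: "nat \<Rightarrow> real \<Rightarrow> real \<Rightarrow> real" where
  "bar' d \<tau> r = - (real d * \<tau> * Im ((1 + \<i> * of_real (\<tau> * r)) ^ (d - 1)))"

lemma bar_derivative: "(bar d \<tau> has_real_derivative bar' d \<tau> r) (at r)"
proof -
  have "((\<lambda>r. (1 + \<i> * of_real (\<tau> * r)) ^ d) has_vector_derivative
     (of_nat d * (1 + \<i> * of_real (\<tau> * r)) ^ (d - 1) * (\<i> * of_real \<tau>))) (at r)"
  proof -
    have "((\<lambda>z. (1 + \<i> * of_real \<tau> * z) ^ d) has_field_derivative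
       (of_nat d * (1 + \<i> * of_real \<tau> * of_real r) ^ (d - 1) * (\<i> * of_real \<tau>))) (at (of_real r))"
      by (auto intro!: derivative_eq_intros)
    from has_vector_derivative_real_field[OF this] show ?thesis by (simp add: mult.assoc)
  qed
  from bounded_linear.has_vector_derivative[OF bounded_linear_Re this]
  have "(bar d \<tau> has_vector_derivative Re (of_nat d * (1 + \<i> * of_real (\<tau> * r)) ^ (d - 1) * (\<i> * of_real \<tau>))) (at r)"
    by (simp only: bar_def[abs_def])
  moreover have "Re (of_nat d * (1 + \<i> * of_real (\<tau> * r)) ^ (d - 1) * (\<i> * of_real \<tau>)) = bar' d \<tau> r"
    by (simp add: bar'_def)
  ultimately show ?thesis by (simp add: has_real_derivative_iff_has_vector_derivative)
qed

text \<open>With \<open>\<tau> r = tan \<phi>\<close> the barrier is \<open>cos (d \<phi>) / cos \<phi> ^ d\<close>. The hypotheses say that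
  \<open>d \<phi>\<close> lies in the \<open>k\<close>-th half period.\<close>

lemma barrier_signs:
  fixes \<psi> :: real
  assumes \<phi>: "\<phi> = arctan (\<tau> * r)" and \<psi>: "real d * \<phi> = real k * pi + \<psi>" "0 \<le> \<psi>" "\<psi> \<le> pi"
    and small: "0 \<le> \<phi>" "\<phi> \<le> 3 / 10" and d: "d > 0" and \<tau>: "\<tau> > 0"
  shows "\<psi> \<le> pi / 3 \<Longrightarrow> 1 / 2 \<le> (-1) ^ k * bar d \<tau> r"
    and "2 * pi / 3 \<le> \<psi> \<Longrightarrow> (-1) ^ k * bar d \<tau> r \<le> - 1 / 2"
    and "pi / 3 \<le> \<psi> \<Longrightarrow> \<psi> \<le> 2 * pi / 3 \<Longrightarrow> (-1) ^ k * bar' d \<tau> r \<le> - (real d * \<tau> / 2)"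
proof -
  have r: "\<tau> * r = tan \<phi>" by (simp add: \<phi> tan_arctan)
  have b: "- (pi / 2) < \<phi>" "\<phi> < pi / 2" unfolding \<phi> by (rule arctan_lbound, rule arctan_ubound)
  have c: "0 < cos \<phi>" "cos \<phi> \<le> 1" using cos_gt_zero_pi[OF b] by auto
  have inv: "1 \<le> 1 / cos \<phi> ^ m" for m
    using c power_le_one[of "cos \<phi>" m] by (simp add: field_simps)
  have sq: "(-1) ^ k * (-1) ^ k = (1::real)" by (simp flip: power_mult_distrib)
  have ck: "cos (real k * pi + x) = (-1) ^ k * cos x" "sin (real k * pi + x) = (-1) ^ k * sin x" for x
    by (simp_all add: cos_add sin_add)
  have e1: "(-1) ^ k * bar d \<tau> r = 1 / cos \<phi> ^ d * cos \<psi>"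
  proof -
    have "bar d \<tau> r = 1 / cos \<phi> ^ d * ((-1) ^ k * cos \<psi>)"
      unfolding bar_def r barrier_polar[OF b] \<psi>(1) Re_of_real_times by (simp add: ck)
    then have "(-1) ^ k * bar d \<tau> r = ((-1) ^ k * (-1) ^ k) * (1 / cos \<phi> ^ d * cos \<psi>)" by (simp only: mult_ac)
    then show ?thesis unfolding sq by simp
  qed
  have e2: "(-1) ^ k * bar' d \<tau> r = - (real d * \<tau> * (1 / cos \<phi> ^ (d - 1) * sin (\<psi> - \<phi>)))"
  proof -
    have "real (d - 1) * \<phi> = real k * pi + (\<psi> - \<phi>)" using \<psi>(1) d by (simp add: of_nat_diff algebra_simps)
    then have "bar' d \<tau> r = - (real d * \<tau> * (1 / cos \<phi> ^ (d - 1) * ((-1) ^ k * sin (\<psi> - \<phi>))))"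
      unfolding bar'_def r barrier_polar[OF b] by (simp add: ck)
    then have "(-1) ^ k * bar' d \<tau> r = ((-1) ^ k * (-1) ^ k) * (- (real d * \<tau> * (1 / cos \<phi> ^ (d - 1) * sin (\<psi> - \<phi>))))"
      by (simp only: mult_ac mult_minus_right)
    then show ?thesis unfolding sq by simp
  qed
  show "1 / 2 \<le> (-1) ^ k * bar d \<tau> r" if "\<psi> \<le> pi / 3"
  proof -
    have "cos (pi / 3) \<le> cos \<psi>" using that \<psi>(2) by (intro cos_monotone_0_pi_le) auto
    then have h: "1 / 2 \<le> cos \<psi>" by (simp add: cos_60)
    have "1 * (1 / 2) \<le> 1 / cos \<phi> ^ d * cos \<psi>" using inv[of d] h c(1) by (intro mult_mono) (auto simp: less_imp_le)
    then show ?thesis unfolding e1 by simp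
  qed
  show "(-1) ^ k * bar d \<tau> r \<le> - 1 / 2" if "2 * pi / 3 \<le> \<psi>"
  proof -
    have "cos (pi - \<psi>) \<ge> cos (pi / 3)" using that \<psi>(3) by (intro cos_monotone_0_pi_le) auto
    then have h: "1 / 2 \<le> - cos \<psi>" by (simp add: cos_60)
    have "1 * (1 / 2) \<le> 1 / cos \<phi> ^ d * (- cos \<psi>)" using inv[of d] h c(1) by (intro mult_mono) (auto simp: less_imp_le)
    then show ?thesis unfolding e1 mult_minus_right by linarith
  qed
  show "(-1) ^ k * bar' d \<tau> r \<le> - (real d * \<tau> / 2)" if "pi / 3 \<le> \<psi>" "\<psi> \<le> 2 * pi / 3"
  proof -
    have l: "pi / 6 \<le> \<psi> - \<phi>" "\<psi> - \<phi> \<le> pi - pi / 6" using that small pi_gt3 by linarith+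
    have "1 / 2 \<le> sin (\<psi> - \<phi>)"
    proof (cases "\<psi> - \<phi> \<le> pi / 2")
      case True
      then have "sin (pi / 6) \<le> sin (\<psi> - \<phi>)" using l by (intro sin_monotone_2pi_le) auto
      then show ?thesis by (simp add: sin_30)
    next
      case False
      then have "sin (pi / 6) \<le> sin (pi - (\<psi> - \<phi>))" using l by (intro sin_monotone_2pi_le) auto
      then show ?thesis by (simp add: sin_30)
    qed
    then have "1 * (1 / 2) \<le> 1 / cos \<phi> ^ (d - 1) * sin (\<psi> - \<phi>)" using inv[of "d - 1"] c(1) by (intro mult_mono) (auto simp: less_imp_le)
    then have "real d * \<tau> * (1 / 2) \<le> real d * \<tau> * (1 / cos \<phi> ^ (d - 1) * sin (\<psi> - \<phi>))"
      using \<tau> by (intro mult_left_mono) auto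
    then show ?thesis unfolding e2 by simp
  qed
qed

lemma tan_le_of_small:
  assumes "0 \<le> y" "y \<le> (3 / 10 :: real)" shows "tan y \<le> 11 / 10 * y"
proof -
  have c: "1 - y\<^sup>2 / 2 \<le> cos y"
  proof -
    have "(sin (y / 2))\<^sup>2 \<le> (y / 2)\<^sup>2" using assms sin_x_le_x[of "y / 2"] sin_ge_zero[of "y / 2"] pi_gt3 by (intro power_mono) auto
    moreover have "cos y = 1 - 2 * (sin (y / 2))\<^sup>2" using cos_double_sin[of "y / 2"] by simp
    ultimately show ?thesis by (simp add: power_divide)
  qed
  have "y\<^sup>2 \<le> (3 / 10)\<^sup>2" using assms by (intro power_mono) auto
  then have c2: "10 / 11 \<le> cos y" using c by (simp add: power2_eq_square)
  have "tan y = sin y / cos y" by (simp add: tan_def)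
  also have "\<dots> \<le> y / cos y" using c2 sin_x_le_x[OF assms(1)] by (intro divide_right_mono) auto
  also have "\<dots> \<le> y / (10 / 11)" using c2 assms by (intro divide_left_mono) auto
  finally show ?thesis by simp
qed

section \<open>A nest at a place\<close>

text \<open>The annuli end at the radii \<open>tan (k \<pi> / d) / \<tau>\<close>, between which \<open>d * arctan (\<tau> r)\<close> runs through the half
  period number \<open>k\<close>. In the outer thirds of a half period the barrier is at least \<open>1 / 2\<close> in absolute
  value, and in the middle third its derivative is at least \<open>d \<tau> / 2\<close>; the factor \<open>r0\<close> in the
  bound for \<open>T'\<close> puts both estimates on the same scale because \<open>d \<tau> r0 = sqrt 12 * n\<close>. The last radius is below \<open>r0\<close>
  since \<open>tan y \<le> 1.1 y\<close> for small \<open>y\<close> and \<open>1.1 \<pi> < sqrt 12\<close>.\<close>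

lemma nest_at_place:
  assumes n: "n \<ge> 1" "10000 * n \<le> d" and sm: "smooth_real_curve d P" and orth: "orthogonal_matrix A"
    and \<tau>: "\<tau> = sqrt (6 * real n / real d)" and r0: "r0 = sqrt (2 * real n / real d)"
    and dec: "\<And>r \<theta>. polar_form d P A (r, \<theta>) = \<sigma> * bar d \<tau> r + T \<theta> r"
    and T': "\<And>r \<theta>. (T \<theta> has_real_derivative T' \<theta> r) (at r)"
    and T: "\<And>r \<theta>. 0 \<le> r \<Longrightarrow> r \<le> r0 \<Longrightarrow> \<bar>T \<theta> r\<bar> \<le> M" "\<And>r \<theta>. 0 \<le> r \<Longrightarrow> r \<le> r0 \<Longrightarrow> r0 * \<bar>T' \<theta> r\<bar> \<le> M"
    and M: "2 * M < \<sigma>" "0 < M"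
  shows "\<exists>N. nest d P N \<and> card N = n \<and> \<Union>N \<subseteq> place_disc A r0 \<and> {} \<notin> N"
proof -
  have d0: "real d > 0" "d > 0" using n by auto
  have \<tau>0: "\<tau> > 0" "r0 > 0" using n d0 by (simp_all add: \<tau> r0)
  have \<tau>r0: "\<tau> * r0 = sqrt 12 * real n / real d"
  proof -
    have "\<tau> * r0 = sqrt (12 * (real n / real d)\<^sup>2)" unfolding \<tau> r0 real_sqrt_mult[symmetric] by (simp add: power2_eq_square)
    also have "\<dots> = sqrt 12 * (real n / real d)" unfolding real_sqrt_mult using n d0 by simp
    finally show ?thesis by simp
  qed
  define u where "u x = real x * pi / (3 * real d)" for x :: nat
  define rad where "rad x = tan (u x) / \<tau>" for x
  have un: "u (3 * n) \<le> 4 / 10000"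
  proof -
    have "real n / real d \<le> 1 / 10000" using n d0 by (simp add: field_simps)
    then have "real n / real d * pi \<le> 1 / 10000 * 4" using pi_less_4 by (intro mult_mono) auto
    then show ?thesis by (simp add: u_def)
  qed
  have u_mono: "x \<le> y \<Longrightarrow> u x \<le> u y" for x y using d0 by (simp add: u_def divide_right_mono mult_right_mono)
  have u_smono: "x < y \<Longrightarrow> u x < u y" for x y using d0 by (simp add: u_def divide_strict_right_mono)
  have u0: "0 \<le> u x" for x using d0 by (simp add: u_def)
  have us: "u x \<le> 3 / 10" if "x \<le> 3 * n" for x using u_mono[OF that] un by linarith
  have ub: "u x < pi / 2" if "x \<le> 3 * n" for x using us[OF that] pi_gt3 by linarith
  have rad_less: "rad x < rad y" if "x < y" "y \<le> 3 * n" for x y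
    unfolding rad_def using u_smono[OF that(1)] u0[of x] ub[OF that(2)] \<tau>0(1)
    by (intro divide_strict_right_mono tan_monotone) auto
  have rad0: "0 \<le> rad x" if "x \<le> 3 * n" for x
    unfolding rad_def using tan_gt_zero[of "u x"] u0[of x] ub[OF that] \<tau>0(1) by (cases "u x = 0") auto
  have at: "arctan (\<tau> * rad x) = u x" if "x \<le> 3 * n" for x
    unfolding rad_def using \<tau>0(1) arctan_tan[of "u x"] ub[OF that] u0[of x] pi_gt_zero by auto
  have rad_le: "rad x \<le> r \<Longrightarrow> u x \<le> arctan (\<tau> * r)" and rad_ge: "r \<le> rad x \<Longrightarrow> arctan (\<tau> * r) \<le> u x" if "x \<le> 3 * n" for x r
    using at[OF that] \<tau>0(1) by (metis arctan_le_iff mult_le_cancel_left_pos)+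
  have rn: "rad (3 * n) \<le> r0"
  proof -
    have "tan (u (3 * n)) \<le> 11 / 10 * u (3 * n)" by (rule tan_le_of_small[OF u0 us]) simp
    also have "\<dots> = (11 / 10 * pi) * (real n / real d)" by (simp add: u_def)
    also have "\<dots> \<le> sqrt 12 * (real n / real d)"
    proof (rule mult_right_mono)
      have "11 / 10 * pi \<le> 11 / 10 * (3.1416 :: real)" using pi_approx by simp
      also have "\<dots> \<le> sqrt 12" by (rule real_le_rsqrt) (simp add: power2_eq_square)
      finally show "11 / 10 * pi \<le> sqrt 12" .
    qed (use d0 in simp)
    also have "\<dots> = \<tau> * r0" by (simp add: \<tau>r0)
    finally show ?thesis using \<tau>0(1) by (simp add: rad_def pos_divide_le_eq mult.commute)
  qed
  have radr0: "rad x \<le> r0" if "x \<le> 3 * n" for x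
  proof (cases "x = 3 * n")
    case False
    then show ?thesis using rad_less[of x "3 * n"] that rn by linarith
  qed (use rn in simp)
  have one: "(\<exists>!s. rad (3 * k) < s \<and> s < rad (3 * k + 3) \<and> polar_form d P A (s, \<theta>) = 0) \<and>
     (\<forall>s. rad (3 * k) < s \<longrightarrow> s < rad (3 * k + 3) \<longrightarrow> polar_form d P A (s, \<theta>) = 0 \<longrightarrow>
        (\<exists>D. D \<noteq> 0 \<and> ((\<lambda>s. polar_form d P A (s, \<theta>)) has_real_derivative D) (at s)))" if k: "k < n" for k \<theta>
  proof -
    let ?e = "(-1) ^ k :: real"
    define q where "q r = ?e * polar_form d P A (r, \<theta>)" for r
    define q' where "q' r = ?e * (\<sigma> * bar' d \<tau> r + T' \<theta> r)" for r
    have pd: "((\<lambda>s. polar_form d P A (s, \<theta>)) has_real_derivative (\<sigma> * bar' d \<tau> r + T' \<theta> r)) (at r)" for r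
      unfolding dec by (intro DERIV_add DERIV_cmult bar_derivative T')
    have der: "(q has_real_derivative q' r) (at r)" for r
      unfolding q_def q'_def by (rule DERIV_cmult[OF pd])
    have x: "3 * k \<le> 3 * n" "3 * k + 1 \<le> 3 * n" "3 * k + 2 \<le> 3 * n" "3 * k + 3 \<le> 3 * n" using k by auto
    have e1: "\<bar>?e * y\<bar> = \<bar>y\<bar>" for y :: real by (simp add: abs_mult)
    have sg: "0 < \<sigma>" using M by linarith
    define \<psi> where "\<psi> r = real d * arctan (\<tau> * r) - real k * pi" for r
    have ang: "real d * arctan (\<tau> * r) = real k * pi + \<psi> r" for r by (simp add: \<psi>_def)
    have ul: "u (3 * k + m) \<le> arctan (\<tau> * r) \<Longrightarrow> real m * pi / 3 \<le> \<psi> r"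
      "arctan (\<tau> * r) \<le> u (3 * k + m) \<Longrightarrow> \<psi> r \<le> real m * pi / 3" for m r
    proof -
      have e: "real d * u (3 * k + m) = real k * pi + real m * pi / 3" using d0 by (simp add: u_def field_simps)
      show "u (3 * k + m) \<le> arctan (\<tau> * r) \<Longrightarrow> real m * pi / 3 \<le> \<psi> r"
        using mult_left_mono[of "u (3 * k + m)" "arctan (\<tau> * r)" "real d"] e by (simp add: \<psi>_def)
      show "arctan (\<tau> * r) \<le> u (3 * k + m) \<Longrightarrow> \<psi> r \<le> real m * pi / 3"
        using mult_left_mono[of "arctan (\<tau> * r)" "u (3 * k + m)" "real d"] e by (simp add: \<psi>_def)
    qed
    have info: "0 \<le> \<psi> r" "\<psi> r \<le> pi" "0 \<le> arctan (\<tau> * r)" "arctan (\<tau> * r) \<le> 3 / 10" "\<bar>T \<theta> r\<bar> \<le> M" "r0 * \<bar>T' \<theta> r\<bar> \<le> M"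
      if r: "rad (3 * k) \<le> r" "r \<le> rad (3 * k + 3)" for r
    proof -
      have rr: "0 \<le> r" "r \<le> r0" using r rad0[OF x(1)] radr0[OF x(4)] by linarith+
      show "\<bar>T \<theta> r\<bar> \<le> M" "r0 * \<bar>T' \<theta> r\<bar> \<le> M" using T rr by blast+
      show "0 \<le> arctan (\<tau> * r)" "arctan (\<tau> * r) \<le> 3 / 10"
        using rad_le[OF x(1) r(1)] rad_ge[OF x(4) r(2)] u0[of "3 * k"] us[OF x(4)] by linarith+
      show "0 \<le> \<psi> r" using ul(1)[of 0] rad_le[OF x(1) r(1)] by simp
      show "\<psi> r \<le> pi" using ul(2)[of r 3] rad_ge[OF x(4) r(2)] by simp
    qed
    have thirds: "r \<le> rad (3 * k + 1) \<Longrightarrow> \<psi> r \<le> pi / 3" "rad (3 * k + 1) \<le> r \<Longrightarrow> pi / 3 \<le> \<psi> r"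
      "r \<le> rad (3 * k + 2) \<Longrightarrow> \<psi> r \<le> 2 * pi / 3" "rad (3 * k + 2) \<le> r \<Longrightarrow> 2 * pi / 3 \<le> \<psi> r" for r
      using ul(2)[of r 1] rad_ge[OF x(2), of r] ul(1)[of 1 r] rad_le[OF x(2), of r]
        ul(2)[of r 2] rad_ge[OF x(3), of r] ul(1)[of 2 r] rad_le[OF x(3), of r] by simp_all
    have qe: "q r = \<sigma> * (?e * bar d \<tau> r) + ?e * T \<theta> r" for r by (simp add: q_def dec algebra_simps)
    have qe': "q' r = \<sigma> * (?e * bar' d \<tau> r) + ?e * T' \<theta> r" for r by (simp add: q'_def algebra_simps)
    have ord: "rad (3 * k) < rad (3 * k + 1)" "rad (3 * k + 1) < rad (3 * k + 2)" "rad (3 * k + 2) < rad (3 * k + 3)"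
      by (rule rad_less; use x in simp)+
    have pos: "q r > 0" if "rad (3 * k) < r" "r \<le> rad (3 * k + 1)" for r
    proof -
      have rr: "rad (3 * k) \<le> r" "r \<le> rad (3 * k + 3)" using that ord by linarith+
      note i = info[OF rr]
      have "1 / 2 \<le> ?e * bar d \<tau> r" by (rule barrier_signs(1)[OF refl ang i(1-4) d0(2) \<tau>0(1) thirds(1)[OF that(2)]])
      then have "\<sigma> * (1 / 2) \<le> \<sigma> * (?e * bar d \<tau> r)" using sg by (intro mult_left_mono) auto
      then show ?thesis unfolding qe using i(5) e1[of "T \<theta> r"] M by linarith
    qed
    have neg: "q r < 0" if "rad (3 * k + 2) \<le> r" "r < rad (3 * k + 3)" for r
    proof -
      have rr: "rad (3 * k) \<le> r" "r \<le> rad (3 * k + 3)" using that ord by linarith+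
      note i = info[OF rr]
      have "?e * bar d \<tau> r \<le> - 1 / 2" by (rule barrier_signs(2)[OF refl ang i(1-4) d0(2) \<tau>0(1) thirds(4)[OF that(1)]])
      then have "\<sigma> * (?e * bar d \<tau> r) \<le> \<sigma> * (- 1 / 2)" using sg by (intro mult_left_mono) auto
      then show ?thesis unfolding qe using i(5) e1[of "T \<theta> r"] M by linarith
    qed
    (* middle third: the derivative of the barrier dominates that of the noise *)
    have dcr: "q' r < 0" if "rad (3 * k + 1) \<le> r" "r \<le> rad (3 * k + 2)" for r
    proof -
      have rr: "rad (3 * k) \<le> r" "r \<le> rad (3 * k + 3)" using that ord by linarith+
      note i = info[OF rr]
      have "?e * bar' d \<tau> r \<le> - (real d * \<tau> / 2)" by (rule barrier_signs(3)[OF refl ang i(1-4) d0(2) \<tau>0(1) thirds(2)[OF that(1)] thirds(3)[OF that(2)]])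
      then have "r0 * (?e * bar' d \<tau> r) \<le> r0 * (- (real d * \<tau> / 2))" using \<tau>0 by (intro mult_left_mono) auto
      also have "\<dots> = - (sqrt 12 * real n / 2)"
      proof -
        have "r0 * (real d * \<tau> / 2) = real d * (\<tau> * r0) / 2" by simp
        then show ?thesis unfolding \<tau>r0 using d0 by simp
      qed
      also have "\<dots> \<le> - 1 / 2"
      proof -
        have "1 \<le> sqrt 12" by simp
        then have "1 * 1 \<le> sqrt 12 * real n" using n by (intro mult_mono) auto
        then show ?thesis by simp
      qed
      finally have "\<sigma> * (r0 * (?e * bar' d \<tau> r)) \<le> \<sigma> * (- 1 / 2)" using sg by (intro mult_left_mono) auto
      moreover have "r0 * (?e * T' \<theta> r) \<le> M"
        using i(6) e1[of "T' \<theta> r"] \<tau>0(2) by (metis abs_le_D1 abs_mult abs_of_pos)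
      moreover have "r0 * q' r = \<sigma> * (r0 * (?e * bar' d \<tau> r)) + r0 * (?e * T' \<theta> r)" unfolding qe' by (simp add: algebra_simps)
      ultimately have "r0 * q' r < 0" using M by linarith
      then show ?thesis using \<tau>0(2) by (simp add: mult_less_0_iff)
    qed
    have ez: "q r = 0 \<longleftrightarrow> polar_form d P A (r, \<theta>) = 0" for r by (simp add: q_def)
    have "\<exists>!s. rad (3 * k) < s \<and> s < rad (3 * k + 3) \<and> q s = 0"
      by (rule unique_simple_zero(1)[OF ord der pos neg dcr])
    moreover have "\<sigma> * bar' d \<tau> s + T' \<theta> s \<noteq> 0" if "rad (3 * k) < s" "s < rad (3 * k + 3)" "q s = 0" for s
      using unique_simple_zero(2)[OF ord der pos neg dcr that] by (auto simp: q'_def)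
    ultimately show ?thesis unfolding ez using pd by blast
  qed
  have s3: "3 * Suc k = 3 * k + 3" for k by simp
  have "\<exists>N. nest d P N \<and> card N = n \<and> \<Union>N \<subseteq> place_disc A (rad (3 * n)) \<and> {} \<notin> N"
  proof (rule nest_of_annuli[OF sm orth, of "\<lambda>k. rad (3 * k)"])
    show "0 \<le> rad (3 * 0)" by (rule rad0) simp
    show "rad (3 * k) < rad (3 * Suc k)" if "k < n" for k by (rule rad_less) (use that in auto)
    show "\<exists>!s. rad (3 * k) < s \<and> s < rad (3 * Suc k) \<and> polar_form d P A (s, \<theta>) = 0" if "k < n" for k \<theta>
      using one[OF that] unfolding s3 by blast
    show "\<exists>D. D \<noteq> 0 \<and> ((\<lambda>s. polar_form d P A (s, \<theta>)) has_real_derivative D) (at s)"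
      if "k < n" "rad (3 * k) < s" "s < rad (3 * Suc k)" "polar_form d P A (s, \<theta>) = 0" for k s \<theta>
      using one[OF that(1)] that(2-4) unfolding s3 by blast
  qed
  moreover have "place_disc A (rad (3 * n)) \<subseteq> place_disc A r0"
    unfolding place_disc_def using rn by fastforce
  ultimately show ?thesis by blast
qed

text \<open>The order in the affine coordinates of the monomial with the given exponents.\<close>

definition jk :: "nat \<times> nat \<times> nat \<Rightarrow> nat" where "jk \<gamma> = fst (snd \<gamma>) + snd (snd \<gamma>)"

lemma weighted_geometric_sum: "(\<Sum>j<m. (1 + real j) * (1 / 2) ^ j) \<le> 4"
proof -
  have "(\<Sum>j<m. (1 + real j) * (1 / 2) ^ j) = 4 - (2 * real m + 4) * (1 / 2) ^ m"
  proof (induction m)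
    case (Suc m)
    have "4 - (2 * real m + 4) * h + (1 + real m) * h = 4 - (2 * real (Suc m) + 4) * (1 / 2 * h)" for h
      by (simp add: algebra_simps)
    then show ?case by (simp only: sum.lessThan_Suc Suc power_Suc)
  qed simp
  then show ?thesis by simp
qed

text \<open>By \<open>1 + j + k \<le> (1 + j) (1 + k)\<close> the sum is dominated by a product of two convergent series, each at
  most 4.\<close>

lemma exponent_sum_le: "(\<Sum>\<gamma>\<in>exponents d. (1 + real (jk \<gamma>)) * (1 / 2) ^ jk \<gamma>) \<le> 16"
proof -
  let ?f = "\<lambda>j :: nat. (1 + real j) * (1 / 2) ^ j"
  have inj: "inj_on snd (exponents d)" by (auto simp: inj_on_def exponents_def)
  have "(\<Sum>\<gamma>\<in>exponents d. (1 + real (jk \<gamma>)) * (1 / 2) ^ jk \<gamma>) \<le> (\<Sum>\<gamma>\<in>exponents d. ?f (fst (snd \<gamma>)) * ?f (snd (snd \<gamma>)))"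
  proof (rule sum_mono)
    fix \<gamma> :: "nat \<times> nat \<times> nat"
    let ?a = "real (fst (snd \<gamma>))" and ?b = "real (snd (snd \<gamma>))"
    have "0 \<le> ?a * ?b" by simp
    then have "1 + (?a + ?b) \<le> (1 + ?a) * (1 + ?b)" by (simp add: algebra_simps)
    then have "(1 + (?a + ?b)) * (1 / 2) ^ jk \<gamma> \<le> ((1 + ?a) * (1 + ?b)) * (1 / 2) ^ jk \<gamma>" by (rule mult_right_mono) simp
    then show "(1 + real (jk \<gamma>)) * (1 / 2) ^ jk \<gamma> \<le> ?f (fst (snd \<gamma>)) * ?f (snd (snd \<gamma>))"
      by (simp add: jk_def power_add mult_ac)
  qed
  also have "\<dots> = (\<Sum>p\<in>snd ` exponents d. ?f (fst p) * ?f (snd p))"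
    by (simp add: sum.reindex[OF inj])
  also have "\<dots> \<le> (\<Sum>p\<in>{..<Suc d} \<times> {..<Suc d}. ?f (fst p) * ?f (snd p))"
    by (rule sum_mono2) (auto simp: exponents_def)
  also have "\<dots> = (\<Sum>j<Suc d. ?f j) * (\<Sum>k<Suc d. ?f k)"
    by (simp only: sum_product sum.cartesian_product case_prod_unfold)
  also have "\<dots> \<le> 4 * 4"
    by (intro mult_mono weighted_geometric_sum sum_nonneg) auto
  finally show ?thesis by simp
qed

text \<open>The factor \<open>3 * 96 * C1\<close> is that of the multiple of the barrier, and 108 that of the squared norm of the
  barrier.\<close>

definition C2 :: real where "C2 = (3 * 96 * C1)\<^sup>2 * 108"

lemma C2_pos: "C2 > 0" using C1_pos by (simp add: C2_def)

text \<open>The noise is measured by \<open>\<Sum>\<gamma>. (1 + \<bar>\<gamma>\<bar>) * \<bar>p \<gamma>\<bar> * r0 ^ \<bar>\<gamma>\<bar>\<close>, which bounds its values and \<open>r0\<close> times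
  its radial derivative on the disc of radius \<open>r0\<close>. The coefficient bound is used with \<open>R = 8 n\<close>, that is
  \<open>sqrt (R / d) = 2 r0\<close>, which makes the sum over \<open>\<gamma>\<close> a convergent one. The exponent 28 is \<open>8 + 8 + 12\<close>: twice
  the size of the noise, and the squared norm of the barrier.\<close>

lemma place_event:
  assumes n: "n \<ge> 1" "10000 * n \<le> d" and orth: "orthogonal_matrix A"
  shows "\<exists>E\<in>sets (forms d). emeasure (kostlan d) E \<ge> ennreal (exp (- (C2 * exp (28 * real n))) / 2) \<and>
    (\<forall>P\<in>E. smooth_real_curve d P \<longrightarrow>
      (\<exists>N. nest d P N \<and> card N = n \<and> \<Union>N \<subseteq> place_disc A (sqrt (2 * real n / real d)) \<and> {} \<notin> N))"
proof -
  have d0: "real d > 0" "d > 0" using n by auto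
  define \<tau> where "\<tau> = sqrt (6 * real n / real d)"
  define r0 where "r0 = sqrt (2 * real n / real d)"
  define R where "R = 8 * real n"
  have r0p: "r0 > 0" "\<tau> \<ge> 0" using n d0 by (simp_all add: r0_def \<tau>_def)
  have R: "0 < R" "R + 1 \<le> real d" using n by (auto simp: R_def)
  (* 6 times 16: the factor of Markov's argument and the bound for the sum over the exponents *)
  define M where "M = 96 * C1 * real d * exp R"
  have M0: "M > 0" using C1_pos d0 by (simp add: M_def)
  (* the barrier is at least 1/2 in absolute value, so any multiple above 2 * M dominates the noise *)
  define \<sigma> where "\<sigma> = 3 * M"
  obtain B0 where B0: "\<And>r \<theta>. form_eval d B0 (vector [1, r * cos \<theta>, r * sin \<theta>]) = bar d \<tau> r"
    and B0n: "(real_l2_norm d B0)\<^sup>2 \<le> 108 * (1 + 2 * \<tau>\<^sup>2) ^ d / (real d)\<^sup>2"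
    using barrier_exists[OF d0(2) r0p(2)] unfolding bar_def by metis
  define B where "B \<alpha> = \<sigma> * rot d (transpose A) B0 \<alpha>" for \<alpha>
  have orthT: "orthogonal_matrix (transpose A)" using orth by (simp add: orthogonal_matrix_transpose)
  have TA: "transpose A *v (A *v x) = x" for x :: "real^3"
    using orth unfolding orthogonal_matrix_def by (simp add: matrix_vector_mul_assoc del: transpose_matrix_vector)
  have B_eval: "form_eval d B (A *v x) = \<sigma> * form_eval d B0 x" for x
  proof -
    have "form_eval d B (A *v x) = \<sigma> * form_eval d (rot d (transpose A) B0) (A *v x)"
      unfolding form_eval_xmon B_def by (simp add: sum_distrib_left mult.assoc)
    then show ?thesis unfolding form_eval_rot_real TA .
  qed
  have Bn: "(real_l2_norm d B)\<^sup>2 \<le> C2 * exp (28 * real n)"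
  proof -
    have "(real_l2_norm d B)\<^sup>2 = \<sigma>\<^sup>2 * (real_l2_norm d B0)\<^sup>2"
      unfolding real_l2_norm_rot[OF orthT, of d B0, symmetric] real_l2_norm_sq B_def
      by (simp add: sum_distrib_left power_mult_distrib mult_ac)
    also have "\<dots> \<le> \<sigma>\<^sup>2 * (108 * exp (12 * real n) / (real d)\<^sup>2)"
    proof (intro mult_left_mono)
      have "\<tau>\<^sup>2 = 6 * real n / real d" unfolding \<tau>_def using d0 by (intro real_sqrt_pow2) simp
      then have "(1 + 2 * \<tau>\<^sup>2) ^ d = (1 + 12 * real n / real d) ^ d" by simp
      also have "\<dots> \<le> exp (12 * real n / real d) ^ d"
        by (intro power_mono exp_ge_add_one_self) simp
      also have "\<dots> = exp (12 * real n)" using d0 by (simp flip: exp_of_nat_mult)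
      finally have "108 * (1 + 2 * \<tau>\<^sup>2) ^ d / (real d)\<^sup>2 \<le> 108 * exp (12 * real n) / (real d)\<^sup>2"
        by (intro divide_right_mono mult_left_mono) auto
      then show "(real_l2_norm d B0)\<^sup>2 \<le> 108 * exp (12 * real n) / (real d)\<^sup>2" using B0n by linarith
    qed simp
    also have "\<dots> = C2 * (exp (8 * real n) * exp (8 * real n) * exp (12 * real n))"
      using d0 by (simp add: \<sigma>_def M_def C2_def R_def power2_eq_square)
    also have "exp (8 * real n) * exp (8 * real n) * exp (12 * real n) = exp (28 * real n)" by (simp flip: exp_add)
    finally show ?thesis .
  qed
  define c where "c \<gamma> = C1 * real d * exp R * sqrt (real d / R) ^ jk \<gamma>" for \<gamma>
  define a where "a \<gamma> = (1 + real (jk \<gamma>)) * r0 ^ jk \<gamma>" for \<gamma>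
  have half: "r0 * sqrt (real d / R) = 1 / 2"
  proof -
    have "2 * real n / real d * (real d / (8 * real n)) = 1 / 4" using n d0 by simp
    then have "r0 * sqrt (real d / R) = sqrt (1 / 4)"
      unfolding r0_def real_sqrt_mult[symmetric] R_def by simp
    then show ?thesis by (simp only: real_sqrt_divide real_sqrt_one real_sqrt_four)
  qed
  have ac: "6 * (\<Sum>\<gamma>\<in>exponents d. a \<gamma> * c \<gamma>) \<le> M"
  proof -
    have "a \<gamma> * c \<gamma> = C1 * real d * exp R * ((1 + real (jk \<gamma>)) * (1 / 2) ^ jk \<gamma>)" for \<gamma>
      unfolding a_def c_def half[symmetric] by (simp add: power_mult_distrib mult_ac)
    then have "(\<Sum>\<gamma>\<in>exponents d. a \<gamma> * c \<gamma>) = C1 * real d * exp R * (\<Sum>\<gamma>\<in>exponents d. (1 + real (jk \<gamma>)) * (1 / 2) ^ jk \<gamma>)"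
      by (simp only: sum_distrib_left)
    also have "\<dots> \<le> C1 * real d * exp R * 16" using C1_pos by (intro mult_left_mono exponent_sum_le) auto
    finally show ?thesis by (simp add: M_def)
  qed
  define E where "E = {P \<in> space (forms d). (\<Sum>\<gamma>\<in>exponents d. a \<gamma> * \<bar>rot d A (\<lambda>\<alpha>. P \<alpha> - B \<alpha>) \<gamma>\<bar>) \<le> M}"
  have bd: "\<bar>rot d A P \<gamma>\<bar> \<le> c \<gamma> * real_l2_norm d P" if "\<gamma> \<in> exponents d" for \<gamma> P
    using rot_coefficient_bound[OF orth _ R, of "fst \<gamma>" "fst (snd \<gamma>)" "snd (snd \<gamma>)" P] that by (simp add: c_def jk_def)
  have cp: "c \<gamma> > 0" for \<gamma> unfolding c_def using C1_pos d0 R by simp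
  have ap: "a \<gamma> \<ge> 0" for \<gamma> unfolding a_def using r0p by simp
  have pr: "E \<in> sets (forms d)" "emeasure (kostlan d) E \<ge> ennreal (exp (- (real_l2_norm d B)\<^sup>2) / 2)"
    unfolding E_def
    using barrier_probability[OF finite_exponents, where lin_fun = "\<lambda>\<gamma> P. rot d A P \<gamma>" and L = "rotmat d A" and c = c and a = a and M = M and B = B and d = d]
      rot_def bd cp ap ac M0 by blast+
  have "ennreal (exp (- (C2 * exp (28 * real n))) / 2) \<le> ennreal (exp (- (real_l2_norm d B)\<^sup>2) / 2)"
    using Bn by (intro ennreal_leI) simp
  then have em: "emeasure (kostlan d) E \<ge> ennreal (exp (- (C2 * exp (28 * real n))) / 2)" using pr(2) by (rule order_trans)
  have res: "\<exists>N. nest d P N \<and> card N = n \<and> \<Union>N \<subseteq> place_disc A r0 \<and> {} \<notin> N" if P: "P \<in> E" "smooth_real_curve d P" for P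
  proof -
    define D where "D \<alpha> = P \<alpha> - B \<alpha>" for \<alpha>
    let ?p = "rot d A D"
    define g where "g \<theta> \<gamma> = cos \<theta> ^ fst (snd \<gamma>) * sin \<theta> ^ snd (snd \<gamma>)" for \<theta> :: real and \<gamma> :: "nat \<times> nat \<times> nat"
    define T where "T \<theta> r = (\<Sum>\<gamma>\<in>exponents d. ?p \<gamma> * g \<theta> \<gamma> * r ^ jk \<gamma>)" for \<theta> r
    define T' where "T' \<theta> r = (\<Sum>\<gamma>\<in>exponents d. ?p \<gamma> * g \<theta> \<gamma> * (real (jk \<gamma>) * r ^ (jk \<gamma> - 1)))" for \<theta> r
    have g1: "\<bar>g \<theta> \<gamma>\<bar> \<le> 1" for \<theta> \<gamma>
    proof -
      have "\<bar>cos \<theta>\<bar> ^ fst (snd \<gamma>) * \<bar>sin \<theta>\<bar> ^ snd (snd \<gamma>) \<le> 1 * 1" by (intro mult_mono power_le_one) auto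
      then show ?thesis by (simp add: g_def abs_mult power_abs)
    qed
    have sumM: "(\<Sum>\<gamma>\<in>exponents d. \<bar>?p \<gamma>\<bar> * a \<gamma>) \<le> M" using P(1) by (simp add: E_def D_def[abs_def] mult.commute)
    have dec: "polar_form d P A (r, \<theta>) = \<sigma> * bar d \<tau> r + T \<theta> r" for r \<theta>
    proof -
      let ?x = "vector [1, r * cos \<theta>, r * sin \<theta>] :: real^3"
      have "form_eval d P (A *v ?x) = form_eval d B (A *v ?x) + form_eval d D (A *v ?x)"
        unfolding form_eval_xmon D_def sum.distrib[symmetric] by (intro sum.cong refl) (simp add: algebra_simps)
      also have "form_eval d B (A *v ?x) = \<sigma> * bar d \<tau> r" unfolding B_eval B0 ..
      also have "form_eval d D (A *v ?x) = form_eval d ?p ?x" by (rule form_eval_rot_real[symmetric])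
      also have "form_eval d ?p ?x = T \<theta> r"
        unfolding form_eval_xmon T_def by (intro sum.cong refl) (simp add: xmon_def g_def jk_def power_mult_distrib power_add mult_ac)
      finally show ?thesis by (simp add: polar_form_def)
    qed
    have T'd: "(T \<theta> has_real_derivative T' \<theta> r) (at r)" for r \<theta>
      unfolding T_def T'_def
    proof (rule DERIV_sum)
      fix \<gamma>
      show "((\<lambda>r. ?p \<gamma> * g \<theta> \<gamma> * r ^ jk \<gamma>) has_real_derivative ?p \<gamma> * g \<theta> \<gamma> * (real (jk \<gamma>) * r ^ (jk \<gamma> - 1))) (at r)"
        using DERIV_cmult[OF DERIV_pow[of "jk \<gamma>" r UNIV], of "?p \<gamma> * g \<theta> \<gamma>"] by simp
    qed
    have Tb: "\<bar>T \<theta> r\<bar> \<le> M" if r: "0 \<le> r" "r \<le> r0" for r \<theta>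
    proof -
      have "\<bar>T \<theta> r\<bar> \<le> (\<Sum>\<gamma>\<in>exponents d. \<bar>?p \<gamma>\<bar> * a \<gamma>)"
        unfolding T_def
      proof (rule order_trans[OF sum_abs sum_mono])
        fix \<gamma>
        have "\<bar>g \<theta> \<gamma>\<bar> * r ^ jk \<gamma> \<le> (1 + real (jk \<gamma>)) * r0 ^ jk \<gamma>"
          by (rule mult_mono[OF order_trans[OF g1] power_mono]) (use r in auto)
        then have "\<bar>?p \<gamma>\<bar> * (\<bar>g \<theta> \<gamma>\<bar> * r ^ jk \<gamma>) \<le> \<bar>?p \<gamma>\<bar> * a \<gamma>" unfolding a_def by (rule mult_left_mono) simp
        then show "\<bar>?p \<gamma> * g \<theta> \<gamma> * r ^ jk \<gamma>\<bar> \<le> \<bar>?p \<gamma>\<bar> * a \<gamma>" using r by (simp add: abs_mult mult.assoc)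
      qed
      then show ?thesis using sumM by linarith
    qed
    have T'b: "r0 * \<bar>T' \<theta> r\<bar> \<le> M" if r: "0 \<le> r" "r \<le> r0" for r \<theta>
    proof -
      have "\<bar>r0 * T' \<theta> r\<bar> \<le> (\<Sum>\<gamma>\<in>exponents d. \<bar>?p \<gamma>\<bar> * a \<gamma>)"
        unfolding T'_def sum_distrib_left
      proof (rule order_trans[OF sum_abs sum_mono])
        fix \<gamma>
        have "r0 * (real (jk \<gamma>) * r ^ (jk \<gamma> - 1)) \<le> (1 + real (jk \<gamma>)) * r0 ^ jk \<gamma>"
        proof (cases "jk \<gamma>")
          case (Suc m)
          have "real (jk \<gamma>) * (r0 * r ^ m) \<le> (1 + real (jk \<gamma>)) * (r0 * r0 ^ m)"
            by (intro mult_mono power_mono) (use r r0p in auto)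
          then show ?thesis by (simp add: Suc mult_ac)
        qed simp
        then have "\<bar>g \<theta> \<gamma>\<bar> * (r0 * (real (jk \<gamma>) * r ^ (jk \<gamma> - 1))) \<le> 1 * a \<gamma>" unfolding a_def
          by (rule mult_mono[OF g1]) (use r r0p in auto)
        then have "\<bar>?p \<gamma>\<bar> * (\<bar>g \<theta> \<gamma>\<bar> * (r0 * (real (jk \<gamma>) * r ^ (jk \<gamma> - 1)))) \<le> \<bar>?p \<gamma>\<bar> * a \<gamma>"
          by (intro mult_left_mono) auto
        then show "\<bar>r0 * (?p \<gamma> * g \<theta> \<gamma> * (real (jk \<gamma>) * r ^ (jk \<gamma> - 1)))\<bar> \<le> \<bar>?p \<gamma>\<bar> * a \<gamma>"
          using r r0p by (simp add: abs_mult mult_ac)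
      qed
      then show ?thesis using sumM r0p by (simp add: abs_mult)
    qed
    show ?thesis
      by (rule nest_at_place[OF n P(2) orth \<tau>_def r0_def dec T'd Tb T'b _ M0]) (use M0 in \<open>auto simp: \<sigma>_def\<close>)
  qed
  show ?thesis unfolding r0_def[symmetric] by (intro bexI[OF _ pr(1)] conjI ballI impI em res)
qed

section \<open>Many disjoint places\<close>

text \<open>The centres are the points \<open>[1 : i \<delta> : j \<delta>]\<close> of a grid in the unit square, with \<open>\<delta> = 25 r0\<close>. If two discs
  met, unit vectors representing their centres would be within \<open>6 r0\<close> of each other up to sign; the sign is
  \<open>+\<close> because both first coordinates are at least \<open>1 / 2\<close>, and then the affine coordinates would differ by at most \<open>24 r0\<close>,
  less than the spacing.\<close>

lemma disjoint_places:
  assumes r0: "0 < r0" "r0 \<le> 1 / 50"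
  shows "\<exists>(A :: nat \<times> nat \<Rightarrow> real^3^3) (m :: nat). 1 / (50 * r0) \<le> real m \<and> (\<forall>p. orthogonal_matrix (A p)) \<and>
    (\<forall>p\<in>{..<m} \<times> {..<m}. \<forall>p'\<in>{..<m} \<times> {..<m}. p \<noteq> p' \<longrightarrow> place_disc (A p) r0 \<inter> place_disc (A p') r0 = {})"
proof -
  define \<delta> where "\<delta> = 25 * r0"
  have \<delta>: "0 < \<delta>" "\<delta> \<le> 1 / 2" using r0 by (auto simp: \<delta>_def)
  define m where "m = nat \<lfloor>1 / \<delta>\<rfloor>"
  have m1: "real m \<le> 1 / \<delta>" using \<delta> by (simp add: m_def)
  have m2: "1 / (50 * r0) \<le> real m"
  proof -
    have "1 / \<delta> - 1 \<le> real m" using \<delta> unfolding m_def by linarith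
    moreover have "1 \<le> 1 / (2 * \<delta>)" using \<delta> by (simp add: field_simps)
    moreover have "1 / \<delta> = 1 / (2 * \<delta>) + 1 / (2 * \<delta>)" by (simp add: field_simps)
    moreover have "1 / (2 * \<delta>) = 1 / (50 * r0)" by (simp add: \<delta>_def)
    ultimately show ?thesis by linarith
  qed
  have grid: "0 \<le> real i * \<delta> \<and> real i * \<delta> \<le> 1" if "i < m" for i
  proof -
    have "real i * \<delta> \<le> real m * \<delta>" using that \<delta> by (intro mult_right_mono) auto
    also have "\<dots> \<le> 1" using m1 \<delta> by (simp add: pos_le_divide_eq)
    finally show ?thesis using \<delta> by simp
  qed
  define v where "v p = (vector [1, real (fst p) * \<delta>, real (snd p) * \<delta>] :: real^3)" for p :: "nat \<times> nat"
  define a where "a p = (1 / norm (v p)) *\<^sub>R v p" for p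
  have vn: "norm (v p) \<noteq> 0" for p using v_def[of p] by (auto simp: vec_eq_iff forall_3)
  have na: "norm (a p) = 1" for p using vn by (simp add: a_def)
  have "\<exists>A. orthogonal_matrix A \<and> A *v axis 1 1 = a p" for p
    using orthogonal_matrix_exists_basis[OF na[of p], of 1] by metis
  then obtain A where A: "\<And>p. orthogonal_matrix (A p)" "\<And>p. A p *v axis 1 1 = a p" by metis
  have disj: "place_disc (A p) r0 \<inter> place_disc (A p') r0 = {}"
    if p: "p \<in> {..<m} \<times> {..<m}" "p' \<in> {..<m} \<times> {..<m}" "p \<noteq> p'" for p p'
  proof (rule ccontr)
    assume "place_disc (A p) r0 \<inter> place_disc (A p') r0 \<noteq> {}"
    then obtain r \<theta> r' \<theta>' where r: "0 \<le> r" "r < r0" "0 \<le> r'" "r' < r0"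
      and eq: "rp2_point (A p *v vector [1, r * cos \<theta>, r * sin \<theta>]) = rp2_point (A p' *v vector [1, r' * cos \<theta>', r' * sin \<theta>'])"
      unfolding place_disc_def by blast
    have iso: "norm (A q *v x) = norm x" for q x
      using A(1)[of q] orthogonal_transformation_norm[of "(*v) (A q)" x] by (simp add: orthogonal_transformation_matrix)
    have nz: "A q *v vector [1, s, t] \<noteq> 0" for q s t
    proof
      assume "A q *v vector [1, s, t] = 0"
      then have "norm (vector [1, s, t] :: real^3) = 0" using iso[of q "vector [1, s, t]"] by simp
      then show False by (auto simp: vec_eq_iff forall_3)
    qed
    have off: "\<exists>w. A q *v vector [1, s * cos t, s * sin t] = a q + w \<and> norm w = s" if "0 \<le> s" for q s t
    proof -
      have "vector [1, s * cos t, s * sin t] = axis 1 1 + s *\<^sub>R (vector [0, cos t, sin t] :: real^3)"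
        by (auto simp: vec_eq_iff forall_3 axis_def)
      then have "A q *v vector [1, s * cos t, s * sin t] = a q + s *\<^sub>R (A q *v vector [0, cos t, sin t])"
        by (simp only: matrix_vector_right_distrib A(2) matrix_vector_mult_scaleR)
      moreover have "norm (vector [0, cos t, sin t] :: real^3) = 1"
        by (simp add: norm_vec_def L2_set_def sum_3)
      then have "norm (s *\<^sub>R (A q *v vector [0, cos t, sin t])) = s" using that by (simp add: iso)
      ultimately show ?thesis by blast
    qed
    obtain c where c: "A p *v vector [1, r * cos \<theta>, r * sin \<theta>] = c *\<^sub>R (A p' *v vector [1, r' * cos \<theta>', r' * sin \<theta>'])"
      using eq rp2_point_eq_iff[OF nz nz] by blast
    obtain w where w: "A p *v vector [1, r * cos \<theta>, r * sin \<theta>] = a p + w" "norm w = r" using off[OF r(1)] by blast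
    obtain w' where w': "A p' *v vector [1, r' * cos \<theta>', r' * sin \<theta>'] = a p' + w'" "norm w' = r'" using off[OF r(3)] by blast
    have "a p - c *\<^sub>R a p' = c *\<^sub>R w' - w" using c unfolding w(1) w'(1) by (simp add: algebra_simps)
    then have "norm (a p - c *\<^sub>R a p') \<le> norm (c *\<^sub>R w') + norm w" by (metis norm_triangle_ineq4)
    also have "\<dots> \<le> \<bar>c\<bar> * r0 + r0" using r w(2) w'(2) by (simp add: add_mono mult_left_mono)
    finally have 1: "norm (a p - c *\<^sub>R a p') \<le> \<bar>c\<bar> * r0 + r0" .
    have 2: "\<bar>1 - \<bar>c\<bar>\<bar> \<le> norm (a p - c *\<^sub>R a p')"
      using norm_triangle_ineq3[of "a p" "c *\<^sub>R a p'"] by (simp add: na)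
    have c2: "\<bar>c\<bar> \<le> 2"
    proof -
      have "\<bar>c\<bar> * r0 \<le> \<bar>c\<bar> * (1 / 50)" using r0 by (intro mult_left_mono) auto
      then show ?thesis using 1 2 r0 by linarith
    qed
    have "\<bar>c\<bar> * r0 \<le> 2 * r0" using c2 r0 by (intro mult_right_mono) auto
    then have 3: "norm (a p - c *\<^sub>R a p') \<le> 3 * r0" using 1 by linarith
    define e where "e = (if 0 \<le> c then 1 else -1 :: real)"
    have "norm (a p - e *\<^sub>R a p') \<le> norm (a p - c *\<^sub>R a p') + norm ((c - e) *\<^sub>R a p')"
      using norm_triangle_ineq[of "a p - c *\<^sub>R a p'" "(c - e) *\<^sub>R a p'"] by (simp add: algebra_simps)
    also have "norm ((c - e) *\<^sub>R a p') = \<bar>1 - \<bar>c\<bar>\<bar>" by (cases "0 \<le> c") (simp_all add: na e_def abs_minus_commute add.commute)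
    finally have 4: "norm (a p - e *\<^sub>R a p') \<le> 6 * r0" using 2 3 by linarith
    have comp: "\<bar>a p $ i - e * a p' $ i\<bar> \<le> 6 * r0" for i
      using component_le_norm_cart[of "a p - e *\<^sub>R a p'" i] 4 by simp
    have a1: "1 / 2 \<le> a q $ 1" "a q $ 1 \<le> 1" if q: "q \<in> {..<m} \<times> {..<m}" for q
    proof -
      let ?x = "real (fst q) * \<delta>" and ?y = "real (snd q) * \<delta>"
      have g: "0 \<le> ?x" "?x \<le> 1" "0 \<le> ?y" "?y \<le> 1" using grid q by auto
      have "(norm (v q))\<^sup>2 = 1 + ?x\<^sup>2 + ?y\<^sup>2" unfolding v_def norm_vec_def L2_set_def sum_3 by (subst real_sqrt_pow2) auto
      moreover have "?x\<^sup>2 \<le> 1" "?y\<^sup>2 \<le> 1" using g by (simp_all add: power_le_one)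
      ultimately have "(norm (v q))\<^sup>2 \<le> 2\<^sup>2" "1\<^sup>2 \<le> (norm (v q))\<^sup>2" by simp_all
      then have n: "norm (v q) \<le> 2" "1 \<le> norm (v q)"
        using power2_le_imp_le[of "norm (v q)" 2] power2_le_imp_le[of 1 "norm (v q)"] by simp_all
      have "a q $ 1 = 1 / norm (v q)" by (simp add: a_def v_def)
      moreover have "0 < norm (v q)" using n by linarith
      ultimately show "1 / 2 \<le> a q $ 1" "a q $ 1 \<le> 1" using n by (simp_all add: pos_le_divide_eq pos_divide_le_eq)
    qed
    have e1: "e = 1"
    proof (rule ccontr)
      assume "e \<noteq> 1"
      then have "e = -1" by (auto simp: e_def split: if_splits)
      then have "\<bar>a p $ 1 + a p' $ 1\<bar> \<le> 6 * r0" using comp[of 1] by simp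
      then show False using a1(1)[OF p(1)] a1(1)[OF p(2)] r0 by linarith
    qed
    have close: "\<bar>x - x'\<bar> \<le> 24 * r0"
      if x: "a p $ i = a p $ 1 * x" "a p' $ i = a p' $ 1 * x'" "0 \<le> x'" "x' \<le> 1" for i x x'
    proof -
      have "0 \<le> a p $ 1" using a1(1)[OF p(1)] by linarith
      then have "a p $ 1 * \<bar>x - x'\<bar> = \<bar>a p $ 1 * (x - x')\<bar>" by (simp add: abs_mult)
      also have "a p $ 1 * (x - x') = (a p $ i - a p' $ i) - (a p $ 1 - a p' $ 1) * x'" unfolding x(1,2) by (simp add: algebra_simps)
      also have "\<bar>\<dots>\<bar> \<le> \<bar>a p $ i - a p' $ i\<bar> + \<bar>(a p $ 1 - a p' $ 1) * x'\<bar>" by (rule abs_triangle_ineq4)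
      also have "\<dots> = \<bar>a p $ i - a p' $ i\<bar> + \<bar>a p $ 1 - a p' $ 1\<bar> * x'" using x(3) by (simp add: abs_mult)
      also have "\<dots> \<le> 6 * r0 + 6 * r0 * 1"
        using comp[of i] comp[of 1] x(3,4) r0 unfolding e1 by (intro add_mono mult_mono) auto
      finally have "a p $ 1 * \<bar>x - x'\<bar> \<le> 12 * r0" by simp
      moreover have "1 / 2 * \<bar>x - x'\<bar> \<le> a p $ 1 * \<bar>x - x'\<bar>" using a1(1)[OF p(1)] by (rule mult_right_mono) simp
      ultimately have "1 / 2 * \<bar>x - x'\<bar> \<le> 12 * r0" by (meson order_trans)
      then show ?thesis by simp
    qed
    have co: "a q $ 2 = a q $ 1 * (real (fst q) * \<delta>)" "a q $ 3 = a q $ 1 * (real (snd q) * \<delta>)" for q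
      by (simp_all add: a_def v_def)
    have same: "i = i'" if "\<bar>real i * \<delta> - real i' * \<delta>\<bar> \<le> 24 * r0" for i i' :: nat
    proof (rule ccontr)
      assume "i \<noteq> i'"
      then have "1 \<le> \<bar>real i - real i'\<bar>" by linarith
      then have "1 * \<delta> \<le> \<bar>real i - real i'\<bar> * \<delta>" using \<delta> by (intro mult_right_mono) auto
      also have "\<dots> = \<bar>real i * \<delta> - real i' * \<delta>\<bar>" using \<delta> by (simp add: abs_mult left_diff_distrib[symmetric])
      finally show False using that r0 by (simp add: \<delta>_def)
    qed
    have m': "fst p' < m" "snd p' < m" using p(2) by auto
    have "fst p = fst p'" using grid[OF m'(1)] by (intro same close[OF co(1) co(1)]) simp_all
    moreover have "snd p = snd p'" using grid[OF m'(2)] by (intro same close[OF co(2) co(2)]) simp_all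
    ultimately show False using p(3) by (simp add: prod_eq_iff)
  qed
  show ?thesis
    by (intro exI[of _ A] exI[of _ m] conjI m2 allI A(1) ballI impI disj)
qed

section \<open>The expected number of nests\<close>

text \<open>Sum the probabilities over the disjoint places. Nests at different places are different, as
  their ovals are nonempty and lie in disjoint discs; hence their number is a lower bound for the count.\<close>

lemma expected_num_nests_ge:
  assumes n: "n \<ge> 1" "10000 * n \<le> d" and h: "h \<le> real n"
  shows "expected_num_nests d h \<ge> ennreal (real d / (5000 * real n) * (exp (- (C2 * exp (28 * real n))) / 2))"
proof -
  have d0: "real d > 0" "d \<ge> 1" using n by auto
  define r0 where "r0 = sqrt (2 * real n / real d)"
  have r0sq: "r0\<^sup>2 = 2 * real n / real d" unfolding r0_def using d0 by (intro real_sqrt_pow2) simp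
  have r0: "0 < r0" "r0 \<le> 1 / 50"
  proof -
    show "0 < r0" using n d0 by (simp add: r0_def)
    have "2 * real n / real d \<le> 1 / 2500" using n d0 by (simp add: pos_divide_le_eq)
    then show "r0 \<le> 1 / 50" unfolding r0_def by (intro real_le_lsqrt) (auto simp: power2_eq_square)
  qed
  obtain A :: "nat \<times> nat \<Rightarrow> real^3^3" and m :: nat where m: "1 / (50 * r0) \<le> real m"
    and orth: "\<forall>p. orthogonal_matrix (A p)"
    and disj: "\<forall>p\<in>{..<m} \<times> {..<m}. \<forall>p'\<in>{..<m} \<times> {..<m}. p \<noteq> p' \<longrightarrow> place_disc (A p) r0 \<inter> place_disc (A p') r0 = {}"
    using disjoint_places[OF r0] by (elim exE conjE)
  let ?I = "{..<m} \<times> {..<m}"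
  let ?x = "exp (- (C2 * exp (28 * real n))) / 2"
  define good where "good p E \<longleftrightarrow> emeasure (kostlan d) E \<ge> ennreal ?x \<and>
      (\<forall>P\<in>E. smooth_real_curve d P \<longrightarrow> (\<exists>N. nest d P N \<and> card N = n \<and> \<Union>N \<subseteq> place_disc (A p) r0 \<and> {} \<notin> N))" for p E
  have "\<forall>p. \<exists>E. E \<in> sets (forms d) \<and> good p E"
    using place_event[OF n spec[OF orth]] unfolding good_def r0_def Bex_def by (intro allI)
  from choice[OF this] obtain E where E': "\<forall>p. E p \<in> sets (forms d) \<and> good p (E p)" by (elim exE)
  have E: "E p \<in> sets (forms d)" "emeasure (kostlan d) (E p) \<ge> ennreal ?x"
    and nests: "P \<in> E p \<Longrightarrow> smooth_real_curve d P \<Longrightarrow>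
      \<exists>N. nest d P N \<and> card N = n \<and> \<Union>N \<subseteq> place_disc (A p) r0 \<and> {} \<notin> N" for p P
    using spec[OF E', of p] unfolding good_def by simp_all
  have count: "(\<Sum>p\<in>?I. indicator (E p) P) \<le> (of_nat (num_nests d P h) :: ennreal)" if sm: "smooth_real_curve d P" for P
  proof -
    define J where "J = {p \<in> ?I. P \<in> E p}"
    have "\<exists>N. nest d P N \<and> card N = n \<and> \<Union>N \<subseteq> place_disc (A p) r0 \<and> {} \<notin> N" if "p \<in> J" for p
      using nests[of P p] that sm by (simp add: J_def)
    then obtain N where N: "\<And>p. p \<in> J \<Longrightarrow> nest d P (N p)" "\<And>p. p \<in> J \<Longrightarrow> card (N p) = n"
      "\<And>p. p \<in> J \<Longrightarrow> \<Union>(N p) \<subseteq> place_disc (A p) r0" "\<And>p. p \<in> J \<Longrightarrow> {} \<notin> N p" by metis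
    have inj: "inj_on N J"
    proof (rule inj_onI, rule ccontr)
      fix p q assume pq: "p \<in> J" "q \<in> J" "N p = N q" "p \<noteq> q"
      have "N p \<noteq> {}" using N(2)[OF pq(1)] n by auto
      then obtain C where C: "C \<in> N p" by blast
      then obtain y where "y \<in> C" using N(4)[OF pq(1)] by (metis ex_in_conv)
      then have "y \<in> place_disc (A p) r0 \<inter> place_disc (A q) r0" using N(3)[OF pq(1)] N(3)[OF pq(2)] C pq(3) by blast
      then show False using bspec[OF bspec[OF disj], of p q] pq unfolding J_def by blast
    qed
    have "{N. nest d P N \<and> real (card N) \<ge> h} \<subseteq> Pow (components (real_curve d P))"
      by (auto simp: nest_def oval_def)
    then have fin: "finite {N. nest d P N \<and> real (card N) \<ge> h}"
      using finite_components_smooth[OF sm] by (meson finite_Pow_iff finite_subset)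
    have "card J = card (N ` J)" by (rule card_image[OF inj, symmetric])
    also have "\<dots> \<le> num_nests d P h"
      unfolding num_nests_def using N(1,2) h by (intro card_mono[OF fin]) auto
    finally have le: "card J \<le> num_nests d P h" .
    have "(\<Sum>p\<in>?I. indicator (E p) P) = (\<Sum>p\<in>?I. if P \<in> E p then 1 else 0 :: ennreal)"
      by (intro sum.cong refl) (simp add: indicator_def)
    also have "\<dots> = (\<Sum>p\<in>J. 1)" unfolding J_def by (rule sum.inter_filter[symmetric]) simp
    also have "\<dots> = of_nat (card J)" by simp
    also have "\<dots> \<le> of_nat (num_nests d P h)" using le by simp
    finally show ?thesis .
  qed
  have "1 / (50 * r0) * (1 / (50 * r0)) \<le> real m * real m" using m r0 by (intro mult_mono) auto
  then have "1 / (2500 * r0\<^sup>2) \<le> real m * real m" by (simp add: power2_eq_square)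
  moreover have "1 / (2500 * r0\<^sup>2) = real d / (5000 * real n)" unfolding r0sq by simp
  ultimately have "real d / (5000 * real n) * ?x \<le> real m * real m * ?x" by (intro mult_right_mono) auto
  then have "ennreal (real d / (5000 * real n) * ?x) \<le> ennreal (real (m * m) * ?x)" by (intro ennreal_leI) simp
  also have "\<dots> = of_nat (card ?I) * ennreal ?x"
    unfolding ennreal_of_nat_eq_real_of_nat by (subst ennreal_mult[symmetric]) simp_all
  also have "\<dots> = (\<Sum>p\<in>?I. ennreal ?x)" by simp
  also have "\<dots> \<le> (\<Sum>p\<in>?I. emeasure (kostlan d) (E p))" by (rule sum_mono) (rule E(2))
  also have "\<dots> = (\<integral>\<^sup>+P. (\<Sum>p\<in>?I. indicator (E p) P) \<partial>kostlan d)"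
    using E(1) by (subst nn_integral_sum) (simp_all add: sets_kostlan borel_measurable_indicator)
  also have "\<dots> \<le> expected_num_nests d h"
    unfolding expected_num_nests_def using AE_smooth[OF d0(2)] count by (intro nn_integral_mono_AE) auto
  finally show ?thesis .
qed

text \<open>The depth is chosen so that \<open>exp (28 * n)\<close>, which bounds the cost of a nest, is a power less than
  one of \<open>ln d\<close>; the exponent \<open>14 / 15\<close> is where the constant \<open>1 / 30\<close> enters.\<close>

theorem theorem5p8:
  fixes \<epsilon> :: real
  assumes "\<epsilon> > 0"
  shows "\<exists>c::real. c > 0 \<and>
    (\<forall>\<^sub>F d in sequentially.
       expected_num_nests d (1 / 30 * ln (\<epsilon> * ln (real d) / 2))
         \<ge> ennreal (c * real d powr (1 - \<epsilon>) / ln (ln (real d))))"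
proof (intro exI[of _ "1 / 10000"] conjI)
  define C where "C = C2 * exp 28"
  have C: "C > 0" using C2_pos by (simp add: C_def)
  have "\<forall>\<^sub>F d in sequentially. 0 < 1 / 30 * ln (\<epsilon> * ln (real d) / 2)" using assms by real_asymp
  moreover have "\<forall>\<^sub>F d in sequentially. 1 / 30 * ln (\<epsilon> * ln (real d) / 2) + 1 \<le> ln (ln (real d))" using assms by real_asymp
  moreover have "\<forall>\<^sub>F d in sequentially. 10000 * ln (ln (real d)) \<le> real d" by real_asymp
  moreover have "\<forall>\<^sub>F d in sequentially. 0 < \<epsilon> * ln (real d) / 2" using assms by real_asymp
  moreover have "\<forall>\<^sub>F d in sequentially. C * (\<epsilon> * ln (real d) / 2) powr (14 / 15) \<le> \<epsilon> * ln (real d) / 2" using assms C by real_asymp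
  moreover have "\<forall>\<^sub>F d in sequentially. 1 < real d" by real_asymp
  ultimately show "\<forall>\<^sub>F d in sequentially. expected_num_nests d (1 / 30 * ln (\<epsilon> * ln (real d) / 2))
         \<ge> ennreal (1 / 10000 * real d powr (1 - \<epsilon>) / ln (ln (real d)))"
  proof eventually_elim
    case (elim d)
    let ?y = "\<epsilon> * ln (real d) / 2"
    let ?h = "1 / 30 * ln ?y"
    define n where "n = nat \<lceil>?h\<rceil>"
    have n: "?h \<le> real n" "real n \<le> ?h + 1" "n \<ge> 1" using elim(1) unfolding n_def by linarith+
    have nl: "real n \<le> ln (ln (real d))" using n(2) elim(2) by linarith
    then have "real (10000 * n) \<le> real d" using elim(3) by simp
    then have nd: "10000 * n \<le> d" by (simp only: of_nat_le_iff)
    have "?y \<noteq> 0" using elim(4) by (rule less_imp_neq[symmetric])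
    then have pw: "?y powr (14 / 15) = exp (14 / 15 * ln ?y)" unfolding powr_def by (rule if_not_P)
    have "exp (28 * real n) \<le> exp (28 + 14 / 15 * ln ?y)" unfolding exp_le_cancel_iff using n(2) by linarith
    also have "\<dots> = exp 28 * ?y powr (14 / 15)" unfolding pw by (rule exp_add)
    finally have "C2 * exp (28 * real n) \<le> C2 * (exp 28 * ?y powr (14 / 15))" using C2_pos by (intro mult_left_mono) auto
    also have "\<dots> \<le> ?y" using elim(5) by (simp add: C_def mult.assoc)
    also have "\<dots> \<le> \<epsilon> * ln (real d)" using elim(4) by linarith
    finally have "exp (- (\<epsilon> * ln (real d))) \<le> exp (- (C2 * exp (28 * real n)))" by simp
    moreover have "exp (- (\<epsilon> * ln (real d))) = real d powr (- \<epsilon>)" using elim(6) by (simp add: powr_def)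
    ultimately have e: "real d powr (- \<epsilon>) \<le> exp (- (C2 * exp (28 * real n)))" by simp
    have "real d powr (1 - \<epsilon>) = real d * real d powr (- \<epsilon>)"
      using elim(6) powr_add[of "real d" 1 "- \<epsilon>"] by simp
    then have "1 / 10000 * real d powr (1 - \<epsilon>) / ln (ln (real d)) = real d * real d powr (- \<epsilon>) / (10000 * ln (ln (real d)))" by simp
    also have "\<dots> \<le> real d * real d powr (- \<epsilon>) / (10000 * real n)"
    proof (rule divide_left_mono)
      have "0 < 10000 * ln (ln (real d))" "0 < 10000 * real n" using nl n(3) by linarith+
      then show "0 < 10000 * ln (ln (real d)) * (10000 * real n)" by (rule mult_pos_pos)
    qed (use nl in simp_all)
    also have "\<dots> = real d / (5000 * real n) * (real d powr (- \<epsilon>) / 2)" by simp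
    also have "\<dots> \<le> real d / (5000 * real n) * (exp (- (C2 * exp (28 * real n))) / 2)"
      using e by (intro mult_left_mono divide_right_mono) auto
    finally have "ennreal (1 / 10000 * real d powr (1 - \<epsilon>) / ln (ln (real d))) \<le> ennreal (real d / (5000 * real n) * (exp (- (C2 * exp (28 * real n))) / 2))"
      by (rule ennreal_leI)
    also have "\<dots> \<le> expected_num_nests d ?h" by (rule expected_num_nests_ge[OF n(3) nd n(1)])
    finally show ?case .
  qed
qed simp

end
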